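(* For every $V\in(0,2\pi^2)$ there exists a function $u\in C^\infty(\mathbb{R}^3)$ which is a solution (in the sense defined in the context) of $$(-\Delta)^{\frac32}u=2e^{3u}\quad\text{in }\mathbb{R}^3,\qquad \int_{\mathbb{R}^3}e^{3u}\,dx=V.$$
   Context: For $\varphi$ in the Schwartz space $\mathcal{S}(\mathbb{R}^3)$, $(-\Delta)^{\frac12}\varphi$ is the function with Fourier transform $|\xi|\hat\varphi(\xi)$. Let $$L_{1/2}(\mathbb{R}^3)=\Big\{v\in L^1_{\mathrm{loc}}(\mathbb{R}^3):\int_{\mathbb{R}^3}\frac{|v(x)|}{1+|x|^4}\,dx<\infty\Big\}.$$ Given a tempered distribution $f$ on $\mathbb{R}^3$, a function $u$ is a solution of $(-\Delta)^{\frac32}u=f$ if $u\in W^{2,1}_{\mathrm{loc}}(\mathbb{R}^3)$, $\Delta u\in L_{1/2}(\mathbb{R}^3)$ and $$\int_{\mathbb{R}^3}(-\Delta u)\,(-\Delta)^{\frac12}\varphi\,dx=\langle f,\varphi\rangle\quad\text{for every }\varphi\in\mathcal{S}(\mathbb{R}^3).$$ *)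

theory Defs
  imports "HOL-Analysis.Analysis"
begin

definition partial :: "'n::finite \<Rightarrow> (real^'n \<Rightarrow> 'b::real_normed_vector) \<Rightarrow> real^'n \<Rightarrow> 'b"
  where "partial i f x = frechet_derivative f (at x) (axis i 1)"

text \<open>Iterated partial derivatives are indexed by lists of coordinate directions rather than by
  multi-indices; for smooth functions the order of the list is immaterial.\<close>

definition partials :: "'n::finite list \<Rightarrow> (real^'n \<Rightarrow> 'b::real_normed_vector) \<Rightarrow> real^'n \<Rightarrow> 'b"
  where "partials is f = foldr partial is f"

text \<open>Differentiability of all iterated partial derivatives includes their continuity, so this is
  the class of \<open>C\<^sup>\<infinity>\<close> functions.\<close>

definition smooth :: "(real^'n::finite \<Rightarrow> 'b::real_normed_vector) \<Rightarrow> bool"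
  where "smooth f \<longleftrightarrow> (\<forall>is. partials is f differentiable_on UNIV)"

definition schwartz :: "(real^'n::finite \<Rightarrow> complex) set"
  where "schwartz = {\<phi>. smooth \<phi> \<and>
    (\<forall>k is. bounded (range (\<lambda>x. norm x ^ k * norm (partials is \<phi> x))))}"

definition schwartz_seminorm :: "nat \<Rightarrow> 'n::finite list \<Rightarrow> (real^'n \<Rightarrow> complex) \<Rightarrow> real"
  where "schwartz_seminorm k is \<phi> = (SUP x. norm x ^ k * norm (partials is \<phi> x))"

definition tempered_distribution :: "((real^'n::finite \<Rightarrow> complex) \<Rightarrow> complex) \<Rightarrow> bool"
  where "tempered_distribution f \<longleftrightarrow>
    (\<forall>\<phi>\<in>schwartz. \<forall>\<psi>\<in>schwartz. \<forall>a b.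
       f (\<lambda>x. a * \<phi> x + b * \<psi> x) = a * f \<phi> + b * f \<psi>) \<and>
    (\<exists>C N. \<forall>\<phi>\<in>schwartz. norm (f \<phi>) \<le>
       C * (\<Sum>k\<le>N. \<Sum>is\<in>{is. length is \<le> N}. schwartz_seminorm k is \<phi>))"

definition distribution_of :: "(real^'n::finite \<Rightarrow> real) \<Rightarrow> (real^'n \<Rightarrow> complex) \<Rightarrow> complex"
  where "distribution_of F \<phi> = (LINT x|lebesgue. F x *\<^sub>R \<phi> x)"

text \<open>With this convention \<open>-\<Delta>\<close> has symbol \<open>|\<xi>|\<^sup>2\<close>, so that \<open>|\<xi>|\<close> is the symbol of its square root.
  A constant factor in front of the integral would not affect \<open>half_laplacian\<close>.\<close>

definition fourier :: "(real^'n::finite \<Rightarrow> complex) \<Rightarrow> real^'n \<Rightarrow> complex"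
  where "fourier f \<xi> = (LINT x|lebesgue. exp (- (\<i> * of_real (x \<bullet> \<xi>))) * f x)"

text \<open>The operator \<open>(-\<Delta>)\<^sup>1\<^sup>/\<^sup>2\<close> on Schwartz functions. An integrable function is determined almost
  everywhere by its Fourier transform; continuity selects a unique representative. For Schwartz
  \<open>\<phi>\<close> on \<open>\<real>\<^sup>n\<close> it exists: the inverse Fourier transform of \<open>norm \<xi> * fourier \<phi> \<xi>\<close> is smooth and
  \<open>O(|x|\<^sup>-\<^sup>n\<^sup>-\<^sup>1)\<close> at infinity.\<close>

definition half_laplacian :: "(real^'n::finite \<Rightarrow> complex) \<Rightarrow> real^'n \<Rightarrow> complex"
  where "half_laplacian \<phi> = (THE g. continuous_on UNIV g \<and> integrable lebesgue g \<and>
    (\<forall>\<xi>. fourier g \<xi> = of_real (norm \<xi>) * fourier \<phi> \<xi>))"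

definition L1_loc :: "(real^'n::finite \<Rightarrow> real) set"
  where "L1_loc = {v. \<forall>K. compact K \<longrightarrow> v absolutely_integrable_on K}"

definition L_half :: "(real^3 \<Rightarrow> real) set"
  where "L_half = {v \<in> L1_loc. integrable lebesgue (\<lambda>x. \<bar>v x\<bar> / (1 + norm x ^ 4))}"

definition test_functions :: "(real^'n::finite \<Rightarrow> real) set"
  where "test_functions = {\<phi>. smooth \<phi> \<and> compact (closure {x. \<phi> x \<noteq> 0})}"

definition weak_partials ::
    "'n::finite list \<Rightarrow> (real^'n \<Rightarrow> real) \<Rightarrow> (real^'n \<Rightarrow> real) \<Rightarrow> bool"
  where "weak_partials is u w \<longleftrightarrow> u \<in> L1_loc \<and> w \<in> L1_loc \<and>
    (\<forall>\<phi>\<in>test_functions.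
       (LINT x|lebesgue. u x * partials is \<phi> x) =
       (-1) ^ length is * (LINT x|lebesgue. w x * \<phi> x))"

definition W21_loc :: "(real^'n::finite \<Rightarrow> real) set"
  where "W21_loc = {u \<in> L1_loc. \<forall>is. length is \<le> 2 \<longrightarrow> (\<exists>w. weak_partials is u w)}"

definition weak_laplacian :: "(real^'n::finite \<Rightarrow> real) \<Rightarrow> (real^'n \<Rightarrow> real) \<Rightarrow> bool"
  where "weak_laplacian u v \<longleftrightarrow>
    (\<exists>w. (\<forall>i. weak_partials [i, i] u (w i)) \<and> v = (\<lambda>x. \<Sum>i\<in>UNIV. w i x))"

text \<open>Solutions of \<open>(-\<Delta>)\<^sup>3\<^sup>/\<^sup>2 u = f\<close>. The function \<open>v\<close> is a representative of \<open>\<Delta>u\<close>; since weak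
  derivatives are unique almost everywhere, its choice does not matter. The left-hand
  integrand is integrable because \<open>v \<in> L_half\<close> and \<open>half_laplacian \<phi> x\<close> is \<open>O(|x|\<^sup>-\<^sup>4)\<close>.\<close>

definition is_solution :: "((real^3 \<Rightarrow> complex) \<Rightarrow> complex) \<Rightarrow> (real^3 \<Rightarrow> real) \<Rightarrow> bool"
  where "is_solution f u \<longleftrightarrow> tempered_distribution f \<and> u \<in> W21_loc \<and>
    (\<exists>v. weak_laplacian u v \<and> v \<in> L_half \<and>
       (\<forall>\<phi>\<in>schwartz. (LINT x|lebesgue. (- v x) *\<^sub>R half_laplacian \<phi> x) = f \<phi>))"

end

theory Submission
  imports Defs "HOL-Probability.Probability" "HOL-Real_Asymp.Real_Asymp"
begin

text \<open>Put \<open>\<alpha> = V / \<pi>\<^sup>2 < 2\<close>. The solution is sought as \<open>u = \<alpha> (\<rho> * log 1/|x|) - b |x|\<^sup>2 + const\<close> with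
  \<open>e\<^sup>3\<^sup>u = V \<rho>\<close>: the quadratic term contributes a constant to \<open>\<Delta>u\<close>, which \<open>(-\<Delta>)\<^sup>1\<^sup>/\<^sup>2\<close> annihilates.
  The profile \<open>\<rho>\<close> is a fixed point of a map on radial weights which is monotone for the likelihood
  ratio order, because the radial derivative of the potential of a radial weight is the integral of
  a kernel that decreases in the radius. A truncation of the spherical solution
  \<open>(1 + |x|\<^sup>2)\<^sup>-\<^sup>3\<close> is a subsolution exactly when \<open>\<alpha> < 2\<close>, and iterating from it produces a monotone
  sequence dominated by a Gaussian. Convolution with the logarithm gains one derivative, which makes
  the fixed point smooth. Finally \<open>(-\<Delta>)\<^sup>1\<^sup>/\<^sup>2 |x|\<^sup>-\<^sup>2 = 2 \<pi>\<^sup>2 \<delta>\<close> is obtained by writing \<open>|x|\<^sup>-\<^sup>2\<close> and \<open>|\<xi>|\<^sup>-\<^sup>1\<close>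
  as superpositions of Gaussians.\<close>

subsection \<open>Lebesgue measure on three-dimensional space\<close>

text \<open>Dividing by the total mass destroys pointwise monotonicity of the map. The likelihood
  ratio order ignores constant factors, and between weights normalised to the value 1 at the origin
  it becomes a pointwise order again. For \<open>\<alpha> = 2\<close> and b = 0 the profile (1 +
  |x|^2)^-3 is itself a fixed point. Cut off at radius R its mass drops from M = pi^2 / 4 to A, and
  the normalised potential becomes at most M / A times as steep; as \<open>\<alpha> < 2\<close>, a
  large R gives \<open>\<alpha>\<close> M / (2 A) < 1. The remaining slack is spent on the quadratic
  term: on the ball of radius R, ln (1 + |x|^2) grows at least as fast as |x|^2 / (1 + R^2). This
  determines b, which is an output of the construction, and it is where the strict inequality V < 2
  pi^2 enters. The factor in \<open>\<alpha>\<close> comes from the fundamental solution: -Delta of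
  log 1/|x| is |x|^-2, whose half-Laplacian is 2 pi^2 delta, so the coefficient
  \<open>\<alpha>\<close> produces 2 pi^2 \<alpha> \<rho> = 2 V \<rho>.\<close>

lemma distr_lborel_orthogonal:
  fixes f :: "real^3 \<Rightarrow> real^3"
  assumes f: "orthogonal_transformation f"
  shows "distr lborel borel f = lborel"
proof (rule lborel_eqI[symmetric])
  have cont: "continuous_on UNIV f"
    using f by (simp add: linear_continuous_on orthogonal_transformation_linear linear_linear)
  then have [measurable]: "f \<in> borel_measurable borel"
    by (rule borel_measurable_continuous_onI)
  fix l u :: "real^3"
  assume le: "\<And>b. b \<in> Basis \<Longrightarrow> l \<bullet> b \<le> u \<bullet> b"
  have inv: "orthogonal_transformation (inv f)"
    using f by (rule orthogonal_transformation_inv)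
  have eq: "f -` box l u = inv f ` box l u"
    using f orthogonal_transformation_bij bij_vimage_eq_inv_image by blast
  have bm: "box l u \<in> lmeasurable" by simp
  have lm: "inv f ` box l u \<in> lmeasurable"
    using measurable_orthogonal_image[OF inv bm] .
  have op: "f -` box l u \<in> sets borel"
    using measurable_sets[OF \<open>f \<in> borel_measurable borel\<close>, of "box l u"] by simp
  have "emeasure (distr lborel borel f) (box l u) = emeasure lborel (f -` box l u)"
    by (subst emeasure_distr) auto
  also have "\<dots> = emeasure lebesgue (inv f ` box l u)"
    using op by (simp add: eq)
  also have "\<dots> = ennreal (measure lebesgue (inv f ` box l u))"
    using lm by (simp add: emeasure_eq_measure2 fmeasurableD fmeasurableD2)
  also have "\<dots> = ennreal (measure lebesgue (box l u))"
    using measure_orthogonal_image[OF inv bm] by simp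
  also have "\<dots> = (\<Prod>b\<in>Basis. (u - l) \<bullet> b)"
    using le by (simp add: measure_lborel_box_eq)
  finally show "emeasure (distr lborel borel f) (box l u) = (\<Prod>b\<in>Basis. (u - l) \<bullet> b)" .
qed simp

lemma orthogonal_borel_measurable:
  fixes f :: "real^3 \<Rightarrow> real^3"
  assumes f: "orthogonal_transformation f"
  shows "f \<in> borel_measurable borel"
  using f by (intro borel_measurable_continuous_onI)
    (simp add: linear_continuous_on orthogonal_transformation_linear linear_linear)

lemma integral_orthogonal:
  fixes f :: "real^3 \<Rightarrow> real^3" and h :: "real^3 \<Rightarrow> 'b::{banach, second_countable_topology}"
  assumes f: "orthogonal_transformation f" and h: "h \<in> borel_measurable borel"
  shows "(LINT x|lborel. h (f x)) = (LINT x|lborel. h x)"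
  using integral_distr[of f lborel borel h] h
    distr_lborel_orthogonal[OF f] orthogonal_borel_measurable[OF f] by simp

lemma nn_integral_orthogonal:
  fixes f :: "real^3 \<Rightarrow> real^3"
  assumes f: "orthogonal_transformation f" and h: "h \<in> borel_measurable borel"
  shows "(\<integral>\<^sup>+x. h (f x) \<partial>lborel) = (\<integral>\<^sup>+x. h x \<partial>lborel)"
  using nn_integral_distr[of f lborel borel h] h
    distr_lborel_orthogonal[OF f] orthogonal_borel_measurable[OF f] by simp

lemma distr_lborel_shift:
  "distr lborel borel (\<lambda>x. a + x) = (lborel :: 'a::euclidean_space measure)"
  using lborel_affine[of 1 a] by (simp add: density_1)

lemma distr_lborel_reflect:
  "distr lborel borel (\<lambda>x. a - x) = (lborel :: 'a::euclidean_space measure)"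
  using lborel_affine[of "-1" a] by (simp add: density_1)

lemma
  fixes h :: "'a::euclidean_space \<Rightarrow> 'b::{banach, second_countable_topology}"
  assumes h: "h \<in> borel_measurable borel"
  shows integral_shift: "(LINT x|lborel. h (a + x)) = (LINT x|lborel. h x)"
    and integrable_shift: "integrable lborel (\<lambda>x. h (a + x)) \<longleftrightarrow> integrable lborel h"
    and integral_reflect: "(LINT x|lborel. h (a - x)) = (LINT x|lborel. h x)"
    and integrable_reflect: "integrable lborel (\<lambda>x. h (a - x)) \<longleftrightarrow> integrable lborel h"
  using integral_distr[of "\<lambda>x. a + x" lborel borel h] integrable_distr_eq[of "\<lambda>x. a + x" lborel borel h]
    integral_distr[of "\<lambda>x. a - x" lborel borel h] integrable_distr_eq[of "\<lambda>x. a - x" lborel borel h] h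
  by (simp_all add: distr_lborel_shift distr_lborel_reflect)

lemma
  fixes h :: "'a::euclidean_space \<Rightarrow> ennreal"
  assumes h: "h \<in> borel_measurable borel"
  shows nn_integral_shift: "(\<integral>\<^sup>+x. h (a + x) \<partial>lborel) = (\<integral>\<^sup>+x. h x \<partial>lborel)"
    and nn_integral_reflect: "(\<integral>\<^sup>+x. h (a - x) \<partial>lborel) = (\<integral>\<^sup>+x. h x \<partial>lborel)"
  using nn_integral_distr[of "\<lambda>x. a + x" lborel borel h]
    nn_integral_distr[of "\<lambda>x. a - x" lborel borel h] h
  by (simp_all add: distr_lborel_shift distr_lborel_reflect)

lemma emeasure_lborel_Times:
  fixes A :: "'a::euclidean_space set" and B :: "'b::euclidean_space set"
  assumes "A \<in> sets borel" "B \<in> sets borel"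
  shows "emeasure lborel (A \<times> B) = emeasure lborel A * emeasure lborel B"
  unfolding lborel_prod[symmetric] using assms by (simp add: lborel.emeasure_pair_measure_Times)

lemma box_Pair_eq: "box (a, c) (b, d) = box a b \<times> box c d"
  for a b :: "'a::euclidean_space" and c d :: "'b::euclidean_space"
  by (force simp: box_def Basis_prod_def)

text \<open>Brings Fubini to \<open>real^3\<close>; it is used for cylindrical coordinates and to
  factor Gaussian integrals over the coordinates.\<close>

lemma lborel_vec3:
  "distr (lborel :: ((real\<times>real)\<times>real) measure) borel (\<lambda>q. vector [fst (fst q), snd (fst q), snd q] :: real^3) = lborel"
proof (rule lborel_eqI[symmetric])
  let ?f = "\<lambda>q :: (real\<times>real)\<times>real. vector [fst (fst q), snd (fst q), snd q] :: real^3"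
  have f_eq: "?f = (\<lambda>q. fst (fst q) *\<^sub>R axis 1 1 + snd (fst q) *\<^sub>R axis 2 1 + snd q *\<^sub>R axis 3 1)"
    by (auto simp: fun_eq_iff vec_eq_iff forall_3 axis_def)
  have [measurable]: "?f \<in> borel_measurable borel"
    unfolding f_eq by (intro borel_measurable_continuous_onI continuous_intros)
  fix l u :: "real^3"
  assume le: "\<And>b. b \<in> Basis \<Longrightarrow> l \<bullet> b \<le> u \<bullet> b"
  have le': "l $ i \<le> u $ i" for i
    using le[of "axis i 1"] by (simp add: inner_axis axis_in_Basis_iff)
  have box: "?f -` box l u = box ((l$1, l$2), l$3) ((u$1,u$2),u$3)"
  proof -
    have "?f q \<in> box l u \<longleftrightarrow> q \<in> box ((l$1, l$2), l$3) ((u$1,u$2),u$3)" for q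
      by (cases q) (simp only: mem_box_cart forall_3 vector_3 box_Pair_eq fst_conv snd_conv
        mem_Times_iff box_real greaterThanLessThan_iff, auto)
    then show ?thesis by blast
  qed
  have "emeasure (distr lborel borel ?f) (box l u) = emeasure lborel (?f -` box l u)"
    by (subst emeasure_distr) auto
  also have "\<dots> = ennreal ((u$1-l$1) * (u$2-l$2) * (u$3-l$3))"
    unfolding box box_Pair_eq
    using le' by (simp add: emeasure_lborel_Times ennreal_mult borel_prod[symmetric])
  also have "\<dots> = (\<Prod>b\<in>Basis. (u - l) \<bullet> b)"
  proof -
    have "(\<Prod>b\<in>Basis. (u - l) \<bullet> b) = (\<Prod>i\<in>UNIV. (u-l) \<bullet> axis i 1)"
      unfolding Basis_vec_def by (subst prod.UNION_disjoint) (auto simp: axis_eq_axis)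
    then show ?thesis unfolding UNIV_3 by (simp add: inner_axis mult.assoc)
  qed
  finally show "emeasure (distr lborel borel ?f) (box l u) = (\<Prod>b\<in>Basis. (u - l) \<bullet> b)" .
qed simp

text \<open>A disc of radius sqrt a has area pi a, linear in a, so the squared radius has constant
  density. This is why |y|^2 rather than |y| serves as the radial variable.\<close>

lemma distr_lborel_norm_sq_plane:
  "distr (lborel :: (real\<times>real) measure) borel (\<lambda>w. (norm w)\<^sup>2) = density lborel (\<lambda>q. ennreal pi * indicator {0<..} q)"
  (is "?L = ?R")
proof (rule measure_eqI_generator_eq[where E="range (\<lambda>a::real. {..<a})" and \<Omega>=UNIV and A="\<lambda>n::nat. {..<real n}"])
  show "Int_stable (range (\<lambda>a::real. {..<a}))"
  proof (clarsimp simp: Int_stable_def simp del: lessThan_Int_lessThan)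
    show "{..<a} \<inter> {..<b} \<in> range (\<lambda>a::real. {..<a})" for a b :: real
      by (rule range_eqI[of _ _ "min a b"]) auto
  qed
  show "sets ?L = sigma_sets UNIV (range (\<lambda>a::real. {..<a}))"
    "sets ?R = sigma_sets UNIV (range (\<lambda>a::real. {..<a}))"
    unfolding sets_distr sets_density sets_lborel
    by (subst borel_Iio; simp add: sets_measure_of)+
  show "(\<Union>i::nat. {..<real i}) = (UNIV :: real set)"
    using reals_Archimedean2 by auto
  have em: "emeasure ?L {..<a} = ennreal (pi * max 0 a)" for a
  proof -
    have "emeasure ?L {..<a} = emeasure lborel ((\<lambda>w::real\<times>real. (norm w)\<^sup>2) -` {..<a})"
      by (subst emeasure_distr) auto
    also have "(\<lambda>w::real\<times>real. (norm w)\<^sup>2) -` {..<a} = ball 0 (sqrt (max 0 a))"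
    proof -
      have "(norm w)\<^sup>2 < a \<longleftrightarrow> norm w < sqrt (max 0 a)" for w :: "real\<times>real"
      proof -
        have "norm w < sqrt (max 0 a) \<longleftrightarrow> sqrt ((norm w)\<^sup>2) < sqrt (max 0 a)" by simp
        also have "\<dots> \<longleftrightarrow> (norm w)\<^sup>2 < max 0 a" by (rule real_sqrt_less_iff)
        also have "\<dots> \<longleftrightarrow> (norm w)\<^sup>2 < a" using zero_le_power2[of "norm w"] by linarith
        finally show ?thesis by simp
      qed
      then show ?thesis by (auto simp del: zero_le_power2)
    qed
    also have "emeasure lborel \<dots> = ennreal (pi * max 0 a)"
      by (subst emeasure_ball) (auto simp: unit_ball_vol_2)
    finally show ?thesis .
  qed
  have em2: "emeasure ?R {..<a} = ennreal (pi * max 0 a)" for a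
  proof -
    have "emeasure ?R {..<a} = (\<integral>\<^sup>+q. ennreal pi * indicator {0<..<a} q \<partial>lborel)"
      by (subst emeasure_density) (auto intro!: nn_integral_cong simp: indicator_def)
    also have "\<dots> = ennreal pi * ennreal (max 0 a)"
      by (subst nn_integral_cmult) (auto simp: max_def emeasure_lborel_Ioo)
    finally show ?thesis by (simp add: ennreal_mult)
  qed
  show "emeasure ?L X = emeasure ?R X" if "X \<in> range (\<lambda>a::real. {..<a})" for X
    using that em em2 by auto
  show "emeasure ?L {..<real i} \<noteq> \<infinity>" for i
    using em by simp
qed auto

lemma nn_integral_norm_sq_plane:
  fixes h :: "real \<Rightarrow> ennreal"
  assumes [measurable]: "h \<in> borel_measurable borel"
  shows "(\<integral>\<^sup>+w. h ((norm (w::real\<times>real))\<^sup>2) \<partial>lborel) = ennreal pi * (\<integral>\<^sup>+q. h q * indicator {0<..} q \<partial>lborel)"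
proof -
  have "(\<integral>\<^sup>+w. h ((norm (w::real\<times>real))\<^sup>2) \<partial>lborel) = (\<integral>\<^sup>+q. h q \<partial>distr (lborel :: (real\<times>real) measure) borel (\<lambda>w. (norm w)\<^sup>2))"
    by (subst nn_integral_distr) auto
  also have "\<dots> = (\<integral>\<^sup>+q. (ennreal pi * indicator {0<..} q) * h q \<partial>lborel)"
    unfolding distr_lborel_norm_sq_plane by (subst nn_integral_density) auto
  also have "\<dots> = (\<integral>\<^sup>+q. ennreal pi * (h q * indicator {0<..} q) \<partial>lborel)"
    by (intro nn_integral_cong) (simp add: mult_ac)
  also have "\<dots> = ennreal pi * (\<integral>\<^sup>+q. h q * indicator {0<..} q \<partial>lborel)"
    by (subst nn_integral_cmult) auto
  finally show ?thesis .
qed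

text \<open>At fixed height z, |y|^2 is the planar squared radius shifted by z^2, so the pair
  (|y|^2, y_3) has constant density pi on z^2 < p. Integrands that depend on |y| and on the angle to
  one axis are thereby reduced to two real variables.\<close>

lemma nn_integral_cylinder:
  fixes F :: "real \<Rightarrow> real \<Rightarrow> ennreal"
  assumes [measurable]: "case_prod F \<in> borel_measurable (borel \<Otimes>\<^sub>M borel)"
  shows "(\<integral>\<^sup>+y. F ((norm (y::real^3))\<^sup>2) (y$3) \<partial>lborel) =
    ennreal pi * (\<integral>\<^sup>+p. \<integral>\<^sup>+z. F p z * indicator {z. z\<^sup>2 < p} z \<partial>lborel \<partial>lborel)"
proof -
  let ?f = "\<lambda>q :: (real\<times>real)\<times>real. vector [fst (fst q), snd (fst q), snd q] :: real^3"
  have f_eq: "?f = (\<lambda>q. fst (fst q) *\<^sub>R axis 1 1 + snd (fst q) *\<^sub>R axis 2 1 + snd q *\<^sub>R axis 3 1)"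
    by (auto simp: fun_eq_iff vec_eq_iff forall_3 axis_def)
  have [measurable]: "?f \<in> borel_measurable borel"
    unfolding f_eq by (intro borel_measurable_continuous_onI continuous_intros)
  have nf: "(norm (?f q))\<^sup>2 = (norm (fst q))\<^sup>2 + (snd q)\<^sup>2" for q
    unfolding power2_norm_eq_inner inner_vec_def sum_3 inner_prod_def by (simp add: power2_eq_square)
  have [measurable]: "(\<lambda>y::real^3. y$3) \<in> borel_measurable borel"
    by (intro borel_measurable_continuous_onI continuous_intros)
  have "(\<integral>\<^sup>+y. F ((norm (y::real^3))\<^sup>2) (y$3) \<partial>lborel) =
    (\<integral>\<^sup>+y. F ((norm (y::real^3))\<^sup>2) (y$3) \<partial>distr (lborel :: ((real\<times>real)\<times>real) measure) borel ?f)"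
    by (simp add: lborel_vec3)
  also have "\<dots> = (\<integral>\<^sup>+q. F ((norm (fst q))\<^sup>2 + (snd q)\<^sup>2) (snd q) \<partial>(lborel :: ((real\<times>real)\<times>real) measure))"
    by (subst nn_integral_distr) (auto simp: nf)
  also have "\<dots> = (\<integral>\<^sup>+z. \<integral>\<^sup>+w. F ((norm (w::real\<times>real))\<^sup>2 + z\<^sup>2) z \<partial>lborel \<partial>lborel)"
    unfolding lborel_prod[symmetric, where 'a="real\<times>real" and 'b=real]
    by (subst lborel_pair.nn_integral_snd[symmetric]) auto
  also have "\<dots> = (\<integral>\<^sup>+z. ennreal pi * (\<integral>\<^sup>+p. F p z * indicator {z. z\<^sup>2 < p} z \<partial>lborel) \<partial>lborel)"
  proof (intro nn_integral_cong)
    fix z :: real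
    have "(\<integral>\<^sup>+w. F ((norm (w::real\<times>real))\<^sup>2 + z\<^sup>2) z \<partial>lborel) = ennreal pi * (\<integral>\<^sup>+q. F (q + z\<^sup>2) z * indicator {0<..} q \<partial>lborel)"
      by (rule nn_integral_norm_sq_plane) measurable
    also have "(\<integral>\<^sup>+q. F (q + z\<^sup>2) z * indicator {0<..} q \<partial>lborel) = (\<integral>\<^sup>+q. F (z\<^sup>2 + q) z * indicator {z. z\<^sup>2 < z\<^sup>2 + q} z \<partial>lborel)"
      by (intro nn_integral_cong) (auto simp: indicator_def add.commute)
    also have "\<dots> = (\<integral>\<^sup>+q. F (z\<^sup>2 + q) z * indicator {z\<^sup>2 <..} (z\<^sup>2 + q) \<partial>lborel)"
      by (intro nn_integral_cong) (auto simp: indicator_def add.commute)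
    also have "\<dots> = (\<integral>\<^sup>+q. F q z * indicator {z\<^sup>2 <..} q \<partial>lborel)"
      by (rule nn_integral_shift[of "\<lambda>q. F q z * indicator {z\<^sup>2 <..} q"]) measurable
    also have "\<dots> = (\<integral>\<^sup>+q. F q z * indicator {z. z\<^sup>2 < q} z \<partial>lborel)"
      by (intro nn_integral_cong) (auto simp: indicator_def add.commute)
    finally show "(\<integral>\<^sup>+w. F ((norm (w::real\<times>real))\<^sup>2 + z\<^sup>2) z \<partial>lborel) = ennreal pi * (\<integral>\<^sup>+q. F q z * indicator {z. z\<^sup>2 < q} z \<partial>lborel)" .
  qed
  also have "\<dots> = ennreal pi * (\<integral>\<^sup>+z. \<integral>\<^sup>+p. F p z * indicator {z. z\<^sup>2 < p} z \<partial>lborel \<partial>lborel)"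
  proof (subst nn_integral_cmult)
    have [measurable]: "(\<lambda>(z,p). F p z * indicator {z. z\<^sup>2 < p} z) \<in> borel_measurable (borel \<Otimes>\<^sub>M borel)"
      unfolding indicator_def by measurable
    show "(\<lambda>z. \<integral>\<^sup>+p. F p z * indicator {z. z\<^sup>2 < p} z \<partial>lborel) \<in> borel_measurable lborel"
      by measurable
  qed auto
  also have "(\<integral>\<^sup>+z. \<integral>\<^sup>+p. F p z * indicator {z. z\<^sup>2 < p} z \<partial>lborel \<partial>lborel) = (\<integral>\<^sup>+p. \<integral>\<^sup>+z. F p z * indicator {z. z\<^sup>2 < p} z \<partial>lborel \<partial>lborel)"
    unfolding indicator_def by (rule lborel_pair.Fubini') measurable
  finally show ?thesis .
qed

text \<open>The density 2 pi sqrt p is pi times the length of the chord z^2 < p.\<close>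

lemma nn_integral_radial:
  fixes f :: "real \<Rightarrow> ennreal"
  assumes [measurable]: "f \<in> borel_measurable borel"
  shows "(\<integral>\<^sup>+y. f ((norm (y::real^3))\<^sup>2) \<partial>lborel) =
    (\<integral>\<^sup>+p. f p * ennreal (2 * pi * sqrt p) * indicator {0<..} p \<partial>lborel)"
proof -
  have "(\<integral>\<^sup>+y. f ((norm (y::real^3))\<^sup>2) \<partial>lborel) = ennreal pi * (\<integral>\<^sup>+p. \<integral>\<^sup>+z. f p * indicator {z. z\<^sup>2 < p} z \<partial>lborel \<partial>lborel)"
    using nn_integral_cylinder[of "\<lambda>p z. f p"] by simp
  also have "\<dots> = ennreal pi * (\<integral>\<^sup>+p. f p * ennreal (2 * sqrt p) * indicator {0<..} p \<partial>lborel)"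
  proof (intro arg_cong2[where f="(*)"] refl nn_integral_cong)
    fix p :: real
    have "(\<integral>\<^sup>+z. f p * indicator {z. z\<^sup>2 < p} z \<partial>lborel) = f p * emeasure lborel {z. z\<^sup>2 < p}"
      by (subst nn_integral_cmult) auto
    also have "emeasure lborel {z. z\<^sup>2 < p} = ennreal (2 * sqrt p) * indicator {0<..} p"
    proof (cases "p > 0")
      case True
      have "z\<^sup>2 < p \<longleftrightarrow> - sqrt p < z \<and> z < sqrt p" for z
        using real_sqrt_less_iff[of "z\<^sup>2" p] unfolding real_sqrt_abs by linarith
      then have "{z. z\<^sup>2 < p} = {- sqrt p<..<sqrt p}"
        by (simp only: greaterThanLessThan_eq set_eq_iff mem_Collect_eq Int_iff greaterThan_iff lessThan_iff) blast
      then show ?thesis using True by simp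
    next
      case False
      then have "{z. z\<^sup>2 < p} = {}" by (auto simp: not_less) (smt (verit) zero_le_power2)
      then show ?thesis using False by simp
    qed
    finally show "(\<integral>\<^sup>+z. f p * indicator {z. z\<^sup>2 < p} z \<partial>lborel) = f p * ennreal (2 * sqrt p) * indicator {0<..} p"
      by (simp add: mult_ac)
  qed
  also have "\<dots> = (\<integral>\<^sup>+p. f p * ennreal (2 * pi * sqrt p) * indicator {0<..} p \<partial>lborel)"
    by (subst nn_integral_cmult[symmetric]) (auto intro!: nn_integral_cong simp: ennreal_mult' mult_ac)
  finally show ?thesis .
qed

section \<open>Integrals of nonnegative functions through a primitive\<close>

lemma nn_integral_FTC_einterval:
  fixes f F :: "real \<Rightarrow> real" and a b :: ereal
  assumes "a < b"
    and F: "\<And>x. a < ereal x \<Longrightarrow> ereal x < b \<Longrightarrow> (F has_real_derivative f x) (at x)"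
    and f: "\<And>x. a < ereal x \<Longrightarrow> ereal x < b \<Longrightarrow> isCont f x"
    and nn: "\<And>x. a < ereal x \<Longrightarrow> ereal x < b \<Longrightarrow> 0 \<le> f x"
    and A: "((F \<circ> real_of_ereal) \<longlongrightarrow> A) (at_right a)"
    and B: "((F \<circ> real_of_ereal) \<longlongrightarrow> B) (at_left b)"
  shows "(\<integral>\<^sup>+x. ennreal (f x) * indicator (einterval a b) x \<partial>lborel) = ennreal (B - A)"
proof -
  have 1: "set_integrable lborel (einterval a b) f" "(LBINT x=a..b. f x) = B - A"
    using interval_integral_FTC_nonneg[of a b F f A B] assms by auto
  have "(\<integral>\<^sup>+x. ennreal (f x) * indicator (einterval a b) x \<partial>lborel)
      = (\<integral>\<^sup>+x. ennreal (indicator (einterval a b) x *\<^sub>R f x) \<partial>lborel)"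
    by (intro nn_integral_cong) (auto simp: indicator_def)
  also have "\<dots> = ennreal (LINT x|lborel. indicator (einterval a b) x *\<^sub>R f x)"
    by (rule nn_integral_eq_integral) (use 1 nn in \<open>auto simp: set_integrable_def indicator_def einterval_def\<close>)
  also have "(LINT x|lborel. indicator (einterval a b) x *\<^sub>R f x) = B - A"
    using 1(2) \<open>a < b\<close> by (simp add: interval_lebesgue_integral_def set_lebesgue_integral_def less_imp_le)
  finally show ?thesis .
qed

lemma nn_integral_FTC_Ioo:
  fixes f F :: "real \<Rightarrow> real"
  assumes "a < b"
    and F: "\<And>x. a < x \<Longrightarrow> x < b \<Longrightarrow> (F has_real_derivative f x) (at x)"
    and f: "\<And>x. a < x \<Longrightarrow> x < b \<Longrightarrow> isCont f x"
    and nn: "\<And>x. a < x \<Longrightarrow> x < b \<Longrightarrow> 0 \<le> f x"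
    and A: "(F \<longlongrightarrow> A) (at_right a)"
    and B: "(F \<longlongrightarrow> B) (at_left b)"
  shows "(\<integral>\<^sup>+x. ennreal (f x) * indicator {a<..<b} x \<partial>lborel) = ennreal (B - A)"
proof -
  have "einterval (ereal a) (ereal b) = {a<..<b}" by simp
  with nn_integral_FTC_einterval[of "ereal a" "ereal b" F f A B] assms show ?thesis
    by (simp add: ereal_tendsto_simps)
qed

lemma nn_integral_FTC_Ioi:
  fixes f F :: "real \<Rightarrow> real"
  assumes F: "\<And>x. a < x \<Longrightarrow> (F has_real_derivative f x) (at x)"
    and f: "\<And>x. a < x \<Longrightarrow> isCont f x"
    and nn: "\<And>x. a < x \<Longrightarrow> 0 \<le> f x"
    and A: "(F \<longlongrightarrow> A) (at_right a)"
    and B: "(F \<longlongrightarrow> B) at_top"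
  shows "(\<integral>\<^sup>+x. ennreal (f x) * indicator {a<..} x \<partial>lborel) = ennreal (B - A)"
proof -
  have "einterval (ereal a) \<infinity> = {a<..}" by (auto simp: einterval_def)
  with nn_integral_FTC_einterval[of "ereal a" \<infinity> F f A B] assms show ?thesis
    by (simp add: ereal_tendsto_simps)
qed

section \<open>Explicit radial integrals\<close>

lemma nn_integral_inverse_norm_sq_ball:
  "(\<integral>\<^sup>+z. ennreal (1 / (norm (z::real^3))\<^sup>2) * indicator (ball 0 1) z \<partial>lborel) = ennreal (4 * pi)"
proof -
  have "(\<integral>\<^sup>+z. ennreal (1 / (norm (z::real^3))\<^sup>2) * indicator (ball 0 1) z \<partial>lborel) =
     (\<integral>\<^sup>+z. (\<lambda>p. ennreal (1/p) * indicator {..<1} p) ((norm (z::real^3))\<^sup>2) \<partial>lborel)"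
  proof (intro nn_integral_cong)
    fix z :: "real^3"
    have "(norm z)\<^sup>2 < 1 \<longleftrightarrow> norm z < 1"
      using abs_square_less_1[of "norm z"] by simp
    then show "ennreal (1 / (norm z)\<^sup>2) * indicator (ball 0 1) z =
       (\<lambda>p. ennreal (1/p) * indicator {..<1} p) ((norm z)\<^sup>2)"
      by (simp add: indicator_def)
  qed
  also have "\<dots> = (\<integral>\<^sup>+p. ennreal (1/p) * indicator {..<1} p * ennreal (2 * pi * sqrt p) * indicator {0<..} p \<partial>lborel)"
    by (subst nn_integral_radial) auto
  also have "\<dots> = (\<integral>\<^sup>+p. ennreal (2 * pi / sqrt p) * indicator {0<..<1} p \<partial>lborel)"
  proof (intro nn_integral_cong)
    fix p :: real
    have "1/p * (2 * pi * sqrt p) = 2 * pi / sqrt p" if "0 < p"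
      using that real_sqrt_mult_self[of p] by (simp add: field_simps)
    then show "ennreal (1/p) * indicator {..<1} p * ennreal (2 * pi * sqrt p) * indicator {0<..} p
      = ennreal (2 * pi / sqrt p) * indicator {0<..<1} p"
      by (auto simp: indicator_def simp flip: ennreal_mult')
  qed
  also have "\<dots> = ennreal (4 * pi * sqrt 1 - 4 * pi * sqrt 0)"
  proof (rule nn_integral_FTC_Ioo)
    show "((\<lambda>p. 4 * pi * sqrt p) has_real_derivative 2 * pi / sqrt p) (at p)" if "0 < p" for p
      using that by (auto intro!: derivative_eq_intros simp: field_simps)
    show "((\<lambda>p. 4 * pi * sqrt p) \<longlongrightarrow> 4 * pi * sqrt 0) (at_right 0)"
      by (intro tendsto_intros)
    show "((\<lambda>p. 4 * pi * sqrt p) \<longlongrightarrow> 4 * pi * sqrt 1) (at_left 1)"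
      by (intro tendsto_intros)
    show "isCont (\<lambda>p. 2 * pi / sqrt p) p" if "0 < p" for p
      using that by (intro continuous_intros) auto
  qed auto
  finally show ?thesis by simp
qed

lemma nn_integral_inverse_norm_pow4_outside:
  "(\<integral>\<^sup>+z. ennreal (1 / (norm (z::real^3))^4) * indicator (- cball 0 1) z \<partial>lborel) = ennreal (4 * pi)"
proof -
  have "(\<integral>\<^sup>+z. ennreal (1 / (norm (z::real^3))^4) * indicator (- cball 0 1) z \<partial>lborel) =
     (\<integral>\<^sup>+z. (\<lambda>p. ennreal (1/p^2) * indicator {1<..} p) ((norm (z::real^3))\<^sup>2) \<partial>lborel)"
  proof (intro nn_integral_cong)
    fix z :: "real^3"
    have "1 < (norm z)\<^sup>2 \<longleftrightarrow> \<not> norm z \<le> 1"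
      using abs_square_le_1[of "norm z"] by auto
    then show "ennreal (1 / (norm (z::real^3))^4) * indicator (- cball 0 1) z = (\<lambda>p. ennreal (1/p^2) * indicator {1<..} p) ((norm (z::real^3))\<^sup>2)"
      by (auto simp: indicator_def)
  qed
  also have "\<dots> = (\<integral>\<^sup>+p. ennreal (1/p^2) * indicator {1<..} p * ennreal (2 * pi * sqrt p) * indicator {0<..} p \<partial>lborel)"
    by (subst nn_integral_radial) auto
  also have "\<dots> = (\<integral>\<^sup>+p. ennreal (2 * pi / (p * sqrt p)) * indicator {1<..} p \<partial>lborel)"
  proof (intro nn_integral_cong)
    fix p :: real
    have "1/p^2 * (2 * pi * sqrt p) = 2 * pi / (p * sqrt p)" if "1 < p"
      using that real_sqrt_mult_self[of p] by (simp add: field_simps power2_eq_square)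
    then show "ennreal (1/p^2) * indicator {1<..} p * ennreal (2 * pi * sqrt p) * indicator {0<..} p = ennreal (2 * pi / (p * sqrt p)) * indicator {1<..} p"
      by (auto simp: indicator_def simp flip: ennreal_mult')
  qed
  also have "\<dots> = ennreal (0 - (-4 * pi / sqrt 1))"
  proof (rule nn_integral_FTC_Ioi)
    show "((\<lambda>p. -4 * pi / sqrt p) has_real_derivative 2 * pi / (p * sqrt p)) (at p)" if "1 < p" for p
      using that by (auto intro!: derivative_eq_intros simp: field_simps power2_eq_square)
    show "((\<lambda>p. -4 * pi / sqrt p) \<longlongrightarrow> -4 * pi / sqrt 1) (at_right 1)"
      by (intro tendsto_intros) auto
    show "((\<lambda>p. -4 * pi / sqrt p) \<longlongrightarrow> 0) at_top"
      by real_asymp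
    show "isCont (\<lambda>p. 2 * pi / (p * sqrt p)) p" if "1 < p" for p
      using that by (intro continuous_intros) auto
  qed auto
  finally show ?thesis by simp
qed

text \<open>The integrand is 1/8 of the Jacobian (2 / (1 + |x|^2))^3 of stereographic projection, so
  the value is 1/8 of the volume 2 pi^2 of the unit three-sphere.\<close>

lemma nn_integral_bubble_mass:
  "(\<integral>\<^sup>+z. ennreal (1 / (1 + (norm (z::real^3))\<^sup>2)^3) \<partial>lborel) = ennreal (pi\<^sup>2 / 4)"
proof -
  have "(\<integral>\<^sup>+z. ennreal (1 / (1 + (norm (z::real^3))\<^sup>2)^3) \<partial>lborel) =
     (\<integral>\<^sup>+p. ennreal (1/(1+p)^3) * ennreal (2 * pi * sqrt p) * indicator {0<..} p \<partial>lborel)"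
    by (subst nn_integral_radial[of "\<lambda>p. ennreal (1/(1+p)^3)", symmetric]) auto
  also have "\<dots> = (\<integral>\<^sup>+p. ennreal (2 * pi * sqrt p / (1+p)^3) * indicator {0<..} p \<partial>lborel)"
    by (intro nn_integral_cong) (auto simp: indicator_def simp flip: ennreal_mult')
  \<comment> \<open>With s = sqrt p the integrand is 4 pi s^2 / (1 + s^2)^3 ds, and partial
    fractions give this primitive.\<close>
  also have "\<dots> = ennreal (pi\<^sup>2 / 4 - (pi / 2 * (arctan (sqrt 0) + (0 * sqrt 0 - sqrt 0) / (1+0)\<^sup>2)))"
  proof (rule nn_integral_FTC_Ioi)
    show "((\<lambda>p. pi / 2 * (arctan (sqrt p) + (p * sqrt p - sqrt p) / (1+p)\<^sup>2)) has_real_derivative 2 * pi * sqrt p / (1+p)^3) (at p)" if "0 < p" for p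
    proof -
      define s where "s = sqrt p"
      have s: "s > 0" "p = s\<^sup>2" "sqrt p = s" using that by (auto simp: s_def)
      have ne: "(1 + p)\<^sup>2 \<noteq> 0" "1 + s\<^sup>2 \<noteq> 0" using that s(1) by (auto simp: add_nonneg_eq_0_iff)
      have d1: "(sqrt has_real_derivative inverse s / 2) (at p)"
        using DERIV_real_sqrt[OF that] by (simp add: s(3))
      have d2: "((\<lambda>p. arctan (sqrt p)) has_real_derivative inverse (1 + (sqrt p)\<^sup>2) * (inverse s / 2)) (at p)"
        by (rule DERIV_chain2[OF DERIV_arctan d1])
      have d4: "((\<lambda>p. (1 + p)\<^sup>2) has_real_derivative 2 * (1 + p)) (at p)"
        by (auto intro!: derivative_eq_intros)
      show ?thesis
      proof (rule DERIV_cong[OF DERIV_cmult[OF DERIV_add[OF d2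
            DERIV_divide[OF DERIV_diff[OF DERIV_mult[OF DERIV_ident d1] d1] d4 ne(1)]]]], unfold s(3))
        have s0: "s \<noteq> 0" using s by simp
        show "pi / 2 * (inverse (1 + s\<^sup>2) * (inverse s / 2) +
          ((1 * s + inverse s / 2 * p - inverse s / 2) * (1 + p)\<^sup>2 - (p * s - s) * (2 * (1 + p))) /
            ((1 + p)\<^sup>2 * (1 + p)\<^sup>2)) = 2 * pi * s / (1 + p) ^ 3"
          unfolding s(2) using s0 ne(2)
          apply (simp add: divide_simps)
          apply algebra
          done
      qed
    qed
    show "((\<lambda>p. pi / 2 * (arctan (sqrt p) + (p * sqrt p - sqrt p) / (1+p)\<^sup>2)) \<longlongrightarrow> pi / 2 * (arctan (sqrt 0) + (0 * sqrt 0 - sqrt 0) / (1+0)\<^sup>2)) (at_right 0)"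
      by (intro tendsto_intros) auto
    have "((\<lambda>p. pi / 2 * (arctan (sqrt p) + (p * sqrt p - sqrt p) / (1+p)\<^sup>2)) \<longlongrightarrow> pi / 2 * (pi / 2 + 0)) at_top"
      by (intro tendsto_intros filterlim_compose[OF tendsto_arctan_at_top sqrt_at_top]) real_asymp
    then show "((\<lambda>p. pi / 2 * (arctan (sqrt p) + (p * sqrt p - sqrt p) / (1+p)\<^sup>2)) \<longlongrightarrow> pi\<^sup>2 / 4) at_top"
      by (simp add: power2_eq_square)
    show "isCont (\<lambda>p. 2 * pi * sqrt p / (1+p)^3) p" if "0 < p" for p
      using that by (intro continuous_intros) auto
  qed auto
  finally show ?thesis by simp
qed

section \<open>The radial kernel of the logarithmic potential\<close>

definition sphere_log :: "real \<Rightarrow> real" where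
  "sphere_log t = ln \<bar>(1 + t) / (1 - t)\<bar>"

text \<open>With t = |y| / |x|, \<open>1 / 2 + shell t\<close> is the mean of x . (x - y) / |x -
  y|^2 over the sphere of radius |y|. The absolute value in \<open>sphere_log\<close> lets one
  formula cover both sides of t = 1, where the conventions for division and logarithm give the
  correct limit 0.\<close>

definition shell :: "real \<Rightarrow> real" where
  "shell t = (1 - t\<^sup>2) / (4 * t) * sphere_log t"

lemma sphere_log_eq: "0 < t \<Longrightarrow> t < 1 \<Longrightarrow> sphere_log t = ln (1 + t) - ln (1 - t)"
  by (simp add: sphere_log_def ln_div)

lemma sphere_log_inverse: "0 < t \<Longrightarrow> sphere_log (1 / t) = sphere_log t"
proof -
  assume "0 < t"
  then have "(1 + 1/t) / (1 - 1/t) = - ((1 + t) / (1 - t))"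
    by (cases "t = 1") (auto simp: field_simps)
  then show ?thesis unfolding sphere_log_def by (simp only: abs_minus_cancel)
qed

text \<open>Inversion in the unit sphere; it carries sign, monotonicity and bounds from t < 1 to t >
  1.\<close>

lemma shell_inverse: "0 < t \<Longrightarrow> shell (1 / t) = - shell t"
  unfolding shell_def sphere_log_inverse by (simp add: sphere_log_inverse field_simps power2_eq_square)

text \<open>On the unit interval \<open>sphere_log\<close> is 2 artanh, whose derivative 2 / (1 -
  t^2) is at least 2. This inequality fixes the sign of the derivative of
  \<open>shell\<close>.\<close>

lemma sphere_log_ge: assumes "0 < t" "t < 1" shows "2 * t \<le> sphere_log t"
proof -
  let ?f = "\<lambda>t. ln (1 + t) - ln (1 - t) - 2 * t"
  have "?f 0 \<le> ?f t"
  proof (rule DERIV_nonneg_imp_nondecreasing[of 0 t])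
    fix x assume x: "0 \<le> x" "x \<le> t"
    then have x1: "x < 1" using assms by simp
    have "(?f has_real_derivative (1 / (1 + x) * (0 + 1) - 1 / (1 - x) * (0 - 1)) - 2 * 1) (at x)"
      using x x1 by (intro derivative_intros) auto
    then have "(?f has_real_derivative 1 / (1 + x) + 1 / (1 - x) - 2) (at x)"
      by simp
    moreover have "1 / (1 + x) + 1 / (1 - x) - 2 = 2 * x\<^sup>2 / ((1 + x) * (1 - x))"
    proof -
      have "1 + x \<noteq> 0" "1 - x \<noteq> 0" using x assms by auto
      then have "1 / (1 + x) * (1 + x) = 1" "1 / (1 - x) * (1 - x) = 1" "(1 + x) * (1 - x) \<noteq> 0"
        by auto
      moreover from this(1,2) have "(1 / (1 + x) + 1 / (1 - x) - 2) * ((1 + x) * (1 - x)) = 2 * x\<^sup>2"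
        by algebra
      ultimately show ?thesis by (metis nonzero_eq_divide_eq)
    qed
    moreover have "2 * x\<^sup>2 / ((1 + x) * (1 - x)) \<ge> 0" using x assms by simp
    ultimately show "\<exists>y. (?f has_real_derivative y) (at x) \<and> y \<ge> 0" by metis
  qed (use assms in auto)
  then show ?thesis using assms by (simp add: sphere_log_eq)
qed

text \<open>The derivative is - (1 + x^2) / (4 x^2) L + 1 / (2 x) with L >= 2 x, hence at most - x /
  2.\<close>

lemma shell_antimono_unit:
  assumes "0 < s" "s \<le> t" "t < 1" shows "shell t \<le> shell s"
proof -
  let ?f = "\<lambda>t. (1 - t\<^sup>2) / (4 * t) * (ln (1 + t) - ln (1 - t))"
  have "?f t \<le> ?f s"
  proof (rule DERIV_nonpos_imp_nonincreasing[of s t])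
    fix x assume x: "s \<le> x" "x \<le> t"
    then have x0: "0 < x" "x < 1" using assms by auto
    let ?L = "ln (1 + x) - ln (1 - x)"
    have d1: "((\<lambda>t. (1 - t\<^sup>2) / (4 * t)) has_real_derivative - (1 + x\<^sup>2) / (4 * x\<^sup>2)) (at x)"
      using x0 by (auto intro!: derivative_eq_intros simp: field_simps power2_eq_square)
    have d2: "((\<lambda>t. ln (1 + t) - ln (1 - t)) has_real_derivative 1/(1+x) + 1/(1-x)) (at x)"
      using x0 by (auto intro!: derivative_eq_intros simp: field_simps)
    have ne: "1 - x\<^sup>2 \<noteq> 0" using x0 by (simp add: power2_eq_1_iff)
    have e: "1/(1+x) + 1/(1-x) = 2 / (1 - x\<^sup>2)"
      using x0 ne by (simp add: field_simps power2_eq_square)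
    have d: "(?f has_real_derivative - (1 + x\<^sup>2) / (4 * x\<^sup>2) * ?L + 1 / (2 * x)) (at x)"
    proof (rule DERIV_cong[OF DERIV_mult[OF d1 d2]], unfold e)
      show "- (1 + x\<^sup>2) / (4 * x\<^sup>2) * ?L + 2 / (1 - x\<^sup>2) * ((1 - x\<^sup>2) / (4 * x)) =
        - (1 + x\<^sup>2) / (4 * x\<^sup>2) * ?L + 1 / (2 * x)"
        using x0 ne by (simp del: left_diff_distrib right_diff_distrib left_diff_distrib_numeral right_diff_distrib_numeral)
    qed
    have "2 * x \<le> ?L" using sphere_log_ge[OF x0] sphere_log_eq[OF x0] by simp
    moreover have "0 \<le> (1 + x\<^sup>2) / (4 * x\<^sup>2)" by simp
    ultimately have "(1 + x\<^sup>2) / (4 * x\<^sup>2) * (2 * x) \<le> (1 + x\<^sup>2) / (4 * x\<^sup>2) * ?L"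
      by (rule mult_left_mono)
    moreover have "(1 + x\<^sup>2) / (4 * x\<^sup>2) * (2 * x) = 1 / (2 * x) + x / 2"
      using x0 by (simp add: field_simps power2_eq_square)
    moreover have "0 \<le> x / 2" using x0 by simp
    moreover have "- (1 + x\<^sup>2) / (4 * x\<^sup>2) * ?L = - ((1 + x\<^sup>2) / (4 * x\<^sup>2) * ?L)"
      by (simp only: minus_divide_left[symmetric] mult_minus_left)
    ultimately have "- (1 + x\<^sup>2) / (4 * x\<^sup>2) * ?L + 1 / (2 * x) \<le> 0"
      by linarith
    then show "\<exists>y. (?f has_real_derivative y) (at x) \<and> y \<le> 0" using d by blast
  qed (use assms in auto)
  then show ?thesis using assms by (simp add: shell_def sphere_log_eq)
qed

lemma shell_nonneg: assumes "0 < t" "t \<le> 1" shows "0 \<le> shell t"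
proof (cases "t = 1")
  case False
  then have t: "0 < t" "t < 1" using assms by auto
  have "0 \<le> sphere_log t" using sphere_log_ge[OF t] t by linarith
  moreover have "0 \<le> (1 - t\<^sup>2) / (4 * t)" using t by (simp add: power_le_one)
  ultimately show ?thesis unfolding shell_def by (rule mult_nonneg_nonneg[rotated])
qed (simp add: shell_def)

lemma shell_one: "shell 1 = 0" by (simp add: shell_def)

lemma shell_antimono:
  assumes "0 < s" "s \<le> t" shows "shell t \<le> shell s"
proof -
  have A: "shell t \<le> shell s" if "0 < s" "s \<le> t" "t \<le> 1" for s t
    using shell_antimono_unit[of s t] shell_nonneg[of s] that shell_one by (cases "t = 1") auto
  have B: "shell t \<le> 0" if "1 \<le> t" for t
    using shell_nonneg[of "1/t"] shell_inverse[of t] that by auto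
  consider "t \<le> 1" | "s \<le> 1" "1 < t" | "1 < s" by linarith
  then show ?thesis
  proof cases
    case 1 then show ?thesis using A assms by blast
  next
    case 2 then show ?thesis using B[of t] shell_nonneg[of s] assms by linarith
  next
    case 3
    then have "shell (1/s) \<le> shell (1/t)"
      using A[of "1/t" "1/s"] assms by (auto simp: field_simps)
    then show ?thesis using shell_inverse[of s] shell_inverse[of t] assms by auto
  qed
qed

text \<open>For t < 1 the claim is (1 - t^2) L <= 2 t with L = \<open>sphere_log t\<close>; the
  difference vanishes at 0 and has derivative 2 t L >= 0.\<close>

lemma shell_le_half: assumes "0 < t" shows "shell t \<le> 1/2"
proof -
  have A: "shell t \<le> 1/2" if t: "0 < t" "t < 1" for t
  proof -
    let ?f = "\<lambda>t. 2 * t - (1 - t\<^sup>2) * (ln (1 + t) - ln (1 - t))"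
    have "?f 0 \<le> ?f t"
    proof (rule DERIV_nonneg_imp_nondecreasing[of 0 t])
      fix x assume x: "0 \<le> x" "x \<le> t"
      then have x1: "x < 1" using t by simp
      have ne: "1 - x\<^sup>2 \<noteq> 0" using x x1 by (simp add: power2_eq_1_iff)
      have e: "1/(1+x) + 1/(1-x) = 2 / (1 - x\<^sup>2)"
        using x x1 ne by (simp add: field_simps power2_eq_square)
      have d1: "((\<lambda>t. 1 - t\<^sup>2) has_real_derivative - (2 * x)) (at x)"
        by (auto intro!: derivative_eq_intros)
      have d2: "((\<lambda>t. ln (1 + t) - ln (1 - t)) has_real_derivative 1/(1+x) + 1/(1-x)) (at x)"
        using x x1 by (auto intro!: derivative_eq_intros simp: field_simps)
      have d3: "((\<lambda>t::real. 2 * t) has_real_derivative 2) (at x)"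
        by (auto intro!: derivative_eq_intros)
      have "(?f has_real_derivative 2 * x * (ln (1 + x) - ln (1 - x))) (at x)"
      proof (rule DERIV_cong[OF DERIV_diff[OF d3 DERIV_mult[OF d1 d2]]], unfold e)
        show "2 - (- (2 * x) * (ln (1 + x) - ln (1 - x)) + 2 / (1 - x\<^sup>2) * (1 - x\<^sup>2)) =
          2 * x * (ln (1 + x) - ln (1 - x))"
          using ne by (simp del: left_diff_distrib right_diff_distrib left_diff_distrib_numeral right_diff_distrib_numeral)
      qed
      moreover have "2 * x * (ln (1 + x) - ln (1 - x)) \<ge> 0"
        using x x1 by (intro mult_nonneg_nonneg) auto
      ultimately show "\<exists>y. (?f has_real_derivative y) (at x) \<and> y \<ge> 0" by blast
    qed (use t in auto)
    then have "(1 - t\<^sup>2) * sphere_log t \<le> 2 * t" using t by (simp add: sphere_log_eq)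
    then show ?thesis using t by (simp add: shell_def field_simps)
  qed
  show ?thesis
  proof (cases "t < 1")
    case True then show ?thesis using A assms by simp
  next
    case False
    then have "shell t \<le> shell 1" using shell_antimono[of 1 t] by simp
    then show ?thesis by (simp add: shell_one)
  qed
qed

lemma shell_ge_minus_half: assumes "0 < t" shows "-1/2 \<le> shell t"
  using shell_le_half[of "1/t"] shell_inverse[of t] assms by simp

subsection \<open>Spherical means\<close>

definition radial :: "(real^3 \<Rightarrow> 'b) \<Rightarrow> bool" where
  "radial h \<longleftrightarrow> (\<forall>x y. norm x = norm y \<longrightarrow> h x = h y)"

lemma radialD: "radial h \<Longrightarrow> norm x = norm y \<Longrightarrow> h x = h y"
  unfolding radial_def by blast

lemma AE_norm_neq: "AE y in lborel. norm (y::real^3) \<noteq> r"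
proof -
  have "negligible (sphere (0::real^3) r)" by (rule negligible_sphere)
  then have "emeasure lborel (sphere (0::real^3) r) = 0"
    by (simp add: negligible_iff_emeasure0)
  then show ?thesis
    by (intro AE_I[of _ _ "sphere 0 r"]) (auto simp: sphere_def)
qed

lemma AE_neq_point: "AE y in lborel. (y::'a::euclidean_space) \<noteq> x"
  by (rule AE_lborel_singleton)

lemma ln_ratio_nonneg:
  assumes "0 \<le> r" "0 \<le> (s::real)" shows "0 \<le> ln \<bar>(r + s) / (r - s)\<bar>"
proof (cases "r = s \<or> r = 0 \<or> s = 0")
  case True then show ?thesis by auto
next
  case False
  then have "\<bar>r - s\<bar> \<le> r + s" "0 < \<bar>r - s\<bar>" using assms by auto
  then show ?thesis by (intro ln_ge_zero) (simp add: abs_divide field_simps)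
qed

text \<open>This is the integral of 1 / |x - y|^2 over the coordinate z of y along x, at fixed |y|^2
  = p. With s = sqrt p the denominator is (r - s)^2 and (r + s)^2 at the two ends, which produces
  the logarithm.\<close>

lemma nn_integral_chord:
  assumes r: "0 < r" and p: "0 < p" "p \<noteq> r\<^sup>2"
  shows "(\<integral>\<^sup>+z. ennreal (1 / (r\<^sup>2 + p - 2 * r * z)) * indicator {z. z\<^sup>2 < p} z \<partial>lborel) =
    ennreal (1 / r * ln \<bar>(r + sqrt p) / (r - sqrt p)\<bar>)"
proof -
  define s where "s = sqrt p"
  have s: "0 < s" "p = s\<^sup>2" "s \<noteq> r" using p by (auto simp: s_def)
  have pos: "0 < r\<^sup>2 + p - 2 * r * z" if "-s \<le> z" "z \<le> s" for z
  proof -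
    have "r * z \<le> r * s" using that r by simp
    then have "(r - s)\<^sup>2 \<le> r\<^sup>2 + p - 2 * r * z" by (simp add: s(2) power2_eq_square algebra_simps)
    moreover have "0 < (r - s)\<^sup>2" using s by simp
    ultimately show ?thesis by linarith
  qed
  let ?F = "\<lambda>z. - (1 / (2 * r)) * ln (r\<^sup>2 + p - 2 * r * z)"
  have sub: "{z. z\<^sup>2 < p} = {-s<..<s}"
    using abs_le_square_iff[of s] s by (auto simp: abs_square_less_1 s(2) power2_less_imp_less)
      (smt (verit) power2_le_imp_le power2_minus)+
  have "(\<integral>\<^sup>+z. ennreal (1 / (r\<^sup>2 + p - 2 * r * z)) * indicator {-s<..<s} z \<partial>lborel) = ennreal (?F s - ?F (-s))"
  proof (rule nn_integral_FTC_Ioo)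
    fix z assume z: "-s < z" "z < s"
    have pz: "0 < r\<^sup>2 + p - 2 * r * z" using pos[of z] z by simp
    have "((\<lambda>z. r\<^sup>2 + p - 2 * r * z) has_real_derivative - (2 * r)) (at z)"
      by (auto intro!: derivative_eq_intros)
    from DERIV_cmult[OF DERIV_chain2[OF DERIV_ln_divide[OF pz] this], of "- (1 / (2 * r))"]
    show "(?F has_real_derivative 1 / (r\<^sup>2 + p - 2 * r * z)) (at z)"
      using r by simp
    show "isCont (\<lambda>z. 1 / (r\<^sup>2 + p - 2 * r * z)) z"
      using pz by (intro continuous_intros) auto
    show "0 \<le> 1 / (r\<^sup>2 + p - 2 * r * z)" using pz by simp
  next
    show "(?F \<longlongrightarrow> ?F s) (at_left s)" "(?F \<longlongrightarrow> ?F (-s)) (at_right (-s))"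
      using pos[of s] pos[of "-s"] s by (intro tendsto_intros; simp)+
  qed (use s in auto)
  also have "?F s - ?F (-s) = 1 / r * ln \<bar>(r + s) / (r - s)\<bar>"
  proof -
    have e: "r\<^sup>2 + p - 2 * r * s = \<bar>r - s\<bar>\<^sup>2" "r\<^sup>2 + p - 2 * r * (-s) = (r + s)\<^sup>2"
      by (simp_all add: s(2) power2_eq_square algebra_simps)
    have "ln (\<bar>r - s\<bar>\<^sup>2) = 2 * ln \<bar>r - s\<bar>" "ln ((r + s)\<^sup>2) = 2 * ln (r + s)"
      by (simp_all only: ln_realpow of_nat_numeral)
    moreover have "ln \<bar>(r + s) / (r - s)\<bar> = ln (r + s) - ln \<bar>r - s\<bar>"
      using r s by (simp add: abs_divide ln_div)
    ultimately have "- (1 / (2 * r)) * ln (\<bar>r - s\<bar>\<^sup>2) - - (1 / (2 * r)) * ln ((r + s)\<^sup>2) = 1 / r * (ln (r + s) - ln \<bar>r - s\<bar>)"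
      using r by (simp only:) (simp add: right_diff_distrib diff_divide_distrib)
    with \<open>ln \<bar>(r + s) / (r - s)\<bar> = ln (r + s) - ln \<bar>r - s\<bar>\<close> show ?thesis unfolding e by (simp only:)
  qed
  finally show ?thesis unfolding sub s_def .
qed

text \<open>The mean of 1 / |x - y|^2 over |y| = s when |x| = r. At s = r the true mean is infinite
  while the formula gives 0; this affects a null set only.\<close>

definition sphere_kernel :: "real \<Rightarrow> real \<Rightarrow> real" where
  "sphere_kernel r s = 1 / (2 * r * s) * ln \<bar>(r + s) / (r - s)\<bar>"

lemma sphere_kernel_nonneg: "0 \<le> r \<Longrightarrow> 0 \<le> s \<Longrightarrow> 0 \<le> sphere_kernel r s"
  unfolding sphere_kernel_def by (intro mult_nonneg_nonneg ln_ratio_nonneg) auto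

lemma sphere_kernel_measurable[measurable]: "(\<lambda>y. sphere_kernel r (norm (y::real^3))) \<in> borel_measurable borel"
  unfolding sphere_kernel_def by measurable

lemma radial_orthogonal:
  assumes "radial h" "orthogonal_transformation f" shows "h (f y) = h y"
  using assms by (intro radialD[OF assms(1)] orthogonal_transformation_norm)

text \<open>A rotation takes x to the third axis, so the integrand depends on |y|^2 and y_3 only;
  \<open>nn_integral_cylinder\<close> followed by \<open>nn_integral_chord\<close> then integrates
  the angle out.\<close>

lemma nn_integral_sphere_mean:
  fixes h :: "real^3 \<Rightarrow> ennreal"
  assumes [measurable]: "h \<in> borel_measurable borel" and rad: "radial h" and x: "x \<noteq> 0"
  shows "(\<integral>\<^sup>+y. h y * ennreal (1 / (norm (x - y))\<^sup>2) \<partial>lborel) =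
    (\<integral>\<^sup>+y. h y * ennreal (sphere_kernel (norm x) (norm y)) \<partial>lborel)"
proof -
  define r where "r = norm x"
  have r: "0 < r" using x by (simp add: r_def)
  let ?e = "axis 3 1 :: real^3"
  have "norm (r *\<^sub>R ?e) = norm x" using r by (simp add: r_def)
  then obtain f where f: "orthogonal_transformation f" "f x = r *\<^sub>R ?e"
    by (metis orthogonal_transformation_exists)
  \<comment> \<open>Reads the radial function off along one axis as a function of p = |y|^2.\<close>
  define H where "H p = h (sqrt p *\<^sub>R ?e)" for p
  have [measurable]: "H \<in> borel_measurable borel"
    unfolding H_def by measurable
  have H: "h y = H ((norm y)\<^sup>2)" for y
    unfolding H_def by (rule radialD[OF rad]) simp
  have "(\<integral>\<^sup>+y. h y * ennreal (1 / (norm (x - y))\<^sup>2) \<partial>lborel) =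
     (\<integral>\<^sup>+y. h (f y) * ennreal (1 / (norm (r *\<^sub>R ?e - f y))\<^sup>2) \<partial>lborel)"
  proof (intro nn_integral_cong)
    fix y
    have "norm (r *\<^sub>R ?e - f y) = norm (f (x - y))"
      using f by (simp add: linear_diff orthogonal_transformation_linear)
    also have "\<dots> = norm (x - y)" by (rule orthogonal_transformation_norm[OF f(1)])
    finally show "h y * ennreal (1 / (norm (x - y))\<^sup>2) = h (f y) * ennreal (1 / (norm (r *\<^sub>R ?e - f y))\<^sup>2)"
      by (simp add: radial_orthogonal[OF rad f(1)])
  qed
  also have "\<dots> = (\<integral>\<^sup>+y. h y * ennreal (1 / (norm (r *\<^sub>R ?e - y))\<^sup>2) \<partial>lborel)"
    by (rule nn_integral_orthogonal[OF f(1)]) measurable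
  also have "\<dots> = (\<integral>\<^sup>+y. (\<lambda>p z. H p * ennreal (1 / (r\<^sup>2 + p - 2 * r * z))) ((norm y)\<^sup>2) ((y::real^3)$3) \<partial>lborel)"
  proof (intro nn_integral_cong)
    fix y :: "real^3"
    have "(norm (r *\<^sub>R ?e - y))\<^sup>2 = r\<^sup>2 + (norm y)\<^sup>2 - 2 * r * y$3"
      unfolding power2_norm_eq_inner
      by (simp add: inner_diff_left inner_diff_right inner_axis inner_axis' power2_eq_square inner_commute)
    then show "h y * ennreal (1 / (norm (r *\<^sub>R ?e - y))\<^sup>2) = (\<lambda>p z. H p * ennreal (1 / (r\<^sup>2 + p - 2 * r * z))) ((norm y)\<^sup>2) (y$3)"
      by (simp add: H)
  qed
  also have "\<dots> = ennreal pi * (\<integral>\<^sup>+p. \<integral>\<^sup>+z. (H p * ennreal (1 / (r\<^sup>2 + p - 2 * r * z))) * indicator {z. z\<^sup>2 < p} z \<partial>lborel \<partial>lborel)"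
    by (rule nn_integral_cylinder) measurable
  also have "\<dots> = (\<integral>\<^sup>+p. ennreal pi * (\<integral>\<^sup>+z. (H p * ennreal (1 / (r\<^sup>2 + p - 2 * r * z))) * indicator {z. z\<^sup>2 < p} z \<partial>lborel) \<partial>lborel)"
    unfolding indicator_def by (subst nn_integral_cmult) auto
  also have "\<dots> = (\<integral>\<^sup>+p. H p * ennreal (sphere_kernel r (sqrt p)) * ennreal (2 * pi * sqrt p) * indicator {0<..} p \<partial>lborel)"
  proof (rule nn_integral_cong_AE)
    have "AE p in lborel. p \<noteq> r\<^sup>2" by (rule AE_lborel_singleton)
    then show "AE p in lborel. ennreal pi * (\<integral>\<^sup>+z. (H p * ennreal (1 / (r\<^sup>2 + p - 2 * r * z))) * indicator {z. z\<^sup>2 < p} z \<partial>lborel) =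
      H p * ennreal (sphere_kernel r (sqrt p)) * ennreal (2 * pi * sqrt p) * indicator {0<..} p"
    proof eventually_elim
      case (elim p)
      show ?case
      proof (cases "0 < p")
        case True
        have "(\<integral>\<^sup>+z. (H p * ennreal (1 / (r\<^sup>2 + p - 2 * r * z))) * indicator {z. z\<^sup>2 < p} z \<partial>lborel) =
          H p * (\<integral>\<^sup>+z. ennreal (1 / (r\<^sup>2 + p - 2 * r * z)) * indicator {z. z\<^sup>2 < p} z \<partial>lborel)"
          by (subst nn_integral_cmult[symmetric]) (auto simp: mult.assoc)
        also have "\<dots> = H p * ennreal (1 / r * ln \<bar>(r + sqrt p) / (r - sqrt p)\<bar>)"
          using nn_integral_chord[OF r True elim] by simp
        finally have "ennreal pi * (\<integral>\<^sup>+z. (H p * ennreal (1 / (r\<^sup>2 + p - 2 * r * z))) * indicator {z. z\<^sup>2 < p} z \<partial>lborel) =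
          H p * ennreal (pi * (1 / r * ln \<bar>(r + sqrt p) / (r - sqrt p)\<bar>))"
          by (simp only: ennreal_mult'[OF pi_ge_zero] mult.left_commute)
        also have "pi * (1 / r * ln \<bar>(r + sqrt p) / (r - sqrt p)\<bar>) = sphere_kernel r (sqrt p) * (2 * pi * sqrt p)"
          using r True by (simp add: sphere_kernel_def)
        finally show ?thesis
          using True sphere_kernel_nonneg[of r "sqrt p"] r by (simp add: ennreal_mult mult.assoc)
      next
        case False
        then have "{z. z\<^sup>2 < p} = {}" using order_le_less_trans[OF zero_le_power2] by blast
        then show ?thesis using False by simp
      qed
    qed
  qed
  also have "\<dots> = (\<integral>\<^sup>+y. (\<lambda>p. H p * ennreal (sphere_kernel r (sqrt p))) ((norm (y::real^3))\<^sup>2) \<partial>lborel)"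
    by (subst nn_integral_radial) (auto simp: sphere_kernel_def)
  also have "\<dots> = (\<integral>\<^sup>+y. h y * ennreal (sphere_kernel (norm x) (norm y)) \<partial>lborel)"
    by (intro nn_integral_cong) (simp add: H r_def)
  finally show ?thesis .
qed

lemma has_bochner_integral_sphere_mean_nonneg:
  fixes h :: "real^3 \<Rightarrow> real"
  assumes [measurable]: "h \<in> borel_measurable borel" and rad: "radial h" and x: "x \<noteq> 0"
    and nn: "\<And>y. 0 \<le> h y" and int: "integrable lborel (\<lambda>y. h y / (norm (x - y))\<^sup>2)"
  shows "has_bochner_integral lborel (\<lambda>y. h y * sphere_kernel (norm x) (norm y))
    (LINT y|lborel. h y / (norm (x - y))\<^sup>2)"
proof -
  have rad': "radial (\<lambda>y. ennreal (h y))"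
    using rad unfolding radial_def by metis
  have "(\<integral>\<^sup>+y. ennreal (h y * sphere_kernel (norm x) (norm y)) \<partial>lborel) =
     (\<integral>\<^sup>+y. ennreal (h y) * ennreal (sphere_kernel (norm x) (norm y)) \<partial>lborel)"
    by (intro nn_integral_cong) (simp add: ennreal_mult nn sphere_kernel_nonneg)
  also have "\<dots> = (\<integral>\<^sup>+y. ennreal (h y) * ennreal (1 / (norm (x - y))\<^sup>2) \<partial>lborel)"
    by (rule nn_integral_sphere_mean[OF _ rad' x, symmetric]) measurable
  also have "\<dots> = (\<integral>\<^sup>+y. ennreal (h y / (norm (x - y))\<^sup>2) \<partial>lborel)"
    by (intro nn_integral_cong) (simp add: nn flip: ennreal_mult)
  also have "\<dots> = ennreal (LINT y|lborel. h y / (norm (x - y))\<^sup>2)"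
    by (rule nn_integral_eq_integral[OF int]) (simp add: nn)
  finally show ?thesis
    by (intro has_bochner_integral_nn_integral) (auto simp: nn sphere_kernel_nonneg)
qed

text \<open>In the application the density changes sign at |y| = |x|, so the nonnegative case is
  applied to its positive and its negative part.\<close>

lemma has_bochner_integral_sphere_mean:
  fixes h :: "real^3 \<Rightarrow> real"
  assumes h[measurable]: "h \<in> borel_measurable borel" and rad: "radial h" and x: "x \<noteq> 0"
    and int: "integrable lborel (\<lambda>y. h y / (norm (x - y))\<^sup>2)"
  shows "has_bochner_integral lborel (\<lambda>y. h y * sphere_kernel (norm x) (norm y))
    (LINT y|lborel. h y / (norm (x - y))\<^sup>2)"
proof -
  have r: "radial (\<lambda>y. max 0 (h y))" "radial (\<lambda>y. max 0 (- h y))"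
    using rad unfolding radial_def by metis+
  have e: "max 0 (h y) / (norm (x - y))\<^sup>2 = max 0 (h y / (norm (x - y))\<^sup>2)" 
     "max 0 (- h y) / (norm (x - y))\<^sup>2 = max 0 (- (h y / (norm (x - y))\<^sup>2))" for y
    by (auto simp: max_def divide_le_0_iff zero_le_divide_iff)
  have i: "integrable lborel (\<lambda>y. max 0 (h y) / (norm (x - y))\<^sup>2)"
    "integrable lborel (\<lambda>y. max 0 (- h y) / (norm (x - y))\<^sup>2)"
    unfolding e using int by (intro integrable_max integrable_minus integrable_zero; simp)+
  note 1 = has_bochner_integral_sphere_mean_nonneg[OF _ r(1) x _ i(1)]
  note 2 = has_bochner_integral_sphere_mean_nonneg[OF _ r(2) x _ i(2)]
  have "has_bochner_integral lborel (\<lambda>y. max 0 (h y) * sphere_kernel (norm x) (norm y) - max 0 (- h y) * sphere_kernel (norm x) (norm y))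
    ((LINT y|lborel. max 0 (h y) / (norm (x - y))\<^sup>2) - (LINT y|lborel. max 0 (- h y) / (norm (x - y))\<^sup>2))"
    by (intro has_bochner_integral_diff 1 2) auto
  also have "(LINT y|lborel. max 0 (h y) / (norm (x - y))\<^sup>2) - (LINT y|lborel. max 0 (- h y) / (norm (x - y))\<^sup>2) =
    (LINT y|lborel. h y / (norm (x - y))\<^sup>2)"
    by (subst Bochner_Integration.integral_diff[symmetric, OF i])
      (auto intro!: Bochner_Integration.integral_cong simp: max_def diff_divide_distrib)
  also have "(\<lambda>y. max 0 (h y) * sphere_kernel (norm x) (norm y) - max 0 (- h y) * sphere_kernel (norm x) (norm y)) =
    (\<lambda>y. h y * sphere_kernel (norm x) (norm y))"
    by (auto simp: max_def fun_eq_iff)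
  finally show ?thesis .
qed

subsection \<open>Convolution with weakly singular kernels\<close>

text \<open>A common envelope for the logarithm, its gradient and its Hessian: |z|^-2 is the worst
  of the three singularities and still integrable near 0 in dimension three, and |z| covers
  logarithmic growth.\<close>

definition kernel_weight :: "real^3 \<Rightarrow> real" where
  "kernel_weight z = 1 / (norm z)\<^sup>2 + 1 + norm z"

definition kernel_class :: "(real^3 \<Rightarrow> 'b::euclidean_space) \<Rightarrow> bool" where
  "kernel_class K \<longleftrightarrow> K \<in> borel_measurable borel \<and> (\<exists>C. \<forall>z. z \<noteq> 0 \<longrightarrow> norm (K z) \<le> C * kernel_weight z)"

text \<open>Exponent 5: one power pays for the linear growth of \<open>kernel_weight\<close>, and
  the remaining 4 exceed the dimension.\<close>

definition decays :: "(real^3 \<Rightarrow> 'b::euclidean_space) \<Rightarrow> bool" where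
  "decays f \<longleftrightarrow> f \<in> borel_measurable borel \<and> (\<exists>C. \<forall>x. norm (f x) \<le> C / (1 + norm x)^5)"

lemma kernel_weight_nonneg: "0 \<le> kernel_weight z"
  by (simp add: kernel_weight_def)

lemma kernel_weight_measurable[measurable]: "kernel_weight \<in> borel_measurable borel"
  unfolding kernel_weight_def by measurable

lemma integrable_inverse_pow4: "integrable lborel (\<lambda>x::real^3. 1 / (1 + norm x)^4)"
proof (rule integrableI_bounded)
  have le: "ennreal (norm (1 / (1 + norm x)^4)) \<le> indicator (cball 0 1) x + ennreal (1 / (norm x)^4) * indicator (- cball 0 1) x" for x :: "real^3"
  proof (cases "x \<in> cball 0 1")
    case True
    have "1 \<le> (1 + norm x)^4" by (intro one_le_power) simp
    then have "norm (1 / (1 + norm x)^4) \<le> 1" using divide_le_eq_1[of 1 "(1 + norm x)^4"] by simp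
    then show ?thesis using True by (simp add: ennreal_leI[of _ 1, simplified])
  next
    case False
    then have "0 < norm x" by auto
    then have "1 / (1 + norm x)^4 \<le> 1 / (norm x)^4"
      by (intro frac_le power_mono zero_less_power) auto
    then have "norm (1 / (1 + norm x)^4) \<le> 1 / (norm x)^4" by simp
    then show ?thesis using False by (simp add: ennreal_leI)
  qed
  have "(\<integral>\<^sup>+x. ennreal (norm (1 / (1 + norm (x::real^3))^4)) \<partial>lborel) \<le>
    (\<integral>\<^sup>+x. indicator (cball 0 1) x + ennreal (1 / (norm (x::real^3))^4) * indicator (- cball 0 1) x \<partial>lborel)"
    by (rule nn_integral_mono) (rule le)
  also have "\<dots> = emeasure lborel (cball (0::real^3) 1) + ennreal (4 * pi)"
    by (subst nn_integral_add) (auto simp: nn_integral_inverse_norm_pow4_outside intro!: borel_measurable_indicator)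
  also have "\<dots> < \<infinity>"
    using emeasure_lborel_cball_finite[of "0::real^3" 1] by (simp add: less_top)
  finally show "(\<integral>\<^sup>+x. ennreal (norm (1 / (1 + norm (x::real^3))^4)) \<partial>lborel) < \<infinity>" .
qed measurable

text \<open>The singular part lives in the unit ball around x and contributes at most 4 pi by
  translation. The rest is bounded through 2 + |x - y| <= (2 + |x|) (1 + |y|), which uses up one of
  the five powers.\<close>

lemma kernel_weight_integral_bound:
  "\<exists>M>0. \<forall>x. (\<integral>\<^sup>+y. ennreal (kernel_weight (x - y) * (1 / (1 + norm y)^5)) \<partial>lborel) \<le> ennreal (M * (1 + norm x))"
proof -
  define I where "I = (LINT y|lborel. 1 / (1 + norm (y::real^3))^4)"
  have I0: "0 \<le> I" unfolding I_def by (intro integral_nonneg_AE) simp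
  have nnI: "(\<integral>\<^sup>+y. ennreal (1 / (1 + norm (y::real^3))^4) \<partial>lborel) = ennreal I"
    unfolding I_def by (rule nn_integral_eq_integral[OF integrable_inverse_pow4]) simp
  have [measurable]: "ball (0::real^3) 1 \<in> sets borel" by simp
  let ?b = "\<lambda>z::real^3. ennreal (1 / (norm z)\<^sup>2) * indicator (ball 0 1) z"
  have "(\<integral>\<^sup>+y. ennreal (kernel_weight (x - y) * (1 / (1 + norm y)^5)) \<partial>lborel) \<le> ennreal ((4 * pi + 2 * I) * (1 + norm x))" for x :: "real^3"
  proof -
    have le: "ennreal (kernel_weight (x - y) * (1 / (1 + norm y)^5)) \<le>
      ?b (x - y) + ennreal (2 + norm x) * ennreal (1 / (1 + norm y)^4)" for y
    proof -
      define e where "e = 1 / (1 + norm y)^5"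
      have "1 \<le> (1 + norm y)^5" by (intro one_le_power) simp
      then have e: "0 \<le> e" "e \<le> 1" unfolding e_def using frac_le[of 1 1 1 "(1 + norm y)^5"] by auto
      have "norm (x - y) \<le> norm x + norm y" by (rule norm_triangle_ineq4)
      then have "2 + norm (x - y) \<le> (2 + norm x) * (1 + norm y)"
      proof -
        have "0 \<le> norm x * norm y" "0 \<le> norm y" by simp_all
        moreover have "(2 + norm x) * (1 + norm y) = 2 + norm x + 2 * norm y + norm x * norm y" by algebra
        ultimately show ?thesis using \<open>norm (x - y) \<le> norm x + norm y\<close> by linarith
      qed
      then have "(2 + norm (x - y)) * e \<le> (2 + norm x) * (1 + norm y) * e"
        using e by (intro mult_right_mono) auto
      also have "\<dots> = (2 + norm x) * (1 / (1 + norm y)^4)"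
      proof -
        have "1 + norm y \<noteq> 0" using norm_ge_zero[of y] by linarith
        moreover have "b * (1 / b^5) = 1 / b^4" if "b \<noteq> 0" for b :: real
          using that by (simp add: field_simps eval_nat_numeral)
        ultimately show ?thesis unfolding e_def mult.assoc by simp
      qed
      finally have 1: "(2 + norm (x - y)) * e \<le> (2 + norm x) * (1 / (1 + norm y)^4)" .
      have 2: "kernel_weight z \<le> indicator (ball 0 1) z * (1 / (norm z)\<^sup>2) + (2 + norm z)" for z :: "real^3"
      proof (cases "norm z < 1")
        case True then show ?thesis by (simp add: kernel_weight_def)
      next
        case False
        then have "1 \<le> (norm z)\<^sup>2" by (intro one_le_power) simp
        then have "1 / (norm z)\<^sup>2 \<le> 1" using divide_le_eq_1[of 1 "(norm z)\<^sup>2"] by simp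
        then show ?thesis using False by (simp add: kernel_weight_def)
      qed
      have "kernel_weight (x - y) * e \<le> (indicator (ball 0 1) (x - y) * (1 / (norm (x - y))\<^sup>2) + (2 + norm (x - y))) * e"
        using 2 e by (intro mult_right_mono) auto
      also have "\<dots> = indicator (ball 0 1) (x - y) * (1 / (norm (x - y))\<^sup>2) * e + (2 + norm (x - y)) * e"
        by (rule distrib_right)
      also have "\<dots> \<le> indicator (ball 0 1) (x - y) * (1 / (norm (x - y))\<^sup>2) * 1 + (2 + norm x) * (1 / (1 + norm y)^4)"
        by (rule add_mono[OF mult_left_mono[OF e(2)] 1]) simp
      finally have "ennreal (kernel_weight (x - y) * e) \<le> ennreal (indicator (ball 0 1) (x - y) * (1 / (norm (x - y))\<^sup>2) + (2 + norm x) * (1 / (1 + norm y)^4))"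
        by (intro ennreal_leI) simp
      also have "\<dots> = ?b (x - y) + ennreal (2 + norm x) * ennreal (1 / (1 + norm y)^4)"
      proof -
        have "ennreal ((2 + norm x) * (1 / (1 + norm y)^4)) = ennreal (2 + norm x) * ennreal (1 / (1 + norm y)^4)"
          by (rule ennreal_mult) auto
        moreover have "ennreal (indicator (ball 0 1) (x - y) * (1 / (norm (x - y))\<^sup>2)) = ?b (x - y)"
          by (auto simp: indicator_def)
        ultimately show ?thesis by (subst ennreal_plus) (simp_all only: zero_le_mult_iff, auto)
      qed
      finally show ?thesis by (simp only: e_def)
    qed
    have "(\<integral>\<^sup>+y. ennreal (kernel_weight (x - y) * (1 / (1 + norm y)^5)) \<partial>lborel) \<le>
      (\<integral>\<^sup>+y. ?b (x - y) + ennreal (2 + norm x) * ennreal (1 / (1 + norm y)^4) \<partial>lborel)"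
      by (rule nn_integral_mono) (rule le)
    also have "\<dots> = (\<integral>\<^sup>+y. ?b (x - y) \<partial>lborel) + ennreal (2 + norm x) * ennreal I"
      by (subst nn_integral_add) (auto simp: nn_integral_cmult nnI)
    also have "(\<integral>\<^sup>+y. ?b (x - y) \<partial>lborel) = ennreal (4 * pi)"
      unfolding nn_integral_inverse_norm_sq_ball[symmetric]
      by (rule nn_integral_reflect) measurable
    also have "ennreal (4 * pi) + ennreal (2 + norm x) * ennreal I = ennreal (4 * pi + (2 + norm x) * I)"
      using I0 by (simp add: ennreal_plus ennreal_mult)
    also have "\<dots> \<le> ennreal ((4 * pi + 2 * I) * (1 + norm x))"
      using I0 mult_nonneg_nonneg[OF I0 norm_ge_zero[of x]] pi_gt_zero mult_nonneg_nonneg[OF pi_ge_zero norm_ge_zero[of x]]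
      by (intro ennreal_leI) (simp add: algebra_simps)
    finally show ?thesis .
  qed
  moreover have "0 < 4 * pi + 2 * I" using I0 pi_gt_zero by linarith
  ultimately show ?thesis by blast
qed

lemma decays_measurable: "decays f \<Longrightarrow> f \<in> borel_measurable borel"
  unfolding decays_def by simp

lemma kernel_class_measurable: "kernel_class K \<Longrightarrow> K \<in> borel_measurable borel"
  unfolding kernel_class_def by simp

lemma decaysE:
  assumes "decays f" obtains C where "C > 0" "\<And>x. norm (f x) \<le> C / (1 + norm x)^5"
proof -
  obtain C where C: "\<And>x. norm (f x) \<le> C / (1 + norm x)^5" using assms by (auto simp: decays_def)
  have "norm (f x) \<le> (\<bar>C\<bar> + 1) / (1 + norm x)^5" for x
    by (rule order_trans[OF C]) (auto intro!: divide_right_mono)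
  then show ?thesis by (intro that[of "\<bar>C\<bar> + 1"]) auto
qed

lemma kernel_classE:
  assumes "kernel_class K" obtains C where "C > 0" "\<And>z. z \<noteq> 0 \<Longrightarrow> norm (K z) \<le> C * kernel_weight z"
proof -
  obtain C where C: "\<And>z. z \<noteq> 0 \<Longrightarrow> norm (K z) \<le> C * kernel_weight z" using assms by (auto simp: kernel_class_def)
  have "norm (K z) \<le> (\<bar>C\<bar> + 1) * kernel_weight z" if "z \<noteq> 0" for z
    by (rule order_trans[OF C[OF that]]) (auto intro!: mult_right_mono kernel_weight_nonneg)
  then show ?thesis by (intro that[of "\<bar>C\<bar> + 1"]) auto
qed

lemma kernel_integral_bound:
  fixes \<Phi> :: "real^3 \<Rightarrow> real^3 \<Rightarrow> 'b::euclidean_space"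
  assumes C: "C > 0" and meas: "\<And>x. \<Phi> x \<in> borel_measurable borel"
    and le: "\<And>x y. y \<noteq> x \<Longrightarrow> norm (\<Phi> x y) \<le> C * (kernel_weight (x - y) * (1 / (1 + norm y)^5))"
  shows "\<exists>M>0. \<forall>x. integrable lborel (\<Phi> x) \<and> (LINT y|lborel. norm (\<Phi> x y)) \<le> M * (1 + norm x)"
proof -
  obtain M where M: "M > 0" and Mb: "\<And>x. (\<integral>\<^sup>+y. ennreal (kernel_weight (x - y) * (1 / (1 + norm y)^5)) \<partial>lborel) \<le> ennreal (M * (1 + norm x))"
    using kernel_weight_integral_bound by blast
  have *: "(\<integral>\<^sup>+y. ennreal (norm (\<Phi> x y)) \<partial>lborel) \<le> ennreal (C * M * (1 + norm x))" for x
  proof -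
    have "(\<integral>\<^sup>+y. ennreal (norm (\<Phi> x y)) \<partial>lborel) \<le> (\<integral>\<^sup>+y. ennreal C * ennreal (kernel_weight (x - y) * (1 / (1 + norm y)^5)) \<partial>lborel)"
    proof (rule nn_integral_mono_AE)
      show "AE y in lborel. ennreal (norm (\<Phi> x y)) \<le> ennreal C * ennreal (kernel_weight (x - y) * (1 / (1 + norm y)^5))"
        using AE_neq_point[of x]
      proof eventually_elim
        case (elim y)
        have "ennreal (norm (\<Phi> x y)) \<le> ennreal (C * (kernel_weight (x - y) * (1 / (1 + norm y)^5)))"
          by (intro ennreal_leI le elim)
        then show ?case using C by (simp only: ennreal_mult'[OF less_imp_le[OF C]])
      qed
    qed
    also have "\<dots> = ennreal C * (\<integral>\<^sup>+y. ennreal (kernel_weight (x - y) * (1 / (1 + norm y)^5)) \<partial>lborel)"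
      by (rule nn_integral_cmult) measurable
    also have "\<dots> \<le> ennreal C * ennreal (M * (1 + norm x))"
      by (intro mult_left_mono Mb) simp
    also have "\<dots> = ennreal (C * M * (1 + norm x))"
      using C by (simp add: ennreal_mult' mult.assoc)
    finally show ?thesis .
  qed
  have i: "integrable lborel (\<Phi> x)" for x
    using *[of x] meas[of x] by (intro integrableI_bounded) (auto intro: order_le_less_trans)
  have "(LINT y|lborel. norm (\<Phi> x y)) \<le> C * M * (1 + norm x)" for x
  proof -
    have "ennreal (LINT y|lborel. norm (\<Phi> x y)) \<le> ennreal (C * M * (1 + norm x))"
      using *[of x] i[of x] by (subst nn_integral_eq_integral[symmetric]) auto
    moreover have "0 \<le> C * M * (1 + norm x)" using C M by simp
    ultimately show ?thesis by simp
  qed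
  then show ?thesis using i C M by (intro exI[of _ "C * M"]) auto
qed

lemma kernel_conv_bound:
  fixes K :: "real^3 \<Rightarrow> 'b::euclidean_space" and f :: "real^3 \<Rightarrow> real"
  assumes K: "kernel_class K" and f: "decays f"
  shows "\<exists>M>0. \<forall>x. integrable lborel (\<lambda>y. f y *\<^sub>R K (x - y)) \<and> (LINT y|lborel. norm (f y *\<^sub>R K (x - y))) \<le> M * (1 + norm x)"
proof -
  obtain c where c: "c > 0" "\<And>x. norm (f x) \<le> c / (1 + norm x)^5" using f decaysE by blast
  obtain k where k: "k > 0" "\<And>z. z \<noteq> 0 \<Longrightarrow> norm (K z) \<le> k * kernel_weight z" using K kernel_classE by blast
  have [measurable]: "f \<in> borel_measurable borel" "K \<in> borel_measurable borel"
    using f K decays_measurable kernel_class_measurable by auto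
  show ?thesis
  proof (rule kernel_integral_bound[of "c * k"])
    fix x y :: "real^3" assume "y \<noteq> x"
    then have "x - y \<noteq> 0" by simp
    then have "norm (f y) * norm (K (x - y)) \<le> (c / (1 + norm y)^5) * (k * kernel_weight (x - y))"
      using c k by (intro mult_mono) auto
    then show "norm (f y *\<^sub>R K (x - y)) \<le> c * k * (kernel_weight (x - y) * (1 / (1 + norm y)^5))"
      by (simp add: mult_ac)
  qed (use c k in auto)
qed

text \<open>The reflected form differs from the convolution by the change of variables \<open>y = x - z\<close>.\<close>

lemma
  fixes K :: "real^3 \<Rightarrow> 'b::euclidean_space" and f :: "real^3 \<Rightarrow> real"
  assumes K: "kernel_class K" and f: "decays f"
  shows kernel_conv_swap: "(LINT y|lborel. f y *\<^sub>R K (x - y)) = (LINT z|lborel. f (x - z) *\<^sub>R K z)"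
    and integrable_kernel_conv_swap: "integrable lborel (\<lambda>z. f (x - z) *\<^sub>R K z)"
    and integrable_kernel_conv: "integrable lborel (\<lambda>y. f y *\<^sub>R K (x - y))"
proof -
  have [measurable]: "f \<in> borel_measurable borel" "K \<in> borel_measurable borel"
    using f K decays_measurable kernel_class_measurable by auto
  show 1: "integrable lborel (\<lambda>y. f y *\<^sub>R K (x - y))" using kernel_conv_bound[OF K f] by blast
  show "(LINT y|lborel. f y *\<^sub>R K (x - y)) = (LINT z|lborel. f (x - z) *\<^sub>R K z)"
    using integral_reflect[of "\<lambda>z. f (x - z) *\<^sub>R K z" x] by simp
  show "integrable lborel (\<lambda>z. f (x - z) *\<^sub>R K z)"
    using 1 integrable_reflect[of "\<lambda>z. f (x - z) *\<^sub>R K z" x] by simp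
qed

lemma continuous_on_integral_dominated:
  fixes F :: "'p::metric_space \<Rightarrow> 'a::euclidean_space \<Rightarrow> 'b::{banach, second_countable_topology}"
  assumes meas: "\<And>x. F x \<in> borel_measurable borel"
    and dom: "\<And>x0. \<exists>w d. 0 < d \<and> integrable lborel w \<and> (\<forall>x. dist x x0 < d \<longrightarrow> (\<forall>z. norm (F x z) \<le> w z))"
    and cont: "\<And>x0 z. isCont (\<lambda>x. F x z) x0"
  shows "continuous_on UNIV (\<lambda>x. LINT z|lborel. F x z)"
proof -
  have "isCont (\<lambda>x. LINT z|lborel. F x z) x0" for x0
    unfolding continuous_at_sequentially o_def
  proof (intro allI impI)
    fix X assume X: "X \<longlonglongrightarrow> x0"
    obtain w d where d: "0 < d" and w: "integrable lborel w"
      and le: "\<And>x z. dist x x0 < d \<Longrightarrow> norm (F x z) \<le> w z"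
      using dom[of x0] by blast
    obtain N where N: "\<And>n. n \<ge> N \<Longrightarrow> dist (X n) x0 < d"
      using tendstoD[OF X d] unfolding eventually_sequentially by blast
    show "(\<lambda>n. LINT z|lborel. F (X n) z) \<longlonglongrightarrow> (LINT z|lborel. F x0 z)"
    proof (rule LIMSEQ_offset[where k=N], rule integral_dominated_convergence[where w=w])
      show "AE z in lborel. (\<lambda>n. F (X (n + N)) z) \<longlonglongrightarrow> F x0 z"
        using cont X by (intro AE_I2 LIMSEQ_ignore_initial_segment[where f="\<lambda>n. F (X n) _"])
          (auto simp: continuous_at_sequentially o_def)
      show "AE z in lborel. norm (F (X (n + N)) z) \<le> w z" for n
        using le N by (intro AE_I2) simp
    qed (use meas w in auto)
  qed
  then show ?thesis by (simp add: continuous_on_eq_continuous_at)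
qed

text \<open>The reflected form keeps the singularity of K at a fixed point, so only the continuous
  factor moves with x. Locally uniform domination comes from 1 + |z| <= (1 + R) (1 + |x -
  z|).\<close>

lemma kernel_conv_continuous:
  fixes K :: "real^3 \<Rightarrow> 'b::euclidean_space" and f :: "real^3 \<Rightarrow> real"
  assumes K: "kernel_class K" and f: "decays f" and cont: "continuous_on UNIV f"
  shows "continuous_on UNIV (\<lambda>x. LINT y|lborel. f y *\<^sub>R K (x - y))"
proof -
  obtain c where c: "c > 0" "\<And>x. norm (f x) \<le> c / (1 + norm x)^5" using f decaysE by blast
  have [measurable]: "f \<in> borel_measurable borel" "K \<in> borel_measurable borel"
    using f K decays_measurable kernel_class_measurable by auto
  \<comment> \<open>The decay profile itself; the convolution bound applied to it yields the
    integrable majorant e z |K z|.\<close>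
  define e where "e z = 1 / (1 + norm (z::real^3))^5" for z
  have e: "decays e"
    unfolding decays_def e_def by (auto intro!: exI[of _ 1])
  have "continuous_on UNIV (\<lambda>x. LINT z|lborel. f (x - z) *\<^sub>R K z)"
  proof (rule continuous_on_integral_dominated)
    fix x0 :: "real^3"
    define R where "R = norm x0 + 1"
    have R: "R \<ge> 0" by (simp add: R_def)
    show "\<exists>w d. 0 < d \<and> integrable lborel w \<and> (\<forall>x. dist x x0 < d \<longrightarrow> (\<forall>z. norm (f (x - z) *\<^sub>R K z) \<le> w z))"
    proof (intro exI conjI allI impI)
      show "integrable lborel (\<lambda>z. c * (1 + R)^5 * (e z * norm (K z)))"
        using integrable_norm[OF integrable_kernel_conv_swap[OF K e, of 0]]
        by (intro integrable_mult_right) (simp add: e_def)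
      fix x z :: "real^3" assume "dist x x0 < 1"
      then have xR: "norm x \<le> R"
        using norm_triangle_sub[of x x0] by (simp add: R_def dist_norm)
      have p: "0 < 1 + norm (x - z)" "0 < 1 + norm z" by (auto intro: add_pos_nonneg)
      have "norm z \<le> norm x + norm (x - z)" using norm_triangle_sub[of z x] by (simp only: norm_minus_commute)
      then have "1 + norm z \<le> (1 + R) * (1 + norm (x - z))"
        using xR mult_nonneg_nonneg[OF R norm_ge_zero[of "x - z"]] by (simp add: algebra_simps)
      then have "(1 + norm z)^5 \<le> (1 + R)^5 * (1 + norm (x - z))^5"
        using power_mono[of "1 + norm z" "(1 + R) * (1 + norm (x - z))" 5] by (simp add: power_mult_distrib)
      then have "1 / (1 + norm (x - z))^5 \<le> (1 + R)^5 * e z"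
        using p by (simp add: e_def divide_simps mult.commute)
      then have "c * (1 / (1 + norm (x - z))^5) \<le> c * ((1 + R)^5 * e z)"
        using c by (intro mult_left_mono) auto
      then have "norm (f (x - z)) \<le> c * (1 + R)^5 * e z"
        using c(2)[of "x - z"] by (simp add: mult.assoc)
      then show "norm (f (x - z) *\<^sub>R K z) \<le> c * (1 + R)^5 * (e z * norm (K z))"
        using mult_right_mono[of "\<bar>f (x - z)\<bar>" "c * (1 + R)^5 * e z" "norm (K z)"]
        by (simp add: mult.assoc)
    qed simp
    show "isCont (\<lambda>x. f (x - z) *\<^sub>R K z) x0" for z
    proof -
      have "isCont f (x0 - z)" using cont by (simp add: continuous_on_eq_continuous_at)
      then have "isCont (\<lambda>x. f (x - z)) x0"
        by (intro isCont_o2[where g=f and f="\<lambda>x. x - z"] continuous_intros)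
      then show ?thesis by (intro continuous_intros)
    qed
  qed measurable
  then show ?thesis by (simp add: kernel_conv_swap[OF K f])
qed

section \<open>Differentiation under the integral along segments\<close>

lemma negligible_line: "negligible {x + t *\<^sub>R v | t. True}" for x v :: "real^3"
proof -
  have "{t *\<^sub>R v | t. True} = span {v}" by (auto simp: span_singleton)
  moreover have "dim (span {v}) < DIM(real^3)" unfolding dim_span by (simp add: dim_singleton)
  ultimately have "dim {t *\<^sub>R v | t. True} < DIM(real^3)" by (simp only:)
  then have "negligible {t *\<^sub>R v | t. True}" by (rule negligible_lowdim)
  then have "negligible ((+) x ` {t *\<^sub>R v | t. True})" by (rule negligible_translation)
  also have "(+) x ` {t *\<^sub>R v | t. True} = {x + t *\<^sub>R v | t. True}" by auto
  finally show ?thesis .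
qed

text \<open>For y off this null set the line through x in direction v avoids the singularity of the
  kernel centred at y.\<close>

lemma AE_not_on_line: "AE y in lborel. \<forall>t. (y::real^3) \<noteq> x + t *\<^sub>R v"
proof -
  let ?L = "{x + t *\<^sub>R v | t. True}"
  have "AE y in lebesgue. y \<notin> ?L"
    using negligible_line[of x v] by (intro AE_not_in) (simp add: negligible_iff_null_sets)
  then have "AE y in lborel. y \<notin> ?L" by (rule AE_completion_iff[THEN iffD1, rotated])
  then show ?thesis by auto
qed

text \<open>Differentiation under the integral sign in integrated form: the fundamental theorem is
  applied for almost every y, and Fubini exchanges it with the y-integral. Difference quotients of a
  kernel whose singularity moves with x have no common integrable majorant, whereas the integrated
  form asks only for the L^1 bound \<open>bd\<close> along the segment.\<close>

lemma parametric_integral_FTC: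
  fixes H :: "real^3 \<Rightarrow> real^3 \<Rightarrow> real" and D :: "real^3 \<Rightarrow> real^3 \<Rightarrow> real^3"
  assumes meas[measurable]: "(\<lambda>(x, y). D x y) \<in> borel_measurable (borel \<Otimes>\<^sub>M borel)"
    and H: "\<And>x. integrable lborel (H x)"
    and ftc: "\<And>x v. AE y in lborel. ((\<lambda>t. D (x + t *\<^sub>R v) y \<bullet> v) has_integral (H (x + v) y - H x y)) {0..1}"
    and D: "\<And>x. integrable lborel (D x)"
    and bd: "\<And>x. (LINT y|lborel. norm (D x y)) \<le> M * (1 + norm x)"
  shows "set_integrable lborel {0..1} (\<lambda>t. (LINT y|lborel. D (x + t *\<^sub>R v) y) \<bullet> v)"
    and "(LINT y|lborel. H (x + v) y) - (LINT y|lborel. H x y) =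
      (LINT t:{0..1}|lborel. (LINT y|lborel. D (x + t *\<^sub>R v) y) \<bullet> v)"
proof -
  define \<phi> where "\<phi> t y = indicator {0..1::real} t *\<^sub>R (D (x + t *\<^sub>R v) y \<bullet> v)" for t y
  have [measurable]: "(\<lambda>(t, y). D (x + t *\<^sub>R v) y) \<in> borel_measurable (borel \<Otimes>\<^sub>M borel)"
    using measurable_compose[of "\<lambda>(t, y). (x + t *\<^sub>R v, y)" "borel \<Otimes>\<^sub>M borel" "borel \<Otimes>\<^sub>M borel", OF _ meas]
    by (simp add: case_prod_unfold)
  have m\<phi>: "case_prod \<phi> \<in> borel_measurable (borel \<Otimes>\<^sub>M borel)"
    unfolding \<phi>_def by measurable
  then have m\<phi>': "case_prod \<phi> \<in> borel_measurable (lborel \<Otimes>\<^sub>M lborel)"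
    by (simp cong: measurable_cong_sets)
  have "0 \<le> (LINT y|lborel. norm (D 0 y))" by (intro integral_nonneg_AE) simp
  moreover have "M * (1 + norm (0::real^3)) = M" by simp
  ultimately have Mnn: "0 \<le> M" using bd[of 0] by linarith
  define B where "B = M * (1 + norm x + norm v) * norm v"
  have i1: "integrable lborel (\<phi> t)" for t
    unfolding \<phi>_def using D[of "x + t *\<^sub>R v"] by simp
  have b1: "(LINT y|lborel. norm (\<phi> t y)) \<le> indicator {0..1} t * B" for t
  proof (cases "t \<in> {0..1}")
    case True
    have "norm (x + t *\<^sub>R v) \<le> norm x + norm v"
      using True norm_triangle_ineq[of x "t *\<^sub>R v"] mult_right_mono[of t 1 "norm v"] by simp
    then have "M * (1 + norm (x + t *\<^sub>R v)) \<le> M * (1 + norm x + norm v)"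
      using Mnn by (intro mult_left_mono) auto
    then have b: "(LINT y|lborel. norm (D (x + t *\<^sub>R v) y)) \<le> M * (1 + norm x + norm v)"
      using bd[of "x + t *\<^sub>R v"] by simp
    have "(LINT y|lborel. norm (\<phi> t y)) \<le> (LINT y|lborel. norm (D (x + t *\<^sub>R v) y) * norm v)"
      using True by (intro integral_mono integrable_norm i1 integrable_mult_left D)
        (auto simp: \<phi>_def Cauchy_Schwarz_ineq2)
    also have "\<dots> \<le> B" using b by (simp add: B_def mult_right_mono)
    finally show ?thesis using True by simp
  qed (simp add: \<phi>_def)
  have int: "integrable (lborel \<Otimes>\<^sub>M lborel) (case_prod \<phi>)"
  proof (rule lborel_pair.Fubini_integrable[OF m\<phi>'])
    show "AE t in lborel. integrable lborel (\<lambda>y. case_prod \<phi> (t, y))" using i1 by simp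
    have "integrable lborel (\<lambda>t. indicator {0..1::real} t * B)"
      by (intro integrable_mult_left) (simp add: integrable_indicator_iff)
    then show "integrable lborel (\<lambda>t. LINT y|lborel. norm (case_prod \<phi> (t, y)))"
    proof (rule Bochner_Integration.integrable_bound)
      have "(\<lambda>(t, y). norm (\<phi> t y)) \<in> borel_measurable (borel \<Otimes>\<^sub>M lborel)"
        using m\<phi> by (simp cong: measurable_cong_sets)
      then have "(\<lambda>t. LINT y|lborel. norm (\<phi> t y)) \<in> borel_measurable borel"
        by (rule lborel.borel_measurable_lebesgue_integral)
      then show "(\<lambda>t. LINT y|lborel. norm (case_prod \<phi> (t, y))) \<in> borel_measurable lborel" by simp
      show "AE t in lborel. norm (LINT y|lborel. norm (case_prod \<phi> (t, y))) \<le> norm (indicator {0..1} t * B)"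
      proof (intro AE_I2)
        fix t
        have "0 \<le> (LINT y|lborel. norm (case_prod \<phi> (t, y)))" by (intro integral_nonneg_AE) simp
        moreover have "(LINT y|lborel. norm (case_prod \<phi> (t, y))) \<le> indicator {0..1} t * B"
          using b1[of t] by simp
        ultimately show "norm (LINT y|lborel. norm (case_prod \<phi> (t, y))) \<le> norm (indicator {0..1} t * B)"
          unfolding real_norm_def by linarith
      qed
    qed
  qed
  have in_t: "(LINT y|lborel. \<phi> t y) = indicator {0..1} t *\<^sub>R ((LINT y|lborel. D (x + t *\<^sub>R v) y) \<bullet> v)" for t
    unfolding \<phi>_def using D[of "x + t *\<^sub>R v"] by simp
  show "set_integrable lborel {0..1} (\<lambda>t. (LINT y|lborel. D (x + t *\<^sub>R v) y) \<bullet> v)"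
    using lborel_pair.integrable_fst[OF int] unfolding in_t set_integrable_def .
  have "(LINT t:{0..1}|lborel. (LINT y|lborel. D (x + t *\<^sub>R v) y) \<bullet> v) = (LINT t|lborel. LINT y|lborel. \<phi> t y)"
    unfolding in_t set_lebesgue_integral_def ..
  also have "\<dots> = (LINT y|lborel. LINT t|lborel. \<phi> t y)"
    by (rule lborel_pair.Fubini_integral[OF int, symmetric])
  also have "\<dots> = (LINT y|lborel. H (x + v) y - H x y)"
  proof (rule integral_cong_AE)
    have "(\<lambda>(y, t). \<phi> t y) \<in> borel_measurable (borel \<Otimes>\<^sub>M lborel)"
      using m\<phi> by (simp cong: measurable_cong_sets)
    then show "(\<lambda>y. LINT t|lborel. \<phi> t y) \<in> borel_measurable lborel"
      using lborel.borel_measurable_lebesgue_integral[of "\<lambda>y t. \<phi> t y" borel] by simp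
    show "(\<lambda>y. H (x + v) y - H x y) \<in> borel_measurable lborel"
      using H[THEN borel_measurable_integrable] by measurable
    show "AE y in lborel. (LINT t|lborel. \<phi> t y) = H (x + v) y - H x y"
      using ftc[of x v] lborel_pair.AE_integrable_snd[OF int]
    proof eventually_elim
      case (elim y)
      then have "set_integrable lborel {0..1} (\<lambda>t. D (x + t *\<^sub>R v) y \<bullet> v)"
        by (simp add: set_integrable_def \<phi>_def)
      then have "((\<lambda>t. D (x + t *\<^sub>R v) y \<bullet> v) has_integral (LINT t:{0..1}|lborel. D (x + t *\<^sub>R v) y \<bullet> v)) {0..1}"
        using set_borel_integral_eq_integral[of "{0..1}" "\<lambda>t. D (x + t *\<^sub>R v) y \<bullet> v"] by (simp add: has_integral_integral)
      then have "(LINT t:{0..1}|lborel. D (x + t *\<^sub>R v) y \<bullet> v) = H (x + v) y - H x y"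
        using elim(1) by (rule has_integral_unique)
      then show ?case by (simp add: set_lebesgue_integral_def \<phi>_def)
    qed
  qed
  also have "\<dots> = (LINT y|lborel. H (x + v) y) - (LINT y|lborel. H x y)"
    by (intro Bochner_Integration.integral_diff H)
  finally show "(LINT y|lborel. H (x + v) y) - (LINT y|lborel. H x y) =
      (LINT t:{0..1}|lborel. (LINT y|lborel. D (x + t *\<^sub>R v) y) \<bullet> v)" by simp
qed

text \<open>The increment is the mean of Q . v over the segment, and continuity at x compares that
  mean with Q x . v.\<close>

lemma has_derivative_of_FTC:
  fixes P :: "real^3 \<Rightarrow> real" and Q :: "real^3 \<Rightarrow> real^3"
  assumes si: "\<And>v. set_integrable lborel {0..1} (\<lambda>t. Q (x + t *\<^sub>R v) \<bullet> v)"
    and eq: "\<And>v. P (x + v) - P x = (LINT t:{0..1}|lborel. Q (x + t *\<^sub>R v) \<bullet> v)"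
    and cont: "isCont Q x"
  shows "(P has_derivative (\<lambda>h. Q x \<bullet> h)) (at x)"
  unfolding has_derivative_at_alt
proof (intro conjI allI impI)
  show "bounded_linear (\<lambda>h. Q x \<bullet> h)" by (rule bounded_linear_inner_right)
  fix e :: real assume "0 < e"
  then obtain d where d: "d > 0" "\<And>z. dist z x < d \<Longrightarrow> dist (Q z) (Q x) < e"
    using cont unfolding continuous_at_eps_delta by blast
  have "norm (P y - P x - Q x \<bullet> (y - x)) \<le> e * norm (y - x)" if y: "norm (y - x) < d" for y
  proof -
    define v where "v = y - x"
    have c: "set_integrable lborel {0..1::real} (\<lambda>t. Q x \<bullet> v)"
      by (simp add: set_integrable_def)
    have int1: "(LINT t:{0..1::real}|lborel. k) = k" for k :: real
      by (simp add: set_lebesgue_integral_def)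
    have "P y - P x - Q x \<bullet> v = (LINT t:{0..1}|lborel. Q (x + t *\<^sub>R v) \<bullet> v - Q x \<bullet> v)"
      using eq[of v] set_integral_diff(2)[OF si[of v] c] by (simp add: v_def int1)
    also have "norm \<dots> \<le> (LINT t:{0..1::real}|lborel. e * norm v)"
      unfolding set_lebesgue_integral_def
    proof (rule order_trans[OF integral_norm_bound], rule integral_mono)
      show "integrable lborel (\<lambda>t. norm (indicator {0..1} t *\<^sub>R (Q (x + t *\<^sub>R v) \<bullet> v - Q x \<bullet> v)))"
        by (rule integrable_norm)
          (use set_integral_diff(1)[OF si[of v] c] in \<open>simp add: set_integrable_def\<close>)
      show "integrable lborel (\<lambda>t. indicator {0..1::real} t *\<^sub>R (e * norm v))" by simp
      fix t :: real
      show "norm (indicator {0..1} t *\<^sub>R (Q (x + t *\<^sub>R v) \<bullet> v - Q x \<bullet> v)) \<le> indicator {0..1} t *\<^sub>R (e * norm v)"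
      proof (cases "t \<in> {0..1}")
        case True
        have "norm (t *\<^sub>R v) \<le> norm v" using True by (simp add: mult_left_le_one_le)
        then have "dist (x + t *\<^sub>R v) x < d" using y by (simp add: dist_norm v_def)
        then have "norm (Q (x + t *\<^sub>R v) - Q x) \<le> e" using d(2)[of "x + t *\<^sub>R v"] by (simp only: dist_norm less_imp_le)
        then have "\<bar>(Q (x + t *\<^sub>R v) - Q x) \<bullet> v\<bar> \<le> e * norm v"
          by (meson Cauchy_Schwarz_ineq2 mult_right_mono norm_ge_zero order_trans)
        then show ?thesis using True by (simp add: inner_diff_left)
      qed simp
    qed
    also have "\<dots> = e * norm v" by (rule int1)
    finally show ?thesis by (simp add: v_def)
  qed
  then show "\<exists>d>0. \<forall>y. norm (y - x) < d \<longrightarrow> norm (P y - P x - Q x \<bullet> (y - x)) \<le> e * norm (y - x)"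
    using d(1) by blast
qed

lemma vec_nth_measurable[measurable]: "(\<lambda>z::real^3. z $ i) \<in> borel_measurable borel"
  by (intro borel_measurable_continuous_onI continuous_intros)

lemma inverse_norm_le_kernel_weight:
  assumes "z \<noteq> 0" shows "1 / norm z \<le> kernel_weight z"
proof -
  have "2 * (1 / norm z) \<le> (1 / norm z)\<^sup>2 + 1"
    using zero_le_power2[of "1 / norm z - 1"] by (simp add: power2_diff)
  moreover have "0 \<le> 1 / norm z" "0 \<le> norm z" by simp_all
  moreover have "(1 / norm z)\<^sup>2 = 1 / (norm z)\<^sup>2" by (simp add: power_divide)
  ultimately show ?thesis unfolding kernel_weight_def by linarith
qed

section \<open>The logarithmic kernel and its first two derivatives\<close>

definition log_kernel :: "real^3 \<Rightarrow> real" where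
  "log_kernel z = - ln (norm z)"

definition log_grad :: "real^3 \<Rightarrow> real^3" where
  "log_grad z = - (1 / (norm z)\<^sup>2) *\<^sub>R z"

definition log_hess :: "3 \<Rightarrow> real^3 \<Rightarrow> real^3" where
  "log_hess i z = (2 * z$i / (norm z)^4) *\<^sub>R z - (1 / (norm z)\<^sup>2) *\<^sub>R axis i 1"

lemma norm_log_grad: "norm (log_grad z) = 1 / norm z"
  by (cases "z = 0") (auto simp: log_grad_def power2_eq_square)

lemma kernel_class_log_kernel: "kernel_class log_kernel"
  unfolding kernel_class_def
proof (intro conjI exI allI impI)
  show "log_kernel \<in> borel_measurable borel" unfolding log_kernel_def by measurable
  fix z :: "real^3" assume z: "z \<noteq> 0"
  have "ln (norm z) \<le> norm z" "ln (1 / norm z) \<le> 1 / norm z"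
    using ln_le_minus_one[of "norm z"] ln_le_minus_one[of "1 / norm z"] z by auto
  moreover have "ln (1 / norm z) = - ln (norm z)" using z by (simp add: ln_div)
  moreover have "norm z \<le> kernel_weight z" by (simp add: kernel_weight_def)
  ultimately show "norm (log_kernel z) \<le> 1 * kernel_weight z"
    using inverse_norm_le_kernel_weight[OF z] by (simp add: log_kernel_def abs_le_iff)
qed

lemma log_grad_measurable[measurable]: "log_grad \<in> borel_measurable borel"
  unfolding log_grad_def by measurable

lemma kernel_class_log_grad: "kernel_class log_grad"
  unfolding kernel_class_def
  by (auto intro!: exI[of _ 1] simp: norm_log_grad inverse_norm_le_kernel_weight)

lemma kernel_class_log_grad_nth: "kernel_class (\<lambda>z. log_grad z $ i)"
  unfolding kernel_class_def
proof (intro conjI exI allI impI)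
  fix z :: "real^3" assume z: "z \<noteq> 0"
  have "norm (log_grad z $ i) \<le> norm (log_grad z)" using component_le_norm_cart[of "log_grad z" i] by simp
  then show "norm (log_grad z $ i) \<le> 1 * kernel_weight z"
    using inverse_norm_le_kernel_weight[OF z] by (simp add: norm_log_grad)
qed measurable

lemma kernel_class_log_hess: "kernel_class (log_hess i)"
  unfolding kernel_class_def
proof (intro conjI exI allI impI)
  show "log_hess i \<in> borel_measurable borel" unfolding log_hess_def by measurable
  fix z :: "real^3" assume z: "z \<noteq> 0"
  have "norm (log_hess i z) \<le> norm ((2 * z$i / (norm z)^4) *\<^sub>R z) + norm ((1 / (norm z)\<^sup>2) *\<^sub>R axis i (1::real))"
    unfolding log_hess_def by (rule norm_triangle_ineq4)
  also have "norm ((2 * z$i / (norm z)^4) *\<^sub>R z) = 2 * \<bar>z$i\<bar> / (norm z)^3"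
    using z by (simp add: abs_mult eval_nat_numeral)
  also have "\<dots> \<le> 2 * norm z / (norm z)^3"
    using component_le_norm_cart[of z i] by (intro divide_right_mono) auto
  also have "2 * norm z / (norm z)^3 + norm ((1 / (norm z)\<^sup>2) *\<^sub>R axis i (1::real)) = 3 * (1 / (norm z)\<^sup>2)"
    using z by (simp add: eval_nat_numeral norm_axis_1 field_simps)
  also have "\<dots> \<le> 3 * kernel_weight z"
    by (intro mult_left_mono) (auto simp: kernel_weight_def)
  finally show "norm (log_hess i z) \<le> 3 * kernel_weight z" by simp
qed

lemma log_kernel_has_derivative:
  assumes "z \<noteq> 0" shows "(log_kernel has_derivative (\<lambda>h. log_grad z \<bullet> h)) (at z)"
proof -
  have 1: "(norm has_derivative (\<lambda>h. sgn z \<bullet> h)) (at z)"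
    using has_derivative_norm[OF assms] by (simp add: inner_commute)
  have "((\<lambda>z. - ln (norm z)) has_derivative (\<lambda>h. - ((sgn z \<bullet> h) * inverse (norm z)))) (at z)"
    using has_derivative_minus[OF has_derivative_ln[OF _ 1]] assms by (simp add: mult.commute)
  moreover have "- ((sgn z \<bullet> h) * inverse (norm z)) = log_grad z \<bullet> h" for h
    by (simp add: log_grad_def sgn_div_norm power2_eq_square divide_inverse)
  ultimately show ?thesis unfolding log_kernel_def[abs_def] by simp
qed

lemma log_grad_nth_has_derivative:
  assumes "z \<noteq> 0" shows "((\<lambda>z. log_grad z $ i) has_derivative (\<lambda>h. log_hess i z \<bullet> h)) (at z)"
proof -
  have n: "z \<bullet> z \<noteq> 0" using assms by simp
  have 1: "((\<lambda>z. z \<bullet> z) has_derivative (\<lambda>h. 2 * (z \<bullet> h))) (at z)"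
    by (auto intro!: derivative_eq_intros simp: inner_commute)
  have 2: "((\<lambda>z::real^3. - (z $ i)) has_derivative (\<lambda>h. - (h $ i))) (at z)"
    by (auto intro!: derivative_eq_intros bounded_linear.has_derivative[OF bounded_linear_vec_nth])
  have "((\<lambda>z. - (z $ i) / (z \<bullet> z)) has_derivative (\<lambda>h. (- (h $ i) * (z \<bullet> z) - - (z$i) * (2 * (z \<bullet> h))) / ((z \<bullet> z) * (z \<bullet> z)))) (at z)"
    by (rule has_derivative_divide'[OF 2 1 n])
  moreover have "(- (h $ i) * (z \<bullet> z) - - (z$i) * (2 * (z \<bullet> h))) / ((z \<bullet> z) * (z \<bullet> z)) = log_hess i z \<bullet> h" for h
  proof -
    have "norm z ^ 4 = (z \<bullet> z) * (z \<bullet> z)" 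
      using power2_norm_eq_inner[of z] by (simp add: eval_nat_numeral)
    then show ?thesis using n
      by (simp add: log_hess_def inner_diff_left inner_axis' power2_norm_eq_inner diff_divide_distrib)
  qed
  moreover have "(\<lambda>z. - (z $ i) / (z \<bullet> z)) = (\<lambda>z. log_grad z $ i)"
    by (simp add: log_grad_def power2_norm_eq_inner fun_eq_iff)
  ultimately show ?thesis by simp
qed

lemma
  fixes K :: "real^3 \<Rightarrow> real" and G :: "real^3 \<Rightarrow> real^3" and f :: "real^3 \<Rightarrow> real"
  assumes K: "kernel_class K" and G: "kernel_class G"
    and der: "\<And>z. z \<noteq> 0 \<Longrightarrow> (K has_derivative (\<lambda>h. G z \<bullet> h)) (at z)"
    and f: "decays f"
  shows kernel_conv_FTC_integrable: "set_integrable lborel {0..1} (\<lambda>t. (LINT y|lborel. f y *\<^sub>R G (x + t *\<^sub>R v - y)) \<bullet> v)"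
    and kernel_conv_FTC: "(LINT y|lborel. f y *\<^sub>R K (x + v - y)) - (LINT y|lborel. f y *\<^sub>R K (x - y)) =
      (LINT t:{0..1}|lborel. (LINT y|lborel. f y *\<^sub>R G (x + t *\<^sub>R v - y)) \<bullet> v)"
proof -
  have [measurable]: "f \<in> borel_measurable borel" "K \<in> borel_measurable borel" "G \<in> borel_measurable borel"
    using f K G decays_measurable kernel_class_measurable by auto
  obtain M where M: "\<And>x. integrable lborel (\<lambda>y. f y *\<^sub>R G (x - y))"
    "\<And>x. (LINT y|lborel. norm (f y *\<^sub>R G (x - y))) \<le> M * (1 + norm x)"
    using kernel_conv_bound[OF G f] by blast
  have ftc: "AE y in lborel. ((\<lambda>t. (f y *\<^sub>R G (x + t *\<^sub>R v - y)) \<bullet> v) has_integral (f y *\<^sub>R K (x + v - y) - f y *\<^sub>R K (x - y))) {0..1}"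
    for x v
    using AE_not_on_line[of x v]
  proof eventually_elim
    case (elim y)
    have "((\<lambda>t. (f y *\<^sub>R G (x + t *\<^sub>R v - y)) \<bullet> v) has_integral (f y *\<^sub>R K (x + 1 *\<^sub>R v - y) - f y *\<^sub>R K (x + 0 *\<^sub>R v - y))) {0..1}"
    proof (rule fundamental_theorem_of_calculus)
      fix t :: real assume "t \<in> {0..1}"
      have ne: "x + t *\<^sub>R v - y \<noteq> 0" using elim by (metis right_minus_eq)
      have "((\<lambda>t. x + t *\<^sub>R v - y) has_derivative (\<lambda>s. s *\<^sub>R v)) (at t within {0..1})"
        by (auto intro!: derivative_eq_intros)
      then have "((\<lambda>t. K (x + t *\<^sub>R v - y)) has_derivative (\<lambda>s. G (x + t *\<^sub>R v - y) \<bullet> (s *\<^sub>R v))) (at t within {0..1})"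
        by (rule has_derivative_compose[where f="\<lambda>t. x + t *\<^sub>R v - y" and g=K, OF _ der[OF ne]])
      then have "((\<lambda>t. f y * K (x + t *\<^sub>R v - y)) has_derivative (\<lambda>s. f y * (G (x + t *\<^sub>R v - y) \<bullet> (s *\<^sub>R v)))) (at t within {0..1})"
        by (rule has_derivative_mult_right)
      then show "((\<lambda>t. f y *\<^sub>R K (x + t *\<^sub>R v - y)) has_vector_derivative (f y *\<^sub>R G (x + t *\<^sub>R v - y)) \<bullet> v) (at t within {0..1})"
        by (simp add: has_vector_derivative_def mult.left_commute)
    qed simp
    then show ?case by simp
  qed
  note * = parametric_integral_FTC[of "\<lambda>x y. f y *\<^sub>R G (x - y)" "\<lambda>x y. f y *\<^sub>R K (x - y)" M,
    OF _ integrable_kernel_conv[OF K f] ftc M]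
  show "set_integrable lborel {0..1} (\<lambda>t. (LINT y|lborel. f y *\<^sub>R G (x + t *\<^sub>R v - y)) \<bullet> v)"
    by (rule *(1)) measurable
  show "(LINT y|lborel. f y *\<^sub>R K (x + v - y)) - (LINT y|lborel. f y *\<^sub>R K (x - y)) =
      (LINT t:{0..1}|lborel. (LINT y|lborel. f y *\<^sub>R G (x + t *\<^sub>R v - y)) \<bullet> v)"
    by (rule *(2)) measurable
qed

text \<open>The integrated identity alone gives a local Lipschitz bound. It makes the potential of
  the truncated, discontinuous starting weight of the iteration continuous.\<close>

lemma kernel_conv_continuous_rough:
  fixes K :: "real^3 \<Rightarrow> real" and G :: "real^3 \<Rightarrow> real^3" and f :: "real^3 \<Rightarrow> real"
  assumes K: "kernel_class K" and G: "kernel_class G"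
    and der: "\<And>z. z \<noteq> 0 \<Longrightarrow> (K has_derivative (\<lambda>h. G z \<bullet> h)) (at z)"
    and f: "decays f"
  shows "continuous_on UNIV (\<lambda>x. LINT y|lborel. f y *\<^sub>R K (x - y))"
proof -
  let ?P = "\<lambda>x. LINT y|lborel. f y *\<^sub>R K (x - y)" and ?Q = "\<lambda>x. LINT y|lborel. f y *\<^sub>R G (x - y)"
  obtain M where M0: "M > 0" and M: "\<And>x. (LINT y|lborel. norm (f y *\<^sub>R G (x - y))) \<le> M * (1 + norm x)"
    using kernel_conv_bound[OF G f] by blast
  have Q: "norm (?Q x) \<le> M * (1 + norm x)" for x
    using integral_norm_bound[of lborel "\<lambda>y. f y *\<^sub>R G (x - y)"] M[of x] by (rule order_trans)
  have FTC: "?P (x + v) - ?P x = (LINT t:{0..1}|lborel. ?Q (x + t *\<^sub>R v) \<bullet> v)" for x v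
    by (rule kernel_conv_FTC[OF K G der f])
  have FTC_int: "set_integrable lborel {0..1} (\<lambda>t. ?Q (x + t *\<^sub>R v) \<bullet> v)" for x v
    by (rule kernel_conv_FTC_integrable[OF K G der f])
  have lip: "\<bar>?P (x + v) - ?P x\<bar> \<le> M * (1 + norm x + norm v) * norm v" for x v
  proof -
    have "\<bar>?P (x + v) - ?P x\<bar> = norm (LINT t|lborel. indicator {0..1} t *\<^sub>R (?Q (x + t *\<^sub>R v) \<bullet> v))"
      using FTC[of x v] by (simp only: set_lebesgue_integral_def real_norm_def)
    also have "\<dots> \<le> (LINT t|lborel. norm (indicator {0..1} t *\<^sub>R (?Q (x + t *\<^sub>R v) \<bullet> v)))"
      by (rule integral_norm_bound)
    also have "\<dots> \<le> (LINT t|lborel. indicator {0..1::real} t *\<^sub>R (M * (1 + norm x + norm v) * norm v))"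
    proof (rule integral_mono)
      show "integrable lborel (\<lambda>t. norm (indicator {0..1} t *\<^sub>R (?Q (x + t *\<^sub>R v) \<bullet> v)))"
        using FTC_int[of x v] unfolding set_integrable_def by (rule integrable_norm)
      show "integrable lborel (\<lambda>t. indicator {0..1::real} t *\<^sub>R (M * (1 + norm x + norm v) * norm v))" by simp
      fix t :: real
      show "norm (indicator {0..1} t *\<^sub>R (?Q (x + t *\<^sub>R v) \<bullet> v)) \<le> indicator {0..1} t *\<^sub>R (M * (1 + norm x + norm v) * norm v)"
      proof (cases "t \<in> {0..1}")
        case True
        have "norm (t *\<^sub>R v) \<le> norm v" using True by (simp add: mult_left_le_one_le)
        then have "norm (x + t *\<^sub>R v) \<le> norm x + norm v" using norm_triangle_ineq[of x "t *\<^sub>R v"] by linarith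
        then have "M * (1 + norm (x + t *\<^sub>R v)) \<le> M * (1 + norm x + norm v)" using M0 by simp
        then have "norm (?Q (x + t *\<^sub>R v)) \<le> M * (1 + norm x + norm v)" using Q[of "x + t *\<^sub>R v"] by linarith
        then have "\<bar>?Q (x + t *\<^sub>R v) \<bullet> v\<bar> \<le> M * (1 + norm x + norm v) * norm v"
          by (rule order_trans[OF Cauchy_Schwarz_ineq2 mult_right_mono]) simp
        then show ?thesis using True by simp
      qed simp
    qed
    also have "\<dots> = M * (1 + norm x + norm v) * norm v" by simp
    finally show ?thesis .
  qed
  have le: "\<bar>?P y - ?P x\<bar> \<le> M * (1 + norm x + norm (y - x)) * norm (y - x)" for x y
    using lip[of x "y - x"] by (simp only: add_diff_cancel_left' add_diff_eq)
  have "isCont ?P x" for x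
  proof -
    have "((\<lambda>y. M * (1 + norm x + norm (y - x)) * norm (y - x)) \<longlongrightarrow> M * (1 + norm x + norm (x - x)) * norm (x - x)) (at x)"
      by (intro tendsto_intros)
    then have "((\<lambda>y. M * (1 + norm x + norm (y - x)) * norm (y - x)) \<longlongrightarrow> 0) (at x)" by simp
    then have "((\<lambda>y. ?P y - ?P x) \<longlongrightarrow> 0) (at x)"
      by (rule Lim_null_comparison[rotated]) (use le in \<open>simp add: always_eventually\<close>)
    then show ?thesis unfolding isCont_def by (rule LIM_zero_cancel)
  qed
  then show ?thesis by (simp add: continuous_on_eq_continuous_at)
qed

lemma kernel_conv_has_derivative:
  fixes K :: "real^3 \<Rightarrow> real" and G :: "real^3 \<Rightarrow> real^3" and f :: "real^3 \<Rightarrow> real"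
  assumes K: "kernel_class K" and G: "kernel_class G"
    and der: "\<And>z. z \<noteq> 0 \<Longrightarrow> (K has_derivative (\<lambda>h. G z \<bullet> h)) (at z)"
    and f: "decays f" and cont: "continuous_on UNIV f"
  shows "((\<lambda>x. LINT y|lborel. f y *\<^sub>R K (x - y)) has_derivative (\<lambda>h. (LINT y|lborel. f y *\<^sub>R G (x - y)) \<bullet> h)) (at x)"
proof (rule has_derivative_of_FTC[OF kernel_conv_FTC_integrable[OF K G der f] kernel_conv_FTC[OF K G der f]])
  show "isCont (\<lambda>x. LINT y|lborel. f y *\<^sub>R G (x - y)) x"
    using kernel_conv_continuous[OF G f cont] by (simp add: continuous_on_eq_continuous_at)
qed

text \<open>In the reflected form only f (x - z) depends on x, so the singular factor is never
  differentiated. This step can be repeated for as long as f has derivatives.\<close>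

lemma kernel_conv_has_derivative_smooth_factor:
  fixes K :: "real^3 \<Rightarrow> real" and g :: "real^3 \<Rightarrow> real^3" and f :: "real^3 \<Rightarrow> real"
  assumes K: "kernel_class K" and f: "decays f" and g: "decays g" and cont: "continuous_on UNIV g"
    and der: "\<And>z. (f has_derivative (\<lambda>h. g z \<bullet> h)) (at z)"
  shows "((\<lambda>x. LINT y|lborel. f y *\<^sub>R K (x - y)) has_derivative
    (\<lambda>h. (\<chi> i. LINT y|lborel. (g y $ i) *\<^sub>R K (x - y)) \<bullet> h)) (at x)"
proof -
  have [measurable]: "f \<in> borel_measurable borel" "K \<in> borel_measurable borel" "g \<in> borel_measurable borel"
    using f K g decays_measurable kernel_class_measurable by auto
  have ng: "decays (\<lambda>y. norm (g y))" and gi: "decays (\<lambda>y. g y $ i)" for i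
  proof -
    obtain C where C: "\<And>x. norm (g x) \<le> C / (1 + norm x)^5" using g by (auto simp: decays_def)
    then show "decays (\<lambda>y. norm (g y))" unfolding decays_def by (auto intro!: exI[of _ C])
    have "norm (g x $ i) \<le> C / (1 + norm x)^5" for x
      using component_le_norm_cart[of "g x" i] C[of x] by simp
    then show "decays (\<lambda>y. g y $ i)" unfolding decays_def by (auto intro!: exI[of _ C])
  qed
  obtain M where Mb: "\<And>x. (LINT y|lborel. norm (norm (g y) *\<^sub>R K (x - y))) \<le> M * (1 + norm x)"
    using kernel_conv_bound[OF K ng] by blast
  define D where "D x z = K z *\<^sub>R g (x - z)" for x z
  have nD: "norm (D x z) = norm (norm (g (x - z)) *\<^sub>R K z)" for x z
    by (simp add: D_def abs_mult mult.commute)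
  have D: "integrable lborel (D x)" for x
    by (rule Bochner_Integration.integrable_bound[OF integrable_kernel_conv_swap[OF K ng, of x]])
       (auto simp: D_def[abs_def] abs_mult mult.commute)
  have Db: "(LINT z|lborel. norm (D x z)) \<le> M * (1 + norm x)" for x
  proof -
    have "(LINT z|lborel. norm (D x z)) = (LINT y|lborel. norm (norm (g y) *\<^sub>R K (x - y)))"
      unfolding nD using integral_reflect[of "\<lambda>z. norm (norm (g (x - z)) *\<^sub>R K z)" x] by simp
    then show ?thesis using Mb[of x] by simp
  qed
  have ftc: "AE z in lborel. ((\<lambda>t. D (x + t *\<^sub>R v) z \<bullet> v) has_integral (f (x + v - z) *\<^sub>R K z - f (x - z) *\<^sub>R K z)) {0..1}" for x v
  proof (rule AE_I2)
    fix z
    have "((\<lambda>t. D (x + t *\<^sub>R v) z \<bullet> v) has_integral (f (x + 1 *\<^sub>R v - z) *\<^sub>R K z - f (x + 0 *\<^sub>R v - z) *\<^sub>R K z)) {0..1}"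
    proof (rule fundamental_theorem_of_calculus)
      fix t :: real assume "t \<in> {0..1}"
      have "((\<lambda>t. x + t *\<^sub>R v - z) has_derivative (\<lambda>s. s *\<^sub>R v)) (at t within {0..1})"
        by (auto intro!: derivative_eq_intros)
      then have "((\<lambda>t. f (x + t *\<^sub>R v - z)) has_derivative (\<lambda>s. g (x + t *\<^sub>R v - z) \<bullet> (s *\<^sub>R v))) (at t within {0..1})"
        by (rule has_derivative_compose[where f="\<lambda>t. x + t *\<^sub>R v - z" and g=f, OF _ der])
      then have "((\<lambda>t. f (x + t *\<^sub>R v - z) * K z) has_derivative (\<lambda>s. (g (x + t *\<^sub>R v - z) \<bullet> (s *\<^sub>R v)) * K z)) (at t within {0..1})"
        by (rule has_derivative_mult_left)
      then show "((\<lambda>t. f (x + t *\<^sub>R v - z) *\<^sub>R K z) has_vector_derivative D (x + t *\<^sub>R v) z \<bullet> v) (at t within {0..1})"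
        by (simp add: has_vector_derivative_def D_def mult_ac)
    qed simp
    then show "((\<lambda>t. D (x + t *\<^sub>R v) z \<bullet> v) has_integral (f (x + v - z) *\<^sub>R K z - f (x - z) *\<^sub>R K z)) {0..1}"
      by simp
  qed
  have mD: "(\<lambda>(x, y). D x y) \<in> borel_measurable (borel \<Otimes>\<^sub>M borel)"
    unfolding D_def by measurable
  note * = parametric_integral_FTC[of D "\<lambda>x z. f (x - z) *\<^sub>R K z" M,
    OF mD integrable_kernel_conv_swap[OF K f] ftc D Db]
  have Q: "(LINT z|lborel. D x z) = (\<chi> i. LINT y|lborel. (g y $ i) *\<^sub>R K (x - y))" for x
  proof (subst vec_eq_iff, intro allI)
    fix i
    have "(LINT z|lborel. D x z) $ i = (LINT z|lborel. D x z $ i)"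
      using integral_bounded_linear[OF bounded_linear_vec_nth D] by simp
    also have "\<dots> = (LINT y|lborel. (g y $ i) *\<^sub>R K (x - y))"
      unfolding kernel_conv_swap[OF K gi] by (simp add: D_def mult.commute)
    finally show "(LINT z|lborel. D x z) $ i = (\<chi> i. LINT y|lborel. (g y $ i) *\<^sub>R K (x - y)) $ i" by simp
  qed
  have cQ: "continuous_on UNIV (\<lambda>x. \<chi> i. LINT y|lborel. (g y $ i) *\<^sub>R K (x - y))"
    by (intro continuous_on_vec_lambda kernel_conv_continuous K gi continuous_intros cont)
  have "((\<lambda>x. LINT z|lborel. f (x - z) *\<^sub>R K z) has_derivative (\<lambda>h. (LINT z|lborel. D x z) \<bullet> h)) (at x)"
    by (rule has_derivative_of_FTC[OF *]) (use cQ in \<open>simp add: Q continuous_on_eq_continuous_at\<close>)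
  then show ?thesis unfolding Q kernel_conv_swap[OF K f] .
qed

subsection \<open>Potentials of radial weights\<close>

lemma decays_integrable:
  fixes f :: "real^3 \<Rightarrow> 'b::euclidean_space"
  assumes "decays f" shows "integrable lborel f"
proof -
  obtain C where C: "C > 0" "\<And>x. norm (f x) \<le> C / (1 + norm x)^5" using decaysE[OF assms] by blast
  have "integrable lborel (\<lambda>x::real^3. C * (1 / (1 + norm x)^4))"
    by (intro integrable_mult_right integrable_inverse_pow4)
  then show ?thesis
  proof (rule Bochner_Integration.integrable_bound)
    show "f \<in> borel_measurable lborel" using decays_measurable[OF assms] by simp
    have "norm (f x) \<le> norm (C * (1 / (1 + norm x)^4))" for x
    proof -
      have "(1 + norm x)^4 \<le> (1 + norm x)^5" by (intro power_increasing) auto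
      then have "C / (1 + norm x)^5 \<le> C / (1 + norm x)^4"
        using C(1) by (intro divide_left_mono mult_pos_pos zero_less_power add_pos_nonneg) auto
      then show ?thesis using C(2)[of x] C(1) by simp
    qed
    then show "AE x in lborel. norm (f x) \<le> norm (C * (1 / (1 + norm x)^4))" by simp
  qed
qed

text \<open>As 1 + r <= exp r, the product is at most exp (n r - c r^2); completing the square gives
  the constant.\<close>

lemma exp_neg_square_poly_bound:
  assumes c: "0 < c" and r: "0 \<le> (r::real)"
  shows "exp (- c * r\<^sup>2) * (1 + r)^n \<le> exp ((real n)\<^sup>2 / (4 * c))"
proof -
  have "(1 + r)^n \<le> exp r ^ n" using r exp_ge_add_one_self[of r] by (intro power_mono) auto
  also have "\<dots> = exp (n * r)" by (simp add: exp_of_nat_mult)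
  finally have "exp (- c * r\<^sup>2) * (1 + r)^n \<le> exp (- c * r\<^sup>2) * exp (n * r)" by simp
  also have "\<dots> = exp (- c * r\<^sup>2 + n * r)" by (rule exp_add[symmetric])
  also have "- c * r\<^sup>2 + n * r \<le> (real n)\<^sup>2 / (4 * c)"
  proof -
    have "0 \<le> (2 * c * r - n)\<^sup>2 / (4 * c)" using c by simp
    also have "\<dots> = c * r\<^sup>2 - n * r + (real n)\<^sup>2 / (4 * c)"
      using c by (simp add: power2_eq_square field_simps)
    finally show ?thesis by simp
  qed
  finally show ?thesis by simp
qed

lemma decays_gaussian_bound:
  fixes f :: "real^3 \<Rightarrow> real"
  assumes "f \<in> borel_measurable borel" "0 < c" "\<And>x. \<bar>f x\<bar> \<le> B * exp (- c * (norm x)\<^sup>2)" "0 \<le> B"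
  shows "decays f"
  unfolding decays_def
proof (intro conjI exI allI)
  fix x :: "real^3"
  have "exp (- c * (norm x)\<^sup>2) \<le> exp ((real 5)\<^sup>2 / (4 * c)) / (1 + norm x)^5"
    using exp_neg_square_poly_bound[OF assms(2), of "norm x" 5]
    by (simp add: pos_le_divide_eq add_pos_nonneg)
  then have "B * exp (- c * (norm x)\<^sup>2) \<le> B * (exp ((real 5)\<^sup>2 / (4 * c)) / (1 + norm x)^5)"
    using assms(4) by (rule mult_left_mono)
  then show "norm (f x) \<le> B * exp ((real 5)\<^sup>2 / (4 * c)) / (1 + norm x)^5"
    using assms(3)[of x] by simp
qed (fact assms)

lemma integral_pos_of_pos:
  fixes f :: "real^3 \<Rightarrow> real"
  assumes i: "integrable lborel f" and pos: "\<And>x. 0 < f x"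
  shows "0 < (LINT x|lborel. f x)"
proof -
  have "(LINT x|lborel. f x) \<noteq> 0"
  proof
    assume "(LINT x|lborel. f x) = 0"
    then have "AE x in lborel. f x = 0"
      using integral_nonneg_eq_0_iff_AE[OF i] pos by (simp add: less_imp_le)
    then have "AE x in (lborel :: (real^3) measure). False" by eventually_elim (use pos in \<open>metis less_irrefl\<close>)
    \<comment> \<open>A closed set containing almost every point is the whole space; applied to the
      empty set this is absurd.\<close>
    then have "AE x in (lebesgue :: (real^3) measure). x \<in> {}" by (auto dest: AE_completion)
    then have "(0 :: real^3) \<in> {}" by (rule mem_closed_if_AE_lebesgue[OF closed_empty])
    then show False by simp
  qed
  moreover have "0 \<le> (LINT x|lborel. f x)" using pos by (intro integral_nonneg_AE) (simp add: less_imp_le)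
  ultimately show ?thesis by simp
qed

definition weight :: "(real^3 \<Rightarrow> real) \<Rightarrow> bool" where
  "weight a \<longleftrightarrow> radial a \<and> decays a \<and> (\<forall>x. 0 \<le> a x) \<and> 0 < (LINT x|lborel. a x)"

definition pot :: "(real^3 \<Rightarrow> real) \<Rightarrow> real^3 \<Rightarrow> real" where
  "pot a x = (LINT y|lborel. a y *\<^sub>R log_kernel (x - y))"

definition pot_grad :: "(real^3 \<Rightarrow> real) \<Rightarrow> real^3 \<Rightarrow> real^3" where
  "pot_grad a x = (LINT y|lborel. a y *\<^sub>R log_grad (x - y))"

text \<open>By \<open>virial_eq\<close> this is - x . grad (pot a) on the sphere |x| = r. The kernel
  multiplying a takes values between 0 and 1.\<close>

definition virial :: "(real^3 \<Rightarrow> real) \<Rightarrow> real \<Rightarrow> real" where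
  "virial a r = (LINT y|lborel. a y * (1 / 2 + shell (norm y / r)))"

lemma shell_eq_sphere_kernel:
  assumes "0 < r" "0 < s"
  shows "shell (s / r) = (r\<^sup>2 - s\<^sup>2) / 2 * sphere_kernel r s"
proof -
  have "(1 + s / r) / (1 - s / r) = (r + s) / (r - s)"
    using assms by (cases "r = s") (auto simp: field_simps)
  moreover have "(1 - (s / r)\<^sup>2) / (4 * (s / r)) = (r\<^sup>2 - s\<^sup>2) / 2 * (1 / (2 * r * s))"
    using assms by (simp add: power_divide field_simps power2_eq_square)
  ultimately show ?thesis unfolding shell_def sphere_log_def sphere_kernel_def by simp
qed

text \<open>The pointwise identity \<open>x \<bullet> (x - y) / |x - y|\<^sup>2 = (1 + (|x|\<^sup>2 - |y|\<^sup>2) / |x - y|\<^sup>2) / 2\<close> reduces the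
  radial derivative of the potential to the spherical means of \<open>1 / |x - y|\<^sup>2\<close>.\<close>

lemma has_bochner_integral_virial:
  assumes a: "weight a" and x: "x \<noteq> 0"
  shows "has_bochner_integral lborel (\<lambda>y. a y * (1 / 2 + shell (norm y / norm x))) (- (pot_grad a x \<bullet> x))"
proof -
  have rad: "radial a" and dec: "decays a" using a by (auto simp: weight_def)
  have [measurable]: "a \<in> borel_measurable borel" by (rule decays_measurable[OF dec])
  define h where "h y = a y * ((norm x)\<^sup>2 - (norm y)\<^sup>2)" for y
  have hrad: "radial h" using rad unfolding radial_def h_def by metis
  have [measurable]: "h \<in> borel_measurable borel" unfolding h_def by measurable
  have ig: "integrable lborel (\<lambda>y. (a y *\<^sub>R log_grad (x - y)) \<bullet> x)"
    by (intro integrable_inner_left integrable_kernel_conv kernel_class_log_grad dec)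
  have ia: "integrable lborel a" by (rule decays_integrable[OF dec])
  have AEeq: "AE y in lborel. h y / (norm (x - y))\<^sup>2 = - 2 * ((a y *\<^sub>R log_grad (x - y)) \<bullet> x) - a y"
    using AE_neq_point[of x]
  proof eventually_elim
    case (elim y)
    then have n: "(norm (x - y))\<^sup>2 \<noteq> 0" by simp
    have "2 * ((x - y) \<bullet> x) = (norm (x - y))\<^sup>2 + ((norm x)\<^sup>2 - (norm y)\<^sup>2)"
      unfolding power2_norm_eq_inner by (simp add: inner_diff_left inner_diff_right inner_commute)
    then have "2 * ((x - y) \<bullet> x) / (norm (x - y))\<^sup>2 = 1 + ((norm x)\<^sup>2 - (norm y)\<^sup>2) / (norm (x - y))\<^sup>2"
      using n by (simp add: add_divide_distrib)
    then have "a y * (2 * ((x - y) \<bullet> x) / (norm (x - y))\<^sup>2) = a y + h y / (norm (x - y))\<^sup>2"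
      by (simp add: h_def distrib_left)
    moreover have "a y * (2 * ((x - y) \<bullet> x) / (norm (x - y))\<^sup>2) = - 2 * ((a y *\<^sub>R log_grad (x - y)) \<bullet> x)"
      by (simp add: log_grad_def)
    ultimately show ?case by linarith
  qed
  have ih: "integrable lborel (\<lambda>y. h y / (norm (x - y))\<^sup>2)"
  proof (rule integrable_cong_AE[THEN iffD2, OF _ _ AEeq])
    show "integrable lborel (\<lambda>y. - 2 * ((a y *\<^sub>R log_grad (x - y)) \<bullet> x) - a y)"
      by (intro Bochner_Integration.integrable_diff integrable_mult_right ig ia)
  qed measurable
  have LH: "(LINT y|lborel. h y / (norm (x - y))\<^sup>2) = - 2 * (pot_grad a x \<bullet> x) - (LINT y|lborel. a y)"
  proof -
    have "(LINT y|lborel. h y / (norm (x - y))\<^sup>2) = (LINT y|lborel. - 2 * ((a y *\<^sub>R log_grad (x - y)) \<bullet> x) - a y)"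
      by (rule integral_cong_AE) (use AEeq in auto)
    also have "\<dots> = - 2 * (LINT y|lborel. (a y *\<^sub>R log_grad (x - y)) \<bullet> x) - (LINT y|lborel. a y)"
      using ig ia by (subst Bochner_Integration.integral_diff) auto
    also have "(LINT y|lborel. (a y *\<^sub>R log_grad (x - y)) \<bullet> x) = pot_grad a x \<bullet> x"
      unfolding pot_grad_def by (intro integral_inner_left integrable_kernel_conv kernel_class_log_grad dec)
    finally show ?thesis .
  qed
  have "has_bochner_integral lborel (\<lambda>y. h y * sphere_kernel (norm x) (norm y)) (- 2 * (pot_grad a x \<bullet> x) - (LINT y|lborel. a y))"
    using has_bochner_integral_sphere_mean[OF _ hrad x ih] unfolding LH by simp
  then have "has_bochner_integral lborel (\<lambda>y. 1 / 2 * a y + 1 / 2 * (h y * sphere_kernel (norm x) (norm y)))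
    (1 / 2 * (LINT y|lborel. a y) + 1 / 2 * (- 2 * (pot_grad a x \<bullet> x) - (LINT y|lborel. a y)))"
    by (intro has_bochner_integral_add has_bochner_integral_mult_right has_bochner_integral_integrable ia)
  also have "1 / 2 * (LINT y|lborel. a y) + 1 / 2 * (- 2 * (pot_grad a x \<bullet> x) - (LINT y|lborel. a y)) = - (pot_grad a x \<bullet> x)"
  proof -
    have "1 / 2 * A + 1 / 2 * (- 2 * P - A) = - P" for A P :: real by (simp add: field_simps)
    then show ?thesis .
  qed
  finally have H: "has_bochner_integral lborel (\<lambda>y. 1 / 2 * a y + 1 / 2 * (h y * sphere_kernel (norm x) (norm y))) (- (pot_grad a x \<bullet> x))" .
  have m1: "(\<lambda>y. 1 / 2 * a y + 1 / 2 * (h y * sphere_kernel (norm x) (norm y))) \<in> borel_measurable lborel"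
    by measurable
  have m2: "(\<lambda>y. a y * (1 / 2 + shell (norm y / norm x))) \<in> borel_measurable lborel"
    unfolding shell_def sphere_log_def by measurable
  have ae: "AE y in lborel. 1 / 2 * a y + 1 / 2 * (h y * sphere_kernel (norm x) (norm y)) = a y * (1 / 2 + shell (norm y / norm x))"
    using AE_neq_point[of 0]
  proof eventually_elim
    case (elim y)
    then have "shell (norm y / norm x) = ((norm x)\<^sup>2 - (norm y)\<^sup>2) / 2 * sphere_kernel (norm x) (norm y)"
      using x by (intro shell_eq_sphere_kernel) auto
    then show ?case by (simp add: h_def distrib_left)
  qed
  show ?thesis by (rule has_bochner_integral_cong_AE[OF m1 m2 ae, THEN iffD1, OF H])
qed

lemma virial_eq: "weight a \<Longrightarrow> x \<noteq> 0 \<Longrightarrow> virial a (norm x) = - (pot_grad a x \<bullet> x)"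
  unfolding virial_def by (rule has_bochner_integral_integral_eq[OF has_bochner_integral_virial])

lemma virial_integrable:
  assumes "weight a" "0 < r"
  shows "integrable lborel (\<lambda>y. a y * (1 / 2 + shell (norm y / r)))"
proof -
  have "norm (r *\<^sub>R axis 1 1 :: real^3) = r" "r *\<^sub>R axis 1 1 \<noteq> (0 :: real^3)"
    using assms by (simp_all add: norm_axis_1)
  then show ?thesis
    using integrable.intros[OF has_bochner_integral_virial[OF assms(1), of "r *\<^sub>R axis 1 1"]] by simp
qed

lemma virial_nonneg:
  assumes "weight a" "0 < r" shows "0 \<le> virial a r"
  unfolding virial_def
proof (rule integral_nonneg_AE)
  show "AE y in lborel. 0 \<le> a y * (1 / 2 + shell (norm y / r))"
    using AE_neq_point[of 0]
  proof eventually_elim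
    case (elim y)
    then have "- 1 / 2 \<le> shell (norm y / r)" using assms by (intro shell_ge_minus_half) auto
    then show ?case using assms by (auto simp: weight_def)
  qed
qed

text \<open>The likelihood ratio order.\<close>

definition less_concentrated :: "(real^3 \<Rightarrow> real) \<Rightarrow> (real^3 \<Rightarrow> real) \<Rightarrow> bool" where
  "less_concentrated a' a \<longleftrightarrow> (\<forall>x y. norm x \<le> norm y \<longrightarrow> a' x * a y \<le> a x * a' y)"

text \<open>Chebyshev's correlation inequality: the ratio a' / a grows with the radius while the
  kernel h decreases, so the product of a' x * a y - a x * a' y with h x - h y is nonpositive for
  every pair. Integrating over both variables gives twice the claim.\<close>

lemma virial_antimono:
  assumes a: "weight a" and a': "weight a'" and le: "less_concentrated a' a" and r: "0 < r"
  shows "virial a' r * (LINT x|lborel. a x) \<le> virial a r * (LINT x|lborel. a' x)"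
proof -
  define h where "h y = 1 / 2 + shell (norm y / r)" for y :: "real^3"
  have v: "virial a r = (LINT y|lborel. a y * h y)" "virial a' r = (LINT y|lborel. a' y * h y)"
    by (simp_all only: virial_def h_def)
  have i: "integrable lborel a" "integrable lborel a'"
    "integrable lborel (\<lambda>y. a y * h y)" "integrable lborel (\<lambda>y. a' y * h y)"
    using a a' virial_integrable[OF _ r] by (auto simp: weight_def h_def decays_integrable)
  have hm: "h y \<le> h x" if "x \<noteq> 0" "norm x \<le> norm y" for x y
    using that r by (auto simp: h_def intro!: shell_antimono divide_right_mono)
  have pt: "(a' x * a y - a x * a' y) * (h x - h y) \<le> 0" if "x \<noteq> 0" "y \<noteq> 0" for x y
  proof (cases "norm x \<le> norm y")
    case True
    then have "a' x * a y - a x * a' y \<le> 0" "0 \<le> h x - h y" using le hm that by (auto simp: less_concentrated_def)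
    then show ?thesis by (rule mult_nonpos_nonneg)
  next
    case False
    then have "a' y * a x \<le> a y * a' x" "h x \<le> h y" using le hm[of y x] that by (auto simp: less_concentrated_def)
    then have "0 \<le> a' x * a y - a x * a' y" "h x - h y \<le> 0" by (simp_all add: mult.commute)
    then show ?thesis by (rule mult_nonneg_nonpos)
  qed
  let ?A = "LINT x|lborel. a x" and ?A' = "LINT x|lborel. a' x"
  let ?B = "LINT x|lborel. a x * h x" and ?B' = "LINT x|lborel. a' x * h x"
  \<comment> \<open>The integral over y is taken first with x fixed, so only single integrals of a,
    a' and of their products with h occur.\<close>
  have inner: "(a' x * h x) * ?A - a' x * ?B - (a x * h x) * ?A' + a x * ?B' \<le> 0" if x: "x \<noteq> 0" for x
  proof -
    have "(a' x * h x) * ?A - a' x * ?B - (a x * h x) * ?A' + a x * ?B' =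
      (LINT y|lborel. (a' x * h x) * a y - a' x * (a y * h y) - (a x * h x) * a' y + a x * (a' y * h y))"
      using i by simp
    also have "\<dots> \<le> (LINT y::real^3|lborel. 0)"
    proof (rule integral_mono_AE)
      show "AE y in lborel. (a' x * h x) * a y - a' x * (a y * h y) - (a x * h x) * a' y + a x * (a' y * h y) \<le> 0"
        using AE_neq_point[of 0]
      proof eventually_elim
        case (elim y)
        have "(a' x * h x) * a y - a' x * (a y * h y) - (a x * h x) * a' y + a x * (a' y * h y) = (a' x * a y - a x * a' y) * (h x - h y)"
          by algebra
        then show ?case using pt[OF x elim] by simp
      qed
    qed (use i in auto)
    finally show ?thesis by simp
  qed
  have "(LINT x|lborel. (a' x * h x) * ?A - a' x * ?B - (a x * h x) * ?A' + a x * ?B') =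
    ?B' * ?A - ?A' * ?B - ?B * ?A' + ?A * ?B'"
    using i by simp
  then have "2 * (?B' * ?A - ?B * ?A') = (LINT x|lborel. (a' x * h x) * ?A - a' x * ?B - (a x * h x) * ?A' + a x * ?B')"
  proof -
    have "2 * (B' * A - B * A') = L" if "L = B' * A - A' * B - B * A' + A * B'" for A A' B B' L :: real
      using that by (simp add: algebra_simps)
    then show ?thesis using \<open>_ = ?B' * ?A - ?A' * ?B - ?B * ?A' + ?A * ?B'\<close> .
  qed
  also have "\<dots> \<le> (LINT x::real^3|lborel. 0)"
  proof (rule integral_mono_AE)
    show "AE x in lborel. (a' x * h x) * ?A - a' x * ?B - (a x * h x) * ?A' + a x * ?B' \<le> 0"
      using AE_neq_point[of 0] by eventually_elim (rule inner)
  qed (use i in auto)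
  finally have "2 * (?B' * ?A - ?B * ?A') \<le> 0" unfolding Bochner_Integration.integral_zero .
  moreover have "X \<le> Y" if "2 * (X - Y) \<le> 0" for X Y :: real using that by simp
  ultimately show ?thesis unfolding v by blast
qed

lemma pot_radial:
  assumes "weight a" shows "radial (pot a)"
  unfolding radial_def
proof (intro allI impI)
  fix x z :: "real^3" assume "norm x = norm z"
  then obtain f where f: "orthogonal_transformation f" "f x = z" by (rule orthogonal_transformation_exists)
  have [measurable]: "a \<in> borel_measurable borel" "log_kernel \<in> borel_measurable borel"
    using assms kernel_class_measurable[OF kernel_class_log_kernel] by (auto simp: weight_def decays_measurable)
  have "pot a z = (LINT y|lborel. a (f y) *\<^sub>R log_kernel (z - f y))"
    unfolding pot_def by (rule integral_orthogonal[OF f(1), symmetric]) measurable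
  also have "\<dots> = pot a x"
    unfolding pot_def
  proof (rule Bochner_Integration.integral_cong[OF refl])
    fix y
    have "norm (z - f y) = norm (f (x - y))" using f by (simp add: linear_diff orthogonal_transformation_linear)
    also have "\<dots> = norm (x - y)" by (rule orthogonal_transformation_norm[OF f(1)])
    finally have "log_kernel (z - f y) = log_kernel (x - y)" by (simp add: log_kernel_def)
    moreover have "a (f y) = a y" using radial_orthogonal[OF _ f(1)] assms by (auto simp: weight_def)
    ultimately show "a (f y) *\<^sub>R log_kernel (z - f y) = a y *\<^sub>R log_kernel (x - y)" by simp
  qed
  finally show "pot a x = pot a z" by simp
qed

lemma virial_measurable:
  assumes "a \<in> borel_measurable borel" shows "virial a \<in> borel_measurable borel"
proof -
  note [measurable] = assms
  have "(\<lambda>(r, y). a y * (1 / 2 + shell (norm y / r))) \<in> borel_measurable (borel \<Otimes>\<^sub>M lborel)"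
    unfolding shell_def sphere_log_def by measurable
  then show ?thesis
    unfolding virial_def[abs_def] by (rule lborel.borel_measurable_lebesgue_integral)
qed

text \<open>The radial derivative - virial a s / s, integrated over s = r1 + t (r2 - r1); t runs
  over the unit interval to match \<open>kernel_conv_FTC\<close>.\<close>

lemma
  assumes a: "weight a" and r: "0 \<le> r1" "r1 < r2" and x: "norm x = r1" "norm z = r2"
  shows pot_ray_integrable: "set_integrable lborel {0..1} (\<lambda>t. (r2 - r1) / (r1 + t * (r2 - r1)) * virial a (r1 + t * (r2 - r1)))"
    and pot_ray: "pot a z - pot a x = - (LINT t:{0..1}|lborel. (r2 - r1) / (r1 + t * (r2 - r1)) * virial a (r1 + t * (r2 - r1)))"
proof -
  let ?e = "axis 1 1 :: real^3"
  let ?w = "\<lambda>t. (r2 - r1) / (r1 + t * (r2 - r1)) * virial a (r1 + t * (r2 - r1))"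
  define v where "v = (r2 - r1) *\<^sub>R ?e"
  have dec: "decays a" using a by (auto simp: weight_def)
  have [measurable]: "virial a \<in> borel_measurable borel" using virial_measurable dec decays_measurable by blast
  have px: "pot a x = pot a (r1 *\<^sub>R ?e)" "pot a z = pot a (r1 *\<^sub>R ?e + v)"
    using x r by (auto intro!: radialD[OF pot_radial[OF a]] simp: v_def simp flip: scaleR_add_left)
  define Q where "Q t = pot_grad a (r1 *\<^sub>R ?e + t *\<^sub>R v) \<bullet> v" for t
  have iQ: "set_integrable lborel {0..1} Q"
    unfolding Q_def pot_grad_def
    by (rule kernel_conv_FTC_integrable[OF kernel_class_log_kernel kernel_class_log_grad log_kernel_has_derivative dec])
  have eq: "pot a z - pot a x = (LINT t:{0..1}|lborel. Q t)"
    unfolding px unfolding Q_def pot_grad_def pot_def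
    by (rule kernel_conv_FTC[OF kernel_class_log_kernel kernel_class_log_grad log_kernel_has_derivative dec])
  have iQ': "integrable lborel (\<lambda>t. - (indicator {0..1} t *\<^sub>R Q t))"
    using iQ by (simp add: set_integrable_def)
  \<comment> \<open>For r1 = 0 the ray starts at the origin, where \<open>virial_eq\<close> does not
    apply, so the point t = 0 is discarded.\<close>
  have ae: "AE t in lborel. - (indicator {0..1} t *\<^sub>R Q t) = indicator {0..1} t *\<^sub>R ?w t"
    using AE_lborel_singleton[of "0::real"]
  proof eventually_elim
    case (elim t)
    show ?case
    proof (cases "t \<in> {0..1}")
      case True
      define s where "s = r1 + t * (r2 - r1)"
      have s: "0 < s" using True elim r by (auto simp: s_def intro!: add_nonneg_pos)
      have "r1 *\<^sub>R ?e + t *\<^sub>R v = s *\<^sub>R ?e" by (simp add: v_def s_def scaleR_add_left)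
      moreover have "virial a s = - (pot_grad a (s *\<^sub>R ?e) \<bullet> (s *\<^sub>R ?e))"
        using virial_eq[OF a, of "s *\<^sub>R ?e"] s by simp
      ultimately have "Q t = - ((r2 - r1) / s * virial a s)"
        using s by (simp add: Q_def v_def)
      then show ?thesis using True by (simp add: s_def)
    qed simp
  qed
  have m: "(\<lambda>t. indicator {0..1} t *\<^sub>R ?w t) \<in> borel_measurable lborel" by measurable
  show "set_integrable lborel {0..1} ?w"
    unfolding set_integrable_def
    using integrable_cong_AE[OF borel_measurable_integrable[OF iQ'] m ae] iQ' by simp
  have "(LINT t:{0..1}|lborel. ?w t) = (LINT t|lborel. - (indicator {0..1} t *\<^sub>R Q t))"
    unfolding set_lebesgue_integral_def
    by (rule integral_cong_AE[OF borel_measurable_integrable[OF iQ'] m ae, symmetric])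
  then show "pot a z - pot a x = - (LINT t:{0..1}|lborel. ?w t)"
    using eq by (simp add: set_lebesgue_integral_def)
qed

subsection \<open>The explicit spherical solution\<close>

definition bubble :: "real^3 \<Rightarrow> real" where
  "bubble y = 1 / (1 + (norm y)\<^sup>2)^3"

definition bubble_log :: "real \<Rightarrow> real \<Rightarrow> real" where
  "bubble_log r p = ln \<bar>(r + sqrt p) / (r - sqrt p)\<bar>"

text \<open>An antiderivative in \<open>p\<close> of \<open>(r\<^sup>2 - p) (1 + p)\<^sup>-\<^sup>3 bubble_log r p\<close>, where \<open>p\<close> stands for \<open>|y|\<^sup>2\<close>.\<close>

definition bubble_prim :: "real \<Rightarrow> real \<Rightarrow> real" where
  "bubble_prim r p = - ((r\<^sup>2 - p)\<^sup>2 / (2 * (1 + p)\<^sup>2 * (1 + r\<^sup>2))) * bubble_log r p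
    + r / (2 * (1 + r\<^sup>2)) * ((r\<^sup>2 - 1) * arctan (sqrt p) + (r\<^sup>2 + 1) * (sqrt p / (1 + p)))"

lemma bubble_log_nonneg: "0 < r \<Longrightarrow> 0 < p \<Longrightarrow> 0 \<le> bubble_log r p"
  unfolding bubble_log_def by (rule ln_ratio_nonneg) auto

text \<open>Squares replace the absolute value, so that one computation of the derivative covers
  both sides of p = r^2.\<close>

lemma bubble_log_eq:
  assumes "0 < r" "0 < p" "p \<noteq> r\<^sup>2"
  shows "bubble_log r p = 1 / 2 * (ln ((r + sqrt p)\<^sup>2) - ln ((r - sqrt p)\<^sup>2))"
proof -
  have ne: "r - sqrt p \<noteq> 0" using assms by auto
  have 1: "ln ((r + sqrt p)\<^sup>2) = 2 * ln (r + sqrt p)" by (simp only: ln_realpow of_nat_numeral)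
  have 2: "ln ((r - sqrt p)\<^sup>2) = 2 * ln \<bar>r - sqrt p\<bar>"
    using ln_realpow[of "\<bar>r - sqrt p\<bar>" 2] by (simp only: power2_abs of_nat_numeral)
  have "bubble_log r p = ln (r + sqrt p) - ln \<bar>r - sqrt p\<bar>"
    using assms ne add_pos_pos[OF assms(1) real_sqrt_gt_zero[OF assms(2)]]
    by (simp add: bubble_log_def abs_divide ln_div)
  then show ?thesis unfolding 1 2 by simp
qed

lemma bubble_log_deriv:
  assumes r: "0 < r" and p: "0 < p" "p \<noteq> r\<^sup>2"
  shows "(bubble_log r has_real_derivative r / (sqrt p * (r\<^sup>2 - p))) (at p)"
proof -
  define s where "s = sqrt p"
  have s: "0 < s" "p = s\<^sup>2" "sqrt p = s" "s \<noteq> r" using p by (auto simp: s_def)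
  have d1: "(sqrt has_real_derivative inverse s / 2) (at p)"
    using DERIV_real_sqrt[OF p(1)] by (simp add: s(3))
  have ds: "((\<lambda>p. (r + sqrt p)\<^sup>2) has_real_derivative 2 * (r + s) * (inverse s / 2)) (at p)"
           "((\<lambda>p. (r - sqrt p)\<^sup>2) has_real_derivative 2 * (r - s) * - (inverse s / 2)) (at p)"
    using DERIV_power[OF DERIV_add[OF DERIV_const[of r] d1], of 2] DERIV_power[OF DERIV_diff[OF DERIV_const[of r] d1], of 2]
    by (simp_all add: s(3) mult_ac)
  have pos: "0 < (r + sqrt p)\<^sup>2" "0 < (r - sqrt p)\<^sup>2" using s r by (auto simp: add_pos_pos)
  have n: "r + s \<noteq> 0" "r - s \<noteq> 0" "s \<noteq> 0" "r\<^sup>2 - p \<noteq> 0" using s r p by auto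
  have "((\<lambda>p. 1 / 2 * (ln ((r + sqrt p)\<^sup>2) - ln ((r - sqrt p)\<^sup>2))) has_real_derivative
     1 / 2 * (1 / (r + sqrt p)\<^sup>2 * (2 * (r + s) * (inverse s / 2)) - 1 / (r - sqrt p)\<^sup>2 * (2 * (r - s) * - (inverse s / 2)))) (at p)"
    by (intro DERIV_cmult DERIV_diff DERIV_chain2[OF DERIV_ln_divide[OF pos(1)] ds(1)] DERIV_chain2[OF DERIV_ln_divide[OF pos(2)] ds(2)])
  moreover have "1 / 2 * (1 / (r + sqrt p)\<^sup>2 * (2 * (r + s) * (inverse s / 2)) - 1 / (r - sqrt p)\<^sup>2 * (2 * (r - s) * - (inverse s / 2)))
    = r / (sqrt p * (r\<^sup>2 - p))"
  proof -
    \<comment> \<open>With the reciprocals as unknowns the identity between fractions becomes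
      polynomial.\<close>
    define u v w where "u = 1 / (r + s)" and "v = 1 / (r - s)" and "w = 1 / s"
    have uvw: "u * (r + s) = 1" "v * (r - s) = 1" "w * s = 1" using n by (auto simp: u_def v_def w_def)
    have e: "1 / (r + s)\<^sup>2 = u\<^sup>2" "1 / (r - s)\<^sup>2 = v\<^sup>2" "inverse s / 2 = w / 2"
      by (simp_all add: u_def v_def w_def power_one_over inverse_eq_divide)
    have "r / (s * (r\<^sup>2 - p)) = r * w * u * v"
    proof -
      have "s * (r\<^sup>2 - p) \<noteq> 0" using n by simp
      moreover have "r * w * u * v * (s * (r\<^sup>2 - s\<^sup>2)) = r * (w * s) * (u * (r + s)) * (v * (r - s))"
        by (simp add: algebra_simps power2_eq_square)
      then have "r * w * u * v * (s * (r\<^sup>2 - p)) = r" unfolding s(2)[symmetric] uvw by simp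
      ultimately show ?thesis by (metis nonzero_eq_divide_eq)
    qed
    moreover have "1 / 2 * (u\<^sup>2 * (2 * (r + s) * (w / 2)) - v\<^sup>2 * (2 * (r - s) * - (w / 2))) = r * w * u * v"
    proof -
      have "u\<^sup>2 * (r + s) = u * (u * (r + s))" "v\<^sup>2 * (r - s) = v * (v * (r - s))"
        "u * (v * (r - s)) + v * (u * (r + s)) = 2 * r * u * v"
        by (simp_all add: algebra_simps power2_eq_square)
      then have "u\<^sup>2 * (r + s) = u" "v\<^sup>2 * (r - s) = v" "u + v = 2 * r * u * v" unfolding uvw by simp_all
      have "1 / 2 * (u\<^sup>2 * (2 * (r + s) * (w / 2)) - v\<^sup>2 * (2 * (r - s) * - (w / 2))) =
        1 / 2 * ((u\<^sup>2 * (r + s) + v\<^sup>2 * (r - s)) * w)"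
        by (simp add: algebra_simps)
      also have "\<dots> = 1 / 2 * ((2 * r * u * v) * w)"
        by (simp only: \<open>u\<^sup>2 * (r + s) = u\<close> \<open>v\<^sup>2 * (r - s) = v\<close> \<open>u + v = 2 * r * u * v\<close>)
      finally show ?thesis by simp
    qed
    ultimately show ?thesis unfolding s(3) e by simp
  qed
  ultimately have D: "((\<lambda>p. 1 / 2 * (ln ((r + sqrt p)\<^sup>2) - ln ((r - sqrt p)\<^sup>2))) has_real_derivative r / (sqrt p * (r\<^sup>2 - p))) (at p)"
    by simp
  show ?thesis
  proof (rule has_field_derivative_transform_within_open[OF D])
    show "open ({0<..} - {r\<^sup>2})" "p \<in> {0<..} - {r\<^sup>2}" using p by auto
    show "1 / 2 * (ln ((r + sqrt p)\<^sup>2) - ln ((r - sqrt p)\<^sup>2)) = bubble_log r p" if "p \<in> {0<..} - {r\<^sup>2}" for p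
      using bubble_log_eq[of r p] r that by simp
  qed
qed

text \<open>Integration by parts: among the primitives of (r^2 - p) / (1 + p)^3, the one with a
  double zero at p = r^2 multiplies the logarithm. The remaining integrand r (r^2 - p) / (2 (1 +
  r^2) (1 + p)^2 sqrt p) is algebraic and has the second summand as its primitive.\<close>

lemma bubble_prim_deriv:
  assumes r: "0 < r" and p: "0 < p" "p \<noteq> r\<^sup>2"
  shows "(bubble_prim r has_real_derivative (r\<^sup>2 - p) / (1 + p)^3 * bubble_log r p) (at p)"
proof -
  define s where "s = sqrt p"
  have s: "0 < s" "p = s\<^sup>2" "sqrt p = s" "s \<noteq> r" using p by (auto simp: s_def)
  have n: "s \<noteq> 0" "r\<^sup>2 - p \<noteq> 0" "1 + p \<noteq> 0" "1 + r\<^sup>2 \<noteq> 0" "2 * (1 + p)\<^sup>2 * (1 + r\<^sup>2) \<noteq> 0"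
    using s r p by (auto simp: add_nonneg_eq_0_iff)
  have d1: "(sqrt has_real_derivative inverse s / 2) (at p)"
    using DERIV_real_sqrt[OF p(1)] by (simp add: s(3))
  define c where "c = (1 + r\<^sup>2)"
  define w where "w = 1 / s"
  define q where "q = 1 / (1 + p)"
  have cw: "c \<noteq> 0" "w * s = 1" "q * (1 + p) = 1" using n by (auto simp: c_def w_def q_def)
  have dA: "((\<lambda>p. (r\<^sup>2 - p)\<^sup>2 / (2 * (1 + p)\<^sup>2 * (1 + r\<^sup>2))) has_real_derivative - ((r\<^sup>2 - p) / (1 + p)^3)) (at p)"
  proof -
    have e: "((\<lambda>p. (r\<^sup>2 - p)\<^sup>2) has_real_derivative - (2 * (r\<^sup>2 - p))) (at p)"
      "((\<lambda>p. 2 * (1 + p)\<^sup>2 * (1 + r\<^sup>2)) has_real_derivative 4 * (1 + p) * (1 + r\<^sup>2)) (at p)"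
      by (auto intro!: derivative_eq_intros)
    show ?thesis
    proof (rule DERIV_cong[OF DERIV_divide[OF e n(5)]])
      have "(- (2 * (r\<^sup>2 - p)) * (2 * (1 + p)\<^sup>2 * c) - (r\<^sup>2 - p)\<^sup>2 * (4 * (1 + p) * c)) / (2 * (1 + p)\<^sup>2 * c * (2 * (1 + p)\<^sup>2 * c))
        = - ((r\<^sup>2 - p) / (1 + p)^3)"
      proof -
        have X: "2 * (1 + p)\<^sup>2 * c * (2 * (1 + p)\<^sup>2 * c) \<noteq> 0" "(1 + p)^3 \<noteq> 0" using n cw by auto
        have "- (2 * (r\<^sup>2 - p)) * (2 * (1 + p)\<^sup>2 * c) - (r\<^sup>2 - p)\<^sup>2 * (4 * (1 + p) * c) = - (4 * (r\<^sup>2 - p) * (1 + p) * c * c)"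
          unfolding c_def by algebra
        moreover have "- (4 * (r\<^sup>2 - p) * (1 + p) * c * c) * (1 + p)^3 = - (r\<^sup>2 - p) * (2 * (1 + p)\<^sup>2 * c * (2 * (1 + p)\<^sup>2 * c))"
          by algebra
        ultimately show ?thesis unfolding minus_divide_left using X by (simp only: frac_eq_eq not_False_eq_True)
      qed
      then show "(- (2 * (r\<^sup>2 - p)) * (2 * (1 + p)\<^sup>2 * (1 + r\<^sup>2)) - (r\<^sup>2 - p)\<^sup>2 * (4 * (1 + p) * (1 + r\<^sup>2))) / (2 * (1 + p)\<^sup>2 * (1 + r\<^sup>2) * (2 * (1 + p)\<^sup>2 * (1 + r\<^sup>2)))
        = - ((r\<^sup>2 - p) / (1 + p)^3)" unfolding c_def .
    qed
  qed
  have dB: "((\<lambda>p. (r\<^sup>2 - 1) * arctan (sqrt p) + (r\<^sup>2 + 1) * (sqrt p / (1 + p))) has_real_derivative (r\<^sup>2 - p) * w * q\<^sup>2) (at p)"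
  proof -
    have d2: "((\<lambda>p. arctan (sqrt p)) has_real_derivative inverse (1 + (sqrt p)\<^sup>2) * (inverse s / 2)) (at p)"
      by (rule DERIV_chain2[OF DERIV_arctan d1])
    have d3: "((\<lambda>p. 1 + p) has_real_derivative 1) (at p)" by (auto intro!: derivative_eq_intros)
    show ?thesis
    proof (rule DERIV_cong[OF DERIV_add[OF DERIV_cmult[OF d2] DERIV_cmult[OF DERIV_divide[OF d1 d3 n(3)]]]])
      have e: "inverse (1 + (sqrt p)\<^sup>2) = q" "inverse s / 2 = w / 2" "X / ((1 + p) * (1 + p)) = X * q\<^sup>2" for X
        using p(1) by (simp_all add: q_def w_def inverse_eq_divide power2_eq_square)
      have "(r\<^sup>2 - 1) * (q * (w / 2)) + (r\<^sup>2 + 1) * ((w / 2 * (1 + p) - s * 1) * q\<^sup>2) = (r\<^sup>2 - p) * w * q\<^sup>2"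
      proof -
        have "(r\<^sup>2 - 1) * (q * w) + (r\<^sup>2 + 1) * ((w * (1 + p) - 2 * s) * q\<^sup>2) = 2 * (r\<^sup>2 - p) * w * q\<^sup>2"
        proof -
          have "s = w * p" using cw(2) by (simp add: s(2) power2_eq_square mult.assoc[symmetric])
          then have 1: "w * (1 + p) - 2 * s = w * (1 - p)" by (simp add: algebra_simps)
          have "q\<^sup>2 * (1 + p) = q * (q * (1 + p))" by (simp only: power2_eq_square mult.assoc)
          then have 2: "q = q\<^sup>2 * (1 + p)" unfolding cw by simp
          have "(r\<^sup>2 - 1) * (q\<^sup>2 * (1 + p) * w) + (r\<^sup>2 + 1) * (w * (1 - p) * q\<^sup>2) = 2 * (r\<^sup>2 - p) * w * q\<^sup>2"
            by (simp add: algebra_simps)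
          then show ?thesis unfolding 1 2[symmetric] .
        qed
        then show ?thesis by (simp add: field_simps)
      qed
      then show "(r\<^sup>2 - 1) * (inverse (1 + (sqrt p)\<^sup>2) * (inverse s / 2)) + (r\<^sup>2 + 1) * ((inverse s / 2 * (1 + p) - sqrt p * 1) / ((1 + p) * (1 + p)))
        = (r\<^sup>2 - p) * w * q\<^sup>2" unfolding e unfolding s(3) .
    qed
  qed
  have "(bubble_prim r has_real_derivative
     (- (- ((r\<^sup>2 - p) / (1 + p)^3)) * bubble_log r p + r / (sqrt p * (r\<^sup>2 - p)) * - ((r\<^sup>2 - p)\<^sup>2 / (2 * (1 + p)\<^sup>2 * (1 + r\<^sup>2))))
       + r / (2 * (1 + r\<^sup>2)) * ((r\<^sup>2 - p) * w * q\<^sup>2)) (at p)"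
    unfolding bubble_prim_def[abs_def]
    by (intro DERIV_add DERIV_mult DERIV_minus dA bubble_log_deriv[OF assms] DERIV_cmult dB)
  moreover have "r / (sqrt p * (r\<^sup>2 - p)) * - ((r\<^sup>2 - p)\<^sup>2 / (2 * (1 + p)\<^sup>2 * (1 + r\<^sup>2))) + r / (2 * (1 + r\<^sup>2)) * ((r\<^sup>2 - p) * w * q\<^sup>2) = 0"
  proof -
    have "r / (s * X) * - (X\<^sup>2 / (2 * Y\<^sup>2 * c)) + r / (2 * c) * (X * (1 / s) * (1 / Y)\<^sup>2) = 0"
      if "X \<noteq> 0" "Y \<noteq> 0" for X Y
      using that n(1) cw(1) by (simp add: power2_eq_square)
    from this[of "r\<^sup>2 - p" "1 + p"] show ?thesis using n unfolding s(3) w_def q_def c_def by blast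
  qed
  ultimately show ?thesis by (simp add: add.assoc)
qed

text \<open>The double zero of the coefficient at p = r^2 absorbs the logarithmic singularity, so
  the primitive passes through the crossing |y| = r without a jump.\<close>

lemma bubble_prim_limits:
  assumes r: "0 < r"
  shows "(bubble_prim r \<longlongrightarrow> 0) (at_right 0)"
    and "(bubble_prim r \<longlongrightarrow> bubble_prim r (r\<^sup>2)) (at (r\<^sup>2))"
    and "(bubble_prim r \<longlongrightarrow> r / (2 * (1 + r\<^sup>2)) * ((r\<^sup>2 - 1) * (pi / 2))) at_top"
proof -
  have n: "1 + r\<^sup>2 \<noteq> 0" by (auto simp: add_nonneg_eq_0_iff)
  have "(bubble_prim r \<longlongrightarrow> - ((r\<^sup>2 - 0)\<^sup>2 / (2 * (1 + 0)\<^sup>2 * (1 + r\<^sup>2))) * ln \<bar>(r + sqrt 0) / (r - sqrt 0)\<bar>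
    + r / (2 * (1 + r\<^sup>2)) * ((r\<^sup>2 - 1) * arctan (sqrt 0) + (r\<^sup>2 + 1) * (sqrt 0 / (1 + 0)))) (at_right 0)"
    unfolding bubble_prim_def[abs_def] bubble_log_def
    by (intro tendsto_intros) (use r n in auto)
  then show "(bubble_prim r \<longlongrightarrow> 0) (at_right 0)" using r by simp
  have ln_le: "bubble_log r p \<le> (r + sqrt p) / \<bar>r - sqrt p\<bar>" if "0 < p" for p
  proof -
    have pp: "0 < r + sqrt p" using r that by (simp add: add_pos_pos)
    have "ln \<bar>(r + sqrt p) / (r - sqrt p)\<bar> \<le> \<bar>(r + sqrt p) / (r - sqrt p)\<bar>"
    proof (cases "r = sqrt p")
      case False
      then have "0 < \<bar>(r + sqrt p) / (r - sqrt p)\<bar>" using pp by simp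
      from ln_le_minus_one[OF this] show ?thesis by linarith
    qed simp
    then show ?thesis using r that by (simp add: bubble_log_def abs_divide add_pos_pos)
  qed
  \<comment> \<open>The crude bound ln t <= t replaces the logarithm by a simple pole in r - sqrt p,
    which the double zero outweighs.\<close>
  have sq: "((\<lambda>p. (r\<^sup>2 - p)\<^sup>2 * bubble_log r p) \<longlongrightarrow> 0) (at (r\<^sup>2))"
  proof (rule tendsto_sandwich[where f="\<lambda>_. 0" and h="\<lambda>p. \<bar>r - sqrt p\<bar> * (r + sqrt p)^3"])
    have ev: "\<forall>\<^sub>F p in at (r\<^sup>2). 0 < p"
      using r by (intro order_tendstoD(1)[OF tendsto_ident_at]) auto
    show "\<forall>\<^sub>F p in at (r\<^sup>2). 0 \<le> (r\<^sup>2 - p)\<^sup>2 * bubble_log r p"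
      using ev by eventually_elim (use r bubble_log_nonneg in auto)
    show "\<forall>\<^sub>F p in at (r\<^sup>2). (r\<^sup>2 - p)\<^sup>2 * bubble_log r p \<le> \<bar>r - sqrt p\<bar> * (r + sqrt p)^3"
      using ev
    proof eventually_elim
      case (elim p)
      have e: "(r\<^sup>2 - p)\<^sup>2 = \<bar>r - sqrt p\<bar> * \<bar>r - sqrt p\<bar> * (r + sqrt p)\<^sup>2"
      proof -
        have "r\<^sup>2 - p = (r - sqrt p) * (r + sqrt p)"
          using elim by (simp add: algebra_simps power2_eq_square)
        then show ?thesis by (simp add: power_mult_distrib power2_eq_square)
      qed
      have "(r\<^sup>2 - p)\<^sup>2 * bubble_log r p \<le> (r\<^sup>2 - p)\<^sup>2 * ((r + sqrt p) / \<bar>r - sqrt p\<bar>)"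
        by (intro mult_left_mono ln_le elim) simp
      also have "\<dots> = \<bar>r - sqrt p\<bar> * ((r + sqrt p)\<^sup>2 * (r + sqrt p))"
      proof -
        have "d * d * Y * (S / d) = d * (Y * S)" for d Y S :: real by simp
        then show ?thesis unfolding e .
      qed
      also have "\<dots> = \<bar>r - sqrt p\<bar> * (r + sqrt p)^3"
        by (simp only: power2_eq_square power3_eq_cube)
      finally show ?case .
    qed
    have "((\<lambda>p. \<bar>r - sqrt p\<bar> * (r + sqrt p)^3) \<longlongrightarrow> \<bar>r - sqrt (r\<^sup>2)\<bar> * (r + sqrt (r\<^sup>2))^3) (at (r\<^sup>2))"
      by (intro tendsto_intros)
    then show "((\<lambda>p. \<bar>r - sqrt p\<bar> * (r + sqrt p)^3) \<longlongrightarrow> 0) (at (r\<^sup>2))" using r by simp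
  qed simp
  have form: "bubble_prim r = (\<lambda>p. - (1 / (2 * (1 + p)\<^sup>2 * (1 + r\<^sup>2))) * ((r\<^sup>2 - p)\<^sup>2 * bubble_log r p)
    + r / (2 * (1 + r\<^sup>2)) * ((r\<^sup>2 - 1) * arctan (sqrt p) + (r\<^sup>2 + 1) * (sqrt p / (1 + p))))"
    unfolding bubble_prim_def[abs_def] by (simp add: fun_eq_iff)
  have "((\<lambda>p. - (1 / (2 * (1 + p)\<^sup>2 * (1 + r\<^sup>2))) * ((r\<^sup>2 - p)\<^sup>2 * bubble_log r p)
    + r / (2 * (1 + r\<^sup>2)) * ((r\<^sup>2 - 1) * arctan (sqrt p) + (r\<^sup>2 + 1) * (sqrt p / (1 + p))))
    \<longlongrightarrow> - (1 / (2 * (1 + r\<^sup>2)\<^sup>2 * (1 + r\<^sup>2))) * 0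
    + r / (2 * (1 + r\<^sup>2)) * ((r\<^sup>2 - 1) * arctan (sqrt (r\<^sup>2)) + (r\<^sup>2 + 1) * (sqrt (r\<^sup>2) / (1 + r\<^sup>2)))) (at (r\<^sup>2))"
    by (intro tendsto_intros sq) (use n in auto)
  then show "(bubble_prim r \<longlongrightarrow> bubble_prim r (r\<^sup>2)) (at (r\<^sup>2))"
    unfolding form[symmetric] by (simp add: bubble_prim_def)
  have log0: "(bubble_log r \<longlongrightarrow> 0) at_top"
  proof -
    have "((\<lambda>p. (r + sqrt p) / (r - sqrt p)) \<longlongrightarrow> -1) at_top" by real_asymp
    then have "((\<lambda>p. ln \<bar>(r + sqrt p) / (r - sqrt p)\<bar>) \<longlongrightarrow> ln \<bar>-1\<bar>) at_top"
      by (intro tendsto_intros) auto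
    then show ?thesis by (simp add: bubble_log_def[abs_def])
  qed
  have c0: "((\<lambda>p. (r\<^sup>2 - p)\<^sup>2 / (2 * (1 + p)\<^sup>2 * (1 + r\<^sup>2))) \<longlongrightarrow> 1 / (2 * (1 + r\<^sup>2))) at_top"
  proof -
    have "((\<lambda>p. (r\<^sup>2 - p)\<^sup>2 / (1 + p)\<^sup>2) \<longlongrightarrow> 1) at_top" by real_asymp
    then have "((\<lambda>p. (r\<^sup>2 - p)\<^sup>2 / (1 + p)\<^sup>2 * (1 / (2 * (1 + r\<^sup>2)))) \<longlongrightarrow> 1 * (1 / (2 * (1 + r\<^sup>2)))) at_top"
      by (intro tendsto_intros)
    moreover have "X / (2 * Y * c) = X / Y * (1 / (2 * c))" for X Y c :: real by simp
    ultimately show ?thesis by (simp only: mult_1_left)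
  qed
  have s0: "((\<lambda>p. sqrt p / (1 + p)) \<longlongrightarrow> 0) at_top" by real_asymp
  have at: "((\<lambda>p. arctan (sqrt p)) \<longlongrightarrow> pi / 2) at_top"
    by (rule filterlim_compose[OF tendsto_arctan_at_top sqrt_at_top])
  have "(bubble_prim r \<longlongrightarrow> - (1 / (2 * (1 + r\<^sup>2))) * 0 + r / (2 * (1 + r\<^sup>2)) * ((r\<^sup>2 - 1) * (pi / 2) + (r\<^sup>2 + 1) * 0)) at_top"
    unfolding bubble_prim_def[abs_def]
    by (intro tendsto_intros c0 log0 at s0)
  then show "(bubble_prim r \<longlongrightarrow> r / (2 * (1 + r\<^sup>2)) * ((r\<^sup>2 - 1) * (pi / 2))) at_top" by simp
qed

text \<open>Supplies the sign of the increment, which is lost when the value of an integral is read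
  as an \<open>ennreal\<close>.\<close>

lemma FTC_nonneg_le:
  fixes f F :: "real \<Rightarrow> real" and a b :: ereal
  assumes "a < b"
    and F: "\<And>x. a < ereal x \<Longrightarrow> ereal x < b \<Longrightarrow> (F has_real_derivative f x) (at x)"
    and f: "\<And>x. a < ereal x \<Longrightarrow> ereal x < b \<Longrightarrow> isCont f x"
    and nn: "\<And>x. a < ereal x \<Longrightarrow> ereal x < b \<Longrightarrow> 0 \<le> f x"
    and A: "((F \<circ> real_of_ereal) \<longlongrightarrow> A) (at_right a)"
    and B: "((F \<circ> real_of_ereal) \<longlongrightarrow> B) (at_left b)"
  shows "A \<le> B"
proof -
  have "(LBINT x=a..b. f x) = B - A"
    using interval_integral_FTC_nonneg[of a b F f A B] assms by auto
  moreover have "0 \<le> (LBINT x=a..b. f x)"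
    unfolding interval_lebesgue_integral_def set_lebesgue_integral_def
    using \<open>a < b\<close> nn by (auto intro!: integral_nonneg_AE simp: indicator_def einterval_def less_imp_le)
  ultimately show ?thesis by simp
qed

lemma bubble_nonneg: "0 \<le> bubble y"
  by (simp add: bubble_def)

lemma bubble_measurable[measurable]: "bubble \<in> borel_measurable borel"
  unfolding bubble_def by measurable

lemma shell_measurable[measurable]: "shell \<in> borel_measurable borel"
  unfolding shell_def sphere_log_def by measurable

lemma has_bochner_integral_bubble: "has_bochner_integral lborel bubble (pi\<^sup>2 / 4)"
  using nn_integral_bubble_mass
  by (intro has_bochner_integral_nn_integral) (auto simp: bubble_def)

lemma shell_bubble_eq:
  assumes "0 < r" "y \<noteq> 0"
  shows "bubble y * shell (norm y / r) = (1 / (1 + (norm y)\<^sup>2)^3) * ((r\<^sup>2 - (norm y)\<^sup>2) / (4 * r * sqrt ((norm y)\<^sup>2)) * bubble_log r ((norm y)\<^sup>2))"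
  using shell_eq_sphere_kernel[of r "norm y"] assms
  by (simp add: bubble_def sphere_kernel_def bubble_log_def)

text \<open>The number c is the sign of r^2 - p on S, hence of \<open>shell\<close>, and makes the
  integrand nonnegative. The factor pi / (2 r) is the density 2 pi sqrt p times the 1 / (4 r sqrt p)
  in \<open>shell\<close>.\<close>

lemma bubble_virial_part:
  fixes S :: "real set"
  assumes r: "0 < r" and c: "c = 1 \<or> c = -1" and S: "S \<in> sets borel" "S \<subseteq> {0<..} - {r\<^sup>2}"
    and nn: "\<And>p. p \<in> S \<Longrightarrow> 0 \<le> c * (r\<^sup>2 - p)"
    and I: "(\<integral>\<^sup>+p. ennreal (c * ((r\<^sup>2 - p) / (1 + p)^3 * bubble_log r p)) * indicator S p \<partial>lborel) = ennreal D" and D: "0 \<le> D"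
  shows "has_bochner_integral lborel (\<lambda>y. bubble y * shell (norm y / r) * indicator S ((norm y)\<^sup>2)) (c * (pi / (2 * r) * D))"
proof -
  note [measurable] = S(1)
  have [measurable]: "bubble_log r \<in> borel_measurable borel" unfolding bubble_log_def by measurable
  define g where "g p = (1 / (1 + p)^3) * (c * (r\<^sup>2 - p) / (4 * r * sqrt p) * bubble_log r p)" for p
  have [measurable]: "g \<in> borel_measurable borel" unfolding g_def by measurable
  have g_nn: "0 \<le> g p" if "p \<in> S" for p
  proof -
    have "0 < p" using that S by auto
    then have "0 \<le> c * (r\<^sup>2 - p) / (4 * r * sqrt p)" using nn[OF that] r by (intro divide_nonneg_pos) auto
    then show ?thesis unfolding g_def using \<open>0 < p\<close> r by (intro mult_nonneg_nonneg bubble_log_nonneg) auto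
  qed
  have g_eq: "c * (bubble y * shell (norm y / r) * indicator S ((norm y)\<^sup>2)) = g ((norm y)\<^sup>2) * indicator S ((norm y)\<^sup>2)" for y
  proof (cases "(norm y)\<^sup>2 \<in> S")
    case True
    then have "y \<noteq> 0" using S by auto
    from shell_bubble_eq[OF r this] show ?thesis using True by (simp add: g_def)
  qed simp
  have "(\<integral>\<^sup>+y. ennreal (c * (bubble y * shell (norm y / r) * indicator S ((norm y)\<^sup>2))) \<partial>lborel) =
    (\<integral>\<^sup>+y. (\<lambda>p. ennreal (g p * indicator S p)) ((norm (y::real^3))\<^sup>2) \<partial>lborel)"
    by (simp only: g_eq)
  also have "\<dots> = (\<integral>\<^sup>+p. ennreal (g p * indicator S p) * ennreal (2 * pi * sqrt p) * indicator {0<..} p \<partial>lborel)"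
    by (rule nn_integral_radial) measurable
  also have "\<dots> = (\<integral>\<^sup>+p. ennreal (pi / (2 * r)) * (ennreal (c * ((r\<^sup>2 - p) / (1 + p)^3 * bubble_log r p)) * indicator S p) \<partial>lborel)"
  proof (intro nn_integral_cong)
    fix p
    show "ennreal (g p * indicator S p) * ennreal (2 * pi * sqrt p) * indicator {0<..} p = ennreal (pi / (2 * r)) * (ennreal (c * ((r\<^sup>2 - p) / (1 + p)^3 * bubble_log r p)) * indicator S p)"
    proof (cases "p \<in> S")
      case True
      then have p: "0 < p" using S by auto
      have "g p * (2 * pi * sqrt p) = pi / (2 * r) * (c * ((r\<^sup>2 - p) / (1 + p)^3 * bubble_log r p))"
      proof -
        have "(1 / Y) * (c * X / (4 * r * s) * L) * (2 * pi * s) = pi / (2 * r) * (c * (X / Y * L))" if "s \<noteq> 0" for X Y s L :: real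
          using that r by (simp add: mult_ac)
        then show ?thesis unfolding g_def using p by (metis real_sqrt_eq_zero_cancel_iff less_irrefl)
      qed
      then have "ennreal (g p) * ennreal (2 * pi * sqrt p) = ennreal (pi / (2 * r)) * ennreal (c * ((r\<^sup>2 - p) / (1 + p)^3 * bubble_log r p))"
        using g_nn[OF True] p r by (simp flip: ennreal_mult')
      then show ?thesis using True p by simp
    qed simp
  qed
  also have "\<dots> = ennreal (pi / (2 * r)) * ennreal D"
    unfolding I[symmetric] by (rule nn_integral_cmult) measurable
  also have "\<dots> = ennreal (pi / (2 * r) * D)" using r by (intro ennreal_mult[symmetric] D divide_nonneg_pos) auto
  finally have nnI: "(\<integral>\<^sup>+y. ennreal (c * (bubble y * shell (norm y / r) * indicator S ((norm y)\<^sup>2))) \<partial>lborel) = ennreal (pi / (2 * r) * D)" .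
  have nn': "0 \<le> c * (bubble y * shell (norm y / r) * indicator S ((norm y)\<^sup>2))" for y
    unfolding g_eq by (auto simp: indicator_def g_nn)
  have "0 \<le> pi / (2 * r) * D" using r D by simp
  then have "has_bochner_integral lborel (\<lambda>y. c * (bubble y * shell (norm y / r) * indicator S ((norm y)\<^sup>2))) (pi / (2 * r) * D)"
    by (intro has_bochner_integral_nn_integral AE_I2 nn' nnI) measurable
  then have "has_bochner_integral lborel (\<lambda>y. c * (c * (bubble y * shell (norm y / r) * indicator S ((norm y)\<^sup>2)))) (c * (pi / (2 * r) * D))"
    by (rule has_bochner_integral_mult_right)
  moreover have "c * (c * z) = z" for z using c by auto
  ultimately show ?thesis by simp
qed

lemma has_bochner_integral_bubble_shell:
  assumes r: "0 < r"
  shows "has_bochner_integral lborel (\<lambda>y. bubble y * shell (norm y / r)) (pi\<^sup>2 / 8 * ((r\<^sup>2 - 1) / (1 + r\<^sup>2)))"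
proof -
  let ?\<phi> = "\<lambda>p. (r\<^sup>2 - p) / (1 + p)^3 * bubble_log r p"
  \<comment> \<open>The value at the crossing |y| = r cancels between the two pieces; only P2, the
    limit at infinity, survives.\<close>
  define P1 where "P1 = bubble_prim r (r\<^sup>2)"
  define P2 where "P2 = r / (2 * (1 + r\<^sup>2)) * ((r\<^sup>2 - 1) * (pi / 2))"
  have r2: "0 < r\<^sup>2" using r by simp
  have lim1: "(bubble_prim r \<longlongrightarrow> P1) (at_left (r\<^sup>2))" "(bubble_prim r \<longlongrightarrow> P1) (at_right (r\<^sup>2))"
    using bubble_prim_limits(2)[OF r] filterlim_at_split unfolding P1_def by blast+
  have cont: "isCont ?\<phi> p" if "0 < p" "p \<noteq> r\<^sup>2" for p
    using that DERIV_isCont[OF bubble_log_deriv[OF r that]] by (intro continuous_intros) auto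
  have nn1: "0 \<le> ?\<phi> p" if "0 < p" "p < r\<^sup>2" for p
    using that r by (intro mult_nonneg_nonneg bubble_log_nonneg divide_nonneg_pos) auto
  have nn2: "0 \<le> - ?\<phi> p" if "r\<^sup>2 < p" for p
  proof -
    have "0 < p" using r2 that by (rule less_trans)
    then have "0 \<le> (p - r\<^sup>2) / (1 + p)^3 * bubble_log r p" using that r by (intro mult_nonneg_nonneg bubble_log_nonneg divide_nonneg_pos) auto
    moreover have "(p - r\<^sup>2) / (1 + p)^3 * bubble_log r p = - ?\<phi> p" by (simp add: minus_divide_left[symmetric] diff_divide_distrib algebra_simps)
    ultimately show ?thesis by simp
  qed
  have d: "(bubble_prim r has_real_derivative ?\<phi> p) (at p)" if "0 < p" "p \<noteq> r\<^sup>2" for p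
    by (rule bubble_prim_deriv[OF r that])
  have I1: "(\<integral>\<^sup>+p. ennreal (?\<phi> p) * indicator {0<..<r\<^sup>2} p \<partial>lborel) = ennreal (P1 - 0)"
    by (rule nn_integral_FTC_Ioo[OF r2]) (use d cont nn1 bubble_prim_limits(1)[OF r] lim1 in auto)
  have P1: "0 \<le> P1"
    by (rule FTC_nonneg_le[of "ereal 0" "ereal (r\<^sup>2)" "bubble_prim r" ?\<phi>])
      (use r2 d cont nn1 bubble_prim_limits(1)[OF r] lim1 in \<open>auto simp: ereal_tendsto_simps zero_ereal_def simp del: ereal_eq_0\<close>)
  have I2: "(\<integral>\<^sup>+p. ennreal (- ?\<phi> p) * indicator {r\<^sup>2<..} p \<partial>lborel) = ennreal (- P2 - - P1)"
  proof (rule nn_integral_FTC_Ioi[of "r\<^sup>2" "\<lambda>p. - bubble_prim r p"])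
    fix p assume "r\<^sup>2 < p"
    then have p: "0 < p" "p \<noteq> r\<^sup>2" using less_trans[OF r2] by auto
    show "((\<lambda>p. - bubble_prim r p) has_real_derivative - ?\<phi> p) (at p)" by (rule DERIV_minus[OF d[OF p]])
    show "isCont (\<lambda>p. - ?\<phi> p) p" by (rule isCont_minus[OF cont[OF p]])
    show "0 \<le> - ?\<phi> p" by (rule nn2) fact
  qed (use tendsto_minus[OF lim1(2)] tendsto_minus[OF bubble_prim_limits(3)[OF r]] in \<open>auto simp: P2_def\<close>)
  have P2: "- P1 \<le> - P2"
  proof (rule FTC_nonneg_le[of "ereal (r\<^sup>2)" \<infinity> "\<lambda>p. - bubble_prim r p" "\<lambda>p. - ?\<phi> p"])
    fix p assume "ereal (r\<^sup>2) < ereal p"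
    then have p: "0 < p" "p \<noteq> r\<^sup>2" "r\<^sup>2 < p" using less_trans[OF r2] by auto
    show "((\<lambda>p. - bubble_prim r p) has_real_derivative - ?\<phi> p) (at p)" by (rule DERIV_minus[OF d[OF p(1,2)]])
    show "isCont (\<lambda>p. - ?\<phi> p) p" by (rule isCont_minus[OF cont[OF p(1,2)]])
    show "0 \<le> - ?\<phi> p" by (rule nn2[OF p(3)])
  qed (use tendsto_minus[OF lim1(2)] tendsto_minus[OF bubble_prim_limits(3)[OF r]] in \<open>auto simp: P2_def ereal_tendsto_simps\<close>)
  have B1: "has_bochner_integral lborel (\<lambda>y. bubble y * shell (norm y / r) * indicator {0<..<r\<^sup>2} ((norm y)\<^sup>2)) (1 * (pi / (2 * r) * P1))"
    by (rule bubble_virial_part[OF r]) (use I1 P1 in auto)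
  have B2: "has_bochner_integral lborel (\<lambda>y. bubble y * shell (norm y / r) * indicator {r\<^sup>2<..} ((norm y)\<^sup>2)) (- 1 * (pi / (2 * r) * (P1 - P2)))"
  proof (rule bubble_virial_part[OF r])
    show "{r\<^sup>2<..} \<subseteq> {0<..} - {r\<^sup>2}" using less_trans[OF r2] by auto
  qed (use I2 P2 in auto)
  have sum: "1 * (pi / (2 * r) * P1) + - 1 * (pi / (2 * r) * (P1 - P2)) = pi\<^sup>2 / 8 * ((r\<^sup>2 - 1) / (1 + r\<^sup>2))"
  proof -
    have "1 * (pi / (2 * r) * P1) + - 1 * (pi / (2 * r) * (P1 - P2)) = pi / (2 * r) * P2" by (simp add: right_diff_distrib)
    also have "\<dots> = pi\<^sup>2 / 8 * ((r\<^sup>2 - 1) / (1 + r\<^sup>2))"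
    proof -
      have "pi / (2 * r) * (r / (2 * c) * (X * (pi / 2))) = pi\<^sup>2 / 8 * (X / c)" for X c :: real
        using r by (simp add: power2_eq_square)
      then show ?thesis unfolding P2_def .
    qed
    finally show ?thesis .
  qed
  have "has_bochner_integral lborel (\<lambda>y. bubble y * shell (norm y / r) * indicator {0<..<r\<^sup>2} ((norm y)\<^sup>2)
      + bubble y * shell (norm y / r) * indicator {r\<^sup>2<..} ((norm y)\<^sup>2)) (pi\<^sup>2 / 8 * ((r\<^sup>2 - 1) / (1 + r\<^sup>2)))" (is "has_bochner_integral lborel ?f _")
    unfolding sum[symmetric] by (rule has_bochner_integral_add[OF B1 B2])
  moreover have "AE y in lborel. ?f y = bubble y * shell (norm y / r)"
    using AE_neq_point[of 0] AE_norm_neq[of r]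
  proof eventually_elim
    case (elim y)
    then have "(norm y)\<^sup>2 \<noteq> r\<^sup>2" using r by (simp add: power2_eq_iff_nonneg)
    then show ?case using elim by (auto simp: indicator_def)
  qed
  moreover have "?f \<in> borel_measurable lborel" "(\<lambda>y. bubble y * shell (norm y / r)) \<in> borel_measurable lborel" by measurable
  ultimately show ?thesis using has_bochner_integral_cong_AE by blast
qed

text \<open>Divided by r and integrated, this says that the potential of \<open>bubble\<close> is -
  (M / 2) ln (1 + |x|^2) up to a constant, where M = pi^2 / 4 is its mass. Hence exp (6 pot / M) is
  a multiple of \<open>bubble\<close>, which solves the fixed-point equation for
  \<open>\<alpha> = 2\<close>, b = 0.\<close>

lemma has_bochner_integral_bubble_virial:
  assumes r: "0 < r"
  shows "has_bochner_integral lborel (\<lambda>y. bubble y * (1 / 2 + shell (norm y / r))) (pi\<^sup>2 / 4 * (r\<^sup>2 / (1 + r\<^sup>2)))"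
proof -
  have "has_bochner_integral lborel (\<lambda>y. bubble y * (1 / 2) + bubble y * shell (norm y / r)) (pi\<^sup>2 / 4 * (1 / 2) + pi\<^sup>2 / 8 * ((r\<^sup>2 - 1) / (1 + r\<^sup>2)))"
    by (intro has_bochner_integral_add has_bochner_integral_bubble_shell r has_bochner_integral_mult_left has_bochner_integral_bubble)
  moreover have "pi\<^sup>2 / 4 * (1 / 2) + pi\<^sup>2 / 8 * ((r\<^sup>2 - 1) / (1 + r\<^sup>2)) = pi\<^sup>2 / 4 * (r\<^sup>2 / (1 + r\<^sup>2))"
  proof -
    have "1 + r\<^sup>2 \<noteq> 0" by (auto simp: add_nonneg_eq_0_iff)
    then have "(r\<^sup>2 - 1) / (1 + r\<^sup>2) = 2 * (r\<^sup>2 / (1 + r\<^sup>2)) - 1"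
      by (simp add: divide_simps)
    moreover have "M / 4 * (1 / 2) + M / 8 * (2 * B - 1) = M / 4 * B" for M B :: real by (simp add: field_simps)
    ultimately show ?thesis by (simp only:)
  qed
  ultimately show ?thesis by (simp add: distrib_left)
qed

subsection \<open>Existence by monotone iteration\<close>

lemma weightD:
  assumes "weight a"
  shows "radial a" "decays a" "\<And>x. 0 \<le> a x" "0 < (LINT x|lborel. a x)" "integrable lborel a" "a \<in> borel_measurable borel"
  using assms unfolding weight_def by (blast intro: decays_integrable decays_measurable)+

section \<open>Comparison of potentials along rays\<close>

lemma pot_antimono:
  assumes a: "weight a" and le: "norm x \<le> norm z"
  shows "pot a z \<le> pot a x"
proof (cases "norm x = norm z")
  case True then show ?thesis using radialD[OF pot_radial[OF a] True] by simp
next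
  case False
  then have lt: "norm x < norm z" using le by simp
  have "0 \<le> (LINT t:{0..1}|lborel. (norm z - norm x) / (norm x + t * (norm z - norm x)) * virial a (norm x + t * (norm z - norm x)))"
    unfolding set_lebesgue_integral_def
  proof (rule integral_nonneg_AE)
    show "AE t in lborel. 0 \<le> indicator {0..1} t *\<^sub>R ((norm z - norm x) / (norm x + t * (norm z - norm x)) * virial a (norm x + t * (norm z - norm x)))"
      using AE_lborel_singleton[of "0::real"]
    proof eventually_elim
      case (elim t)
      show ?case
      proof (cases "t \<in> {0..1}")
        case True
        then have "0 < norm x + t * (norm z - norm x)" using elim lt by (intro add_nonneg_pos) auto
        then show ?thesis using lt virial_nonneg[OF a] True by simp
      qed simp
    qed
  qed
  then show ?thesis using pot_ray[OF a norm_ge_zero lt refl refl] by simp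
qed

lemma pot_compare:
  assumes a: "weight a" and a': "weight a'" and le: "norm x \<le> norm z"
    and v: "\<And>s. 0 < s \<Longrightarrow> virial a' s * (LINT x|lborel. a x) \<le> virial a s * (LINT x|lborel. a' x)"
  shows "(pot a z - pot a x) / (LINT x|lborel. a x) \<le> (pot a' z - pot a' x) / (LINT x|lborel. a' x)"
proof (cases "norm x = norm z")
  case True then show ?thesis using radialD[OF pot_radial[OF a] True] radialD[OF pot_radial[OF a'] True] by simp
next
  case False
  then have lt: "norm x < norm z" using le by simp
  let ?A = "LINT x|lborel. a x" and ?A' = "LINT x|lborel. a' x"
  let ?s = "\<lambda>t. norm x + t * (norm z - norm x)"
  note A = weightD(4)[OF a] weightD(4)[OF a']
  note I = pot_ray_integrable[OF a norm_ge_zero lt refl refl] pot_ray_integrable[OF a' norm_ge_zero lt refl refl]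
  have "(LINT t:{0..1}|lborel. ?A * ((norm z - norm x) / ?s t * virial a' (?s t))) \<le> (LINT t:{0..1}|lborel. ?A' * ((norm z - norm x) / ?s t * virial a (?s t)))"
    unfolding set_lebesgue_integral_def
  proof (rule integral_mono_AE)
    show "integrable lborel (\<lambda>t. indicator {0..1} t *\<^sub>R (?A * ((norm z - norm x) / ?s t * virial a' (?s t))))"
      "integrable lborel (\<lambda>t. indicator {0..1} t *\<^sub>R (?A' * ((norm z - norm x) / ?s t * virial a (?s t))))"
      using set_integrable_mult_right[OF I(2), of ?A] set_integrable_mult_right[OF I(1), of ?A'] by (auto simp: set_integrable_def)
    show "AE t in lborel. indicator {0..1} t *\<^sub>R (?A * ((norm z - norm x) / ?s t * virial a' (?s t))) \<le> indicator {0..1} t *\<^sub>R (?A' * ((norm z - norm x) / ?s t * virial a (?s t)))"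
      using AE_lborel_singleton[of "0::real"]
    proof eventually_elim
      case (elim t)
      show ?case
      proof (cases "t \<in> {0..1}")
        case True
        then have s: "0 < ?s t" using elim lt by (intro add_nonneg_pos) auto
        have "0 \<le> (norm z - norm x) / ?s t" using s lt by simp
        from mult_left_mono[OF v[OF s] this]
        have "?A * ((norm z - norm x) / ?s t * virial a' (?s t)) \<le> ?A' * ((norm z - norm x) / ?s t * virial a (?s t))"
          by (simp only: mult.commute mult.left_commute)
        then show ?thesis using True by simp
      qed simp
    qed
  qed
  then have "?A * (LINT t:{0..1}|lborel. (norm z - norm x) / ?s t * virial a' (?s t)) \<le> ?A' * (LINT t:{0..1}|lborel. (norm z - norm x) / ?s t * virial a (?s t))"
    by (simp only: set_integral_mult_right)
  then have "?A' * (pot a z - pot a x) \<le> ?A * (pot a' z - pot a' x)"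
    unfolding pot_ray[OF a norm_ge_zero lt refl refl] pot_ray[OF a' norm_ge_zero lt refl refl] by simp
  then show ?thesis using A by (simp add: divide_le_eq pos_le_divide_eq mult.commute)
qed

text \<open>The bound on the virial is a multiple of that of \<open>bubble\<close>, and c s / (1 +
  s^2) has the primitive (c / 2) ln (1 + s^2).\<close>

lemma pot_lower_bubble:
  assumes a: "weight a" and le: "norm x \<le> norm z"
    and v: "\<And>s. 0 < s \<Longrightarrow> virial a s \<le> c * (s\<^sup>2 / (1 + s\<^sup>2))"
  shows "- (c / 2) * (ln (1 + (norm z)\<^sup>2) - ln (1 + (norm x)\<^sup>2)) \<le> pot a z - pot a x"
proof (cases "norm x = norm z")
  case True then show ?thesis using radialD[OF pot_radial[OF a] True] by simp
next
  case False
  then have lt: "norm x < norm z" using le by simp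
  let ?s = "\<lambda>t. norm x + t * (norm z - norm x)"
  let ?q = "\<lambda>t. (norm z - norm x) * (c * ?s t / (1 + (?s t)\<^sup>2))"
  note I = pot_ray_integrable[OF a norm_ge_zero lt refl refl]
  have n: "1 + (?s t)\<^sup>2 \<noteq> 0" "0 < 1 + (?s t)\<^sup>2" for t
    by (auto simp: add_nonneg_eq_0_iff intro: add_pos_nonneg)
  have F: "has_bochner_integral lborel (\<lambda>t. ?q t * indicator {0..1} t) (c / 2 * ln (1 + (?s 1)\<^sup>2) - c / 2 * ln (1 + (?s 0)\<^sup>2))"
  proof (rule has_bochner_integral_FTC_Icc_real)
    fix t :: real
    have d: "((\<lambda>t. 1 + (?s t)\<^sup>2) has_real_derivative 2 * ?s t * (norm z - norm x)) (at t)"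
      by (auto intro!: derivative_eq_intros)
    have "((\<lambda>t. c / 2 * ln (1 + (?s t)\<^sup>2)) has_real_derivative c / 2 * (1 / (1 + (?s t)\<^sup>2) * (2 * ?s t * (norm z - norm x)))) (at t)"
      by (rule DERIV_cmult[OF DERIV_chain2[OF DERIV_ln_divide[OF n(2)] d]])
    moreover have "c / 2 * (1 / Y * (2 * S * D)) = D * (c * S / Y)" for Y S D :: real by simp
    ultimately show "((\<lambda>t. c / 2 * ln (1 + (?s t)\<^sup>2)) has_real_derivative ?q t) (at t)" by (simp only:)
    show "isCont ?q t" using n by (intro continuous_intros) auto
  qed simp
  have "(LINT t:{0..1}|lborel. (norm z - norm x) / ?s t * virial a (?s t)) \<le> (LINT t|lborel. ?q t * indicator {0..1} t)"
    unfolding set_lebesgue_integral_def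
  proof (rule integral_mono_AE)
    show "integrable lborel (\<lambda>t. indicator {0..1} t *\<^sub>R ((norm z - norm x) / ?s t * virial a (?s t)))"
      using I by (simp add: set_integrable_def)
    show "integrable lborel (\<lambda>t. ?q t * indicator {0..1} t)" using F by (rule integrable.intros)
    show "AE t in lborel. indicator {0..1} t *\<^sub>R ((norm z - norm x) / ?s t * virial a (?s t)) \<le> ?q t * indicator {0..1} t"
      using AE_lborel_singleton[of "0::real"]
    proof eventually_elim
      case (elim t)
      show ?case
      proof (cases "t \<in> {0..1}")
        case True
        then have s: "0 < ?s t" using elim lt by (intro add_nonneg_pos) auto
        have "0 \<le> (norm z - norm x) / ?s t" using s lt by simp
        from mult_left_mono[OF v[OF s] this]
        have "(norm z - norm x) / ?s t * virial a (?s t) \<le> (norm z - norm x) / ?s t * (c * ((?s t)\<^sup>2 / (1 + (?s t)\<^sup>2)))" .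
        also have "\<dots> = ?q t"
        proof -
          have gen: "D / S * (c * (S\<^sup>2 / Y)) = D * (c * S / Y)" if "S \<noteq> 0" for D S Y :: real
            using that by (simp add: power2_eq_square)
          show ?thesis by (rule gen) (use s in simp)
        qed
        finally show ?thesis using True by simp
      qed simp
    qed
  qed
  also have "\<dots> = c / 2 * ln (1 + (?s 1)\<^sup>2) - c / 2 * ln (1 + (?s 0)\<^sup>2)"
    using F by (rule has_bochner_integral_integral_eq)
  finally show ?thesis
    unfolding pot_ray[OF a norm_ge_zero lt refl refl] by (simp add: right_diff_distrib)
qed

text \<open>Subtracting \<open>pot a 0\<close> forces the value 1 at the origin, and dividing by the
  mass makes the map invariant under scaling of a. Weights are thus normalised at the origin rather
  than by mass.\<close>

definition gibbs :: "real \<Rightarrow> real \<Rightarrow> (real^3 \<Rightarrow> real) \<Rightarrow> real^3 \<Rightarrow> real" where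
  "gibbs \<alpha> b a x = exp (3 * \<alpha> * ((pot a x - pot a 0) / (LINT y|lborel. a y)) - 3 * b * (norm x)\<^sup>2)"

lemma pot_continuous: "decays a \<Longrightarrow> continuous_on UNIV (pot a)"
  unfolding pot_def[abs_def]
  by (rule kernel_conv_continuous_rough[OF kernel_class_log_kernel kernel_class_log_grad log_kernel_has_derivative])

lemma gibbs_le:
  assumes a: "weight a" and \<alpha>: "0 \<le> \<alpha>"
  shows "gibbs \<alpha> b a x \<le> exp (- (3 * b) * (norm x)\<^sup>2)"
proof -
  have "(pot a x - pot a 0) / (LINT y|lborel. a y) \<le> 0"
    using pot_antimono[OF a, of 0 x] weightD(4)[OF a] by (simp add: divide_le_0_iff)
  then have "3 * \<alpha> * ((pot a x - pot a 0) / (LINT y|lborel. a y)) \<le> 0"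
    using \<alpha> by (intro mult_nonneg_nonpos) auto
  then show ?thesis unfolding gibbs_def by simp
qed

lemma weight_of_gaussian_bound:
  assumes "a \<in> borel_measurable borel" "radial a" "\<And>x. 0 < a x" "0 < c" "\<And>x. a x \<le> exp (- c * (norm x)\<^sup>2)"
  shows "weight a"
proof -
  have "decays a"
    by (rule decays_gaussian_bound[of _ c 1]) (use assms in \<open>auto simp: abs_of_pos\<close>)
  then show ?thesis unfolding weight_def using assms decays_integrable[of a] integral_pos_of_pos[of a] by (auto intro: less_imp_le)
qed

lemma weight_gibbs:
  assumes a: "weight a" and \<alpha>: "0 \<le> \<alpha>" and b: "0 < b"
  shows "weight (gibbs \<alpha> b a)"
proof (rule weight_of_gaussian_bound)
  have [measurable]: "pot a \<in> borel_measurable borel"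
    by (intro borel_measurable_continuous_onI pot_continuous weightD(2)[OF a])
  show "gibbs \<alpha> b a \<in> borel_measurable borel" unfolding gibbs_def[abs_def] by measurable
  show "radial (gibbs \<alpha> b a)" unfolding radial_def gibbs_def using radialD[OF pot_radial[OF a]] by metis
  show "gibbs \<alpha> b a x \<le> exp (- (3 * b) * (norm x)\<^sup>2)" for x by (rule gibbs_le[OF a \<alpha>])
qed (use b in \<open>auto simp: gibbs_def\<close>)

text \<open>A less concentrated weight has a flatter normalised potential, by
  \<open>virial_antimono\<close> integrated along the ray. Both products carry the same quadratic
  terms, which cancel.\<close>

lemma gibbs_mono:
  assumes a: "weight a" and a': "weight a'" and \<alpha>: "0 \<le> \<alpha>" and le: "less_concentrated a' a"
  shows "less_concentrated (gibbs \<alpha> b a') (gibbs \<alpha> b a)"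
  unfolding less_concentrated_def
proof (intro allI impI)
  fix x z :: "real^3" assume xz: "norm x \<le> norm z"
  let ?U = "\<lambda>a x. (pot a x - pot a 0) / (LINT y|lborel. a y)"
  have "(pot a z - pot a x) / (LINT x|lborel. a x) \<le> (pot a' z - pot a' x) / (LINT x|lborel. a' x)"
    by (rule pot_compare[OF a a' xz]) (rule virial_antimono[OF a a' le])
  then have "?U a' x + ?U a z \<le> ?U a x + ?U a' z" by (simp add: diff_divide_distrib)
  then have "3 * \<alpha> * (?U a' x + ?U a z) \<le> 3 * \<alpha> * (?U a x + ?U a' z)" using \<alpha> by (intro mult_left_mono) auto
  then show "gibbs \<alpha> b a' x * gibbs \<alpha> b a z \<le> gibbs \<alpha> b a x * gibbs \<alpha> b a' z"
    unfolding gibbs_def exp_add[symmetric] by (simp add: distrib_left)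
qed

lemma less_concentrated_start:
  assumes \<alpha>: "0 < \<alpha>" "\<alpha> < 2"
  obtains b a where "0 < b" "weight a" "a 0 = 1" "less_concentrated (gibbs \<alpha> b a) a"
proof -
  let ?M = "pi\<^sup>2 / 4 :: real"
  have M: "0 < ?M" by simp
  \<comment> \<open>The cutoff bounds the support, which leaves room for a positive b. If the
    farther point z lies outside the ball, the left side of the inequality to be proved is
    0.\<close>
  define a where "a n y = indicator (cball 0 (real n)) y * bubble y" for n y
  have [measurable]: "cball (0::real^3) R \<in> sets borel" for R by simp
  have [measurable]: "a n \<in> borel_measurable borel" for n unfolding a_def by measurable
  have lim: "(\<lambda>n. LINT y|lborel. a n y) \<longlonglongrightarrow> (LINT y|lborel. bubble y)"
  proof (rule integral_dominated_convergence[where w=bubble])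
    show "integrable lborel bubble" using has_bochner_integral_bubble by (rule integrable.intros)
    show "AE y in lborel. (\<lambda>n. a n y) \<longlonglongrightarrow> bubble y"
    proof (rule AE_I2, rule tendsto_eventually)
      fix y :: "real^3"
      obtain N where N: "norm y \<le> real N" using real_arch_simple by blast
      show "\<forall>\<^sub>F n in sequentially. a n y = bubble y"
        using eventually_ge_at_top[of N] by eventually_elim (use N in \<open>auto simp: a_def\<close>)
    qed
    show "AE y in lborel. norm (a n y) \<le> bubble y" for n
      by (auto simp: a_def indicator_def bubble_nonneg)
  qed auto
  have "(LINT y|lborel. bubble y) = ?M" by (rule has_bochner_integral_integral_eq[OF has_bochner_integral_bubble])
  \<comment> \<open>The hypothesis \<open>\<alpha> < 2\<close> enters here: some truncated mass
    exceeds this fraction of the full one.\<close>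
  moreover have "\<alpha> / 2 * ?M < ?M" using \<alpha> M by simp
  ultimately have "\<forall>\<^sub>F n in sequentially. \<alpha> / 2 * ?M < (LINT y|lborel. a n y)"
    by (intro order_tendstoD(1)[OF lim]) (simp only:)
  then obtain n where n: "\<alpha> / 2 * ?M < (LINT y|lborel. a n y)" by (auto simp: eventually_sequentially)
  define A where "A = (LINT y|lborel. a n y)"
  define R where "R = real n"
  have A: "0 < A" using n \<alpha> M unfolding A_def by (meson less_trans mult_pos_pos half_gt_zero)
  have w: "weight (a n)"
    unfolding weight_def
  proof (intro conjI allI)
    show "radial (a n)" unfolding radial_def a_def bubble_def by (auto simp: indicator_def)
    show "0 \<le> a n x" for x by (auto simp: a_def bubble_nonneg)
    show "0 < (LINT x|lborel. a n x)" using A by (simp add: A_def)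
    show "decays (a n)"
      unfolding decays_def
    proof (intro conjI exI allI)
      fix x :: "real^3"
      show "norm (a n x) \<le> (1 + R)^5 / (1 + norm x)^5"
      proof (cases "norm x \<le> R")
        case True
        have "1 \<le> (1 + (norm x)\<^sup>2)^3" by (intro one_le_power) simp
        then have "bubble x \<le> 1" unfolding bubble_def using frac_le[of 1 1 1 "(1 + (norm x)\<^sup>2)^3"] by simp
        moreover have "(1 + norm x)^5 \<le> (1 + R)^5" using True by (intro power_mono) auto
        then have "1 \<le> (1 + R)^5 / (1 + norm x)^5"
          by (subst pos_le_divide_eq) (auto intro: add_pos_nonneg)
        ultimately show ?thesis using bubble_nonneg[of x] by (auto simp: a_def indicator_def)
      qed (simp add: a_def R_def)
    qed simp
  qed
  define c where "c = ?M / A"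
  \<comment> \<open>1 - \<alpha> c / 2 is the slack left between the logarithmic terms; division by
    1 + R^2 converts logarithmic growth on the ball into quadratic growth.\<close>
  define b where "b = (1 - \<alpha> * c / 2) / (1 + R\<^sup>2)"
  have R1: "0 < 1 + R\<^sup>2" by (intro add_pos_nonneg) auto
  have ac: "\<alpha> * c / 2 < 1" using n A by (simp add: c_def A_def[symmetric] divide_less_eq mult.commute)
  have b: "0 < b" using ac R1 by (simp add: b_def)
  \<comment> \<open>Truncation lowers the virial because the kernel is nonnegative; the loss of mass
    is accounted for by c.\<close>
  have vir: "virial (a n) s \<le> ?M * (s\<^sup>2 / (1 + s\<^sup>2))" if s: "0 < s" for s
  proof -
    have "virial (a n) s \<le> (LINT y|lborel. bubble y * (1 / 2 + shell (norm y / s)))"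
      unfolding virial_def
    proof (rule integral_mono_AE)
      show "integrable lborel (\<lambda>y. a n y * (1 / 2 + shell (norm y / s)))" by (rule virial_integrable[OF w s])
      show "integrable lborel (\<lambda>y. bubble y * (1 / 2 + shell (norm y / s)))"
        using has_bochner_integral_bubble_virial[OF s] by (rule integrable.intros)
      show "AE y in lborel. a n y * (1 / 2 + shell (norm y / s)) \<le> bubble y * (1 / 2 + shell (norm y / s))"
        using AE_neq_point[of 0]
      proof eventually_elim
        case (elim y)
        then have "0 \<le> 1 / 2 + shell (norm y / s)" using shell_ge_minus_half[of "norm y / s"] s by simp
        then show ?case by (intro mult_right_mono) (auto simp: a_def indicator_def bubble_nonneg)
      qed
    qed
    also have "\<dots> = ?M * (s\<^sup>2 / (1 + s\<^sup>2))"
      by (rule has_bochner_integral_integral_eq[OF has_bochner_integral_bubble_virial[OF s]])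
    finally show ?thesis .
  qed
  have lc: "less_concentrated (gibbs \<alpha> b (a n)) (a n)"
    unfolding less_concentrated_def
  proof (intro allI impI)
    fix x z :: "real^3" assume xz: "norm x \<le> norm z"
    show "gibbs \<alpha> b (a n) x * a n z \<le> a n x * gibbs \<alpha> b (a n) z"
    proof (cases "norm z \<le> R")
      case False
      then show ?thesis by (simp add: a_def R_def gibbs_def bubble_nonneg)
    next
      case True
      let ?lx = "ln (1 + (norm x)\<^sup>2)" and ?lz = "ln (1 + (norm z)\<^sup>2)"
      have px: "0 < 1 + (norm x)\<^sup>2" "0 < 1 + (norm z)\<^sup>2" by (auto intro: add_pos_nonneg)
      have bub: "a n y = exp (- 3 * ln (1 + (norm y)\<^sup>2))" if "norm y \<le> R" for y
      proof -
        have p: "0 < 1 + (norm y)\<^sup>2" by (auto intro: add_pos_nonneg)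
        have "exp (- 3 * ln (1 + (norm y)\<^sup>2)) = inverse (exp (ln (1 + (norm y)\<^sup>2)) ^ 3)"
          using exp_of_nat_mult[of 3 "ln (1 + (norm y)\<^sup>2)"] by (simp add: exp_minus)
        also have "\<dots> = a n y" using that p by (simp add: a_def R_def bubble_def inverse_eq_divide)
        finally show ?thesis by simp
      qed
      have "(norm x)\<^sup>2 \<le> (norm z)\<^sup>2" using xz by (intro power_mono) auto
      define d where "d = (norm z)\<^sup>2 - (norm x)\<^sup>2"
      have d: "0 \<le> d" using \<open>(norm x)\<^sup>2 \<le> (norm z)\<^sup>2\<close> by (simp add: d_def)
      \<comment> \<open>Uses - ln q >= 1 - q for q = (1 + |x|^2) / (1 + |z|^2), then |z| <= R in the
        denominator.\<close>
      have l: "d / (1 + R\<^sup>2) \<le> ?lz - ?lx"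
      proof -
        have "ln ((1 + (norm x)\<^sup>2) / (1 + (norm z)\<^sup>2)) \<le> (1 + (norm x)\<^sup>2) / (1 + (norm z)\<^sup>2) - 1"
          using px by (intro ln_le_minus_one) simp
        also have "\<dots> = - (d / (1 + (norm z)\<^sup>2))" 
        proof -
          have "X / Y - 1 = - ((Y - X) / Y)" if "Y \<noteq> 0" for X Y :: real using that by (simp add: diff_divide_distrib)
          from this[of "1 + (norm z)\<^sup>2" "1 + (norm x)\<^sup>2"] show ?thesis using px by (simp add: d_def)
        qed
        finally have "d / (1 + (norm z)\<^sup>2) \<le> ?lz - ?lx" using px by (simp add: ln_div)
        moreover have "d / (1 + R\<^sup>2) \<le> d / (1 + (norm z)\<^sup>2)"
          using d px True by (intro divide_left_mono add_left_mono power_mono mult_pos_pos R1) auto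
        ultimately show ?thesis by simp
      qed
      have "- (?M / 2) * (?lz - ?lx) \<le> pot (a n) z - pot (a n) x"
        by (rule pot_lower_bubble[OF w xz vir])
      then have "- (?M / 2) * (?lz - ?lx) / A \<le> (pot (a n) z - pot (a n) x) / A"
        using A by (intro divide_right_mono) auto
      then have "- (c / 2) * (?lz - ?lx) \<le> (pot (a n) z - pot (a n) x) / A"
        by (simp add: c_def)
      then have P: "3 * \<alpha> * (- (c / 2) * (?lz - ?lx)) \<le> 3 * \<alpha> * ((pot (a n) z - pot (a n) x) / A)"
        using \<alpha> by (intro mult_left_mono) auto
      have "3 * (1 - \<alpha> * c / 2) * (d / (1 + R\<^sup>2)) \<le> 3 * (1 - \<alpha> * c / 2) * (?lz - ?lx)"
        using l ac by (intro mult_left_mono) auto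
      moreover have "3 * (1 - \<alpha> * c / 2) * (d / (1 + R\<^sup>2)) = 3 * b * d" by (simp add: b_def)
      moreover have "3 * (1 - \<alpha> * c / 2) * (?lz - ?lx) = 3 * (?lz - ?lx) + 3 * \<alpha> * (- (c / 2) * (?lz - ?lx))"
        by (simp add: algebra_simps)
      ultimately have key: "3 * b * d \<le> 3 * (?lz - ?lx) + 3 * \<alpha> * ((pot (a n) z - pot (a n) x) / A)"
        using P by linarith
      define u where "u y = 3 * \<alpha> * ((pot (a n) y - pot (a n) 0) / A)" for y
      have "u z - u x = 3 * \<alpha> * ((pot (a n) z - pot (a n) x) / A)"
        by (simp add: u_def right_diff_distrib[symmetric] diff_divide_distrib[symmetric])
      then have "u x - 3 * b * (norm x)\<^sup>2 + - 3 * ?lz \<le> - 3 * ?lx + (u z - 3 * b * (norm z)\<^sup>2)"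
        using key unfolding d_def by (simp add: right_diff_distrib)
      then have "exp (u x - 3 * b * (norm x)\<^sup>2) * exp (- 3 * ?lz) \<le> exp (- 3 * ?lx) * exp (u z - 3 * b * (norm z)\<^sup>2)"
        unfolding exp_add[symmetric] by simp
      moreover have "norm x \<le> R" using xz True by simp
      ultimately show ?thesis
        using bub[OF True] bub[of x] by (simp add: gibbs_def u_def A_def)
    qed
  qed
  show ?thesis
    by (rule that[OF b w _ lc]) (simp add: a_def bubble_def)
qed

lemma pot_tendsto:
  assumes "\<And>n. a n \<in> borel_measurable borel" "\<And>n x. 0 \<le> a n x" "\<And>n x. a n x \<le> g x" "decays g" "\<And>x. (\<lambda>n. a n x) \<longlonglongrightarrow> a' x" "a' \<in> borel_measurable borel"
  shows "(\<lambda>n. pot (a n) x) \<longlonglongrightarrow> pot a' x"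
  unfolding pot_def
proof (rule integral_dominated_convergence[where w="\<lambda>y. norm (g y *\<^sub>R log_kernel (x - y))"])
  note [measurable] = assms(1,6) kernel_class_measurable[OF kernel_class_log_kernel]
  show "(\<lambda>y. a' y *\<^sub>R log_kernel (x - y)) \<in> borel_measurable lborel" "\<And>n. (\<lambda>y. a n y *\<^sub>R log_kernel (x - y)) \<in> borel_measurable lborel"
    by measurable
  show "integrable lborel (\<lambda>y. norm (g y *\<^sub>R log_kernel (x - y)))"
    by (intro integrable_norm integrable_kernel_conv kernel_class_log_kernel assms)
  show "AE y in lborel. (\<lambda>n. a n y *\<^sub>R log_kernel (x - y)) \<longlonglongrightarrow> a' y *\<^sub>R log_kernel (x - y)"
    by (intro AE_I2 tendsto_intros assms)
  show "AE y in lborel. norm (a n y *\<^sub>R log_kernel (x - y)) \<le> norm (g y *\<^sub>R log_kernel (x - y))" for n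
    using assms(2,3) by (intro AE_I2) (auto intro!: mult_right_mono simp: abs_mult intro: order_trans[OF assms(3) abs_ge_self])
qed

text \<open>All iterates equal 1 at the origin, so comparing a point with the origin turns the
  likelihood ratio order into pointwise increase. \<open>gibbs_le\<close> gives a majorant
  independent of n, and dominated convergence passes to the limit in the masses and in the
  potentials.\<close>

theorem gibbs_fixed_point:
  assumes \<alpha>: "0 < \<alpha>" "\<alpha> < 2"
  obtains b a where "0 < b" "weight a" "gibbs \<alpha> b a = a"
proof -
  obtain b a0 where b: "0 < b" and a0: "weight a0" "a0 0 = 1" "less_concentrated (gibbs \<alpha> b a0) a0"
    using less_concentrated_start[OF \<alpha>] .
  define a where "a n = (gibbs \<alpha> b ^^ n) a0" for n
  have aSuc: "a (Suc n) = gibbs \<alpha> b (a n)" for n by (simp add: a_def)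
  have w: "weight (a n)" for n
    by (induction n) (use a0 \<alpha> b in \<open>auto simp: aSuc intro!: weight_gibbs, simp add: a_def\<close>)
  have lc: "less_concentrated (a (Suc n)) (a n)" for n
  proof (induction n)
    case 0 then show ?case using a0 by (simp add: a_def)
  next
    case (Suc n) then show ?case unfolding aSuc using \<alpha> w by (intro gibbs_mono weight_gibbs b) (auto simp: aSuc)
  qed
  have one: "a n 0 = 1" for n
    by (cases n) (use a0 in \<open>auto simp: aSuc gibbs_def, simp add: a_def\<close>)
  have mono: "a n x \<le> a (Suc n) x" for n x
    using lc[of n] one unfolding less_concentrated_def by (metis mult_1 norm_ge_zero norm_zero)
  define g where "g x = exp (- (3 * b) * (norm (x::real^3))\<^sup>2)" for x
  have g: "decays g" unfolding g_def by (rule decays_gaussian_bound[of _ "3 * b" 1]) (use b in auto)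
  have le_Suc: "a (Suc n) x \<le> g x" for n x unfolding aSuc g_def using gibbs_le[OF w] \<alpha> by simp
  \<comment> \<open>The starting weight is covered as well, because it lies below its
    successor.\<close>
  have le: "a n x \<le> g x" for n x using mono[of n x] le_Suc[of n x] by simp
  have inc: "incseq (\<lambda>n. a n x)" for x by (rule incseq_SucI) (rule mono)
  define a' where "a' x = lim (\<lambda>n. a n x)" for x
  have lim: "(\<lambda>n. a n x) \<longlonglongrightarrow> a' x" for x
  proof -
    obtain L where L: "(\<lambda>n. a n x) \<longlonglongrightarrow> L"
      by (rule incseq_convergent[OF inc, of x "g x"]) (use le in auto)
    then show ?thesis unfolding a'_def limI[OF L] .
  qed
  have am: "a n \<in> borel_measurable borel" for n by (rule weightD(6)[OF w])
  have a'm: "a' \<in> borel_measurable borel"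
    using lim am by (intro borel_measurable_LIMSEQ_metric[where f=a and M=borel and g=a'])
  have nn: "0 \<le> a n x" for n x by (rule weightD(3)[OF w])
  have ge: "a n x \<le> a' x" for n x using incseq_le[OF inc lim] .
  have a'le: "a' x \<le> g x" for x by (rule LIMSEQ_le_const2[OF lim]) (use le in auto)
  have w': "weight a'"
  proof (rule weight_of_gaussian_bound[of _ "3 * b"])
    show "radial a'"
      unfolding radial_def
    proof (intro allI impI)
      fix x y :: "real^3" assume "norm x = norm y"
      then have "a n x = a n y" for n by (rule radialD[OF weightD(1)[OF w]])
      then show "a' x = a' y" by (simp add: a'_def)
    qed
    have "0 < a (Suc 0) x" for x unfolding aSuc gibbs_def by simp
    then show "0 < a' x" for x using ge by (rule less_le_trans)
    show "a' x \<le> exp (- (3 * b) * (norm x)\<^sup>2)" for x using a'le unfolding g_def .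
  qed (use a'm b in auto)
  have limI: "(\<lambda>n. LINT x|lborel. a n x) \<longlonglongrightarrow> (LINT x|lborel. a' x)"
    by (rule integral_dominated_convergence[where w=g])
      (use am a'm lim le nn decays_integrable[OF g] in auto)
  have limP: "(\<lambda>n. pot (a n) x) \<longlonglongrightarrow> pot a' x" for x
    by (rule pot_tendsto[OF am nn le g lim a'm])
  have "gibbs \<alpha> b a' x = a' x" for x
  proof -
    have "(\<lambda>n. gibbs \<alpha> b (a n) x) \<longlonglongrightarrow> gibbs \<alpha> b a' x"
      unfolding gibbs_def using weightD(4)[OF w'] by (intro tendsto_intros limP limI) auto
    then have "(\<lambda>n. a (Suc n) x) \<longlonglongrightarrow> gibbs \<alpha> b a' x" unfolding aSuc .
    then show ?thesis using LIMSEQ_Suc[OF lim] LIMSEQ_unique by blast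
  qed
  then show ?thesis using that[OF b w'] by blast
qed

subsection \<open>Regularity\<close>

definition poly_growth :: "(real^3 \<Rightarrow> real) \<Rightarrow> bool" where
  "poly_growth f \<longleftrightarrow> (\<exists>C n. \<forall>x. \<bar>f x\<bar> \<le> C * (1 + norm x)^n)"

definition rapid_decay :: "(real^3 \<Rightarrow> real) \<Rightarrow> bool" where
  "rapid_decay f \<longleftrightarrow> (\<forall>n. \<exists>C. \<forall>x. \<bar>f x\<bar> * (1 + norm x)^n \<le> C)"

text \<open>C^n with the growth condition W on the function and on each derivative up to order n.
  With W as a parameter the same closure lemmas serve polynomial growth and rapid decay.\<close>

primrec Ck :: "((real^3 \<Rightarrow> real) \<Rightarrow> bool) \<Rightarrow> nat \<Rightarrow> (real^3 \<Rightarrow> real) \<Rightarrow> bool" where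
  "Ck W 0 f \<longleftrightarrow> continuous_on UNIV f \<and> W f"
| "Ck W (Suc n) f \<longleftrightarrow> (\<forall>x. f differentiable (at x)) \<and> W f \<and> (\<forall>i. Ck W n (partial i f))"

definition grad :: "(real^3 \<Rightarrow> real) \<Rightarrow> real^3 \<Rightarrow> real^3" where
  "grad f x = (\<chi> i. partial i f x)"

lemma partial_eq_frechet: "(f has_derivative f') (at x) \<Longrightarrow> partial i f x = f' (axis i 1)"
  unfolding partial_def by (metis frechet_derivative_at)

lemma partial_eq_nth: "(f has_derivative (\<lambda>h. g \<bullet> h)) (at x) \<Longrightarrow> partial i f x = g $ i"
  by (simp add: partial_eq_frechet inner_axis)

lemma has_derivative_grad:
  assumes "f differentiable (at x)" shows "(f has_derivative (\<lambda>h. grad f x \<bullet> h)) (at x)"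
proof -
  let ?D = "frechet_derivative f (at x)"
  have D: "(f has_derivative ?D) (at x)" using assms frechet_derivative_works by blast
  have lin: "linear ?D" by (rule has_derivative_linear[OF D])
  have "?D h = grad f x \<bullet> h" for h
  proof -
    have "?D h = ?D (\<Sum>i\<in>UNIV. (h $ i) *\<^sub>R axis i 1)"
      by (simp add: basis_expansion scalar_mult_eq_scaleR[symmetric])
    also have "\<dots> = (\<Sum>i\<in>UNIV. h $ i * ?D (axis i 1))"
      by (simp add: linear_sum[OF lin] linear_cmul[OF lin])
    also have "\<dots> = grad f x \<bullet> h"
      by (simp add: grad_def inner_vec_def partial_def mult.commute)
    finally show ?thesis .
  qed
  then have "?D = (\<lambda>h. grad f x \<bullet> h)" by auto
  then show ?thesis using D by simp
qed

lemma Ck_continuous: "Ck W n f \<Longrightarrow> continuous_on UNIV f"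
  by (cases n) (auto simp: continuous_on_eq_continuous_at intro!: differentiable_imp_continuous_within)

lemma Ck_W: "Ck W n f \<Longrightarrow> W f"
  by (cases n) auto

lemma Ck_SucD: "Ck W (Suc n) f \<Longrightarrow> Ck W n f"
proof (induction n arbitrary: f)
  case 0 then show ?case using Ck_continuous[of W "Suc 0" f] by auto
next
  case (Suc n)
  have "Ck W n (partial i f)" for i using Suc.prems by (intro Suc.IH) simp
  then show ?case using Suc.prems by simp
qed

lemma Ck_partials: "Ck W (n + length is) f \<Longrightarrow> Ck W n (partials is f)"
proof (induction "is" arbitrary: n)
  case Nil then show ?case by (simp add: partials_def)
next
  case (Cons i js)
  then have "Ck W (Suc n) (partials js f)" by (intro Cons.IH) simp
  then show ?case by (simp add: partials_def)
qed

lemma Ck_smooth: assumes "\<And>n. Ck W n f" shows "smooth f"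
  unfolding smooth_def
proof
  fix js
  have "Ck W (Suc 0) (partials js f)" by (rule Ck_partials) (rule assms)
  then show "partials js f differentiable_on UNIV" by (simp add: differentiable_on_def)
qed

lemma Ck_add:
  assumes W: "\<And>f g. W f \<Longrightarrow> W g \<Longrightarrow> W (\<lambda>x. f x + g x)"
  shows "Ck W n f \<Longrightarrow> Ck W n g \<Longrightarrow> Ck W n (\<lambda>x. f x + g x)"
proof (induction n arbitrary: f g)
  case 0 then show ?case using W by (auto intro: continuous_on_add)
next
  case (Suc n)
  have "partial i (\<lambda>x. f x + g x) = (\<lambda>x. partial i f x + partial i g x)" for i
  proof
    fix x
    have "((\<lambda>x. f x + g x) has_derivative (\<lambda>h. (grad f x + grad g x) \<bullet> h)) (at x)"
      unfolding inner_add_left using Suc.prems by (intro has_derivative_add has_derivative_grad) auto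
    then show "partial i (\<lambda>x. f x + g x) x = partial i f x + partial i g x"
      by (subst partial_eq_nth) (auto simp: grad_def)
  qed
  then show ?case using Suc W by (simp add: differentiable_add)
qed

lemma Ck_mult:
  assumes W: "\<And>f g. W1 f \<Longrightarrow> W2 g \<Longrightarrow> W3 (\<lambda>x. f x * g x)"
    and W3: "\<And>f g. W3 f \<Longrightarrow> W3 g \<Longrightarrow> W3 (\<lambda>x. f x + g x)"
  shows "Ck W1 n f \<Longrightarrow> Ck W2 n g \<Longrightarrow> Ck W3 n (\<lambda>x. f x * g x)"
proof (induction n arbitrary: f g)
  case 0 then show ?case using W by (auto intro: continuous_on_mult)
next
  case (Suc n)
  have p: "partial i (\<lambda>x. f x * g x) = (\<lambda>x. f x * partial i g x + partial i f x * g x)" for i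
  proof
    fix x
    have "((\<lambda>x. f x * g x) has_derivative (\<lambda>h. f x * (grad g x \<bullet> h) + (grad f x \<bullet> h) * g x)) (at x)"
      using Suc.prems by (intro has_derivative_mult has_derivative_grad) auto
    from partial_eq_frechet[OF this, of i]
    show "partial i (\<lambda>x. f x * g x) x = f x * partial i g x + partial i f x * g x"
      by (simp add: grad_def inner_axis)
  qed
  have "Ck W3 n (partial i (\<lambda>x. f x * g x))" for i
    unfolding p
  proof (rule Ck_add[where W=W3])
    show "Ck W3 n (\<lambda>x. f x * partial i g x)" "Ck W3 n (\<lambda>x. partial i f x * g x)"
      using Suc.prems Ck_SucD[OF Suc.prems(1)] Ck_SucD[OF Suc.prems(2)] by (auto intro: Suc.IH)
  qed (rule W3)
  then show ?case using Suc.prems W by (auto intro: differentiable_mult)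
qed

lemma poly_growth_const: "poly_growth (\<lambda>x. c)"
  unfolding poly_growth_def by (intro exI[of _ "\<bar>c\<bar>"] exI[of _ 0]) simp

lemma one_plus_norm_pow_mono: "m \<le> n \<Longrightarrow> (1 + norm (x::real^3))^m \<le> (1 + norm x)^n"
  by (intro power_increasing) auto

lemma poly_growth_add: assumes "poly_growth f" "poly_growth g" shows "poly_growth (\<lambda>x. f x + g x)"
proof -
  obtain C n D m where *: "\<And>x. \<bar>f x\<bar> \<le> C * (1 + norm x)^n" "\<And>x. \<bar>g x\<bar> \<le> D * (1 + norm x)^m"
    using assms unfolding poly_growth_def by blast
  have "\<bar>f x + g x\<bar> \<le> (\<bar>C\<bar> + \<bar>D\<bar>) * (1 + norm x)^(n + m)" for x
  proof -
    have "C * (1 + norm x)^n \<le> \<bar>C\<bar> * (1 + norm x)^(n + m)" "D * (1 + norm x)^m \<le> \<bar>D\<bar> * (1 + norm x)^(n + m)"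
      by (intro mult_mono one_plus_norm_pow_mono; simp)+
    then show ?thesis using *[of x] abs_triangle_ineq[of "f x" "g x"] by (simp add: distrib_right)
  qed
  then show ?thesis unfolding poly_growth_def by blast
qed

lemma poly_growth_mult: assumes "poly_growth f" "poly_growth g" shows "poly_growth (\<lambda>x. f x * g x)"
proof -
  obtain C n D m where *: "\<And>x. \<bar>f x\<bar> \<le> C * (1 + norm x)^n" "\<And>x. \<bar>g x\<bar> \<le> D * (1 + norm x)^m"
    using assms unfolding poly_growth_def by blast
  have "\<bar>f x * g x\<bar> \<le> (C * D) * (1 + norm x)^(n + m)" for x
  proof -
    have "\<bar>f x\<bar> * \<bar>g x\<bar> \<le> (C * (1 + norm x)^n) * (D * (1 + norm x)^m)"
      using * by (intro mult_mono) (auto intro: order_trans[OF abs_ge_zero])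
    then show ?thesis by (simp add: abs_mult power_add mult_ac)
  qed
  then show ?thesis unfolding poly_growth_def by blast
qed

lemma rapid_decay_add: assumes "rapid_decay f" "rapid_decay g" shows "rapid_decay (\<lambda>x. f x + g x)"
  unfolding rapid_decay_def
proof
  fix n
  obtain C D where *: "\<And>x. \<bar>f x\<bar> * (1 + norm x)^n \<le> C" "\<And>x. \<bar>g x\<bar> * (1 + norm x)^n \<le> D"
    using assms unfolding rapid_decay_def by blast
  have "\<bar>f x + g x\<bar> * (1 + norm x)^n \<le> C + D" for x
  proof -
    have "\<bar>f x + g x\<bar> * (1 + norm x)^n \<le> (\<bar>f x\<bar> + \<bar>g x\<bar>) * (1 + norm x)^n" by (intro mult_right_mono) auto
    then show ?thesis using *[of x] by (simp add: distrib_right)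
  qed
  then show "\<exists>C. \<forall>x. \<bar>f x + g x\<bar> * (1 + norm x)^n \<le> C" by blast
qed

lemma rapid_decay_mult_poly: assumes "rapid_decay f" "poly_growth g" shows "rapid_decay (\<lambda>x. f x * g x)"
  unfolding rapid_decay_def
proof
  fix n
  obtain D m where D: "\<And>x. \<bar>g x\<bar> \<le> D * (1 + norm x)^m" using assms unfolding poly_growth_def by blast
  obtain C where C: "\<And>x. \<bar>f x\<bar> * (1 + norm x)^(m + n) \<le> C" using assms unfolding rapid_decay_def by blast
  have D0: "0 \<le> D" using D[of 0] by simp
  have "\<bar>f x * g x\<bar> * (1 + norm x)^n \<le> D * C" for x
  proof -
    have "\<bar>f x\<bar> * \<bar>g x\<bar> * (1 + norm x)^n \<le> \<bar>f x\<bar> * (D * (1 + norm x)^m) * (1 + norm x)^n"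
      using D by (intro mult_right_mono mult_left_mono) auto
    also have "\<dots> = D * (\<bar>f x\<bar> * (1 + norm x)^(m + n))" by (simp add: power_add mult_ac)
    also have "\<dots> \<le> D * C" using C D0 by (rule mult_left_mono)
    finally show ?thesis by (simp add: abs_mult)
  qed
  then show "\<exists>C. \<forall>x. \<bar>f x * g x\<bar> * (1 + norm x)^n \<le> C" by blast
qed

lemma rapid_decay_decays: assumes "rapid_decay f" "continuous_on UNIV f" shows "decays f"
  unfolding decays_def
proof (intro conjI)
  show "f \<in> borel_measurable borel" using assms(2) by (rule borel_measurable_continuous_onI)
  obtain C where C: "\<And>x. \<bar>f x\<bar> * (1 + norm x)^5 \<le> C" using assms(1) unfolding rapid_decay_def by blast
  then show "\<exists>C. \<forall>x. norm (f x) \<le> C / (1 + norm x)^5"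
    by (intro exI[of _ C] allI) (simp add: pos_le_divide_eq add_pos_nonneg)
qed

lemma Ck_rapid_decays: "Ck rapid_decay n f \<Longrightarrow> decays f"
  by (intro rapid_decay_decays Ck_W Ck_continuous)

lemma decays_grad:
  assumes "Ck rapid_decay (Suc n) f" shows "decays (grad f)" "continuous_on UNIV (grad f)"
proof -
  have d: "decays (partial i f)" and c: "continuous_on UNIV (partial i f)" for i
    using assms Ck_rapid_decays[of n "partial i f"] Ck_continuous[of rapid_decay n "partial i f"] by auto
  show cg: "continuous_on UNIV (grad f)"
    unfolding grad_def[abs_def] by (intro continuous_on_vec_lambda c)
  obtain C where C: "\<And>i x. norm (partial i f x) \<le> C i / (1 + norm x)^5"
    using d unfolding decays_def by metis
  have "norm (grad f x) \<le> (\<Sum>i\<in>UNIV. C i) / (1 + norm x)^5" for x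
  proof -
    have "norm (grad f x) \<le> (\<Sum>i\<in>UNIV. \<bar>grad f x $ i\<bar>)" by (rule norm_le_l1_cart)
    also have "\<dots> \<le> (\<Sum>i\<in>UNIV. C i / (1 + norm x)^5)"
      using C by (intro sum_mono) (simp add: grad_def)
    finally show ?thesis by (simp add: sum_divide_distrib)
  qed
  then show "decays (grad f)"
    unfolding decays_def using borel_measurable_continuous_onI[OF cg] by blast
qed

section \<open>Derivatives of potentials and weak derivatives\<close>

lemma poly_growth_conv:
  fixes K :: "real^3 \<Rightarrow> real"
  assumes "kernel_class K" "decays f"
  shows "poly_growth (\<lambda>x. LINT y|lborel. f y *\<^sub>R K (x - y))"
proof -
  obtain M where M: "\<And>x. (LINT y|lborel. norm (f y *\<^sub>R K (x - y))) \<le> M * (1 + norm x)"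
    using kernel_conv_bound[OF assms] by blast
  have "\<bar>LINT y|lborel. f y *\<^sub>R K (x - y)\<bar> \<le> M * (1 + norm x)^1" for x
    using order_trans[OF integral_norm_bound M[of x]] by (simp only: real_norm_def power_one_right)
  then show ?thesis unfolding poly_growth_def by blast
qed

lemma pot_has_derivative:
  assumes "decays f" "continuous_on UNIV f"
  shows "(pot f has_derivative (\<lambda>h. pot_grad f x \<bullet> h)) (at x)"
  unfolding pot_def[abs_def] pot_grad_def
  by (rule kernel_conv_has_derivative[OF kernel_class_log_kernel kernel_class_log_grad log_kernel_has_derivative assms])

lemma pot_grad_nth:
  assumes "decays f"
  shows "pot_grad f x $ i = (LINT y|lborel. f y *\<^sub>R (log_grad (x - y) $ i))"
  unfolding pot_grad_def
  using integral_bounded_linear[OF bounded_linear_vec_nth integrable_kernel_conv[OF kernel_class_log_grad assms], of x i]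
  by simp

text \<open>Derivatives are moved onto f while it has any; the last one falls on the kernel, whose
  gradient |z|^-1 is still locally integrable. Hence the gain of one order.\<close>

lemma Ck_pot: "Ck rapid_decay n f \<Longrightarrow> Ck poly_growth (Suc n) (pot f)"
proof (induction n arbitrary: f)
  case 0
  then have f: "decays f" "continuous_on UNIV f" using Ck_rapid_decays[of 0 f] by auto
  have p: "partial i (pot f) = (\<lambda>x. LINT y|lborel. f y *\<^sub>R (log_grad (x - y) $ i))" for i
    using partial_eq_nth[OF pot_has_derivative[OF f]] pot_grad_nth[OF f(1)] by auto
  have "Ck poly_growth 0 (partial i (pot f))" for i
    unfolding p Ck.simps
    using kernel_conv_continuous[OF kernel_class_log_grad_nth f] poly_growth_conv[OF kernel_class_log_grad_nth f(1)] by auto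
  moreover have "poly_growth (pot f)"
    unfolding pot_def[abs_def] by (rule poly_growth_conv[OF kernel_class_log_kernel f(1)])
  moreover have "pot f differentiable (at x)" for x
    using pot_has_derivative[OF f] unfolding differentiable_def by blast
  ultimately show ?case by simp
next
  case (Suc n)
  have f: "decays f" "continuous_on UNIV f" using Suc.prems Ck_rapid_decays Ck_continuous by blast+
  note g = decays_grad[OF Suc.prems]
  have der: "(f has_derivative (\<lambda>h. grad f z \<bullet> h)) (at z)" for z
    using Suc.prems by (intro has_derivative_grad) simp
  have p: "partial i (pot f) = pot (partial i f)" for i
  proof
    fix x
    have "(pot f has_derivative (\<lambda>h. (\<chi> i. LINT y|lborel. (grad f y $ i) *\<^sub>R log_kernel (x - y)) \<bullet> h)) (at x)"
      unfolding pot_def[abs_def]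
      by (rule kernel_conv_has_derivative_smooth_factor[OF kernel_class_log_kernel f(1) g der])
    then show "partial i (pot f) x = pot (partial i f) x"
      by (subst partial_eq_nth) (auto simp: pot_def grad_def)
  qed
  have "Ck poly_growth (Suc n) (partial i (pot f))" for i
    unfolding p using Suc.prems by (intro Suc.IH) simp
  moreover have "poly_growth (pot f)"
    unfolding pot_def[abs_def] by (rule poly_growth_conv[OF kernel_class_log_kernel f(1)])
  moreover have "pot f differentiable (at x)" for x
    using pot_has_derivative[OF f] unfolding differentiable_def by blast
  ultimately show ?case by simp
qed

lemma integral_partial_eq_0:
  assumes "Ck rapid_decay (Suc 0) f"
  shows "(LINT x|lborel. partial i f x) = 0"
proof -
  \<comment> \<open>Convolution with the constant kernel 1 does not depend on x, and its derivative
    is the integral in question.\<close>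
  have K: "kernel_class (\<lambda>z. 1 :: real)"
    unfolding kernel_class_def by (intro conjI exI[of _ 1]) (auto simp: kernel_weight_def)
  have f: "decays f" using assms by (rule Ck_rapid_decays)
  note g = decays_grad[OF assms]
  have der: "(f has_derivative (\<lambda>h. grad f z \<bullet> h)) (at z)" for z
    using assms by (intro has_derivative_grad) simp
  have "((\<lambda>x. LINT y|lborel. f y *\<^sub>R 1) has_derivative (\<lambda>h. (\<chi> i. LINT y|lborel. (grad f y $ i) *\<^sub>R 1) \<bullet> h)) (at (0::real^3))"
    by (rule kernel_conv_has_derivative_smooth_factor[OF K f g der])
  from partial_eq_nth[OF this, of i]
  have "partial i (\<lambda>x::real^3. LINT y|lborel. f y *\<^sub>R 1) 0 = (LINT x|lborel. partial i f x)"
    by (simp add: grad_def)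
  moreover have "partial i (\<lambda>x::real^3. c) 0 = 0" for c :: real
    by (rule partial_eq_frechet[OF has_derivative_const])
  ultimately show ?thesis by simp
qed

lemma integral_by_parts:
  assumes u: "Ck poly_growth (Suc 0) u" and f: "Ck rapid_decay (Suc 0) f"
  shows "(LINT x|lborel. u x * partial i f x) = - (LINT x|lborel. partial i u x * f x)"
proof -
  have p: "partial i (\<lambda>x. f x * u x) x = f x * partial i u x + partial i f x * u x" for x
  proof -
    have "((\<lambda>x. f x * u x) has_derivative (\<lambda>h. f x * (grad u x \<bullet> h) + (grad f x \<bullet> h) * u x)) (at x)"
      using u f by (intro has_derivative_mult has_derivative_grad) auto
    from partial_eq_frechet[OF this, of i] show ?thesis by (simp add: grad_def inner_axis)
  qed
  have fu: "Ck rapid_decay (Suc 0) (\<lambda>x. f x * u x)"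
    by (rule Ck_mult[OF rapid_decay_mult_poly rapid_decay_add f u])
  have 1: "Ck rapid_decay 0 (\<lambda>x. f x * partial i u x)"
  proof (rule Ck_mult[OF rapid_decay_mult_poly rapid_decay_add Ck_SucD[OF f]])
    show "Ck poly_growth 0 (partial i u)" using u unfolding Ck.simps(2) by blast
  qed
  have 2: "Ck rapid_decay 0 (\<lambda>x. partial i f x * u x)"
  proof (rule Ck_mult[OF rapid_decay_mult_poly rapid_decay_add _ Ck_SucD[OF u]])
    show "Ck rapid_decay 0 (partial i f)" using f unfolding Ck.simps(2) by blast
  qed
  note i = decays_integrable[OF Ck_rapid_decays[OF 1]] decays_integrable[OF Ck_rapid_decays[OF 2]]
  have "(LINT x|lborel. f x * partial i u x) + (LINT x|lborel. partial i f x * u x) = (LINT x|lborel. partial i (\<lambda>x. f x * u x) x)"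
    unfolding p by (rule Bochner_Integration.integral_add[OF i, symmetric])
  also have "\<dots> = 0" by (rule integral_partial_eq_0[OF fu])
  finally show ?thesis by (simp add: mult.commute)
qed

text \<open>\<open>partials\<close> applies the head of the list last, so the head is the first
  derivative to be moved onto u; this reverses the list.\<close>

lemma integral_partials_by_parts:
  assumes f: "\<And>n. Ck rapid_decay n f"
  shows "(\<And>n. Ck poly_growth n u) \<Longrightarrow> (LINT x|lborel. u x * partials is f x) = (-1) ^ length is * (LINT x|lborel. partials (rev is) u x * f x)"
proof (induction "is" arbitrary: u)
  case Nil then show ?case by (simp add: partials_def)
next
  case (Cons i js)
  have Cp: "Ck poly_growth n (partial i u)" for n using Cons.prems[of "Suc n"] by simp
  have Cf: "Ck rapid_decay (Suc 0) (partials js f)" by (rule Ck_partials) (rule f)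
  have "(LINT x|lborel. u x * partials (i # js) f x) = (LINT x|lborel. u x * partial i (partials js f) x)"
    by (simp add: partials_def)
  also have "\<dots> = - (LINT x|lborel. partial i u x * partials js f x)"
    by (rule integral_by_parts[OF Cons.prems Cf])
  also have "(LINT x|lborel. partial i u x * partials js f x) = (-1) ^ length js * (LINT x|lborel. partials (rev js) (partial i u) x * f x)"
    by (rule Cons.IH[OF Cp])
  also have "partials (rev js) (partial i u) = partials (rev (i # js)) u" by (simp add: partials_def)
  finally show ?case by simp
qed

lemma test_function_Ck:
  assumes "f \<in> test_functions" shows "Ck rapid_decay n f"
proof -
  have sm: "smooth f" and cp: "compact (closure {x. f x \<noteq> 0})" using assms by (auto simp: test_functions_def)
  obtain R where R: "\<And>x. f x \<noteq> 0 \<Longrightarrow> norm x \<le> R"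
  proof -
    obtain R where R: "\<And>x. x \<in> closure {x. f x \<noteq> 0} \<Longrightarrow> norm x \<le> R"
      using compact_imp_bounded[OF cp] unfolding bounded_iff by blast
    show ?thesis
    proof (rule that)
      fix x assume "f x \<noteq> 0"
      then have "x \<in> closure {x. f x \<noteq> 0}" by (intro subsetD[OF closure_subset]) simp
      then show "norm x \<le> R" by (rule R)
    qed
  qed
  \<comment> \<open>Outside the ball f vanishes on an open set, hence so do its derivatives.\<close>
  have van: "partials js f x = 0" if "R < norm x" for js x
    using that
  proof (induction js arbitrary: x)
    case Nil
    then have "f x = 0" using R[of x] by linarith
    then show ?case by (simp add: partials_def)
  next
    case (Cons i js)
    have op: "open {x::real^3. R < norm x}" by (intro open_Collect_less continuous_intros)
    have "((\<lambda>_. 0) has_derivative (\<lambda>h. 0::real)) (at x)" by simp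
    then have "(partials js f has_derivative (\<lambda>h. 0)) (at x)"
      by (rule has_derivative_transform_within_open[OF _ op]) (use Cons in auto)
    from partial_eq_frechet[OF this] show ?case by (simp add: partials_def)
  qed
  have diff: "partials js f differentiable (at x)" for js x
    using sm by (simp add: smooth_def differentiable_on_def)
  have cont: "continuous_on UNIV (partials js f)" for js
    by (auto simp: continuous_on_eq_continuous_at intro!: differentiable_imp_continuous_within diff)
  have rd: "rapid_decay (partials js f)" for js
    unfolding rapid_decay_def
  proof
    fix n
    have "bounded ((\<lambda>x. \<bar>partials js f x\<bar> * (1 + norm x)^n) ` cball 0 R)"
      by (intro compact_imp_bounded compact_continuous_image compact_cball continuous_intros continuous_on_subset[OF cont]) auto
    then obtain C where C: "\<forall>x\<in>cball 0 R. \<bar>partials js f x\<bar> * (1 + norm x)^n \<le> C"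
      unfolding bounded_iff by auto
    have "\<bar>partials js f x\<bar> * (1 + norm x)^n \<le> max C 0" for x
      using bspec[OF C, of x] van[of x js] by (cases "norm x \<le> R") auto
    then show "\<exists>C. \<forall>x. \<bar>partials js f x\<bar> * (1 + norm x)^n \<le> C" by blast
  qed
  have "Ck rapid_decay n (partials js f)" for js
  proof (induction n arbitrary: js)
    case 0 then show ?case using cont rd by simp
  next
    case (Suc n)
    have "partial i (partials js f) = partials (i # js) f" for i by (simp add: partials_def)
    then show ?case using Suc diff rd by simp
  qed
  from this[of "[]"] show ?thesis by (simp add: partials_def)
qed

lemma continuous_L1_loc:
  fixes f :: "real^'n \<Rightarrow> real"
  assumes "continuous_on UNIV f" shows "f \<in> L1_loc"
  unfolding L1_loc_def
proof (clarsimp)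
  fix K :: "(real^'n) set" assume "compact K"
  then have "integrable lborel (\<lambda>x. indicator K x *\<^sub>R f x)"
    by (intro borel_integrable_compact continuous_on_subset[OF assms]) auto
  then show "f absolutely_integrable_on K"
    unfolding set_integrable_def by (subst integrable_completion) (auto dest: borel_measurable_integrable)
qed

lemma weak_partials_of_Ck:
  assumes u: "\<And>n. Ck poly_growth n u"
  shows "weak_partials is u (partials (rev is) u)"
  unfolding weak_partials_def
proof (intro conjI ballI)
  have C: "Ck poly_growth n (partials js u)" for js n by (rule Ck_partials[OF u])
  show "u \<in> L1_loc" "partials (rev is) u \<in> L1_loc"
    using u C by (auto intro!: continuous_L1_loc Ck_continuous)
  fix f :: "real^3 \<Rightarrow> real" assume "f \<in> test_functions"
  then have f: "Ck rapid_decay n f" for n by (rule test_function_Ck)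
  have [measurable]: "u \<in> borel_measurable borel" "f \<in> borel_measurable borel"
    "partials is f \<in> borel_measurable borel" "partials (rev is) u \<in> borel_measurable borel"
    using Ck_continuous[OF u] Ck_continuous[OF f] Ck_continuous[OF C] Ck_continuous[OF Ck_partials[OF f]]
    by (auto intro: borel_measurable_continuous_onI)
  show "(LINT x|lebesgue. u x * partials is f x) = (-1) ^ length is * (LINT x|lebesgue. partials (rev is) u x * f x)"
    using integral_partials_by_parts[OF f u, of "is"] by (simp add: integral_completion)
qed

subsection \<open>The Fourier transform and Gaussians\<close>

text \<open>\<open>fourier\<close> with \<open>lborel\<close> in place of its completion, since
  Fubini is applied to products of \<open>lborel\<close>; \<open>fourier_eq_FT\<close> identifies
  the two.\<close>

definition FT :: "(real^3 \<Rightarrow> complex) \<Rightarrow> real^3 \<Rightarrow> complex" where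
  "FT f \<xi> = (LINT x|lborel. iexp (- (x \<bullet> \<xi>)) * f x)"

lemma
  fixes f :: "'a::euclidean_space \<Rightarrow> complex" and g :: "'b::euclidean_space \<Rightarrow> complex"
  assumes f: "integrable lborel f" and g: "integrable lborel g"
  shows integrable_pair_mult: "integrable (lborel \<Otimes>\<^sub>M lborel) (\<lambda>(x, y). f x * g y)"
    and integral_pair_mult: "(LINT z|lborel. f (fst z) * g (snd z)) = (LINT x|lborel. f x) * (LINT y|lborel. g y)"
proof -
  have [measurable]: "f \<in> borel_measurable lborel" "g \<in> borel_measurable lborel" using f g by auto
  show 1: "integrable (lborel \<Otimes>\<^sub>M lborel) (\<lambda>(x, y). f x * g y)"
  proof (rule lborel_pair.Fubini_integrable)
    show "(\<lambda>(x, y). f x * g y) \<in> borel_measurable (lborel \<Otimes>\<^sub>M lborel)" by measurable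
    have "integrable lborel (\<lambda>x. norm (f x) * (LINT y|lborel. norm (g y)))"
      using f by (intro integrable_mult_left integrable_norm)
    then show "integrable lborel (\<lambda>x. LINT y|lborel. norm (case (x, y) of (x, y) \<Rightarrow> f x * g y))"
      using g by (simp add: norm_mult)
    show "AE x in lborel. integrable lborel (\<lambda>y. case (x, y) of (x, y) \<Rightarrow> f x * g y)"
      using g by simp
  qed
  have "(LINT z|lborel. f (fst z) * g (snd z)) = (LINT z|(lborel \<Otimes>\<^sub>M lborel). (\<lambda>(x, y). f x * g y) z)"
    unfolding lborel_prod by (simp add: case_prod_unfold)
  also have "\<dots> = (LINT x|lborel. LINT y|lborel. f x * g y)"
    using lborel_pair.integral_fst[OF 1] by simp
  also have "\<dots> = (LINT x|lborel. f x) * (LINT y|lborel. g y)"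
    using f g by simp
  finally show "(LINT z|lborel. f (fst z) * g (snd z)) = (LINT x|lborel. f x) * (LINT y|lborel. g y)" .
qed

lemma
  fixes f g h :: "real \<Rightarrow> complex"
  assumes f: "integrable lborel f" and g: "integrable lborel g" and h: "integrable lborel h"
  shows integral_vec3_mult: "(LINT x|lborel. f (x$1) * g (x$2) * h ((x::real^3)$3)) = (LINT x|lborel. f x) * (LINT x|lborel. g x) * (LINT x|lborel. h x)"
    and integrable_vec3_mult: "integrable lborel (\<lambda>x. f (x$1) * g (x$2) * h ((x::real^3)$3))"
proof -
  have [measurable]: "f \<in> borel_measurable borel" "g \<in> borel_measurable borel" "h \<in> borel_measurable borel" using f g h by auto
  let ?v = "\<lambda>q :: (real\<times>real)\<times>real. vector [fst (fst q), snd (fst q), snd q] :: real^3"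
  have f_eq: "?v = (\<lambda>q. fst (fst q) *\<^sub>R axis 1 1 + snd (fst q) *\<^sub>R axis 2 1 + snd q *\<^sub>R axis 3 1)"
    by (auto simp: fun_eq_iff vec_eq_iff forall_3 axis_def)
  have [measurable]: "?v \<in> borel_measurable borel"
    unfolding f_eq by (intro borel_measurable_continuous_onI continuous_intros)
  let ?F = "\<lambda>x. f (x$1) * g (x$2) * h ((x::real^3)$3)"
  have mF: "?F \<in> borel_measurable borel" by measurable
  have fg: "integrable lborel (\<lambda>w. f (fst w) * g (snd w))"
    using integrable_pair_mult[OF f g] unfolding lborel_prod by (simp add: case_prod_unfold)
  have "integrable lborel (\<lambda>q. ?F (?v q))"
    using integrable_pair_mult[OF fg h] unfolding lborel_prod by (simp add: case_prod_unfold)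
  then show "integrable lborel ?F"
    using integrable_distr_eq[of ?v "lborel" borel ?F] mF unfolding lborel_vec3 by simp
  have "(LINT x|lborel. ?F x) = (LINT q|lborel. ?F (?v q))"
    using integral_distr[of ?v "lborel" borel ?F] mF unfolding lborel_vec3 by simp
  also have "\<dots> = (LINT x|lborel. f x) * (LINT x|lborel. g x) * (LINT x|lborel. h x)"
    using integral_pair_mult[OF fg h] integral_pair_mult[OF f g] by simp
  finally show "(LINT x|lborel. ?F x) = (LINT x|lborel. f x) * (LINT x|lborel. g x) * (LINT x|lborel. h x)" .
qed

lemma
  fixes z :: real
  assumes p: "0 < p"
  shows integral_gauss_iexp: "(LINT t|lborel. iexp (z * t) * of_real (exp (- p\<^sup>2 * t\<^sup>2))) = of_real (sqrt pi / p * exp (- z\<^sup>2 / (4 * p\<^sup>2)))"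
    and integrable_gauss_iexp: "integrable lborel (\<lambda>t. iexp (z * t) * of_real (exp (- p\<^sup>2 * t\<^sup>2)))"
proof -
  \<comment> \<open>The substitution t = c x turns p^2 t^2 into x^2 / 2, the exponent of the
    standard normal density, and the integral into its characteristic function.\<close>
  define c where "c = 1 / (sqrt 2 * p)"
  have c: "0 < c" using p by (simp add: c_def)
  let ?f = "\<lambda>t. iexp (z * t) * of_real (exp (- p\<^sup>2 * t\<^sup>2))"
  have eq: "?f (0 + c * x) = of_real (sqrt (2 * pi)) * (std_normal_density x *\<^sub>R iexp (z * c * x))" for x
  proof -
    have "p\<^sup>2 * (c * x)\<^sup>2 = x\<^sup>2 / 2" using p by (simp add: c_def power_mult_distrib power_divide)
    then have "exp (- p\<^sup>2 * (c * x)\<^sup>2) = sqrt (2 * pi) * std_normal_density x"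
      by (simp add: std_normal_density_def)
    then show ?thesis by (simp add: scaleR_conv_of_real mult_ac)
  qed
  have int: "integrable lborel (\<lambda>x. std_normal_density x *\<^sub>R iexp (z * c * x))"
  proof (rule Bochner_Integration.integrable_bound)
    show "integrable lborel std_normal_density" by (rule integrable_normal_density) simp
    show "AE x in lborel. norm (std_normal_density x *\<^sub>R iexp (z * c * x)) \<le> norm (std_normal_density x)"
      by (simp add: norm_exp_i_times)
  qed measurable
  have "integrable lborel (\<lambda>x. ?f (0 + c * x))" unfolding eq by (intro integrable_mult_right int)
  then show "integrable lborel ?f" using lborel_integrable_real_affine_iff[of c ?f 0] c by simp
  have ch: "(LINT x|lborel. std_normal_density x *\<^sub>R iexp (z * c * x)) = of_real (exp (- (z * c)\<^sup>2 / 2))"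
  proof -
    have "char std_normal_distribution (z * c) = (LINT x|lborel. std_normal_density x *\<^sub>R iexp (z * c * x))"
      unfolding char_def by (subst integral_density) auto
    then show ?thesis by (simp add: char_std_normal_distribution)
  qed
  have "(LINT t|lborel. ?f t) = \<bar>c\<bar> *\<^sub>R (LINT x|lborel. ?f (0 + c * x))"
    by (rule lborel_integral_real_affine) (use c in simp)
  also have "\<dots> = of_real (c * sqrt (2 * pi) * exp (- (z * c)\<^sup>2 / 2))"
    unfolding eq using c ch by (simp add: scaleR_conv_of_real)
  also have "c * sqrt (2 * pi) = sqrt pi / p" by (simp add: c_def real_sqrt_mult)
  also have "- (z * c)\<^sup>2 / 2 = - z\<^sup>2 / (4 * p\<^sup>2)" by (simp add: c_def power_mult_distrib power_divide)
  finally show "(LINT t|lborel. ?f t) = of_real (sqrt pi / p * exp (- z\<^sup>2 / (4 * p\<^sup>2)))" .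
qed

lemma gauss3_factor:
  "iexp (z \<bullet> \<xi>) * of_real (exp (- p\<^sup>2 * (norm \<xi>)\<^sup>2)) =
    (iexp (z$1 * \<xi>$1) * of_real (exp (- p\<^sup>2 * (\<xi>$1)\<^sup>2))) * (iexp (z$2 * \<xi>$2) * of_real (exp (- p\<^sup>2 * (\<xi>$2)\<^sup>2)))
     * (iexp (z$3 * \<xi>$3) * of_real (exp (- p\<^sup>2 * (\<xi>$3)\<^sup>2)))" for z \<xi> :: "real^3"
proof -
  have "z \<bullet> \<xi> = z$1 * \<xi>$1 + z$2 * \<xi>$2 + z$3 * \<xi>$3" by (simp add: inner_vec_def sum_3)
  then have 1: "iexp (z \<bullet> \<xi>) = iexp (z$1 * \<xi>$1) * iexp (z$2 * \<xi>$2) * iexp (z$3 * \<xi>$3)"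
    by (simp add: distrib_left exp_add)
  have "- p\<^sup>2 * (norm \<xi>)\<^sup>2 = - p\<^sup>2 * (\<xi>$1)\<^sup>2 + - p\<^sup>2 * (\<xi>$2)\<^sup>2 + - p\<^sup>2 * (\<xi>$3)\<^sup>2"
    unfolding power2_norm_eq_inner inner_vec_def sum_3 by (simp add: power2_eq_square distrib_left)
  then have 2: "exp (- p\<^sup>2 * (norm \<xi>)\<^sup>2) = exp (- p\<^sup>2 * (\<xi>$1)\<^sup>2) * exp (- p\<^sup>2 * (\<xi>$2)\<^sup>2) * exp (- p\<^sup>2 * (\<xi>$3)\<^sup>2)"
    by (simp only: exp_add)
  show ?thesis unfolding 1 2 of_real_mult by (simp only: mult_ac)
qed

lemma
  fixes z :: "real^3"
  assumes p: "0 < p"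
  shows integral_gauss3: "(LINT \<xi>|lborel. iexp (z \<bullet> \<xi>) * of_real (exp (- p\<^sup>2 * (norm \<xi>)\<^sup>2))) = of_real ((sqrt pi / p)^3 * exp (- (norm z)\<^sup>2 / (4 * p\<^sup>2)))"
    and integrable_gauss3: "integrable lborel (\<lambda>\<xi>. iexp (z \<bullet> \<xi>) * of_real (exp (- p\<^sup>2 * (norm \<xi>)\<^sup>2)))"
proof -
  show "integrable lborel (\<lambda>\<xi>. iexp (z \<bullet> \<xi>) * of_real (exp (- p\<^sup>2 * (norm \<xi>)\<^sup>2)))"
    unfolding gauss3_factor by (intro integrable_vec3_mult integrable_gauss_iexp p)
  have "(LINT \<xi>|lborel. iexp (z \<bullet> \<xi>) * of_real (exp (- p\<^sup>2 * (norm \<xi>)\<^sup>2))) =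
     of_real (sqrt pi / p * exp (- (z$1)\<^sup>2 / (4 * p\<^sup>2))) * of_real (sqrt pi / p * exp (- (z$2)\<^sup>2 / (4 * p\<^sup>2))) * of_real (sqrt pi / p * exp (- (z$3)\<^sup>2 / (4 * p\<^sup>2)))"
    unfolding gauss3_factor
    by (simp only: integral_vec3_mult[OF integrable_gauss_iexp integrable_gauss_iexp integrable_gauss_iexp, OF p p p] integral_gauss_iexp[OF p])
  also have "\<dots> = of_real ((sqrt pi / p)^3 * (exp (- (z$1)\<^sup>2 / (4 * p\<^sup>2)) * exp (- (z$2)\<^sup>2 / (4 * p\<^sup>2)) * exp (- (z$3)\<^sup>2 / (4 * p\<^sup>2))))"
    unfolding of_real_mult[symmetric] power3_eq_cube by (simp only: mult_ac)
  also have "exp (- (z$1)\<^sup>2 / (4 * p\<^sup>2)) * exp (- (z$2)\<^sup>2 / (4 * p\<^sup>2)) * exp (- (z$3)\<^sup>2 / (4 * p\<^sup>2)) = exp (- (norm z)\<^sup>2 / (4 * p\<^sup>2))"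
    unfolding power2_norm_eq_inner inner_vec_def sum_3 exp_add[symmetric]
    by (simp add: power2_eq_square add_divide_distrib[symmetric] minus_divide_left[symmetric] diff_divide_distrib[symmetric] algebra_simps)
  finally show "(LINT \<xi>|lborel. iexp (z \<bullet> \<xi>) * of_real (exp (- p\<^sup>2 * (norm \<xi>)\<^sup>2))) = of_real ((sqrt pi / p)^3 * exp (- (norm z)\<^sup>2 / (4 * p\<^sup>2)))" .
qed

lemma integrable_gauss3_real:
  assumes "0 < p" shows "integrable lborel (\<lambda>\<xi>::real^3. exp (- p\<^sup>2 * (norm \<xi>)\<^sup>2))"
  using integrable_norm[OF integrable_gauss3[OF assms, of 0]] by simp

lemma FT_measurable[measurable]:
  assumes [measurable]: "f \<in> borel_measurable borel" shows "FT f \<in> borel_measurable borel"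
proof -
  have "(\<lambda>(\<xi>, x). iexp (- (x \<bullet> \<xi>)) * f x) \<in> borel_measurable (borel \<Otimes>\<^sub>M lborel)" by measurable
  then show ?thesis unfolding FT_def[abs_def] by (rule lborel.borel_measurable_lebesgue_integral)
qed

text \<open>Fubini for g x exp (i (y - x) . xi) exp (- p^2 |xi|^2), whose integral over xi is again
  Gaussian. It holds for every integrable g; inversion, uniqueness and the transform of |x|^-2 are
  all drawn from it.\<close>

lemma integral_mult_gauss:
  fixes g :: "real^3 \<Rightarrow> complex"
  assumes g: "integrable lborel g" and p: "0 < p"
  shows "(LINT x|lborel. g x * of_real (exp (- (norm (x - y))\<^sup>2 / (4 * p\<^sup>2)))) =
    of_real ((p / sqrt pi)^3) * (LINT \<xi>|lborel. of_real (exp (- p\<^sup>2 * (norm \<xi>)\<^sup>2)) * iexp (y \<bullet> \<xi>) * FT g \<xi>)"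
proof -
  have [measurable]: "g \<in> borel_measurable borel" using g by auto
  define \<Phi> where "\<Phi> x \<xi> = g x * (iexp ((y - x) \<bullet> \<xi>) * of_real (exp (- p\<^sup>2 * (norm \<xi>)\<^sup>2)))" for x \<xi>
  have [measurable]: "case_prod \<Phi> \<in> borel_measurable (lborel \<Otimes>\<^sub>M lborel)" unfolding \<Phi>_def by measurable
  have int: "integrable (lborel \<Otimes>\<^sub>M lborel) (case_prod \<Phi>)"
  proof (rule Bochner_Integration.integrable_bound[OF integrable_pair_mult[OF g]])
    show "integrable lborel (\<lambda>\<xi>::real^3. of_real (exp (- p\<^sup>2 * (norm \<xi>)\<^sup>2)) :: complex)"
      using integrable_gauss3_real[OF p] by simp
    show "AE z in lborel \<Otimes>\<^sub>M lborel. norm (case z of (x, y) \<Rightarrow> \<Phi> x y) \<le> norm (case z of (x, \<xi>) \<Rightarrow> g x * of_real (exp (- p\<^sup>2 * (norm \<xi>)\<^sup>2)))"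
      by (auto simp: \<Phi>_def norm_mult norm_exp_i_times split: prod.split)
  qed measurable
  have "(LINT \<xi>|lborel. of_real (exp (- p\<^sup>2 * (norm \<xi>)\<^sup>2)) * iexp (y \<bullet> \<xi>) * FT g \<xi>) = (LINT \<xi>|lborel. LINT x|lborel. \<Phi> x \<xi>)"
  proof (rule Bochner_Integration.integral_cong[OF refl])
    fix \<xi> :: "real^3"
    have "of_real (exp (- p\<^sup>2 * (norm \<xi>)\<^sup>2)) * iexp (y \<bullet> \<xi>) * FT g \<xi> =
      (LINT x|lborel. of_real (exp (- p\<^sup>2 * (norm \<xi>)\<^sup>2)) * iexp (y \<bullet> \<xi>) * (iexp (- (x \<bullet> \<xi>)) * g x))"
      unfolding FT_def by (rule integral_mult_right_zero[symmetric])
    also have "\<dots> = (LINT x|lborel. \<Phi> x \<xi>)"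
    proof (rule Bochner_Integration.integral_cong[OF refl])
      fix x
      have "iexp ((y - x) \<bullet> \<xi>) = iexp (y \<bullet> \<xi>) * iexp (- (x \<bullet> \<xi>))"
        unfolding exp_add[symmetric] by (simp add: inner_diff_left algebra_simps)
      then show "of_real (exp (- p\<^sup>2 * (norm \<xi>)\<^sup>2)) * iexp (y \<bullet> \<xi>) * (iexp (- (x \<bullet> \<xi>)) * g x) = \<Phi> x \<xi>"
        unfolding \<Phi>_def by (simp only: mult_ac)
    qed
    finally show "of_real (exp (- p\<^sup>2 * (norm \<xi>)\<^sup>2)) * iexp (y \<bullet> \<xi>) * FT g \<xi> = (LINT x|lborel. \<Phi> x \<xi>)" .
  qed
  also have "\<dots> = (LINT x|lborel. LINT \<xi>|lborel. \<Phi> x \<xi>)"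
    by (rule lborel_pair.Fubini_integral[OF int])
  also have "\<dots> = (LINT x|lborel. of_real ((sqrt pi / p)^3) * (g x * of_real (exp (- (norm (x - y))\<^sup>2 / (4 * p\<^sup>2)))))"
    unfolding \<Phi>_def using integral_gauss3[OF p]
    by (simp add: norm_minus_commute mult_ac)
  also have "\<dots> = of_real ((sqrt pi / p)^3) * (LINT x|lborel. g x * of_real (exp (- (norm (x - y))\<^sup>2 / (4 * p\<^sup>2))))"
    by (rule integral_mult_right_zero)
  finally have "(LINT \<xi>|lborel. of_real (exp (- p\<^sup>2 * (norm \<xi>)\<^sup>2)) * iexp (y \<bullet> \<xi>) * FT g \<xi>) =
    of_real ((sqrt pi / p)^3) * (LINT x|lborel. g x * of_real (exp (- (norm (x - y))\<^sup>2 / (4 * p\<^sup>2))))" .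
  moreover have "of_real ((p / sqrt pi)^3) * (of_real ((sqrt pi / p)^3) * w) = w" for w :: complex
  proof -
    have "(p / sqrt pi)^3 * (sqrt pi / p)^3 = 1" using p unfolding power_mult_distrib[symmetric] by simp
    then show ?thesis by (simp only: mult.assoc[symmetric] of_real_mult[symmetric] of_real_1 mult_1_left)
  qed
  ultimately show ?thesis by (simp only:)
qed

section \<open>Inversion and uniqueness\<close>

lemma
  fixes f :: "real^3 \<Rightarrow> 'b::{banach, second_countable_topology}"
  assumes c: "c \<noteq> 0" and [measurable]: "f \<in> borel_measurable borel"
  shows integral_affine3: "(LINT x|lborel. f x) = \<bar>c\<bar>^3 *\<^sub>R (LINT x|lborel. f (t + c *\<^sub>R x))"
proof -
  have "(LINT x|lborel. f x) = (LINT x|density (distr lborel borel (\<lambda>x. t + c *\<^sub>R x)) (\<lambda>_. ennreal (\<bar>c\<bar>^3)). f x)"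
    using lborel_affine[OF c, of t] by simp
  also have "\<dots> = (LINT x|distr lborel borel (\<lambda>x. t + c *\<^sub>R x). \<bar>c\<bar>^3 *\<^sub>R f x)"
    by (subst integral_density) auto
  also have "\<dots> = (LINT x|lborel. \<bar>c\<bar>^3 *\<^sub>R f (t + c *\<^sub>R x))"
    by (subst integral_distr) auto
  finally show ?thesis by simp
qed

text \<open>The substitution x = y + P n z fixes the Gaussian at exp (- |z|^2 / 4), whose integral
  is (2 sqrt pi)^3, and leaves h (y + P n z) to converge to h y.\<close>

lemma approx_identity:
  fixes h :: "real^3 \<Rightarrow> complex"
  assumes [measurable]: "h \<in> borel_measurable borel" and bd: "\<And>x. norm (h x) \<le> B" and cont: "isCont h y"
    and P: "\<And>n. 0 < P n" "P \<longlonglongrightarrow> 0"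
  shows "(\<lambda>n. of_real (1 / (P n)^3) * (LINT x|lborel. h x * of_real (exp (- (norm (x - y))\<^sup>2 / (4 * (P n)\<^sup>2))))) \<longlonglongrightarrow> of_real ((2 * sqrt pi)^3) * h y"
proof -
  have eq: "of_real (1 / (P n)^3) * (LINT x|lborel. h x * of_real (exp (- (norm (x - y))\<^sup>2 / (4 * (P n)\<^sup>2)))) =
    (LINT z|lborel. h (y + P n *\<^sub>R z) * of_real (exp (- (1/2)\<^sup>2 * (norm z)\<^sup>2)))" for n
  proof -
    have "(norm (y + P n *\<^sub>R z - y))\<^sup>2 / (4 * (P n)\<^sup>2) = (1/2)\<^sup>2 * (norm z)\<^sup>2" for z
      using P(1)[of n] by (simp add: power_mult_distrib power_divide)
    then have "(LINT x|lborel. h x * of_real (exp (- (norm (x - y))\<^sup>2 / (4 * (P n)\<^sup>2)))) =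
      \<bar>P n\<bar>^3 *\<^sub>R (LINT z|lborel. h (y + P n *\<^sub>R z) * of_real (exp (- (1/2)\<^sup>2 * (norm z)\<^sup>2)))"
      using P(1)[of n] by (subst integral_affine3[of "P n" _ y]) (auto simp: minus_divide_left[symmetric])
    then show ?thesis using P(1)[of n] by (simp add: scaleR_conv_of_real power3_eq_cube)
  qed
  have i: "integrable lborel (\<lambda>z::real^3. exp (- (1/2)\<^sup>2 * (norm z)\<^sup>2))" by (rule integrable_gauss3_real) simp
  have "(\<lambda>n. LINT z|lborel. h (y + P n *\<^sub>R z) * of_real (exp (- (1/2)\<^sup>2 * (norm z)\<^sup>2))) \<longlonglongrightarrow>
    (LINT z|lborel. h y * of_real (exp (- (1/2)\<^sup>2 * (norm (z::real^3))\<^sup>2)))"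
  proof (rule integral_dominated_convergence[where w="\<lambda>z. B * exp (- (1/2)\<^sup>2 * (norm z)\<^sup>2)"])
    show "integrable lborel (\<lambda>z::real^3. B * exp (- (1/2)\<^sup>2 * (norm z)\<^sup>2))" by (intro integrable_mult_right i)
    show "AE z in lborel. (\<lambda>n. h (y + P n *\<^sub>R z) * of_real (exp (- (1/2)\<^sup>2 * (norm z)\<^sup>2))) \<longlonglongrightarrow> h y * of_real (exp (- (1/2)\<^sup>2 * (norm z)\<^sup>2))"
    proof (rule AE_I2)
      fix z :: "real^3"
      have "(\<lambda>n. y + P n *\<^sub>R z) \<longlonglongrightarrow> y + 0 *\<^sub>R z" by (intro tendsto_intros P)
      then have "(\<lambda>n. y + P n *\<^sub>R z) \<longlonglongrightarrow> y" by simp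
      then have "(\<lambda>n. h (y + P n *\<^sub>R z)) \<longlonglongrightarrow> h y" using cont by (simp add: continuous_at_sequentially o_def)
      then show "(\<lambda>n. h (y + P n *\<^sub>R z) * of_real (exp (- (1/2)\<^sup>2 * (norm z)\<^sup>2))) \<longlonglongrightarrow> h y * of_real (exp (- (1/2)\<^sup>2 * (norm z)\<^sup>2))"
        by (intro tendsto_intros)
    qed
    show "AE z in lborel. norm (h (y + P n *\<^sub>R z) * of_real (exp (- (1/2)\<^sup>2 * (norm z)\<^sup>2))) \<le> B * exp (- (1/2)\<^sup>2 * (norm z)\<^sup>2)" for n
      using bd by (intro AE_I2) (simp add: norm_mult mult_right_mono)
  qed auto
  moreover have "(LINT z|lborel. h y * of_real (exp (- (1/2)\<^sup>2 * (norm (z::real^3))\<^sup>2))) = of_real ((2 * sqrt pi)^3) * h y"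
  proof -
    have "(LINT z|lborel. of_real (exp (- (1/2)\<^sup>2 * (norm (z::real^3))\<^sup>2)) :: complex) = of_real ((sqrt pi / (1/2))^3 * exp (- (norm (0::real^3))\<^sup>2 / (4 * (1/2)\<^sup>2)))"
      using integral_gauss3[of "1/2" 0] by simp
    then have "(LINT z|lborel. of_real (exp (- (1/2)\<^sup>2 * (norm (z::real^3))\<^sup>2)) :: complex) = of_real ((2 * sqrt pi)^3)"
      by (simp add: mult.commute)
    then show ?thesis by (simp only: integral_mult_right_zero mult.commute)
  qed
  ultimately show ?thesis unfolding eq by (simp only:)
qed

text \<open>In \<open>integral_mult_gauss\<close> let p tend to 0: the left side, divided by p^3, is
  an approximate identity and the integral on the right is dominated by |FT f|. The constant is (2
  sqrt pi)^3 (sqrt pi)^3 = 8 pi^3.\<close>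

lemma Fourier_inversion:
  fixes f :: "real^3 \<Rightarrow> complex"
  assumes cont: "continuous_on UNIV f" and bd: "\<And>x. norm (f x) \<le> B" and i: "integrable lborel f" and iF: "integrable lborel (FT f)"
  shows "(LINT \<xi>|lborel. iexp (y \<bullet> \<xi>) * FT f \<xi>) = of_real (8 * pi^3) * f y"
proof -
  have [measurable]: "f \<in> borel_measurable borel" using i by auto
  define P where "P n = 1 / real (Suc n)" for n
  have P: "0 < P n" for n by (simp add: P_def)
  have P0: "P \<longlonglongrightarrow> 0" unfolding P_def by (rule LIMSEQ_Suc[OF lim_1_over_n])
  have "(\<lambda>n. of_real (1 / (P n)^3) * (LINT x|lborel. f x * of_real (exp (- (norm (x - y))\<^sup>2 / (4 * (P n)\<^sup>2))))) \<longlonglongrightarrow> of_real ((2 * sqrt pi)^3) * f y"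
    by (rule approx_identity[OF _ bd _ P P0]) (use cont in \<open>auto simp: continuous_on_eq_continuous_at\<close>)
  moreover have "of_real (1 / (P n)^3) * (LINT x|lborel. f x * of_real (exp (- (norm (x - y))\<^sup>2 / (4 * (P n)\<^sup>2)))) =
    of_real ((1 / sqrt pi)^3) * (LINT \<xi>|lborel. of_real (exp (- (P n)\<^sup>2 * (norm \<xi>)\<^sup>2)) * iexp (y \<bullet> \<xi>) * FT f \<xi>)" for n
  proof -
    have "1 / (P n)^3 * (P n / sqrt pi)^3 = (1 / sqrt pi)^3" using P[of n] by (simp add: power_divide)
    then show ?thesis unfolding integral_mult_gauss[OF i P] by (simp only: mult.assoc[symmetric] of_real_mult[symmetric])
  qed
  ultimately have 1: "(\<lambda>n. of_real ((1 / sqrt pi)^3) * (LINT \<xi>|lborel. of_real (exp (- (P n)\<^sup>2 * (norm \<xi>)\<^sup>2)) * iexp (y \<bullet> \<xi>) * FT f \<xi>)) \<longlonglongrightarrow> of_real ((2 * sqrt pi)^3) * f y"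
    by simp
  have "(\<lambda>n. LINT \<xi>|lborel. of_real (exp (- (P n)\<^sup>2 * (norm \<xi>)\<^sup>2)) * iexp (y \<bullet> \<xi>) * FT f \<xi>) \<longlonglongrightarrow> (LINT \<xi>|lborel. iexp (y \<bullet> \<xi>) * FT f \<xi>)"
  proof (rule integral_dominated_convergence[where w="\<lambda>\<xi>. norm (FT f \<xi>)"])
    show "AE \<xi> in lborel. (\<lambda>n. of_real (exp (- (P n)\<^sup>2 * (norm \<xi>)\<^sup>2)) * iexp (y \<bullet> \<xi>) * FT f \<xi>) \<longlonglongrightarrow> iexp (y \<bullet> \<xi>) * FT f \<xi>"
    proof (rule AE_I2)
      fix \<xi> :: "real^3"
      have "(\<lambda>n. of_real (exp (- (P n)\<^sup>2 * (norm \<xi>)\<^sup>2)) * iexp (y \<bullet> \<xi>) * FT f \<xi>) \<longlonglongrightarrow> of_real (exp (- 0\<^sup>2 * (norm \<xi>)\<^sup>2)) * iexp (y \<bullet> \<xi>) * FT f \<xi>"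
        by (intro tendsto_intros P0)
      then show "(\<lambda>n. of_real (exp (- (P n)\<^sup>2 * (norm \<xi>)\<^sup>2)) * iexp (y \<bullet> \<xi>) * FT f \<xi>) \<longlonglongrightarrow> iexp (y \<bullet> \<xi>) * FT f \<xi>"
        by simp
    qed
    show "AE \<xi> in lborel. norm (of_real (exp (- (P n)\<^sup>2 * (norm \<xi>)\<^sup>2)) * iexp (y \<bullet> \<xi>) * FT f \<xi>) \<le> norm (FT f \<xi>)" for n
      by (intro AE_I2) (auto simp: norm_mult norm_exp_i_times intro!: mult_left_le_one_le)
  qed (use iF in auto)
  then have "(\<lambda>n. of_real ((1 / sqrt pi)^3) * (LINT \<xi>|lborel. of_real (exp (- (P n)\<^sup>2 * (norm \<xi>)\<^sup>2)) * iexp (y \<bullet> \<xi>) * FT f \<xi>)) \<longlonglongrightarrow> of_real ((1 / sqrt pi)^3) * (LINT \<xi>|lborel. iexp (y \<bullet> \<xi>) * FT f \<xi>)"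
    by (rule tendsto_mult_left)
  with 1 have e: "of_real ((1 / sqrt pi)^3) * (LINT \<xi>|lborel. iexp (y \<bullet> \<xi>) * FT f \<xi>) = of_real ((2 * sqrt pi)^3) * f y"
    using LIMSEQ_unique by blast
  have s: "sqrt pi ^ 3 * (1 / sqrt pi)^3 = 1" "sqrt pi ^ 3 * (2 * sqrt pi)^3 = 8 * pi^3"
  proof -
    have "sqrt pi ^ 3 * sqrt pi ^ 3 = pi ^ 3" unfolding power_mult_distrib[symmetric] by simp
    then show "sqrt pi ^ 3 * (2 * sqrt pi)^3 = 8 * pi^3" by (simp add: power_mult_distrib)
    show "sqrt pi ^ 3 * (1 / sqrt pi)^3 = 1" unfolding power_mult_distrib[symmetric] by simp
  qed
  have "(LINT \<xi>|lborel. iexp (y \<bullet> \<xi>) * FT f \<xi>) = of_real (sqrt pi ^ 3 * (1 / sqrt pi)^3) * (LINT \<xi>|lborel. iexp (y \<bullet> \<xi>) * FT f \<xi>)"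
    unfolding s by simp
  also have "\<dots> = of_real (sqrt pi ^ 3) * (of_real ((2 * sqrt pi)^3) * f y)"
    unfolding of_real_mult mult.assoc e ..
  also have "\<dots> = of_real (8 * pi^3) * f y" unfolding s(2)[symmetric] by (simp only: of_real_mult mult.assoc)
  finally show ?thesis .
qed

text \<open>Since g may be unbounded, the approximate identity is applied to its cutoff h to the
  unit ball around y. The Gaussian means of g vanish by hypothesis, and the discarded part is at
  most P^-3 exp (- 1 / (4 P^2)) times the L^1 norm of g, which tends to 0.\<close>

lemma Fourier_unique:
  fixes g :: "real^3 \<Rightarrow> complex"
  assumes cont: "continuous_on UNIV g" and i: "integrable lborel g" and z: "\<And>\<xi>. FT g \<xi> = 0"
  shows "g y = 0"
proof -
  have [measurable]: "g \<in> borel_measurable borel" using i by auto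
  have [measurable]: "ball y 1 \<in> sets borel" by simp
  define h where "h x = indicator (ball y 1) x *\<^sub>R g x" for x
  have [measurable]: "h \<in> borel_measurable borel" unfolding h_def by measurable
  define P where "P n = 1 / real (Suc n)" for n
  have P: "0 < P n" for n by (simp add: P_def)
  have P0: "P \<longlonglongrightarrow> 0" unfolding P_def by (rule LIMSEQ_Suc[OF lim_1_over_n])
  have "bounded (g ` cball y 1)"
    by (intro compact_imp_bounded compact_continuous_image continuous_on_subset[OF cont]) auto
  then obtain B where B: "\<forall>x\<in>cball y 1. norm (g x) \<le> B" unfolding bounded_iff by auto
  have B0: "0 \<le> B" using B by (meson centre_in_cball norm_ge_zero order_trans zero_le_one)
  have hb: "norm (h x) \<le> B" for x
  proof (cases "x \<in> ball y 1")
    case True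
    then have "x \<in> cball y 1" by simp
    then show ?thesis using B True by (simp add: h_def)
  qed (use B0 in \<open>simp add: h_def\<close>)
  have hc: "isCont h y"
  proof -
    have "isCont g y" using cont by (simp add: continuous_on_eq_continuous_at)
    moreover have "\<forall>\<^sub>F x in nhds y. g x = h x"
    proof -
      have "\<forall>\<^sub>F x in nhds y. x \<in> ball y 1" by (rule eventually_nhds_in_open) auto
      then show ?thesis by eventually_elim (simp add: h_def)
    qed
    ultimately show ?thesis using isCont_cong[of g h y] by simp
  qed
  define E where "E n x = exp (- (norm (x - y))\<^sup>2 / (4 * (P n)\<^sup>2))" for n x
  have [measurable]: "E n \<in> borel_measurable borel" for n unfolding E_def by measurable
  have E1: "norm (E n x) \<le> 1" for n x by (simp add: E_def)
  have lim1: "(\<lambda>n. of_real (1 / (P n)^3) * (LINT x|lborel. h x * of_real (E n x))) \<longlonglongrightarrow> of_real ((2 * sqrt pi)^3) * h y"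
    unfolding E_def by (rule approx_identity[OF _ hb hc P P0]) measurable
  have lim2: "(\<lambda>n. of_real (1 / (P n)^3) * (LINT x|lborel. h x * of_real (E n x))) \<longlonglongrightarrow> 0"
  proof (rule Lim_null_comparison)
    have gE: "integrable lborel (\<lambda>x. g x * of_real (E n x))" for n
      by (rule Bochner_Integration.integrable_bound[OF i]) (use E1 in \<open>auto simp: norm_mult intro!: mult_left_le\<close>)
    have hE: "integrable lborel (\<lambda>x. h x * of_real (E n x))" for n
      by (rule Bochner_Integration.integrable_bound[OF i]) (use E1 in \<open>auto simp: norm_mult h_def indicator_def intro!: mult_left_le\<close>)
    have "norm (LINT x|lborel. h x * of_real (E n x)) \<le> exp (- 1 / (4 * (P n)\<^sup>2)) * (LINT x|lborel. norm (g x))" for n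
    proof -
      have "(LINT x|lborel. g x * of_real (E n x)) = 0"
        unfolding E_def integral_mult_gauss[OF i P] z by simp
      then have "(LINT x|lborel. h x * of_real (E n x)) = (LINT x|lborel. h x * of_real (E n x) - g x * of_real (E n x))"
        using gE hE by simp
      also have "norm \<dots> \<le> (LINT x|lborel. norm (h x * of_real (E n x) - g x * of_real (E n x)))"
        by (rule integral_norm_bound)
      also have "\<dots> \<le> (LINT x|lborel. exp (- 1 / (4 * (P n)\<^sup>2)) * norm (g x))"
      proof (rule integral_mono)
        show "integrable lborel (\<lambda>x. norm (h x * of_real (E n x) - g x * of_real (E n x)))"
          by (intro integrable_norm Bochner_Integration.integrable_diff gE hE)
        show "integrable lborel (\<lambda>x. exp (- 1 / (4 * (P n)\<^sup>2)) * norm (g x))" using i by simp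
        fix x
        show "norm (h x * of_real (E n x) - g x * of_real (E n x)) \<le> exp (- 1 / (4 * (P n)\<^sup>2)) * norm (g x)"
        proof (cases "x \<in> ball y 1")
          case False
          then have "1 \<le> (norm (x - y))\<^sup>2" by (intro one_le_power) (simp add: dist_norm norm_minus_commute)
          then have "E n x \<le> exp (- 1 / (4 * (P n)\<^sup>2))"
            unfolding E_def by (intro exp_le_cancel_iff[THEN iffD2] divide_right_mono) auto
          then have "norm (g x) * E n x \<le> norm (g x) * exp (- 1 / (4 * (P n)\<^sup>2))"
            by (rule mult_left_mono) simp
          moreover have "norm (h x * of_real (E n x) - g x * of_real (E n x)) = norm (g x) * E n x"
            using False by (simp add: h_def norm_mult E_def)
          ultimately show ?thesis by (simp only: mult.commute)
        qed (simp add: h_def)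
      qed
      also have "\<dots> = exp (- 1 / (4 * (P n)\<^sup>2)) * (LINT x|lborel. norm (g x))" by simp
      finally show ?thesis .
    qed
    then have "norm (of_real (1 / (P n)^3) * (LINT x|lborel. h x * of_real (E n x))) \<le> 1 / (P n)^3 * (exp (- 1 / (4 * (P n)\<^sup>2)) * (LINT x|lborel. norm (g x)))" for n
      using P[of n] by (simp add: norm_mult norm_divide norm_power divide_right_mono)
    then show "\<forall>\<^sub>F n in sequentially. norm (of_real (1 / (P n)^3) * (LINT x|lborel. h x * of_real (E n x)) :: complex) \<le> 1 / (P n)^3 * exp (- 1 / (4 * (P n)\<^sup>2)) * (LINT x|lborel. norm (g x))"
      by (simp only: mult.assoc eventually_sequentially) blast
    have "(\<lambda>n. 1 / (P n)^3 * exp (- 1 / (4 * (P n)\<^sup>2))) \<longlonglongrightarrow> 0"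
      unfolding P_def by real_asymp
    then have "(\<lambda>n. 1 / (P n)^3 * exp (- 1 / (4 * (P n)\<^sup>2)) * (LINT x|lborel. norm (g x))) \<longlonglongrightarrow> 0 * (LINT x|lborel. norm (g x))"
      by (intro tendsto_mult tendsto_const)
    then show "(\<lambda>n. 1 / (P n)^3 * exp (- 1 / (4 * (P n)\<^sup>2)) * (LINT x|lborel. norm (g x))) \<longlonglongrightarrow> 0" by simp
  qed
  have "of_real ((2 * sqrt pi)^3) * h y = 0" using LIMSEQ_unique[OF lim1 lim2] .
  then show ?thesis by (simp add: h_def)
qed

subsection \<open>The half-Laplacian of a Schwartz function\<close>

lemma partials_bounded_linear:
  fixes f :: "real^3 \<Rightarrow> 'a::real_normed_vector" and L :: "'a \<Rightarrow> 'b::real_normed_vector"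
  assumes L: "bounded_linear L" and sm: "smooth f"
  shows "partials is (\<lambda>x. L (f x)) = (\<lambda>x. L (partials is f x))"
proof (induction "is")
  case Nil then show ?case by (simp add: partials_def)
next
  case (Cons i js)
  have "partial i (\<lambda>x. L (partials js f x)) x = L (partial i (partials js f) x)" for x
  proof -
    have "partials js f differentiable (at x)" using sm by (simp add: smooth_def differentiable_on_def)
    then have D: "(partials js f has_derivative frechet_derivative (partials js f) (at x)) (at x)"
      by (simp add: frechet_derivative_works)
    have "((\<lambda>x. L (partials js f x)) has_derivative (\<lambda>h. L (frechet_derivative (partials js f) (at x) h))) (at x)"
      by (rule bounded_linear.has_derivative[OF L D])
    from frechet_derivative_at[OF this] show ?thesis unfolding partial_def by metis
  qed
  then have "partial i (partials js (\<lambda>x. L (f x))) = (\<lambda>x. L (partial i (partials js f) x))"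
    unfolding Cons.IH by (simp add: fun_eq_iff)
  then show ?case by (simp add: partials_def)
qed

text \<open>Used with L = Re and L = Im to bring the calculus of real functions to Schwartz
  functions.\<close>

lemma schwartz_component_Ck:
  assumes \<phi>: "\<phi> \<in> schwartz" and L: "bounded_linear L" and L1: "\<And>z. \<bar>L z\<bar> \<le> norm (z::complex)"
  shows "Ck rapid_decay n (\<lambda>x::real^3. L (\<phi> x))"
proof -
  have sm: "smooth \<phi>" and bd: "\<And>k is. bounded (range (\<lambda>x. norm x ^ k * norm (partials is \<phi> x)))"
    using \<phi> by (auto simp: schwartz_def)
  let ?f = "\<lambda>js x. L (partials js \<phi> x)"
  have diff0: "partials js \<phi> differentiable (at x)" for js x
    using sm by (simp add: smooth_def differentiable_on_def)
  have diff: "?f js differentiable (at x)" for js x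
    using bounded_linear.has_derivative[OF L iffD1[OF frechet_derivative_works diff0]] unfolding differentiable_def by blast
  have cont: "continuous_on UNIV (?f js)" for js
    by (auto simp: continuous_on_eq_continuous_at intro!: differentiable_imp_continuous_within diff)
  have rd: "rapid_decay (?f js)" for js
    unfolding rapid_decay_def
  proof
    fix n
    obtain A where A: "\<And>x. norm x ^ 0 * norm (partials js \<phi> x) \<le> A"
      using bd[of 0 js] unfolding bounded_iff by auto
    obtain B where B: "\<And>x. norm x ^ n * norm (partials js \<phi> x) \<le> B"
      using bd[of n js] unfolding bounded_iff by auto
    have "\<bar>?f js x\<bar> * (1 + norm x)^n \<le> 2^n * (A + B)" for x
    proof -
      have "(1 + norm x)^n \<le> 2^n * (1 + norm x ^ n)"
      proof (cases "norm x \<le> 1")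
        case True
        then have "(1 + norm x)^n \<le> 2^n" by (intro power_mono) auto
        also have "\<dots> \<le> 2^n * (1 + norm x ^ n)" by simp
        finally show ?thesis .
      next
        case False
        then have "(1 + norm x)^n \<le> (2 * norm x)^n" by (intro power_mono) auto
        also have "\<dots> \<le> 2^n * (1 + norm x ^ n)" by (simp add: power_mult_distrib)
        finally show ?thesis .
      qed
      then have "\<bar>?f js x\<bar> * (1 + norm x)^n \<le> norm (partials js \<phi> x) * (2^n * (1 + norm x ^ n))"
        by (intro mult_mono L1) auto
      also have "\<dots> = 2^n * (norm x ^ 0 * norm (partials js \<phi> x) + norm x ^ n * norm (partials js \<phi> x))"
        by (simp add: algebra_simps)
      also have "\<dots> \<le> 2^n * (A + B)" by (intro mult_left_mono add_mono A B) simp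
      finally show ?thesis .
    qed
    then show "\<exists>C. \<forall>x. \<bar>?f js x\<bar> * (1 + norm x)^n \<le> C" by blast
  qed
  have "Ck rapid_decay n (?f js)" for js
  proof (induction n arbitrary: js)
    case 0 then show ?case using cont rd by simp
  next
    case (Suc n)
    have "partial i (?f js) = ?f (i # js)" for i
    proof -
      have "partial i (partials js (\<lambda>x. L (\<phi> x))) = partials (i # js) (\<lambda>x. L (\<phi> x))" by (simp add: partials_def)
      then show ?thesis unfolding partials_bounded_linear[OF L sm] .
    qed
    then show ?case using Suc diff rd by simp
  qed
  from this[of "[]"] show ?thesis by (simp add: partials_def)
qed

lemma trig_Ck:
  fixes \<xi> :: "real^3"
  shows "Ck poly_growth (Suc 0) (\<lambda>x. cos (x \<bullet> \<xi>))" "Ck poly_growth (Suc 0) (\<lambda>x. sin (x \<bullet> \<xi>))"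
    "partial i (\<lambda>x. cos (x \<bullet> \<xi>)) = (\<lambda>x. - (\<xi> $ i) * sin (x \<bullet> \<xi>))"
    "partial i (\<lambda>x. sin (x \<bullet> \<xi>)) = (\<lambda>x. \<xi> $ i * cos (x \<bullet> \<xi>))"
proof -
  have D: "((\<lambda>x. cos (x \<bullet> \<xi>)) has_derivative (\<lambda>h. (- sin (x \<bullet> \<xi>) *\<^sub>R \<xi>) \<bullet> h)) (at x)"
    "((\<lambda>x. sin (x \<bullet> \<xi>)) has_derivative (\<lambda>h. (cos (x \<bullet> \<xi>) *\<^sub>R \<xi>) \<bullet> h)) (at x)" for x
    by (auto intro!: derivative_eq_intros simp: inner_commute mult.commute)
  show p: "partial i (\<lambda>x. cos (x \<bullet> \<xi>)) = (\<lambda>x. - (\<xi> $ i) * sin (x \<bullet> \<xi>))"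
    "partial i (\<lambda>x. sin (x \<bullet> \<xi>)) = (\<lambda>x. \<xi> $ i * cos (x \<bullet> \<xi>))" for i
    by (auto simp: partial_eq_nth[OF D(1)] partial_eq_nth[OF D(2)])
  have g: "poly_growth (\<lambda>x. c * cos (x \<bullet> \<xi>))" "poly_growth (\<lambda>x. c * sin (x \<bullet> \<xi>))" for c
    unfolding poly_growth_def by (rule exI[of _ "\<bar>c\<bar>"], rule exI[of _ 0], simp add: abs_mult mult_left_le)+
  have d: "(\<lambda>x. cos (x \<bullet> \<xi>)) differentiable (at x)" "(\<lambda>x. sin (x \<bullet> \<xi>)) differentiable (at x)" for x
    using D unfolding differentiable_def by blast+
  have c: "continuous_on UNIV (\<lambda>x. - (\<xi> $ i) * sin (x \<bullet> \<xi>))" "continuous_on UNIV (\<lambda>x. \<xi> $ i * cos (x \<bullet> \<xi>))" for i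
    by (intro continuous_intros)+
  show "Ck poly_growth (Suc 0) (\<lambda>x. cos (x \<bullet> \<xi>))" "Ck poly_growth (Suc 0) (\<lambda>x. sin (x \<bullet> \<xi>))"
    using d c g(1)[of 1] g(2)[of 1] g(1)[of "\<xi> $ i" for i] g(2)[of "- (\<xi> $ i)" for i] by (simp_all add: p)
qed

text \<open>Four integrations by parts bound xi_i^4 times the transform, and decay of order 4 makes
  the transform integrable in dimension three. Cosine and sine parts are treated separately because
  \<open>Ck\<close> is a class of real functions.\<close>

lemma rapid_FT_bound:
  assumes f: "\<And>n. Ck rapid_decay n f"
  shows "\<exists>C. \<forall>\<xi>. norm (FT (\<lambda>x. of_real (f x)) \<xi>) \<le> C / (1 + norm \<xi>)^4"
proof -
  define c s where "c g \<xi> = (LINT x|lborel. cos (x \<bullet> \<xi>) * g x)" and "s g \<xi> = (LINT x|lborel. sin (x \<bullet> \<xi>) * g x)" for g :: "real^3 \<Rightarrow> real" and \<xi>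
  have cs: "c (partial i g) \<xi> = \<xi> $ i * s g \<xi>" "s (partial i g) \<xi> = - (\<xi> $ i) * c g \<xi>" if "Ck rapid_decay (Suc 0) g" for i g \<xi>
    using integral_by_parts[OF trig_Ck(1)[of \<xi>] that, of i] integral_by_parts[OF trig_Ck(2)[of \<xi>] that, of i]
    unfolding trig_Ck(3,4) c_def s_def by (simp_all add: mult.assoc)
  have bound: "\<bar>c g \<xi>\<bar> \<le> (LINT x|lborel. \<bar>g x\<bar>)" "\<bar>s g \<xi>\<bar> \<le> (LINT x|lborel. \<bar>g x\<bar>)" if "Ck rapid_decay 0 g" for g \<xi>
  proof -
    have i: "integrable lborel g" by (rule decays_integrable[OF Ck_rapid_decays[OF that]])
    have [measurable]: "g \<in> borel_measurable borel" using i by auto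
    have b: "\<bar>LINT x|lborel. t (x \<bullet> \<xi>) * g x\<bar> \<le> (LINT x|lborel. \<bar>g x\<bar>)" if t: "\<And>u. \<bar>t u\<bar> \<le> 1" "t \<in> borel_measurable borel" for t :: "real \<Rightarrow> real"
    proof -
      note [measurable] = t(2)
      have le: "norm (t (x \<bullet> \<xi>) * g x) \<le> \<bar>g x\<bar>" for x
        using t(1) by (simp add: abs_mult mult_left_le_one_le)
      have "integrable lborel (\<lambda>x. t (x \<bullet> \<xi>) * g x)"
        by (rule Bochner_Integration.integrable_bound[OF i]) (use le in auto)
      then have "(LINT x|lborel. norm (t (x \<bullet> \<xi>) * g x)) \<le> (LINT x|lborel. \<bar>g x\<bar>)"
        using i le by (intro integral_mono) auto
      then show ?thesis using integral_norm_bound[of lborel "\<lambda>x. t (x \<bullet> \<xi>) * g x"] by (simp only: real_norm_def)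
    qed
    show "\<bar>c g \<xi>\<bar> \<le> (LINT x|lborel. \<bar>g x\<bar>)" "\<bar>s g \<xi>\<bar> \<le> (LINT x|lborel. \<bar>g x\<bar>)"
      unfolding c_def s_def by (auto intro!: b)
  qed
  define N where "N g = (LINT x|lborel. \<bar>g x\<bar>)" for g :: "real^3 \<Rightarrow> real"
  define f4 where "f4 i = partials [i, i, i, i] f" for i
  have Cp: "Ck rapid_decay n (partials js f)" for n js by (rule Ck_partials) (rule f)
  have p: "partials (i # js) f = partial i (partials js f)" for i js by (simp add: partials_def)
  \<comment> \<open>Cosine and sine parts alternate, and after four derivatives each returns to
    itself with a positive sign.\<close>
  have c4: "c (f4 i) \<xi> = (\<xi> $ i)^4 * c f \<xi>" "s (f4 i) \<xi> = (\<xi> $ i)^4 * s f \<xi>" for i \<xi>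
  proof -
    have nil: "partials [] f = f" by (simp add: partials_def)
    have st: "c (partials (i # js) f) \<xi> = \<xi> $ i * s (partials js f) \<xi>" "s (partials (i # js) f) \<xi> = - (\<xi> $ i) * c (partials js f) \<xi>" for i js
      unfolding p by (rule cs[OF Cp])+
    show "c (f4 i) \<xi> = (\<xi> $ i)^4 * c f \<xi>" "s (f4 i) \<xi> = (\<xi> $ i)^4 * s f \<xi>"
      unfolding f4_def st nil by (simp_all add: eval_nat_numeral)
  qed
  define A where "A = N f + (\<Sum>i\<in>UNIV. N (f4 i))"
  \<comment> \<open>The constant comes from (1 + r)^4 <= 8 (1 + r^4), |xi|^4 <= 3 S and 8 (1 + 3 S)
    <= 72 (1 + S), where S is the sum of the xi_i^4. It is doubled below for the two parts.\<close>
  have main: "t * (1 + norm \<xi>)^4 \<le> 72 * A"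
    if t: "0 \<le> t" "t \<le> N f" "\<And>i. (\<xi> $ i)^4 * t \<le> N (f4 i)" for t and \<xi> :: "real^3"
  proof -
    have a: "(1 + r)^4 \<le> 8 * (1 + r^4)" if "0 \<le> r" for r :: real
    proof -
      have "(1 + r)\<^sup>2 \<le> 2 * (1 + r\<^sup>2)" using zero_le_power2[of "r - 1"] by (simp add: power2_eq_square algebra_simps)
      then have "((1 + r)\<^sup>2)\<^sup>2 \<le> (2 * (1 + r\<^sup>2))\<^sup>2" by (intro power_mono) auto
      also have "\<dots> = 4 * (1 + r\<^sup>2)\<^sup>2" by algebra
      also have "(1 + r\<^sup>2)\<^sup>2 \<le> 2 * (1 + (r\<^sup>2)\<^sup>2)" using zero_le_power2[of "r\<^sup>2 - 1"] by (simp add: power2_eq_square algebra_simps)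
      finally show ?thesis by (simp add: power_mult[symmetric])
    qed
    have b: "norm \<xi> ^ 4 \<le> 3 * ((\<xi>$1)^4 + (\<xi>$2)^4 + (\<xi>$3)^4)"
    proof -
      have "norm \<xi> ^ 4 = ((norm \<xi>)\<^sup>2)\<^sup>2" by (simp add: power_mult[symmetric])
      also have "(norm \<xi>)\<^sup>2 = (\<xi>$1)\<^sup>2 + (\<xi>$2)\<^sup>2 + (\<xi>$3)\<^sup>2"
        unfolding power2_norm_eq_inner inner_vec_def sum_3 by (simp add: power2_eq_square)
      also have "((\<xi>$1)\<^sup>2 + (\<xi>$2)\<^sup>2 + (\<xi>$3)\<^sup>2)\<^sup>2 \<le> 3 * (((\<xi>$1)\<^sup>2)\<^sup>2 + ((\<xi>$2)\<^sup>2)\<^sup>2 + ((\<xi>$3)\<^sup>2)\<^sup>2)"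
      proof -
        have "(a + b + c)\<^sup>2 \<le> 3 * (a\<^sup>2 + b\<^sup>2 + c\<^sup>2)" for a b c :: real
          using zero_le_power2[of "a - b"] zero_le_power2[of "b - c"] zero_le_power2[of "a - c"]
          by (simp add: power2_eq_square algebra_simps)
        then show ?thesis .
      qed
      finally show ?thesis by (simp add: power_mult[symmetric])
    qed
    have S: "(\<Sum>i\<in>UNIV. (\<xi> $ i)^4 * t) \<le> (\<Sum>i\<in>UNIV. N (f4 i))" by (intro sum_mono t)
    have "(1 + norm \<xi>)^4 \<le> 8 * (1 + 3 * ((\<xi>$1)^4 + (\<xi>$2)^4 + (\<xi>$3)^4))" using a[of "norm \<xi>"] b by simp
    also have "\<dots> \<le> 72 * (1 + ((\<xi>$1)^4 + (\<xi>$2)^4 + (\<xi>$3)^4))" by simp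
    finally have "t * (1 + norm \<xi>)^4 \<le> t * (72 * (1 + ((\<xi>$1)^4 + (\<xi>$2)^4 + (\<xi>$3)^4)))" using t(1) by (rule mult_left_mono)
    also have "\<dots> = 72 * (t + (\<Sum>i\<in>UNIV. (\<xi> $ i)^4 * t))" by (simp add: sum_3 algebra_simps)
    also have "\<dots> \<le> 72 * A" unfolding A_def using S t(2) by (intro mult_left_mono add_mono) auto
    finally show ?thesis .
  qed
  have "norm (FT (\<lambda>x. of_real (f x)) \<xi>) \<le> 144 * A / (1 + norm \<xi>)^4" for \<xi>
  proof -
    have i: "integrable lborel f" by (rule decays_integrable[OF Ck_rapid_decays[OF f]])
    have [measurable]: "f \<in> borel_measurable borel" using i by auto
    have ic: "integrable lborel (\<lambda>x. cos (x \<bullet> \<xi>) * f x)" "integrable lborel (\<lambda>x. sin (x \<bullet> \<xi>) * f x)"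
      by (rule Bochner_Integration.integrable_bound[OF i]; simp add: abs_mult mult_left_le_one_le)+
    have "iexp (- (x \<bullet> \<xi>)) * of_real (f x) = of_real (cos (x \<bullet> \<xi>) * f x) - \<i> * of_real (sin (x \<bullet> \<xi>) * f x)" for x
      by (simp add: complex_eq_iff Re_exp Im_exp)
    then have "FT (\<lambda>x. of_real (f x)) \<xi> = (LINT x|lborel. of_real (cos (x \<bullet> \<xi>) * f x) - \<i> * of_real (sin (x \<bullet> \<xi>) * f x))"
      by (simp add: FT_def)
    also have "\<dots> = of_real (c f \<xi>) - \<i> * of_real (s f \<xi>)"
      using ic by (simp add: c_def s_def del: of_real_mult)
    finally have "norm (FT (\<lambda>x. of_real (f x)) \<xi>) \<le> \<bar>c f \<xi>\<bar> + \<bar>s f \<xi>\<bar>"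
      using norm_triangle_ineq4[of "of_real (c f \<xi>) :: complex" "\<i> * of_real (s f \<xi>)"] by (simp add: norm_mult)
    moreover have "\<bar>c f \<xi>\<bar> * (1 + norm \<xi>)^4 \<le> 72 * A" "\<bar>s f \<xi>\<bar> * (1 + norm \<xi>)^4 \<le> 72 * A"
    proof -
      have 4: "(\<xi> $ i)^4 * \<bar>c f \<xi>\<bar> = \<bar>c (f4 i) \<xi>\<bar>" "(\<xi> $ i)^4 * \<bar>s f \<xi>\<bar> = \<bar>s (f4 i) \<xi>\<bar>" for i
        unfolding c4 by (simp_all add: abs_mult)
      show "\<bar>c f \<xi>\<bar> * (1 + norm \<xi>)^4 \<le> 72 * A" "\<bar>s f \<xi>\<bar> * (1 + norm \<xi>)^4 \<le> 72 * A"
        using bound[OF f] bound[OF Cp] unfolding f4_def[symmetric] by (auto intro!: main simp: 4 N_def f4_def)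
    qed
    ultimately have "norm (FT (\<lambda>x. of_real (f x)) \<xi>) * (1 + norm \<xi>)^4 \<le> 144 * A"
      using mult_right_mono[of "norm (FT (\<lambda>x. of_real (f x)) \<xi>)" "\<bar>c f \<xi>\<bar> + \<bar>s f \<xi>\<bar>" "(1 + norm \<xi>)^4"] by (simp add: distrib_right)
    moreover have "0 < (1 + norm \<xi>)^4" by (intro zero_less_power add_pos_nonneg) auto
    ultimately show ?thesis by (simp only: pos_le_divide_eq)
  qed
  then show ?thesis by blast
qed

lemma gradient_bound:
  fixes f :: "real^3 \<Rightarrow> real" and g :: "real^3 \<Rightarrow> real^3"
  assumes S: "convex S" and d: "\<And>z. z \<in> S \<Longrightarrow> (f has_derivative (\<lambda>h. g z \<bullet> h)) (at z)"
    and B: "\<And>z. z \<in> S \<Longrightarrow> norm (g z) \<le> B" and ab: "a \<in> S" "b \<in> S"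
  shows "\<bar>f a - f b\<bar> \<le> B * norm (a - b)"
proof -
  have "norm (f a - f b) \<le> B * norm (a - b)"
  proof (rule differentiable_bound[OF S _ _ ab])
    fix z assume z: "z \<in> S"
    show "(f has_derivative (\<lambda>h. g z \<bullet> h)) (at z within S)" by (rule has_derivative_at_withinI[OF d[OF z]])
    show "onorm (\<lambda>h. g z \<bullet> h) \<le> B"
    proof (rule onorm_le)
      fix h
      have "norm (g z \<bullet> h) \<le> norm (g z) * norm h" using Cauchy_Schwarz_ineq2 by simp
      also have "\<dots> \<le> B * norm h" using B[OF z] by (rule mult_right_mono) simp
      finally show "norm (g z \<bullet> h) \<le> B * norm h" .
    qed
  qed
  then show ?thesis by simp
qed

text \<open>The second difference is the change of z |-> f (z + y) - f z between x - y and x, and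
  the gradient of that function is a difference of gradients of f. Two applications of the mean
  value inequality give |y|^2.\<close>

lemma second_difference_bound:
  fixes f :: "real^3 \<Rightarrow> real"
  assumes f: "Ck rapid_decay (Suc (Suc 0)) f"
  shows "\<exists>C\<ge>0. \<forall>x y. norm y \<le> 1 \<longrightarrow> \<bar>2 * f x - f (x + y) - f (x - y)\<bar> \<le> C * (norm y)\<^sup>2 / (1 + norm x)^5"
proof -
  have fi: "Ck rapid_decay (Suc 0) (partial i f)" for i using f by simp
  have "\<exists>C. \<forall>x. norm (grad (partial i f) x) \<le> C / (1 + norm x)^5" for i
    using decays_grad(1)[OF fi[of i]] by (auto simp: decays_def)
  then obtain C where C: "\<And>i x. norm (grad (partial i f) x) \<le> C i / (1 + norm x)^5" by metis
  define c where "c = (\<Sum>i\<in>UNIV. C i)"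
  have C0: "0 \<le> C i" for i using C[of i 0] order_trans[OF norm_ge_zero C[of i 0]] by simp
  have c0: "0 \<le> c" unfolding c_def by (intro sum_nonneg C0)
  have d1: "(f has_derivative (\<lambda>h. grad f z \<bullet> h)) (at z)" for z using f by (intro has_derivative_grad) simp
  have d2: "(partial i f has_derivative (\<lambda>h. grad (partial i f) z \<bullet> h)) (at z)" for i z using fi[of i] by (intro has_derivative_grad) simp
  have "\<bar>2 * f x - f (x + y) - f (x - y)\<bar> \<le> 3^5 * c * (norm y)\<^sup>2 / (1 + norm x)^5" if y: "norm y \<le> 1" for x y
  proof -
    \<comment> \<open>All intermediate points lie within distance 2 of x, where 1 + |x| <= 3 (1 +
      |z|); hence the factor 3^5.\<close>
    have pb: "norm (grad (partial i f) z) \<le> 3^5 * C i / (1 + norm x)^5" if z: "z \<in> cball x 2" for i z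
    proof -
      have gen: "a \<le> b + c \<Longrightarrow> 0 \<le> b \<Longrightarrow> c \<le> 2 \<Longrightarrow> 1 + a \<le> 3 * (1 + b)" for a b c :: real
        by argo
      have "1 + norm x \<le> 3 * (1 + norm z)"
        using z unfolding mem_cball dist_norm by (rule gen[OF norm_triangle_sub[of x z] norm_ge_zero])
      then have "(1 + norm x)^5 \<le> (3 * (1 + norm z))^5" by (intro power_mono) auto
      then have "(1 + norm x)^5 \<le> 3^5 * (1 + norm z)^5" by (simp only: power_mult_distrib)
      moreover have "0 < (1 + norm z)^5" "0 < (1 + norm x)^5" by (auto intro!: zero_less_power add_pos_nonneg)
      ultimately have "1 / (1 + norm z)^5 \<le> 3^5 / (1 + norm x)^5" by (simp add: divide_simps)
      then have "C i * (1 / (1 + norm z)^5) \<le> C i * (3^5 / (1 + norm x)^5)" by (rule mult_left_mono[OF _ C0])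
      then show ?thesis using C[of i z] by (simp add: mult.commute)
    qed
    have gb: "norm (grad f (z + y) - grad f z) \<le> 3^5 * c / (1 + norm x)^5 * norm y" if z: "z \<in> cball x 1" for z
    proof -
      have in2: "z + y \<in> cball x 2" "z \<in> cball x 2"
        using z y norm_triangle_ineq4[of "x - z" y] by (auto simp: dist_norm diff_diff_eq)
      have "norm (grad f (z + y) - grad f z) \<le> (\<Sum>i\<in>UNIV. \<bar>(grad f (z + y) - grad f z) $ i\<bar>)" by (rule norm_le_l1_cart)
      also have "\<dots> \<le> (\<Sum>i\<in>UNIV. 3^5 * C i / (1 + norm x)^5 * norm y)"
      proof (rule sum_mono)
        fix i
        have "\<bar>partial i f (z + y) - partial i f z\<bar> \<le> 3^5 * C i / (1 + norm x)^5 * norm (z + y - z)"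
          by (rule gradient_bound[OF convex_cball d2 pb in2])
        then show "\<bar>(grad f (z + y) - grad f z) $ i\<bar> \<le> 3^5 * C i / (1 + norm x)^5 * norm y" by (simp add: grad_def)
      qed
      also have "\<dots> = 3^5 * c / (1 + norm x)^5 * norm y"
        unfolding c_def by (simp only: sum_distrib_left sum_distrib_right sum_divide_distrib)
      finally show ?thesis .
    qed
    have "\<bar>(f (x + y) - f x) - (f ((x - y) + y) - f (x - y))\<bar> \<le> 3^5 * c / (1 + norm x)^5 * norm y * norm (x - (x - y))"
    proof (rule gradient_bound[where S="cball x 1" and f="\<lambda>z. f (z + y) - f z" and g="\<lambda>z. grad f (z + y) - grad f z", OF convex_cball _ gb])
      fix z
      have "((\<lambda>z. f (z + y)) has_derivative (\<lambda>h. grad f (z + y) \<bullet> h)) (at z)"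
        by (rule has_derivative_compose[where f="\<lambda>z. z + y" and g=f, OF _ d1]) (auto intro!: derivative_eq_intros)
      then show "((\<lambda>z. f (z + y) - f z) has_derivative (\<lambda>h. (grad f (z + y) - grad f z) \<bullet> h)) (at z)"
        unfolding inner_diff_left by (intro has_derivative_diff d1)
    qed (use y in \<open>auto simp: dist_norm\<close>)
    moreover have "(f (x + y) - f x) - (f ((x - y) + y) - f (x - y)) = - (2 * f x - f (x + y) - f (x - y))" by simp
    ultimately have "\<bar>2 * f x - f (x + y) - f (x - y)\<bar> \<le> 3^5 * c / (1 + norm x)^5 * norm y * norm y"
      by (simp only: abs_minus_cancel) simp
    then show ?thesis by (simp add: power2_eq_square)
  qed
  then show ?thesis using c0 by (intro exI[of _ "3^5 * c"]) auto
qed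

text \<open>Up to constants, a majorant of the second difference of a Schwartz function times
  |y|^-4: near 0 the cancellation gains |y|^2, elsewhere boundedness suffices.\<close>

definition diff_weight :: "real^3 \<Rightarrow> real" where
  "diff_weight y = (if norm y \<le> 1 then 1 / (norm y)\<^sup>2 else 1 / (norm y)^4)"

lemma diff_weight_measurable[measurable]: "diff_weight \<in> borel_measurable borel"
  unfolding diff_weight_def by measurable

lemma diff_weight_nonneg: "0 \<le> diff_weight y"
  by (simp add: diff_weight_def)

lemma integrable_diff_weight: "integrable lborel diff_weight"
proof (rule integrableI_bounded)
  have [measurable]: "ball (0::real^3) 1 \<in> sets borel" "cball (0::real^3) 1 \<in> sets borel" by simp_all
  have "(\<integral>\<^sup>+y. ennreal (norm (diff_weight y)) \<partial>lborel) =
    (\<integral>\<^sup>+y. ennreal (1 / (norm (y::real^3))\<^sup>2) * indicator (ball 0 1) y + ennreal (1 / (norm y)^4) * indicator (- cball 0 1) y \<partial>lborel)"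
  proof (rule nn_integral_cong_AE)
    show "AE y in lborel. ennreal (norm (diff_weight y)) = ennreal (1 / (norm (y::real^3))\<^sup>2) * indicator (ball 0 1) y + ennreal (1 / (norm y)^4) * indicator (- cball 0 1) y"
      using AE_norm_neq[of 1] by eventually_elim (auto simp: diff_weight_def)
  qed
  also have "\<dots> = ennreal (4 * pi) + ennreal (4 * pi)"
    by (subst nn_integral_add) (auto simp: nn_integral_inverse_norm_sq_ball nn_integral_inverse_norm_pow4_outside)
  also have "\<dots> < \<infinity>" by simp
  finally show "(\<integral>\<^sup>+y. ennreal (norm (diff_weight y)) \<partial>lborel) < \<infinity>" .
qed measurable

text \<open>2 - 2 cos (y . xi) is the Fourier multiplier of the second difference with step y, so
  this is the multiplier of its integral against |y|^-4.\<close>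

definition sphere_symbol :: "real^3 \<Rightarrow> real" where
  "sphere_symbol \<xi> = (LINT y|lborel. (2 - 2 * cos (y \<bullet> \<xi>)) * (1 / (norm y)^4))"

text \<open>2 - 2 cos t = 4 sin^2 (t / 2) is at most 4 and at most t^2; the first bound serves large
  |y|, the second small |y|.\<close>

lemma sphere_symbol_bound:
  "\<bar>(2 - 2 * cos (y \<bullet> \<xi>)) * (1 / (norm y)^4)\<bar> \<le> (4 + (norm \<xi>)\<^sup>2) * diff_weight y"
proof -
  have c: "0 \<le> 2 - 2 * cos t" "2 - 2 * cos t \<le> 4" "2 - 2 * cos t \<le> t\<^sup>2" for t :: real
  proof -
    show "0 \<le> 2 - 2 * cos t" by simp
    show "2 - 2 * cos t \<le> 4" using cos_ge_minus_one[of t] by linarith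
    have "2 - 2 * cos t = 4 * (sin (t / 2))\<^sup>2" using cos_double_sin[of "t / 2"] by simp
    also have "(sin (t / 2))\<^sup>2 \<le> (t / 2)\<^sup>2" using abs_sin_x_le_abs_x[of "t / 2"] unfolding abs_le_square_iff .
    finally show "2 - 2 * cos t \<le> t\<^sup>2" by (simp add: power_divide)
  qed
  show ?thesis
  proof (cases "norm y \<le> 1")
    case True
    have "(y \<bullet> \<xi>)\<^sup>2 \<le> (norm y * norm \<xi>)\<^sup>2" using Cauchy_Schwarz_ineq2[of y \<xi>] by (simp add: abs_le_square_iff[symmetric])
    then have "2 - 2 * cos (y \<bullet> \<xi>) \<le> (norm y)\<^sup>2 * (norm \<xi>)\<^sup>2" using c(3)[of "y \<bullet> \<xi>"] by (simp add: power_mult_distrib)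
    then have "(2 - 2 * cos (y \<bullet> \<xi>)) * (1 / (norm y)^4) \<le> (norm y)\<^sup>2 * (norm \<xi>)\<^sup>2 * (1 / (norm y)^4)" by (rule mult_right_mono) simp
    also have "\<dots> = (norm \<xi>)\<^sup>2 * (1 / (norm y)\<^sup>2)" by (cases "y = 0") (auto simp: eval_nat_numeral)
    also have "\<dots> \<le> (4 + (norm \<xi>)\<^sup>2) * (1 / (norm y)\<^sup>2)" by (intro mult_right_mono) auto
    finally have "(2 - 2 * cos (y \<bullet> \<xi>)) * (1 / (norm y)^4) \<le> (4 + (norm \<xi>)\<^sup>2) * diff_weight y" using True by (simp only: diff_weight_def if_True)
    moreover have "0 \<le> (2 - 2 * cos (y \<bullet> \<xi>)) * (1 / (norm y)^4)" using c(1) by (intro mult_nonneg_nonneg) auto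
    ultimately show ?thesis by linarith
  next
    case False
    have "(2 - 2 * cos (y \<bullet> \<xi>)) * (1 / (norm y)^4) \<le> (4 + (norm \<xi>)\<^sup>2) * (1 / (norm y)^4)"
    proof (rule mult_right_mono)
      show "2 - 2 * cos (y \<bullet> \<xi>) \<le> 4 + (norm \<xi>)\<^sup>2" using c(2)[of "y \<bullet> \<xi>"] zero_le_power2[of "norm \<xi>"] by linarith
    qed simp
    then have "(2 - 2 * cos (y \<bullet> \<xi>)) * (1 / (norm y)^4) \<le> (4 + (norm \<xi>)\<^sup>2) * diff_weight y" using False by (simp only: diff_weight_def if_False)
    moreover have "0 \<le> (2 - 2 * cos (y \<bullet> \<xi>)) * (1 / (norm y)^4)" using c(1) by (intro mult_nonneg_nonneg) auto
    ultimately show ?thesis by linarith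
  qed
qed

lemma sphere_symbol_integrable: "integrable lborel (\<lambda>y. (2 - 2 * cos (y \<bullet> \<xi>)) * (1 / (norm (y::real^3))^4))"
proof (rule Bochner_Integration.integrable_bound)
  show "integrable lborel (\<lambda>y. (4 + (norm \<xi>)\<^sup>2) * diff_weight y)" by (intro integrable_mult_right integrable_diff_weight)
  show "AE y in lborel. norm ((2 - 2 * cos (y \<bullet> \<xi>)) * (1 / (norm (y::real^3))^4)) \<le> norm ((4 + (norm \<xi>)\<^sup>2) * diff_weight y)"
    by (intro AE_I2) (simp only: real_norm_def order_trans[OF sphere_symbol_bound abs_ge_self])
qed measurable

text \<open>Rotation invariance and the scaling \<open>y \<mapsto> y / |\<xi>|\<close> show that the symbol is a multiple of \<open>|\<xi>|\<close>.\<close>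

lemma sphere_symbol_eq: "sphere_symbol \<xi> = norm \<xi> * sphere_symbol (axis 1 1)"
proof (cases "\<xi> = 0")
  case True then show ?thesis by (simp add: sphere_symbol_def)
next
  case False
  define r where "r = norm \<xi>"
  have r: "0 < r" using False by (simp add: r_def)
  let ?e = "axis 1 1 :: real^3"
  have "norm \<xi> = norm (r *\<^sub>R ?e)" using r by (simp add: r_def norm_axis_1)
  then obtain f where f: "orthogonal_transformation f" "f \<xi> = r *\<^sub>R ?e" by (rule orthogonal_transformation_exists)
  have "sphere_symbol \<xi> = (LINT y|lborel. (2 - 2 * cos (f y \<bullet> (r *\<^sub>R ?e))) * (1 / (norm (f y))^4))"
    unfolding sphere_symbol_def f(2)[symmetric]
    using f(1) by (simp add: orthogonal_transformation_norm orthogonal_transformation_def)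
  also have "\<dots> = (LINT y|lborel. (2 - 2 * cos (y \<bullet> (r *\<^sub>R ?e))) * (1 / (norm (y::real^3))^4))"
    by (rule integral_orthogonal[OF f(1)]) measurable
  also have "\<dots> = \<bar>1 / r\<bar>^3 *\<^sub>R (LINT y|lborel. (2 - 2 * cos ((0 + (1 / r) *\<^sub>R y) \<bullet> (r *\<^sub>R ?e))) * (1 / (norm (0 + (1 / r) *\<^sub>R (y::real^3)))^4))"
    by (rule integral_affine3) (use r in auto)
  also have "\<dots> = (1 / r)^3 * (LINT y|lborel. r^4 * ((2 - 2 * cos (y \<bullet> ?e)) * (1 / (norm (y::real^3))^4)))"
    using r by (simp add: power_divide mult.commute)
  also have "\<dots> = (1 / r)^3 * (r^4 * sphere_symbol ?e)"
    unfolding sphere_symbol_def by (subst integral_mult_right_zero) simp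
  also have "\<dots> = r * sphere_symbol ?e" using r by (simp add: eval_nat_numeral)
  finally show ?thesis by (simp add: r_def)
qed

text \<open>If it vanished, the closed set where cos (y . e_1) = 1 would have full measure, hence be
  the whole space; y = pi e_1 refutes this.\<close>

lemma sphere_symbol_pos: "0 < sphere_symbol (axis 1 1)"
proof -
  let ?h = "\<lambda>y::real^3. (2 - 2 * cos (y \<bullet> axis 1 1)) * (1 / (norm y)^4)"
  have nn: "0 \<le> ?h y" for y by (intro mult_nonneg_nonneg) auto
  have "sphere_symbol (axis 1 1) \<noteq> 0"
  proof
    assume "sphere_symbol (axis 1 1) = 0"
    then have "AE y in lborel. ?h y = 0"
      using integral_nonneg_eq_0_iff_AE[OF sphere_symbol_integrable] nn unfolding sphere_symbol_def by blast
    then have "AE y in lborel. y \<in> {y::real^3. cos (y \<bullet> axis 1 1) = 1}"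
      using AE_neq_point[of 0] by eventually_elim auto
    then have "AE y in lebesgue. y \<in> {y::real^3. cos (y \<bullet> axis 1 1) = 1}" by (rule AE_completion)
    moreover have "closed {y::real^3. cos (y \<bullet> axis 1 1) = 1}" by (intro closed_Collect_eq continuous_intros)
    ultimately have "pi *\<^sub>R axis 1 1 \<in> {y::real^3. cos (y \<bullet> axis 1 1) = 1}" by (intro mem_closed_if_AE_lebesgue)
    then show False by (simp add: inner_axis)
  qed
  moreover have "0 \<le> sphere_symbol (axis 1 1)" unfolding sphere_symbol_def by (intro integral_nonneg_AE AE_I2 nn)
  ultimately show ?thesis by simp
qed

lemma schwartz_basic:
  assumes \<phi>: "\<phi> \<in> schwartz"
  shows "continuous_on UNIV \<phi>" "integrable lborel \<phi>" "\<exists>B. \<forall>x::real^3. norm (\<phi> x) \<le> B"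
    "\<exists>C\<ge>0. \<forall>x y. norm y \<le> 1 \<longrightarrow> norm (2 * \<phi> x - \<phi> (x + y) - \<phi> (x - y)) \<le> C * (norm y)\<^sup>2 / (1 + norm x)^5"
    "\<exists>C. \<forall>\<xi>. norm (FT \<phi> \<xi>) \<le> C / (1 + norm \<xi>)^4"
proof -
  have R: "Ck rapid_decay n (\<lambda>x. Re (\<phi> x))" and I: "Ck rapid_decay n (\<lambda>x. Im (\<phi> x))" for n
    by (rule schwartz_component_Ck[OF \<phi>]; simp add: bounded_linear_Re bounded_linear_Im abs_Re_le_cmod abs_Im_le_cmod)+
  note dR = Ck_rapid_decays[OF R] and dI = Ck_rapid_decays[OF I]
  have eq: "\<phi> = (\<lambda>x. of_real (Re (\<phi> x)) + \<i> * of_real (Im (\<phi> x)))"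
    by (simp add: complex_eq fun_eq_iff)
  show "continuous_on UNIV \<phi>"
    by (subst eq) (intro continuous_intros Ck_continuous[OF R] Ck_continuous[OF I])
  have iR: "integrable lborel (\<lambda>x. complex_of_real (Re (\<phi> x)))" and iI: "integrable lborel (\<lambda>x. \<i> * complex_of_real (Im (\<phi> x)))"
    using decays_integrable[OF dR] decays_integrable[OF dI] by (auto intro!: integrable_mult_right)
  show "integrable lborel \<phi>" by (subst eq) (intro Bochner_Integration.integrable_add iR iI)
  obtain A B where AB: "\<And>x. norm (Re (\<phi> x)) \<le> A / (1 + norm x)^5" "A > 0" "\<And>x. norm (Im (\<phi> x)) \<le> B / (1 + norm x)^5" "B > 0"
    using decaysE[OF dR] decaysE[OF dI] by metis
  have "norm (\<phi> x) \<le> A + B" for x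
  proof -
    have "1 \<le> (1 + norm x)^5" by (intro one_le_power) simp
    then have "A / (1 + norm x)^5 \<le> A / 1" "B / (1 + norm x)^5 \<le> B / 1" using AB by (auto intro!: divide_left_mono add_pos_nonneg simp del: div_by_1)
    then show ?thesis using AB(1)[of x] AB(3)[of x] cmod_le[of "\<phi> x"] by simp
  qed
  then show "\<exists>B. \<forall>x::real^3. norm (\<phi> x) \<le> B" by blast
  obtain C where C: "C \<ge> 0" "\<And>x y. norm y \<le> 1 \<Longrightarrow> \<bar>2 * Re (\<phi> x) - Re (\<phi> (x + y)) - Re (\<phi> (x - y))\<bar> \<le> C * (norm y)\<^sup>2 / (1 + norm x)^5"
    using second_difference_bound[OF R] by blast
  obtain D where D: "D \<ge> 0" "\<And>x y. norm y \<le> 1 \<Longrightarrow> \<bar>2 * Im (\<phi> x) - Im (\<phi> (x + y)) - Im (\<phi> (x - y))\<bar> \<le> D * (norm y)\<^sup>2 / (1 + norm x)^5"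
    using second_difference_bound[OF I] by blast
  have "norm (2 * \<phi> x - \<phi> (x + y) - \<phi> (x - y)) \<le> (C + D) * (norm y)\<^sup>2 / (1 + norm x)^5" if "norm y \<le> 1" for x y
    using cmod_le[of "2 * \<phi> x - \<phi> (x + y) - \<phi> (x - y)"] C(2)[OF that, of x] D(2)[OF that, of x]
    by (simp add: distrib_right add_divide_distrib)
  then show "\<exists>C\<ge>0. \<forall>x y. norm y \<le> 1 \<longrightarrow> norm (2 * \<phi> x - \<phi> (x + y) - \<phi> (x - y)) \<le> C * (norm y)\<^sup>2 / (1 + norm x)^5"
    using C(1) D(1) by (intro exI[of _ "C + D"]) auto
  obtain E F where EF: "\<And>\<xi>. norm (FT (\<lambda>x. of_real (Re (\<phi> x))) \<xi>) \<le> E / (1 + norm \<xi>)^4" "\<And>\<xi>. norm (FT (\<lambda>x. of_real (Im (\<phi> x))) \<xi>) \<le> F / (1 + norm \<xi>)^4"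
    using rapid_FT_bound[OF R] rapid_FT_bound[OF I] by blast
  have "norm (FT \<phi> \<xi>) \<le> (E + F) / (1 + norm \<xi>)^4" for \<xi>
  proof -
    have [measurable]: "(\<lambda>x. Re (\<phi> x)) \<in> borel_measurable borel" "(\<lambda>x. Im (\<phi> x)) \<in> borel_measurable borel"
      using dR dI by (auto simp: decays_measurable)
    have j: "integrable lborel (\<lambda>x. iexp (- (x \<bullet> \<xi>)) * of_real (Re (\<phi> x)))" "integrable lborel (\<lambda>x. iexp (- (x \<bullet> \<xi>)) * of_real (Im (\<phi> x)))"
      by (rule Bochner_Integration.integrable_bound[OF decays_integrable[OF dR]]; simp add: norm_mult)
         (rule Bochner_Integration.integrable_bound[OF decays_integrable[OF dI]]; simp add: norm_mult)
    have "FT \<phi> \<xi> = (LINT x|lborel. iexp (- (x \<bullet> \<xi>)) * of_real (Re (\<phi> x)) + \<i> * (iexp (- (x \<bullet> \<xi>)) * of_real (Im (\<phi> x))))"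
      unfolding FT_def by (subst eq) (simp add: algebra_simps)
    also have "\<dots> = FT (\<lambda>x. of_real (Re (\<phi> x))) \<xi> + \<i> * FT (\<lambda>x. of_real (Im (\<phi> x))) \<xi>"
      unfolding FT_def by (subst Bochner_Integration.integral_add[OF j(1) integrable_mult_right[OF j(2)]]) simp
    finally have "norm (FT \<phi> \<xi>) \<le> norm (FT (\<lambda>x. of_real (Re (\<phi> x))) \<xi>) + norm (FT (\<lambda>x. of_real (Im (\<phi> x))) \<xi>)"
      using norm_triangle_ineq[of "FT (\<lambda>x. of_real (Re (\<phi> x))) \<xi>" "\<i> * FT (\<lambda>x. of_real (Im (\<phi> x))) \<xi>"] by (simp add: norm_mult)
    then show ?thesis using EF[of \<xi>] by (simp add: add_divide_distrib)
  qed
  then show "\<exists>C. \<forall>\<xi>. norm (FT \<phi> \<xi>) \<le> C / (1 + norm \<xi>)^4" by blast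
qed

lemma integrable_FT_schwartz:
  assumes \<phi>: "\<phi> \<in> schwartz" shows "integrable lborel (FT \<phi>)"
proof -
  obtain C where C: "\<And>\<xi>. norm (FT \<phi> \<xi>) \<le> C / (1 + norm \<xi>)^4" using schwartz_basic(5)[OF \<phi>] by blast
  have [measurable]: "\<phi> \<in> borel_measurable borel" using schwartz_basic(2)[OF \<phi>] by auto
  have "integrable lborel (\<lambda>\<xi>::real^3. C * (1 / (1 + norm \<xi>)^4))" by (intro integrable_mult_right integrable_inverse_pow4)
  then show ?thesis
  proof (rule Bochner_Integration.integrable_bound)
    show "AE \<xi> in lborel. norm (FT \<phi> \<xi>) \<le> norm (C * (1 / (1 + norm \<xi>)^4))"
      using order_trans[OF C abs_ge_self] by (intro AE_I2) (simp only: real_norm_def mult_1_right times_divide_eq_right)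
  qed measurable
qed

text \<open>The operator with symbol \<open>|\<xi>|\<close> is realised, up to the factor \<open>sphere_symbol (axis 1 1)\<close>, by the
  hypersingular integral of second differences against \<open>|y|\<^sup>-\<^sup>4\<close>.\<close>

lemma hypersingular_integral:
  assumes \<phi>: "\<phi> \<in> schwartz"
  defines "D \<equiv> \<lambda>x y. (2 * \<phi> x - \<phi> (x + y) - \<phi> (x - y)) * of_real (1 / (norm (y::real^3))^4)"
  defines "g \<equiv> \<lambda>x. LINT y|lborel. D x y"
  shows "continuous_on UNIV g" "integrable lborel g" "\<exists>B. \<forall>x. norm (g x) \<le> B"
    "FT g \<xi> = of_real (sphere_symbol \<xi>) * FT \<phi> \<xi>"
proof -
  note cont = schwartz_basic(1)[OF \<phi>] and int = schwartz_basic(2)[OF \<phi>]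
  have [measurable]: "\<phi> \<in> borel_measurable borel" using int by auto
  obtain B where B: "\<And>x. norm (\<phi> x) \<le> B" using schwartz_basic(3)[OF \<phi>] by blast
  have B0: "0 \<le> B" using B[of 0] norm_ge_zero order_trans by blast
  obtain C where C0: "C \<ge> 0" and C: "\<And>x y. norm y \<le> 1 \<Longrightarrow> norm (2 * \<phi> x - \<phi> (x + y) - \<phi> (x - y)) \<le> C * (norm y)\<^sup>2 / (1 + norm x)^5"
    using schwartz_basic(4)[OF \<phi>] by blast
  have nD: "norm (D x y) = norm (2 * \<phi> x - \<phi> (x + y) - \<phi> (x - y)) * (1 / (norm y)^4)" for x y
    by (simp add: D_def norm_mult norm_divide norm_power)
  have near: "norm (D x y) \<le> C * diff_weight y * (1 / (1 + norm x)^5)" if "norm y \<le> 1" for x y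
  proof -
    have "norm (D x y) \<le> C * (norm y)\<^sup>2 / (1 + norm x)^5 * (1 / (norm y)^4)"
      unfolding nD by (intro mult_right_mono C that) simp
    also have "\<dots> = C * ((norm y)\<^sup>2 * (1 / (norm y)^4)) * (1 / (1 + norm x)^5)" by simp
    also have "(norm y)\<^sup>2 * (1 / (norm y)^4) = diff_weight y"
      using that by (cases "y = 0") (auto simp: diff_weight_def eval_nat_numeral)
    finally show ?thesis .
  qed
  have tri: "norm (2 * \<phi> x - \<phi> (x + y) - \<phi> (x - y)) \<le> 2 * norm (\<phi> x) + norm (\<phi> (x + y)) + norm (\<phi> (x - y))" for x y
    using norm_triangle_ineq4[of "2 * \<phi> x - \<phi> (x + y)" "\<phi> (x - y)"] norm_triangle_ineq4[of "2 * \<phi> x" "\<phi> (x + y)"] by (simp add: norm_mult)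
  have far: "norm (D x y) \<le> diff_weight y * (2 * norm (\<phi> x) + norm (\<phi> (x + y)) + norm (\<phi> (x - y)))" if "\<not> norm y \<le> 1" for x y
  proof -
    have "norm (D x y) \<le> (2 * norm (\<phi> x) + norm (\<phi> (x + y)) + norm (\<phi> (x - y))) * (1 / (norm y)^4)"
      unfolding nD by (intro mult_right_mono tri) simp
    then show ?thesis using that by (simp add: diff_weight_def mult.commute)
  qed
  have bd: "norm (D x y) \<le> (C + 4 * B) * diff_weight y" for x y
  proof (cases "norm y \<le> 1")
    case True
    have "1 \<le> (1 + norm x)^5" by (intro one_le_power) simp
    then have "1 / (1 + norm x)^5 \<le> 1" using frac_le[of 1 1 1 "(1 + norm x)^5"] by simp
    then have "C * diff_weight y * (1 / (1 + norm x)^5) \<le> C * diff_weight y * 1"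
      using C0 diff_weight_nonneg by (intro mult_left_mono) auto
    also have "\<dots> \<le> (C + 4 * B) * diff_weight y" using B0 diff_weight_nonneg[of y] by (simp add: distrib_right)
    finally show ?thesis using near[OF True, of x] by linarith
  next
    case False
    have "2 * norm (\<phi> x) + norm (\<phi> (x + y)) + norm (\<phi> (x - y)) \<le> C + 4 * B"
      using B[of x] B[of "x + y"] B[of "x - y"] C0 by linarith
    then have "diff_weight y * (2 * norm (\<phi> x) + norm (\<phi> (x + y)) + norm (\<phi> (x - y))) \<le> diff_weight y * (C + 4 * B)"
      by (intro mult_left_mono diff_weight_nonneg)
    then show ?thesis using far[OF False, of x] by (simp add: mult.commute)
  qed
  have iw: "integrable lborel (\<lambda>y. (C + 4 * B) * diff_weight y)" by (intro integrable_mult_right integrable_diff_weight)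
  have Dm: "(\<lambda>(x, y). D x y) \<in> borel_measurable (borel \<Otimes>\<^sub>M borel)" unfolding D_def by measurable
  have Dx: "D x \<in> borel_measurable borel" for x unfolding D_def by measurable
  have iD: "integrable lborel (D x)" for x
    by (rule Bochner_Integration.integrable_bound[OF iw]) (use Dx in \<open>auto intro!: AE_I2 order_trans[OF bd abs_ge_self]\<close>)
  show "continuous_on UNIV g"
    unfolding g_def
  proof (rule continuous_on_integral_dominated[OF Dx])
    show "\<exists>w d. 0 < d \<and> integrable lborel w \<and> (\<forall>x. dist x x0 < d \<longrightarrow> (\<forall>z. norm (D x z) \<le> w z))" for x0
      using iw bd by (intro exI[of _ "\<lambda>y. (C + 4 * B) * diff_weight y"] exI[of _ 1]) auto
    have "isCont \<phi> z" for z using cont by (simp add: continuous_on_eq_continuous_at)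
    then show "isCont (\<lambda>x. D x y) x0" for x0 y
      unfolding D_def by (intro continuous_intros isCont_o2[where g=\<phi> and f="\<lambda>x. x + y"] isCont_o2[where g=\<phi> and f="\<lambda>x. x - y"]) auto
  qed
  have "norm (g x) \<le> (LINT y|lborel. (C + 4 * B) * diff_weight y)" for x
    unfolding g_def by (rule order_trans[OF integral_norm_bound integral_mono[OF integrable_norm[OF iD] iw bd]])
  then show "\<exists>B. \<forall>x. norm (g x) \<le> B" by blast
  define N where "N = (LINT x|lborel. norm (\<phi> x))"
  define J where "J = (LINT x|lborel. 1 / (1 + norm (x::real^3))^4)"
  have J0: "0 \<le> J" "0 \<le> N" unfolding J_def N_def by (auto intro!: integral_nonneg_AE)
  have s: "(LINT x|lborel. norm (\<phi> (x + y))) = N" "integrable lborel (\<lambda>x. \<phi> (x + y))" for y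
    using integral_shift[of "\<lambda>x. norm (\<phi> x)" y] integrable_shift[of \<phi> y] int by (simp_all add: N_def add.commute)
  have s': "(LINT x|lborel. norm (\<phi> (x - y))) = N" "integrable lborel (\<lambda>x. \<phi> (x - y))" for y
    using s[of "- y"] by simp_all
  have iy: "integrable lborel (\<lambda>x. D x y)" for y
    unfolding D_def by (intro integrable_mult_left Bochner_Integration.integrable_diff integrable_mult_right int s s')
  \<comment> \<open>An L^1 bound in x that is integrable in y; through Fubini it gives both the
    integrability of g and its transform.\<close>
  have iyb: "(LINT x|lborel. norm (D x y)) \<le> (C * J + 4 * N) * diff_weight y" for y
  proof (cases "norm y \<le> 1")
    case True
    have "(LINT x|lborel. norm (D x y)) \<le> (LINT x|lborel. C * diff_weight y * (1 / (1 + norm (x::real^3))^4))"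
    proof (rule integral_mono[OF integrable_norm[OF iy]])
      show "integrable lborel (\<lambda>x::real^3. C * diff_weight y * (1 / (1 + norm x)^4))"
        by (intro integrable_mult_right integrable_inverse_pow4)
      fix x :: "real^3"
      have "(1 + norm x)^4 \<le> (1 + norm x)^5" by (intro power_increasing) auto
      moreover have "0 < (1 + norm x)^4" by (intro zero_less_power add_pos_nonneg) auto
      ultimately have "1 / (1 + norm x)^5 \<le> 1 / (1 + norm x)^4" by (intro frac_le) auto
      then have "C * diff_weight y * (1 / (1 + norm x)^5) \<le> C * diff_weight y * (1 / (1 + norm x)^4)"
        using C0 diff_weight_nonneg by (intro mult_left_mono) auto
      then show "norm (D x y) \<le> C * diff_weight y * (1 / (1 + norm x)^4)" using near[OF True, of x] by linarith
    qed
    also have "\<dots> = C * J * diff_weight y" unfolding J_def by (subst integral_mult_right_zero) simp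
    also have "\<dots> \<le> (C * J + 4 * N) * diff_weight y" using J0 diff_weight_nonneg by (intro mult_right_mono) auto
    finally show ?thesis .
  next
    case False
    have "(LINT x|lborel. norm (D x y)) \<le> (LINT x|lborel. diff_weight y * (2 * norm (\<phi> x) + norm (\<phi> (x + y)) + norm (\<phi> (x - y))))"
      by (rule integral_mono[OF integrable_norm[OF iy] _ far[OF False]])
        (intro integrable_mult_right Bochner_Integration.integrable_add integrable_norm int s s')
    also have "\<dots> = diff_weight y * (LINT x|lborel. 2 * norm (\<phi> x) + norm (\<phi> (x + y)) + norm (\<phi> (x - y)))"
      by (rule integral_mult_right_zero)
    also have "(LINT x|lborel. 2 * norm (\<phi> x) + norm (\<phi> (x + y)) + norm (\<phi> (x - y))) = 2 * N + N + N"
      using int s[of y] s'[of y] by (simp add: N_def)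
    also have "diff_weight y * (2 * N + N + N) \<le> (C * J + 4 * N) * diff_weight y"
      using J0 C0 diff_weight_nonneg[of y] by (simp add: algebra_simps)
    finally show ?thesis .
  qed
  have iyx: "integrable (lborel \<Otimes>\<^sub>M lborel) (\<lambda>(y, x). D x y)"
  proof (rule lborel_pair.Fubini_integrable)
    show m: "(\<lambda>(y, x). D x y) \<in> borel_measurable (lborel \<Otimes>\<^sub>M lborel)" unfolding D_def by measurable
    show "AE y in lborel. integrable lborel (\<lambda>x. case (y, x) of (y, x) \<Rightarrow> D x y)" using iy by simp
    have "integrable lborel (\<lambda>y. (C * J + 4 * N) * diff_weight y)" by (intro integrable_mult_right integrable_diff_weight)
    then show "integrable lborel (\<lambda>y. LINT x|lborel. norm (case (y, x) of (y, x) \<Rightarrow> D x y))"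
    proof (rule Bochner_Integration.integrable_bound)
      have "(\<lambda>(y, x). norm (D x y)) \<in> borel_measurable (borel \<Otimes>\<^sub>M lborel)" unfolding D_def by measurable
      from lborel.borel_measurable_lebesgue_integral[OF this]
      show "(\<lambda>y. LINT x|lborel. norm (case (y, x) of (y, x) \<Rightarrow> D x y)) \<in> borel_measurable lborel" by simp
      show "AE y in lborel. norm (LINT x|lborel. norm (case (y, x) of (y, x) \<Rightarrow> D x y)) \<le> norm ((C * J + 4 * N) * diff_weight y)"
      proof (rule AE_I2)
        fix y
        have "0 \<le> (LINT x|lborel. norm (D x y))" by (intro integral_nonneg_AE) simp
        then show "norm (LINT x|lborel. norm (case (y, x) of (y, x) \<Rightarrow> D x y)) \<le> norm ((C * J + 4 * N) * diff_weight y)"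
          using iyb[of y] unfolding real_norm_def case_prod_conv by linarith
      qed
    qed
  qed
  show ig: "integrable lborel g"
    using lborel_pair.integrable_snd[of "\<lambda>y x. D x y"] iyx unfolding g_def by simp
  have sh: "(LINT x|lborel. iexp (- (x \<bullet> \<xi>)) * \<phi> (x + y)) = iexp (y \<bullet> \<xi>) * FT \<phi> \<xi>" for y
  proof -
    have "(LINT x|lborel. iexp (- (x \<bullet> \<xi>)) * \<phi> (x + y)) = (LINT x|lborel. iexp (- ((x + - y) \<bullet> \<xi>)) * \<phi> x)"
      using integral_shift[of "\<lambda>x. iexp (- (x \<bullet> \<xi>)) * \<phi> (x + y)" "- y"] by (simp add: add.commute)
    also have "\<dots> = (LINT x|lborel. iexp (y \<bullet> \<xi>) * (iexp (- (x \<bullet> \<xi>)) * \<phi> x))"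
    proof (rule Bochner_Integration.integral_cong[OF refl])
      fix x
      have "iexp (- ((x + - y) \<bullet> \<xi>)) = iexp (y \<bullet> \<xi>) * iexp (- (x \<bullet> \<xi>))"
        unfolding exp_add[symmetric] by (simp add: inner_diff_left algebra_simps)
      then show "iexp (- ((x + - y) \<bullet> \<xi>)) * \<phi> x = iexp (y \<bullet> \<xi>) * (iexp (- (x \<bullet> \<xi>)) * \<phi> x)" by (simp only: mult.assoc)
    qed
    finally show ?thesis unfolding FT_def by (simp only: integral_mult_right_zero)
  qed
  have iE: "integrable lborel (\<lambda>x. iexp (- (x \<bullet> \<xi>)) * h x)" if "integrable lborel h" for h :: "real^3 \<Rightarrow> complex"
    by (rule Bochner_Integration.integrable_bound[OF that]) (use that in \<open>auto simp: norm_mult\<close>)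
  have inner: "(LINT x|lborel. iexp (- (x \<bullet> \<xi>)) * D x y) = of_real ((2 - 2 * cos (y \<bullet> \<xi>)) * (1 / (norm y)^4)) * FT \<phi> \<xi>" for y
  proof -
    have "(LINT x|lborel. iexp (- (x \<bullet> \<xi>)) * D x y) = (LINT x|lborel. of_real (1 / (norm y)^4) *
      (2 * (iexp (- (x \<bullet> \<xi>)) * \<phi> x) - iexp (- (x \<bullet> \<xi>)) * \<phi> (x + y) - iexp (- (x \<bullet> \<xi>)) * \<phi> (x + - y)))"
    proof (rule Bochner_Integration.integral_cong[OF refl])
      have gen: "E * ((2 * p - q - r) * w) = w * (2 * (E * p) - E * q - E * r)" for E p q r w :: complex
        by (simp add: algebra_simps)
      show "iexp (- (x \<bullet> \<xi>)) * D x y = of_real (1 / (norm y)^4) *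
        (2 * (iexp (- (x \<bullet> \<xi>)) * \<phi> x) - iexp (- (x \<bullet> \<xi>)) * \<phi> (x + y) - iexp (- (x \<bullet> \<xi>)) * \<phi> (x + - y))" for x
        unfolding D_def gen by simp
    qed
    also have "\<dots> = of_real (1 / (norm y)^4) * (LINT x|lborel.
      2 * (iexp (- (x \<bullet> \<xi>)) * \<phi> x) - iexp (- (x \<bullet> \<xi>)) * \<phi> (x + y) - iexp (- (x \<bullet> \<xi>)) * \<phi> (x + - y))"
      by (rule integral_mult_right_zero)
    also have "(LINT x|lborel. 2 * (iexp (- (x \<bullet> \<xi>)) * \<phi> x) - iexp (- (x \<bullet> \<xi>)) * \<phi> (x + y) - iexp (- (x \<bullet> \<xi>)) * \<phi> (x + - y)) =
      2 * FT \<phi> \<xi> - iexp (y \<bullet> \<xi>) * FT \<phi> \<xi> - iexp (- y \<bullet> \<xi>) * FT \<phi> \<xi>"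
      by (subst Bochner_Integration.integral_diff, intro Bochner_Integration.integrable_diff integrable_mult_right iE int s, intro iE s,
          subst Bochner_Integration.integral_diff, intro integrable_mult_right iE int, intro iE s, simp only: integral_mult_right_zero sh, simp only: FT_def)
    also have "\<dots> = (2 - (iexp (y \<bullet> \<xi>) + iexp (- y \<bullet> \<xi>))) * FT \<phi> \<xi>" by (simp only: left_diff_distrib distrib_right) (simp only: diff_diff_eq)
    also have "iexp (y \<bullet> \<xi>) + iexp (- y \<bullet> \<xi>) = of_real (2 * cos (y \<bullet> \<xi>))"
      by (simp add: complex_eq_iff Re_exp Im_exp)
    finally show ?thesis by (simp add: mult_ac)
  qed
  have ie: "integrable (lborel \<Otimes>\<^sub>M lborel) (\<lambda>(y, x). iexp (- (x \<bullet> \<xi>)) * D x y)"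
  proof (rule Bochner_Integration.integrable_bound[OF iyx])
    show "(\<lambda>(y, x). iexp (- (x \<bullet> \<xi>)) * D x y) \<in> borel_measurable (lborel \<Otimes>\<^sub>M lborel)" unfolding D_def by measurable
  qed (auto simp: norm_mult)
  have "FT g \<xi> = (LINT x|lborel. LINT y|lborel. iexp (- (x \<bullet> \<xi>)) * D x y)"
    unfolding FT_def g_def by (simp only: integral_mult_right_zero)
  also have "\<dots> = (LINT y|lborel. LINT x|lborel. iexp (- (x \<bullet> \<xi>)) * D x y)"
    by (rule lborel_pair.Fubini_integral[OF ie])
  also have "\<dots> = (LINT y|lborel. of_real ((2 - 2 * cos (y \<bullet> \<xi>)) * (1 / (norm (y::real^3))^4)) * FT \<phi> \<xi>)"
    unfolding inner ..
  also have "\<dots> = of_real (sphere_symbol \<xi>) * FT \<phi> \<xi>"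
    unfolding sphere_symbol_def by (simp only: integral_mult_left_zero integral_complex_of_real)
  finally show "FT g \<xi> = of_real (sphere_symbol \<xi>) * FT \<phi> \<xi>" .
qed

lemma fourier_eq_FT: "f \<in> borel_measurable borel \<Longrightarrow> fourier f = FT f"
  unfolding fourier_def[abs_def] FT_def[abs_def] by (simp add: integral_completion)

text \<open>The hypersingular integral divided by its constant is continuous and integrable with the
  prescribed transform. \<open>Fourier_unique\<close> shows that no other function qualifies, which
  resolves the description in \<open>half_laplacian\<close>.\<close>

lemma half_laplacian_schwartz:
  fixes \<phi> :: "real^3 \<Rightarrow> complex"
  assumes \<phi>: "\<phi> \<in> schwartz"
  shows "continuous_on UNIV (half_laplacian \<phi>)" "integrable lborel (half_laplacian \<phi>)"
    "\<exists>B. \<forall>x. norm (half_laplacian \<phi> x) \<le> B" "FT (half_laplacian \<phi>) \<xi> = of_real (norm \<xi>) * FT \<phi> \<xi>"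
proof -
  define g where "g x = (LINT y|lborel. (2 * \<phi> x - \<phi> (x + y) - \<phi> (x - y)) * of_real (1 / (norm (y::real^3))^4))" for x
  note H = hypersingular_integral[OF \<phi>, folded g_def]
  define S where "S = sphere_symbol (axis 1 1)"
  have S: "0 < S" using sphere_symbol_pos by (simp add: S_def)
  define G where "G x = of_real (1 / S) * g x" for x
  have Gc: "continuous_on UNIV G" unfolding G_def by (intro continuous_intros H(1))
  have Gi: "integrable lborel G" unfolding G_def by (intro integrable_mult_right H(2))
  have Gb: "\<exists>B. \<forall>x. norm (G x) \<le> B"
  proof -
    obtain B where B: "\<And>x. norm (g x) \<le> B" using H(3) by blast
    have "norm (G x) \<le> 1 / S * B" for x
      using S B[of x] by (simp add: G_def norm_mult norm_divide divide_right_mono)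
    then show ?thesis by blast
  qed
  have GF: "FT G \<xi> = of_real (norm \<xi>) * FT \<phi> \<xi>" for \<xi>
  proof -
    have "FT G \<xi> = (LINT x|lborel. of_real (1 / S) * (iexp (- (x \<bullet> \<xi>)) * g x))"
      unfolding FT_def G_def by (simp only: mult.left_commute)
    also have "\<dots> = of_real (1 / S) * FT g \<xi>" unfolding FT_def by (rule integral_mult_right_zero)
    also have "\<dots> = of_real (1 / S * (norm \<xi> * S)) * FT \<phi> \<xi>"
      unfolding H(4) sphere_symbol_eq[of \<xi>] S_def by (simp only: of_real_mult mult.assoc)
    finally show ?thesis using S by simp
  qed
  have [measurable]: "\<phi> \<in> borel_measurable borel" "G \<in> borel_measurable borel" using schwartz_basic(2)[OF \<phi>] Gi by auto
  have "half_laplacian \<phi> = G"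
    unfolding half_laplacian_def
  proof (rule the_equality)
    show "continuous_on UNIV G \<and> integrable lebesgue G \<and> (\<forall>\<xi>. fourier G \<xi> = of_real (norm \<xi>) * fourier \<phi> \<xi>)"
      using Gc Gi GF by (simp add: fourier_eq_FT integrable_completion)
    \<comment> \<open>A competitor is only known to be continuous and integrable; uniqueness was
      proved in that generality for this reason.\<close>
    fix k assume k: "continuous_on UNIV k \<and> integrable lebesgue k \<and> (\<forall>\<xi>. fourier k \<xi> = of_real (norm \<xi>) * fourier \<phi> \<xi>)"
    then have km[measurable]: "k \<in> borel_measurable borel" by (intro borel_measurable_continuous_onI) simp
    have ki: "integrable lborel k" using k by (simp add: integrable_completion)
    have kF: "FT k \<xi> = FT G \<xi>" for \<xi> using k GF by (simp add: fourier_eq_FT)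
    have iE: "integrable lborel (\<lambda>x. iexp (- (x \<bullet> \<xi>)) * h x)" if "integrable lborel h" for h :: "real^3 \<Rightarrow> complex" and \<xi>
      by (rule Bochner_Integration.integrable_bound[OF that]) (use that in \<open>auto simp: norm_mult\<close>)
    have "FT (\<lambda>x. k x - G x) \<xi> = FT k \<xi> - FT G \<xi>" for \<xi>
      unfolding FT_def right_diff_distrib by (rule Bochner_Integration.integral_diff[OF iE[OF ki] iE[OF Gi]])
    then have "FT (\<lambda>x. k x - G x) \<xi> = 0" for \<xi> using kF by simp
    then have "k y - G y = 0" for y
      using k Gc by (intro Fourier_unique[of "\<lambda>x. k x - G x"] continuous_intros Bochner_Integration.integrable_diff ki Gi) auto
    then show "k = G" by auto
  qed
  then show "continuous_on UNIV (half_laplacian \<phi>)" "integrable lborel (half_laplacian \<phi>)"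
    "\<exists>B. \<forall>x. norm (half_laplacian \<phi> x) \<le> B" "FT (half_laplacian \<phi>) \<xi> = of_real (norm \<xi>) * FT \<phi> \<xi>"
    using Gc Gi Gb GF by auto
qed

text \<open>exp (- q / (4 p^2)) / q is a primitive in p that rises from 0 at p = 0 to 1 / q at
  infinity. With q = |x - y|^2 the inverse square becomes a superposition of the Gaussians in
  \<open>integral_mult_gauss\<close>.\<close>

lemma inverse_square_subordination:
  assumes q: "0 < (q::real)"
  shows "has_bochner_integral lborel (\<lambda>p. indicator {0<..} p * (exp (- q / (4 * p\<^sup>2)) / (2 * p^3))) (1 / q)"
proof (rule has_bochner_integral_nn_integral)
  have "(\<integral>\<^sup>+p. ennreal (exp (- q / (4 * p\<^sup>2)) / (2 * p^3)) * indicator {0<..} p \<partial>lborel) = ennreal (1 / q - 0)"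
    (is "?L = _")
  proof (rule nn_integral_FTC_Ioi[where F="\<lambda>p. exp (- q / (4 * p\<^sup>2)) / q"])
    fix p :: real assume p: "0 < p"
    have "((\<lambda>p. exp (- q / (4 * p\<^sup>2)) / q) has_real_derivative exp (- q / (4 * p\<^sup>2)) * (- (- q * (4 * (2 * p))) / (4 * p\<^sup>2)\<^sup>2) / q) (at p)"
      using p q by (auto intro!: derivative_eq_intros simp: power2_eq_square)
    moreover have "- (- q * (4 * (2 * p))) / (4 * p\<^sup>2)\<^sup>2 = q * (1 / (2 * p^3))"
      using p by (simp add: field_simps eval_nat_numeral)
    moreover have "t * (q * (1 / (2 * p^3))) / q = t / (2 * p^3)" for t using q by simp
    ultimately show "((\<lambda>p. exp (- q / (4 * p\<^sup>2)) / q) has_real_derivative exp (- q / (4 * p\<^sup>2)) / (2 * p^3)) (at p)"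
      by (simp only:)
    show "isCont (\<lambda>p. exp (- q / (4 * p\<^sup>2)) / (2 * p^3)) p" using p by (intro continuous_intros) auto
    show "0 \<le> exp (- q / (4 * p\<^sup>2)) / (2 * p^3)" using p by simp
  next
    show "((\<lambda>p. exp (- q / (4 * p\<^sup>2)) / q) \<longlongrightarrow> 0) (at_right 0)" using q by real_asymp
    show "((\<lambda>p. exp (- q / (4 * p\<^sup>2)) / q) \<longlongrightarrow> 1 / q) at_top" using q by real_asymp (simp add: inverse_eq_divide)
  qed
  moreover have "(\<integral>\<^sup>+p. ennreal (indicator {0<..} p * (exp (- q / (4 * p\<^sup>2)) / (2 * p^3))) \<partial>lborel) = ?L"
    by (intro nn_integral_cong) (simp add: indicator_def)
  ultimately show "(\<integral>\<^sup>+p. ennreal (indicator {0<..} p * (exp (- q / (4 * p\<^sup>2)) / (2 * p^3))) \<partial>lborel) = ennreal (1 / q)"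
    by simp
  show "AE p in lborel. 0 \<le> indicator {0<..} p * (exp (- q / (4 * p\<^sup>2)) / (2 * p^3))" by (auto simp: indicator_def)
qed (use q in auto)

text \<open>The integral of exp (- p^2 r^2) over p > 0 is sqrt pi / (2 r); the extra factor r is the
  symbol |xi|, which thereby cancels.\<close>

lemma half_gaussian:
  assumes r: "0 < r"
  shows "has_bochner_integral lborel (\<lambda>p. indicator {0<..} p * (exp (- p\<^sup>2 * r\<^sup>2) * r)) (sqrt pi / 2)"
proof -
  have "has_bochner_integral lborel (\<lambda>p. indicator {0..} (0 + r * p) *\<^sub>R exp (- (0 + r * p)\<^sup>2)) ((sqrt pi / 2) /\<^sub>R \<bar>r\<bar>)"
    using gaussian_moment_0 r by (subst (asm) lborel_has_bochner_integral_real_affine_iff[where c=r and t=0]) auto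
  moreover have "(sqrt pi / 2) /\<^sub>R \<bar>r\<bar> * r = sqrt pi / 2" using r by simp
  ultimately have "has_bochner_integral lborel (\<lambda>p. indicator {0..} (0 + r * p) *\<^sub>R exp (- (0 + r * p)\<^sup>2) * r) (sqrt pi / 2)"
    using has_bochner_integral_mult_left[where c=r] by metis
  then have "has_bochner_integral lborel (\<lambda>p. indicator {0..} p * (exp (- p\<^sup>2 * r\<^sup>2) * r)) (sqrt pi / 2)"
    using r by (simp add: indicator_def zero_le_mult_iff power_mult_distrib mult_ac)
  moreover have "AE p in lborel. indicator {0..} p * (exp (- p\<^sup>2 * r\<^sup>2) * r) = indicator {0<..} p * (exp (- p\<^sup>2 * r\<^sup>2) * r)"
    using AE_lborel_singleton[of 0] by eventually_elim (auto simp: indicator_def)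
  ultimately show ?thesis by (subst (asm) has_bochner_integral_cong_AE) auto
qed

text \<open>Nonnegativity of w makes the integral of |w x p * g x| over p equal to W x |g x|, so
  integrability of the superposed kernel against g justifies Fubini.\<close>

lemma subordination_swap:
  fixes w :: "real^3 \<Rightarrow> real \<Rightarrow> real" and g :: "real^3 \<Rightarrow> complex"
  assumes [measurable]: "(\<lambda>(x, p). w x p) \<in> borel_measurable (borel \<Otimes>\<^sub>M borel)" "g \<in> borel_measurable borel"
    and nn: "\<And>x p. 0 \<le> w x p" and W: "AE x in lborel. has_bochner_integral lborel (w x) (W x)"
    and i: "integrable lborel (\<lambda>x. of_real (W x) * g x)"
  shows "(LINT p|lborel. LINT x|lborel. of_real (w x p) * g x) = (LINT x|lborel. of_real (W x) * g x)"
proof -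
  have cp: "integrable lborel (\<lambda>p. of_real (w x p) * g x) \<and> (LINT p|lborel. of_real (w x p) * g x) = of_real (W x) * g x
      \<and> (LINT p|lborel. norm (of_real (w x p) * g x)) = norm (of_real (W x) * g x)"
    if h: "has_bochner_integral lborel (w x) (W x)" for x
  proof -
    have hi: "integrable lborel (w x)" "(LINT p|lborel. w x p) = W x"
      using h by (auto simp: has_bochner_integral_iff)
    have W0: "0 \<le> W x" unfolding hi(2)[symmetric] by (intro integral_nonneg_AE AE_I2 nn)
    have c: "integrable lborel (\<lambda>p. complex_of_real (w x p))" using hi(1) by simp
    have "(LINT p|lborel. of_real (w x p) * g x) = of_real (W x) * g x"
      unfolding hi(2)[symmetric] by (simp only: integral_mult_left_zero integral_complex_of_real)
    moreover have "(LINT p|lborel. norm (of_real (w x p) * g x)) = norm (of_real (W x) * g x)"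
    proof -
      have "(LINT p|lborel. norm (of_real (w x p) * g x)) = (LINT p|lborel. w x p * norm (g x))"
        using nn by (simp add: norm_mult)
      also have "\<dots> = W x * norm (g x)" unfolding hi(2)[symmetric] by (rule integral_mult_left_zero)
      finally show ?thesis using W0 by (simp add: norm_mult)
    qed
    ultimately show ?thesis using c by (auto intro!: integrable_mult_left)
  qed
  have m: "(\<lambda>(x, p). of_real (w x p) * g x) \<in> borel_measurable (borel \<Otimes>\<^sub>M borel)" by measurable
  have int: "integrable (lborel \<Otimes>\<^sub>M lborel) (\<lambda>(x, p). of_real (w x p) * g x)"
  proof (rule lborel_pair.Fubini_integrable)
    show "(\<lambda>(x, p). of_real (w x p) * g x) \<in> borel_measurable (lborel \<Otimes>\<^sub>M lborel)" using m by simp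
    show "AE x in lborel. integrable lborel (\<lambda>p. case (x, p) of (x, p) \<Rightarrow> of_real (w x p) * g x)"
      using W by eventually_elim (use cp in auto)
    have mm: "(\<lambda>x. LINT p|lborel. norm (of_real (w x p) * g x)) \<in> borel_measurable lborel"
      by measurable
    have "AE x in lborel. norm (of_real (W x) * g x) = (LINT p|lborel. norm (of_real (w x p) * g x))"
      using W by eventually_elim (use cp in auto)
    with integrable_norm[OF i] mm show "integrable lborel (\<lambda>x. LINT p|lborel. norm (case (x, p) of (x, p) \<Rightarrow> of_real (w x p) * g x))"
      unfolding case_prod_conv by (subst integrable_cong_AE[symmetric]) auto
  qed
  have "(LINT p|lborel. LINT x|lborel. of_real (w x p) * g x) = (LINT x|lborel. LINT p|lborel. of_real (w x p) * g x)"
    by (rule lborel_pair.Fubini_integral[OF int])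
  also have "\<dots> = (LINT x|lborel. of_real (W x) * g x)"
  proof (rule integral_cong_AE)
    show "(\<lambda>x. LINT p|lborel. of_real (w x p) * g x) \<in> borel_measurable lborel" by measurable
    show "(\<lambda>x. of_real (W x) * g x) \<in> borel_measurable lborel" using i by auto
    show "AE x in lborel. (LINT p|lborel. of_real (w x p) * g x) = of_real (W x) * g x"
      using W by eventually_elim (use cp in auto)
  qed
  finally show ?thesis .
qed

text \<open>Within distance 1 of y the bound B meets a singularity of integral 4 pi, and farther
  away the kernel is at most 1. The resulting bound is uniform in y.\<close>

lemma
  fixes f :: "real^3 \<Rightarrow> 'b::{banach, second_countable_topology}"
  assumes f: "integrable lborel f" and B: "\<And>x. norm (f x) \<le> B"
  shows integrable_inverse_sq_conv: "integrable lborel (\<lambda>x. (1 / (norm (x - y))\<^sup>2) *\<^sub>R f x)"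
    and inverse_sq_conv_bound: "(LINT x|lborel. norm ((1 / (norm (x - y))\<^sup>2) *\<^sub>R f x)) \<le> B * (4 * pi) + (LINT x|lborel. norm (f x))"
proof -
  have B0: "0 \<le> B" using order_trans[OF norm_ge_zero B] .
  have [measurable]: "f \<in> borel_measurable borel" using f by auto
  define k where "k z = 1 / (norm z)\<^sup>2 * indicator (ball 0 1) z" for z :: "real^3"
  have [measurable]: "ball (0::real^3) 1 \<in> sets borel" by simp
  have km[measurable]: "k \<in> borel_measurable borel" unfolding k_def by measurable
  have "has_bochner_integral lborel k (4 * pi)"
  proof (rule has_bochner_integral_nn_integral)
    show "(\<integral>\<^sup>+x. ennreal (k x) \<partial>lborel) = ennreal (4 * pi)"
      unfolding nn_integral_inverse_norm_sq_ball[symmetric] by (intro nn_integral_cong) (simp add: k_def indicator_def)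
  qed (auto simp: k_def)
  then have k: "integrable lborel k" "(LINT z|lborel. k z) = 4 * pi" by (auto simp: has_bochner_integral_iff)
  have ks: "integrable lborel (\<lambda>x. k (x - y))" "(LINT x|lborel. k (x - y)) = 4 * pi"
    using integrable_shift[of k "- y"] integral_shift[of k "- y"] k by simp_all
  have bd: "norm ((1 / (norm (x - y))\<^sup>2) *\<^sub>R f x) \<le> B * k (x - y) + norm (f x)" for x
  proof (cases "norm (x - y) < 1")
    case True
    have "1 / (norm (x - y))\<^sup>2 * norm (f x) \<le> 1 / (norm (x - y))\<^sup>2 * B" by (intro mult_left_mono B) simp
    then have "norm ((1 / (norm (x - y))\<^sup>2) *\<^sub>R f x) \<le> B * k (x - y)" using True by (simp add: k_def mult.commute)
    then show ?thesis by (rule order_trans) simp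
  next
    case False
    then have "1 / (norm (x - y))\<^sup>2 \<le> 1" using one_le_power[of "norm (x - y)" 2] by (simp add: divide_simps)
    then have "1 / (norm (x - y))\<^sup>2 * norm (f x) \<le> 1 * norm (f x)" by (rule mult_right_mono) simp
    moreover have "0 \<le> B * k (x - y)" using B0 by (simp add: k_def)
    ultimately show ?thesis by simp
  qed
  have ib: "integrable lborel (\<lambda>x. B * k (x - y) + norm (f x))" using ks f by simp
  show 1: "integrable lborel (\<lambda>x. (1 / (norm (x - y))\<^sup>2) *\<^sub>R f x)"
    by (rule Bochner_Integration.integrable_bound[OF ib]) (measurable, intro AE_I2 order_trans[OF bd], simp)
  have "(LINT x|lborel. norm ((1 / (norm (x - y))\<^sup>2) *\<^sub>R f x)) \<le> (LINT x|lborel. B * k (x - y) + norm (f x))"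
    by (rule integral_mono[OF integrable_norm[OF 1] ib bd])
  also have "\<dots> = B * (4 * pi) + (LINT x|lborel. norm (f x))" using ks f by simp
  finally show "(LINT x|lborel. norm ((1 / (norm (x - y))\<^sup>2) *\<^sub>R f x)) \<le> B * (4 * pi) + (LINT x|lborel. norm (f x))" .
qed

text \<open>Both \<open>|x - y|\<^sup>-\<^sup>2\<close> and \<open>|\<xi>|\<^sup>-\<^sup>1\<close> are superpositions of Gaussians, and the Gaussian formula
  \<open>integral_mult_gauss\<close> carries one into the other.\<close>

lemma integral_inverse_sq_half_laplacian:
  fixes \<phi> :: "real^3 \<Rightarrow> complex"
  assumes \<phi>: "\<phi> \<in> schwartz"
  shows "(LINT x|lborel. (1 / (norm (x - y))\<^sup>2) *\<^sub>R half_laplacian \<phi> x) = of_real (2 * pi\<^sup>2) * \<phi> y"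
proof -
  define g where "g = half_laplacian \<phi>"
  have gi: "integrable lborel g" and gF: "FT g \<xi> = of_real (norm \<xi>) * FT \<phi> \<xi>" for \<xi>
    using half_laplacian_schwartz[OF \<phi>] by (auto simp: g_def)
  obtain B where B: "\<And>x. norm (g x) \<le> B" using half_laplacian_schwartz(3)[OF \<phi>] by (auto simp: g_def)
  have [measurable]: "g \<in> borel_measurable borel" "\<phi> \<in> borel_measurable borel" using gi schwartz_basic(2)[OF \<phi>] by auto
  define w where "w x p = indicator {0<..} p * (exp (- (norm (x - y))\<^sup>2 / (4 * p\<^sup>2)) / (2 * p^3))" for x and p :: real
  define v where "v \<xi> p = indicator {0<..} p * (exp (- p\<^sup>2 * (norm \<xi>)\<^sup>2) * norm \<xi>)" for \<xi> :: "real^3" and p :: real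
  define c where "c = 1 / (2 * (sqrt pi)^3)"
  have "(LINT x|lborel. (1 / (norm (x - y))\<^sup>2) *\<^sub>R g x) = (LINT x|lborel. of_real (1 / (norm (x - y))\<^sup>2) * g x)"
    by (simp only: scaleR_conv_of_real)
  also have "\<dots> = (LINT p|lborel. LINT x|lborel. of_real (w x p) * g x)"
  proof (rule subordination_swap[symmetric])
    show "(\<lambda>(x, p). w x p) \<in> borel_measurable (borel \<Otimes>\<^sub>M borel)" unfolding w_def by measurable
    show "0 \<le> w x p" for x p by (auto simp: w_def indicator_def)
    show "AE x in lborel. has_bochner_integral lborel (w x) (1 / (norm (x - y))\<^sup>2)"
      using AE_neq_point[of y]
    proof eventually_elim
      case (elim x)
      then show ?case unfolding w_def[abs_def] by (intro inverse_square_subordination) simp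
    qed
    show "integrable lborel (\<lambda>x. of_real (1 / (norm (x - y))\<^sup>2) * g x)"
      using integrable_inverse_sq_conv[OF gi B] by (simp only: scaleR_conv_of_real)
  qed simp
  also have "\<dots> = (LINT p|lborel. of_real c * (LINT \<xi>|lborel. of_real (v \<xi> p) * (iexp (y \<bullet> \<xi>) * FT \<phi> \<xi>)))"
  proof (rule Bochner_Integration.integral_cong[OF refl])
    fix p :: real
    show "(LINT x|lborel. of_real (w x p) * g x) = of_real c * (LINT \<xi>|lborel. of_real (v \<xi> p) * (iexp (y \<bullet> \<xi>) * FT \<phi> \<xi>))"
    proof (cases "0 < p")
      case False then show ?thesis by (simp add: w_def v_def)
    next
      case True
      have "(LINT x|lborel. of_real (w x p) * g x) = (LINT x|lborel. of_real (1 / (2 * p^3)) * (g x * of_real (exp (- (norm (x - y))\<^sup>2 / (4 * p\<^sup>2)))))"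
        using True by (intro Bochner_Integration.integral_cong[OF refl]) (simp add: w_def)
      also have "\<dots> = of_real (1 / (2 * p^3)) * (LINT x|lborel. g x * of_real (exp (- (norm (x - y))\<^sup>2 / (4 * p\<^sup>2))))"
        by (rule integral_mult_right_zero)
      also have "\<dots> = of_real (1 / (2 * p^3) * (p / sqrt pi)^3) * (LINT \<xi>|lborel. of_real (exp (- p\<^sup>2 * (norm \<xi>)\<^sup>2)) * iexp (y \<bullet> \<xi>) * FT g \<xi>)"
        unfolding integral_mult_gauss[OF gi True] of_real_mult by (simp only: mult.assoc)
      \<comment> \<open>The powers of p cancel: the weight p^-3 of the first superposition becomes
        Lebesgue measure in p, as the second one requires.\<close>
      also have "1 / (2 * p^3) * (p / sqrt pi)^3 = c" using True by (simp add: c_def power_divide)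
      also have "(LINT \<xi>|lborel. of_real (exp (- p\<^sup>2 * (norm \<xi>)\<^sup>2)) * iexp (y \<bullet> \<xi>) * FT g \<xi>) = (LINT \<xi>|lborel. of_real (v \<xi> p) * (iexp (y \<bullet> \<xi>) * FT \<phi> \<xi>))"
      proof (rule Bochner_Integration.integral_cong[OF refl])
        have gen: "E * I * (R * F) = E * R * (I * F)" for E I R F :: complex by (simp add: mult_ac)
        fix \<xi> :: "real^3"
        have "v \<xi> p = exp (- p\<^sup>2 * (norm \<xi>)\<^sup>2) * norm \<xi>" using True by (simp add: v_def)
        then show "of_real (exp (- p\<^sup>2 * (norm \<xi>)\<^sup>2)) * iexp (y \<bullet> \<xi>) * FT g \<xi> = of_real (v \<xi> p) * (iexp (y \<bullet> \<xi>) * FT \<phi> \<xi>)"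
          by (simp only: gF of_real_mult gen)
      qed
      finally show ?thesis .
    qed
  qed
  also have "\<dots> = of_real c * (LINT p|lborel. LINT \<xi>|lborel. of_real (v \<xi> p) * (iexp (y \<bullet> \<xi>) * FT \<phi> \<xi>))"
    by (rule integral_mult_right_zero)
  also have "(LINT p|lborel. LINT \<xi>|lborel. of_real (v \<xi> p) * (iexp (y \<bullet> \<xi>) * FT \<phi> \<xi>)) = (LINT \<xi>|lborel. of_real (sqrt pi / 2) * (iexp (y \<bullet> \<xi>) * FT \<phi> \<xi>))"
  proof (rule subordination_swap)
    show "(\<lambda>(\<xi>, p). v \<xi> p) \<in> borel_measurable (borel \<Otimes>\<^sub>M borel)" unfolding v_def by measurable
    show "(\<lambda>\<xi>. iexp (y \<bullet> \<xi>) * FT \<phi> \<xi>) \<in> borel_measurable borel" by measurable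
    show "0 \<le> v x p" for x p by (auto simp: v_def indicator_def)
    show "AE \<xi> in lborel. has_bochner_integral lborel (v \<xi>) (sqrt pi / 2)"
      using AE_neq_point[of 0]
    proof eventually_elim
      case (elim \<xi>)
      then show ?case unfolding v_def[abs_def] by (intro half_gaussian) simp
    qed
    show "integrable lborel (\<lambda>\<xi>. of_real (sqrt pi / 2) * (iexp (y \<bullet> \<xi>) * FT \<phi> \<xi>))"
      by (intro integrable_mult_right Bochner_Integration.integrable_bound[OF integrable_FT_schwartz[OF \<phi>]])
        (measurable, simp add: norm_mult)
  qed
  also have "\<dots> = of_real (sqrt pi / 2) * (LINT \<xi>|lborel. iexp (y \<bullet> \<xi>) * FT \<phi> \<xi>)" by (rule integral_mult_right_zero)
  also have "(LINT \<xi>|lborel. iexp (y \<bullet> \<xi>) * FT \<phi> \<xi>) = of_real (8 * pi^3) * \<phi> y"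
  proof -
    obtain B' where "\<And>x. norm (\<phi> x) \<le> B'" using schwartz_basic(3)[OF \<phi>] by blast
    then show ?thesis by (rule Fourier_inversion[OF schwartz_basic(1)[OF \<phi>] _ schwartz_basic(2)[OF \<phi>] integrable_FT_schwartz[OF \<phi>]])
  qed
  also have "of_real c * (of_real (sqrt pi / 2) * (of_real (8 * pi^3) * \<phi> y)) = of_real (c * (sqrt pi / 2) * (8 * pi^3)) * \<phi> y"
    by (simp only: of_real_mult mult.assoc)
  \<comment> \<open>The three factors come from the Gaussian formula, from
    \<open>half_gaussian\<close> and from Fourier inversion.\<close>
  also have "c * (sqrt pi / 2) * (8 * pi^3) = 2 * pi\<^sup>2"
  proof -
    have "s \<noteq> 0 \<Longrightarrow> 1 / (2 * s^3) * (s / 2) * (8 * (s\<^sup>2)^3) = 2 * (s\<^sup>2)\<^sup>2" for s :: real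
      by (simp add: field_simps eval_nat_numeral)
    from this[of "sqrt pi"] show ?thesis by (simp add: c_def)
  qed
  finally show ?thesis unfolding g_def .
qed

subsection \<open>Regularity of the fixed point\<close>

lemma Ck_const: "Ck poly_growth n (\<lambda>x. c)"
proof (induction n arbitrary: c)
  case 0 show ?case by (simp add: poly_growth_const)
next
  case (Suc n)
  have "partial i (\<lambda>x::real^3. c) = (\<lambda>x. 0)" for i
    using partial_eq_frechet[OF has_derivative_const] by auto
  then show ?case using Suc by (simp add: poly_growth_const)
qed

lemma Ck_coordinate: "Ck poly_growth n (\<lambda>x. c * x $ i)"
proof -
  have g: "poly_growth (\<lambda>x. c * x $ i)"
    unfolding poly_growth_def
  proof (intro exI allI)
    fix x :: "real^3"
    have "\<bar>x $ i\<bar> \<le> (1 + norm x)^1" using component_le_norm_cart[of x i] by simp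
    then show "\<bar>c * x $ i\<bar> \<le> \<bar>c\<bar> * (1 + norm x)^1" unfolding abs_mult by (rule mult_left_mono) simp
  qed
  have d: "((\<lambda>x. c * x $ i) has_derivative (\<lambda>h. c * h $ i)) (at x)" for x :: "real^3"
    by (intro has_derivative_mult_right bounded_linear_imp_has_derivative bounded_linear_vec_nth)
  have "partial j (\<lambda>x::real^3. c * x $ i) = (\<lambda>x. c * axis j 1 $ i)" for j
    using partial_eq_frechet[OF d] by auto
  moreover have "(\<lambda>x. c * x $ i) differentiable (at x)" for x :: "real^3"
    using d unfolding differentiable_def by blast
  ultimately show ?thesis using g by (cases n) (auto intro!: continuous_intros simp: Ck_const)
qed

lemma norm_sq_has_derivative:
  "((\<lambda>x. (norm x)\<^sup>2) has_derivative (\<lambda>h. (2 *\<^sub>R x) \<bullet> h)) (at (x::'a::real_inner))"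
  unfolding power2_norm_eq_inner by (auto intro!: derivative_eq_intros simp: inner_commute)

lemma Ck_norm_sq: "Ck poly_growth n (\<lambda>x. (norm x)\<^sup>2)"
proof -
  have g: "poly_growth (\<lambda>x. (norm x)\<^sup>2)"
    unfolding poly_growth_def
  proof (intro exI allI)
    fix x :: "real^3"
    have "(norm x)\<^sup>2 \<le> (1 + norm x)\<^sup>2" by (intro power_mono) auto
    then show "\<bar>(norm x)\<^sup>2\<bar> \<le> 1 * (1 + norm x)\<^sup>2" by simp
  qed
  have "partial i (\<lambda>x::real^3. (norm x)\<^sup>2) = (\<lambda>x. 2 * x $ i)" for i
    using partial_eq_nth[OF norm_sq_has_derivative] by auto
  moreover have "(\<lambda>x. (norm x)\<^sup>2) differentiable (at x)" for x :: "real^3"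
    using norm_sq_has_derivative unfolding differentiable_def by blast
  ultimately show ?thesis using g by (cases n) (auto intro!: continuous_intros simp: Ck_coordinate)
qed

text \<open>The candidate for u, with k = \<alpha> / A. The quadratic term is written as a sum of
  products so that \<open>Ck_add\<close> and \<open>Ck_mult\<close> apply directly.\<close>

definition log_profile :: "real \<Rightarrow> real \<Rightarrow> real \<Rightarrow> (real^3 \<Rightarrow> real) \<Rightarrow> real^3 \<Rightarrow> real" where
  "log_profile k c b a x = k * pot a x + (c + - b * (norm x)\<^sup>2)"

lemma Ck_log_profile:
  assumes "Ck rapid_decay n a" shows "Ck poly_growth (Suc n) (log_profile k c b a)"
proof -
  note add = Ck_add[of poly_growth, OF poly_growth_add] and mult = Ck_mult[of poly_growth poly_growth poly_growth, OF poly_growth_mult poly_growth_add]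
  show ?thesis
    unfolding log_profile_def[abs_def]
    by (rule add[OF _ _ mult[OF _ _ _ _ Ck_const Ck_pot[OF assms]] add[OF _ _ Ck_const mult[OF _ _ _ _ Ck_const Ck_norm_sq]]])
qed

text \<open>Bootstrap: if a has n derivatives then its exponent has n + 1, and each partial
  derivative of a is 3 a times one of the exponent, hence has n.\<close>

lemma Ck_exp_fixed:
  assumes a: "\<And>x. a x = K * exp (3 * log_profile k c b a x)" and cont: "continuous_on UNIV a" and dec: "rapid_decay a"
  shows "Ck rapid_decay n a"
proof (induction n)
  case 0 show ?case using cont dec by simp
next
  case (Suc n)
  let ?u = "log_profile k c b a"
  have u: "Ck poly_growth (Suc n) ?u" by (rule Ck_log_profile[OF Suc])
  have d: "(a has_derivative (\<lambda>h. ((a x * 3) *\<^sub>R grad ?u x) \<bullet> h)) (at x)" for x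
  proof -
    have du: "(?u has_derivative (\<lambda>h. grad ?u x \<bullet> h)) (at x)" using u by (intro has_derivative_grad) simp
    have "((\<lambda>x. K * exp (3 * ?u x)) has_derivative (\<lambda>h. K * (3 * (grad ?u x \<bullet> h) * exp (3 * ?u x)))) (at x)"
      by (intro has_derivative_mult_right has_derivative_exp du)
    moreover have "K * (3 * (grad ?u x \<bullet> h) * exp (3 * ?u x)) = ((a x * 3) *\<^sub>R grad ?u x) \<bullet> h" for h
      by (subst a[of x]) simp
    moreover have "(\<lambda>x. K * exp (3 * ?u x)) = a" using a by auto
    ultimately show ?thesis by simp
  qed
  have "partial i a = (\<lambda>x. a x * (3 * partial i ?u x))" for i
    using partial_eq_nth[OF d] by (auto simp: grad_def)
  moreover have "Ck rapid_decay n (\<lambda>x. a x * (3 * partial i ?u x))" for i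
  proof -
    have "Ck poly_growth n (partial i ?u)" using u by simp
    from Ck_mult[of poly_growth poly_growth poly_growth, OF poly_growth_mult poly_growth_add Ck_const this]
    show ?thesis by (intro Ck_mult[of rapid_decay poly_growth rapid_decay, OF rapid_decay_mult_poly rapid_decay_add Suc])
  qed
  moreover have "a differentiable (at x)" for x using d unfolding differentiable_def by blast
  ultimately show ?case using dec by simp
qed

lemma rapid_decay_gaussian_bound:
  assumes c: "0 < c" and le: "\<And>x. \<bar>a x\<bar> \<le> exp (- c * (norm x)\<^sup>2)"
  shows "rapid_decay a"
  unfolding rapid_decay_def
proof (intro allI exI)
  fix n and x :: "real^3"
  have "\<bar>a x\<bar> * (1 + norm x)^n \<le> exp (- c * (norm x)\<^sup>2) * (1 + norm x)^n"
    by (intro mult_right_mono le) simp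
  also have "\<dots> \<le> exp ((real n)\<^sup>2 / (4 * c))" by (rule exp_neg_square_poly_bound[OF c norm_ge_zero])
  finally show "\<bar>a x\<bar> * (1 + norm x)^n \<le> exp ((real n)\<^sup>2 / (4 * c))" .
qed

subsection \<open>The equation\<close>

lemma sum_log_hess: "(\<Sum>i\<in>UNIV. log_hess i z $ i) = - (1 / (norm z)\<^sup>2)"
proof -
  have n: "(norm z)\<^sup>2 = (z$1)\<^sup>2 + (z$2)\<^sup>2 + (z$3)\<^sup>2"
    unfolding power2_norm_eq_inner by (simp add: inner_vec_def sum_3 power2_eq_square)
  have "(\<Sum>i\<in>UNIV. log_hess i z $ i) = (\<Sum>i\<in>UNIV. 2 * (z$i)\<^sup>2 / (norm z)^4 - 1 / (norm z)\<^sup>2)"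
    by (intro sum.cong) (auto simp: log_hess_def power2_eq_square axis_def)
  also have "\<dots> = 2 * (norm z)\<^sup>2 / (norm z)^4 - 3 * (1 / (norm z)\<^sup>2)"
    unfolding n by (simp add: sum_3 add_divide_distrib)
  also have "\<dots> = - (1 / (norm z)\<^sup>2)" by (cases "z = 0") (auto simp: eval_nat_numeral)
  finally show ?thesis .
qed

text \<open>Both derivatives fall on the kernel: the singularity |z|^-2 of \<open>log_hess\<close>
  is locally integrable, so no point mass arises, and its trace is - |z|^-2. The quadratic term
  contributes - 2 b in each direction.\<close>

lemma laplacian_log_profile:
  assumes a: "decays a" and cont: "continuous_on UNIV a"
  shows "(\<Sum>i\<in>UNIV. partials [i, i] (log_profile k c b a) x) = - k * (LINT y|lborel. a y * (1 / (norm (x - y))\<^sup>2)) - 6 * b"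
proof -
  let ?u = "log_profile k c b a"
  have "((\<lambda>x. k * pot a x + (c + - b * (norm x)\<^sup>2)) has_derivative (\<lambda>h. k * (pot_grad a x \<bullet> h) + (0 + - b * ((2 *\<^sub>R x) \<bullet> h)))) (at x)" for x
    by (intro has_derivative_add has_derivative_mult_right pot_has_derivative[OF a cont] norm_sq_has_derivative has_derivative_const)
  moreover have "k * (pot_grad a x \<bullet> h) + (0 + - b * ((2 *\<^sub>R x) \<bullet> h)) = (k *\<^sub>R pot_grad a x - (2 * b) *\<^sub>R x) \<bullet> h" for x h
    by (simp add: inner_diff_left)
  ultimately have d1: "(?u has_derivative (\<lambda>h. (k *\<^sub>R pot_grad a x - (2 * b) *\<^sub>R x) \<bullet> h)) (at x)" for x
    unfolding log_profile_def[abs_def] by simp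
  have p1: "partial i ?u = (\<lambda>x. k * (LINT y|lborel. a y *\<^sub>R (log_grad (x - y) $ i)) - 2 * b * x $ i)" for i
    using partial_eq_nth[OF d1] by (auto simp: pot_grad_nth[OF a])
  have "((\<lambda>x. k * (LINT y|lborel. a y *\<^sub>R (log_grad (x - y) $ i)) - 2 * b * x $ i) has_derivative
    (\<lambda>h. k * ((LINT y|lborel. a y *\<^sub>R log_hess i (x - y)) \<bullet> h) - 2 * b * h $ i)) (at x)" for i x
    by (intro has_derivative_diff has_derivative_mult_right bounded_linear_imp_has_derivative[OF bounded_linear_vec_nth]
      kernel_conv_has_derivative[OF kernel_class_log_grad_nth kernel_class_log_hess log_grad_nth_has_derivative a cont])
  then have "partial i (partial i ?u) x = k * ((LINT y|lborel. a y *\<^sub>R log_hess i (x - y)) \<bullet> axis i 1) - 2 * b * axis i 1 $ i" for i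
    unfolding p1 by (rule partial_eq_frechet)
  then have p2: "partials [i, i] ?u x = k * (LINT y|lborel. a y *\<^sub>R log_hess i (x - y)) $ i - 2 * b" for i
    by (simp add: partials_def inner_axis)
  have ih: "integrable lborel (\<lambda>y. a y *\<^sub>R log_hess i (x - y))" for i
    by (rule integrable_kernel_conv[OF kernel_class_log_hess a])
  have n: "(LINT y|lborel. a y *\<^sub>R log_hess i (x - y)) $ i = (LINT y|lborel. (a y *\<^sub>R log_hess i (x - y)) $ i)" for i
    by (rule integral_bounded_linear[OF bounded_linear_vec_nth ih, symmetric])
  have ihn: "integrable lborel (\<lambda>y. (a y *\<^sub>R log_hess i (x - y)) $ i)" for i
    by (rule integrable_bounded_linear[OF bounded_linear_vec_nth ih])
  have "(\<Sum>i\<in>UNIV. partials [i, i] ?u x) = k * (\<Sum>i\<in>UNIV. LINT y|lborel. (a y *\<^sub>R log_hess i (x - y)) $ i) - 6 * b"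
    unfolding p2 n by (simp add: sum_subtractf sum_distrib_left)
  also have "(\<Sum>i\<in>UNIV. LINT y|lborel. (a y *\<^sub>R log_hess i (x - y)) $ i) = (LINT y|lborel. (\<Sum>i\<in>UNIV. (a y *\<^sub>R log_hess i (x - y)) $ i))"
    by (rule Bochner_Integration.integral_sum[symmetric]) (rule ihn)
  also have "\<dots> = (LINT y|lborel. - (a y * (1 / (norm (x - y))\<^sup>2)))"
    by (simp only: vector_scaleR_component real_scaleR_def sum_distrib_left[symmetric] sum_log_hess mult_minus_right)
  finally show ?thesis by simp
qed

lemma integrable_inverse_one_plus_norm_pow4: "integrable lborel (\<lambda>x::real^3. 1 / (1 + norm x ^ 4))"
proof (rule Bochner_Integration.integrable_bound)
  show "integrable lborel (\<lambda>x::real^3. 8 * (1 / (1 + norm x)^4))" by (intro integrable_mult_right integrable_inverse_pow4)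
  show "AE x in lborel. norm (1 / (1 + norm x ^ 4)) \<le> norm (8 * (1 / (1 + norm (x::real^3))^4))"
  proof (rule AE_I2)
    fix x :: "real^3"
    have gen: "s \<le> 8 * t \<Longrightarrow> 0 < s \<Longrightarrow> 0 < t \<Longrightarrow> norm (1 / t) \<le> norm (8 * (1 / s))" for s t :: real
      by (simp add: divide_simps)
    have sq: "(1 + s)\<^sup>2 \<le> 2 * (1 + s\<^sup>2)" for s :: real
      using zero_le_power2[of "1 - s"] by (simp add: power2_eq_square algebra_simps)
    have "((1 + norm x)\<^sup>2)\<^sup>2 \<le> (2 * (1 + (norm x)\<^sup>2))\<^sup>2" by (intro power_mono sq) auto
    also have "\<dots> = 4 * (1 + (norm x)\<^sup>2)\<^sup>2" unfolding power_mult_distrib by simp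
    also have "\<dots> \<le> 4 * (2 * (1 + ((norm x)\<^sup>2)\<^sup>2))" by (intro mult_left_mono sq) auto
    finally have "(1 + norm x)^4 \<le> 8 * (1 + norm x ^ 4)" by (simp add: power_mult[symmetric])
    moreover have "0 < (1 + norm x)^4" "0 < 1 + norm x ^ 4" by (intro zero_less_power add_pos_nonneg; simp)+
    ultimately show "norm (1 / (1 + norm x ^ 4)) \<le> norm (8 * (1 / (1 + norm x)^4))" by (rule gen)
  qed
qed measurable

lemma bounded_continuous_L_half:
  fixes v :: "real^3 \<Rightarrow> real"
  assumes cont: "continuous_on UNIV v" and M: "\<And>x. \<bar>v x\<bar> \<le> M"
  shows "v \<in> L_half"
proof -
  have [measurable]: "v \<in> borel_measurable borel" using cont by (intro borel_measurable_continuous_onI)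
  have "integrable lborel (\<lambda>x. \<bar>v x\<bar> / (1 + norm x ^ 4))"
  proof (rule Bochner_Integration.integrable_bound)
    show "integrable lborel (\<lambda>x::real^3. M * (1 / (1 + norm x ^ 4)))" by (intro integrable_mult_right integrable_inverse_one_plus_norm_pow4)
    show "AE x in lborel. norm (\<bar>v x\<bar> / (1 + norm x ^ 4)) \<le> norm (M * (1 / (1 + norm x ^ 4)))"
    proof (rule AE_I2)
      fix x :: "real^3"
      have "0 < 1 + norm x ^ 4" by (intro add_pos_nonneg) auto
      then have "\<bar>v x\<bar> / (1 + norm x ^ 4) \<le> \<bar>M\<bar> / (1 + norm x ^ 4)" using M[of x] by (intro divide_right_mono) auto
      then show "norm (\<bar>v x\<bar> / (1 + norm x ^ 4)) \<le> norm (M * (1 / (1 + norm x ^ 4)))" by simp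
    qed
  qed measurable
  then show ?thesis using continuous_L1_loc[OF cont] by (simp add: L_half_def integrable_completion)
qed

section \<open>The right-hand side as a distribution and the weak equation\<close>

lemma integrable_scale_schwartz:
  assumes F: "integrable lborel F" and \<phi>: "\<phi> \<in> schwartz"
  shows "integrable lborel (\<lambda>x::real^3. F x *\<^sub>R \<phi> x)"
proof -
  obtain B where B: "\<And>x. norm (\<phi> x) \<le> B" using schwartz_basic(3)[OF \<phi>] by blast
  have [measurable]: "F \<in> borel_measurable borel" "\<phi> \<in> borel_measurable borel" using F schwartz_basic(2)[OF \<phi>] by auto
  show ?thesis
  proof (rule Bochner_Integration.integrable_bound)
    show "integrable lborel (\<lambda>x. \<bar>F x\<bar> * B)" using F by simp
    show "AE x in lborel. norm (F x *\<^sub>R \<phi> x) \<le> norm (\<bar>F x\<bar> * B)"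
    proof (rule AE_I2)
      fix x
      have "\<bar>F x\<bar> * norm (\<phi> x) \<le> \<bar>F x\<bar> * B" by (intro mult_left_mono B) simp
      then show "norm (F x *\<^sub>R \<phi> x) \<le> norm (\<bar>F x\<bar> * B)" by simp
    qed
  qed measurable
qed

lemma distribution_of_eq_lborel:
  assumes F: "integrable lborel F" and \<phi>: "\<phi> \<in> schwartz"
  shows "distribution_of F \<phi> = (LINT x|lborel. F x *\<^sub>R \<phi> (x::real^3))"
  using integrable_scale_schwartz[OF assms] unfolding distribution_of_def by (intro integral_completion) auto

lemma tempered_distribution_of_integrable:
  fixes F :: "real^3 \<Rightarrow> real"
  assumes F: "integrable lborel F"
  shows "tempered_distribution (distribution_of F)"
  unfolding tempered_distribution_def
proof (intro conjI ballI allI)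
  fix \<phi> \<psi> :: "real^3 \<Rightarrow> complex" and a b assume p: "\<phi> \<in> schwartz" "\<psi> \<in> schwartz"
  have i: "integrable lborel (\<lambda>x. a * (F x *\<^sub>R \<phi> x))" "integrable lborel (\<lambda>x. b * (F x *\<^sub>R \<psi> x))"
    by (intro integrable_mult_right integrable_scale_schwartz[OF F] p)+
  have e: "F x *\<^sub>R (a * \<phi> x + b * \<psi> x) = a * (F x *\<^sub>R \<phi> x) + b * (F x *\<^sub>R \<psi> x)" for x
    by (simp add: scaleR_add_right)
  have "distribution_of F (\<lambda>x. a * \<phi> x + b * \<psi> x) = (LINT x|lborel. a * (F x *\<^sub>R \<phi> x) + b * (F x *\<^sub>R \<psi> x))"
    unfolding distribution_of_def e using i by (intro integral_completion) auto
  also have "\<dots> = a * distribution_of F \<phi> + b * distribution_of F \<psi>"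
    unfolding distribution_of_eq_lborel[OF F p(1)] distribution_of_eq_lborel[OF F p(2)]
    by (simp only: Bochner_Integration.integral_add[OF i] integral_mult_right_zero)
  finally show "distribution_of F (\<lambda>x. a * \<phi> x + b * \<psi> x) = a * distribution_of F \<phi> + b * distribution_of F \<psi>" .
next
  \<comment> \<open>Order N = 0: the only index is the empty list, and the seminorm is the supremum
    norm.\<close>
  have "norm (distribution_of F \<phi>) \<le> (LINT x|lborel. \<bar>F x\<bar>) * (\<Sum>k\<le>0. \<Sum>is\<in>{is. length is \<le> 0}. schwartz_seminorm k is \<phi>)"
    if p: "\<phi> \<in> schwartz" for \<phi> :: "real^3 \<Rightarrow> complex"
  proof -
    obtain B where B: "\<And>x. norm (\<phi> x) \<le> B" using schwartz_basic(3)[OF p] by blast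
    have "bdd_above (range (\<lambda>x. norm (\<phi> x)))" using B by (intro bdd_aboveI[of _ B]) auto
    then have s: "norm (\<phi> x) \<le> (SUP x. norm (\<phi> x))" for x by (intro cSUP_upper) auto
    have "norm (distribution_of F \<phi>) \<le> (LINT x|lborel. norm (F x *\<^sub>R \<phi> x))"
      unfolding distribution_of_eq_lborel[OF F p] by (rule integral_norm_bound)
    also have "\<dots> \<le> (LINT x|lborel. \<bar>F x\<bar> * (SUP x. norm (\<phi> x)))"
    proof (rule integral_mono[OF integrable_norm[OF integrable_scale_schwartz[OF F p]]])
      show "integrable lborel (\<lambda>x. \<bar>F x\<bar> * (SUP x. norm (\<phi> x)))" using F by simp
      show "norm (F x *\<^sub>R \<phi> x) \<le> \<bar>F x\<bar> * (SUP x. norm (\<phi> x))" for x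
        using mult_left_mono[OF s[of x], of "\<bar>F x\<bar>"] by simp
    qed
    also have "\<dots> = (LINT x|lborel. \<bar>F x\<bar>) * (SUP x. norm (\<phi> x))" by (rule integral_mult_left_zero)
    also have "(SUP x. norm (\<phi> x)) = (\<Sum>k\<le>0. \<Sum>is\<in>{is. length is \<le> 0}. schwartz_seminorm k is \<phi>)"
      by (simp add: schwartz_seminorm_def partials_def)
    finally show ?thesis .
  qed
  then show "\<exists>C N. \<forall>\<phi>\<in>schwartz. norm (distribution_of F \<phi>) \<le> C * (\<Sum>k\<le>N. \<Sum>is\<in>{is. length is \<le> N}. schwartz_seminorm k is \<phi>)"
    by blast
qed

text \<open>Fubini brings the integral over x inside, where
  \<open>integral_inverse_sq_half_laplacian\<close> evaluates it;
  \<open>inverse_sq_conv_bound\<close>, being uniform in y, gives absolute integrability.\<close>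

lemma potential_half_laplacian:
  fixes a :: "real^3 \<Rightarrow> real" and \<phi> :: "real^3 \<Rightarrow> complex"
  assumes a: "integrable lborel a" and \<phi>: "\<phi> \<in> schwartz"
  defines "J \<equiv> \<lambda>x. LINT y|lborel. a y * (1 / (norm (x - y))\<^sup>2)"
  shows "integrable lborel (\<lambda>x. J x *\<^sub>R half_laplacian \<phi> x)"
    and "(LINT x|lborel. J x *\<^sub>R half_laplacian \<phi> x) = of_real (2 * pi\<^sup>2) * (LINT y|lborel. a y *\<^sub>R \<phi> y)"
proof -
  define g where "g = half_laplacian \<phi>"
  have gi: "integrable lborel g" using half_laplacian_schwartz(2)[OF \<phi>] by (simp add: g_def)
  obtain B where B: "\<And>x. norm (g x) \<le> B" using half_laplacian_schwartz(3)[OF \<phi>] by (auto simp: g_def)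
  have [measurable]: "g \<in> borel_measurable borel" "a \<in> borel_measurable borel" using gi a by auto
  define C where "C = B * (4 * pi) + (LINT x|lborel. norm (g x))"
  define F where "F y x = a y *\<^sub>R ((1 / (norm (x - y))\<^sup>2) *\<^sub>R g x)" for y x
  have Fm: "(\<lambda>(y, x). F y x) \<in> borel_measurable (borel \<Otimes>\<^sub>M borel)" unfolding F_def by measurable
  have int: "integrable (lborel \<Otimes>\<^sub>M lborel) (\<lambda>(y, x). F y x)"
  proof (rule lborel_pair.Fubini_integrable)
    show "(\<lambda>(y, x). F y x) \<in> borel_measurable (lborel \<Otimes>\<^sub>M lborel)" using Fm by simp
    show "AE y in lborel. integrable lborel (\<lambda>x. case (y, x) of (y, x) \<Rightarrow> F y x)"
      unfolding F_def case_prod_conv by (intro AE_I2 integrable_scaleR_right integrable_inverse_sq_conv[OF gi B])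
    have "integrable lborel (\<lambda>y. \<bar>a y\<bar> * C)" using a by simp
    then show "integrable lborel (\<lambda>y. LINT x|lborel. norm (case (y, x) of (y, x) \<Rightarrow> F y x))"
    proof (rule Bochner_Integration.integrable_bound)
      have "(\<lambda>(y, x). norm (F y x)) \<in> borel_measurable (borel \<Otimes>\<^sub>M lborel)" unfolding F_def by measurable
      from lborel.borel_measurable_lebesgue_integral[OF this]
      show "(\<lambda>y. LINT x|lborel. norm (case (y, x) of (y, x) \<Rightarrow> F y x)) \<in> borel_measurable lborel" by simp
      show "AE y in lborel. norm (LINT x|lborel. norm (case (y, x) of (y, x) \<Rightarrow> F y x)) \<le> norm (\<bar>a y\<bar> * C)"
      proof (rule AE_I2)
        fix y
        have "(LINT x|lborel. norm (F y x)) = \<bar>a y\<bar> * (LINT x|lborel. norm ((1 / (norm (x - y))\<^sup>2) *\<^sub>R g x))"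
          unfolding F_def norm_scaleR[of "a y"] by (rule integral_mult_right_zero)
        also have "\<dots> \<le> \<bar>a y\<bar> * C"
          unfolding C_def by (intro mult_left_mono inverse_sq_conv_bound[OF gi B]) simp
        finally have "(LINT x|lborel. norm (F y x)) \<le> \<bar>a y\<bar> * C" .
        moreover have "0 \<le> (LINT x|lborel. norm (F y x))" by (intro integral_nonneg_AE) simp
        ultimately show "norm (LINT x|lborel. norm (case (y, x) of (y, x) \<Rightarrow> F y x)) \<le> norm (\<bar>a y\<bar> * C)"
          unfolding real_norm_def case_prod_conv by linarith
      qed
    qed
  qed
  have J: "(LINT y|lborel. F y x) = J x *\<^sub>R g x" for x
    unfolding F_def J_def scaleR_scaleR scaleR_conv_of_real
    by (simp only: mult.assoc[symmetric] of_real_mult[symmetric] integral_mult_left_zero integral_complex_of_real)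
  show "integrable lborel (\<lambda>x. J x *\<^sub>R half_laplacian \<phi> x)"
    using lborel_pair.integrable_snd[of "\<lambda>y x. F y x"] int unfolding J g_def by simp
  have "(LINT x|lborel. J x *\<^sub>R g x) = (LINT y|lborel. LINT x|lborel. F y x)"
    unfolding J[symmetric] by (rule lborel_pair.Fubini_integral[OF int])
  also have "\<dots> = (LINT y|lborel. a y *\<^sub>R (of_real (2 * pi\<^sup>2) * \<phi> y))"
    unfolding F_def g_def integral_inverse_sq_half_laplacian[OF \<phi>, symmetric] by (simp only: integral_scaleR_right)
  also have "\<dots> = (LINT y|lborel. of_real (2 * pi\<^sup>2) * (a y *\<^sub>R \<phi> y))" by (simp only: mult_scaleR_right)
  also have "\<dots> = of_real (2 * pi\<^sup>2) * (LINT y|lborel. a y *\<^sub>R \<phi> y)" by (rule integral_mult_right_zero)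
  finally show "(LINT x|lborel. J x *\<^sub>R half_laplacian \<phi> x) = of_real (2 * pi\<^sup>2) * (LINT y|lborel. a y *\<^sub>R \<phi> y)" unfolding g_def .
qed

text \<open>The integral is the transform at the origin, where the symbol |xi| vanishes. This
  removes the constant \<open>6 * b\<close> from the equation.\<close>

lemma integral_half_laplacian:
  fixes \<phi> :: "real^3 \<Rightarrow> complex"
  assumes \<phi>: "\<phi> \<in> schwartz" shows "(LINT x|lborel. half_laplacian \<phi> x) = 0"
proof -
  have "(LINT x|lborel. half_laplacian \<phi> x) = FT (half_laplacian \<phi>) 0" by (simp add: FT_def)
  then show ?thesis by (simp add: half_laplacian_schwartz(4)[OF \<phi>])
qed

lemma is_solution_log_profile:
  assumes a: "\<And>n. Ck rapid_decay n a" and eq: "\<And>x. f x = 2 * pi\<^sup>2 * k * a x"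
  shows "is_solution (distribution_of f) (log_profile k c b a)"
proof -
  let ?u = "log_profile k c b a"
  have u: "Ck poly_growth n ?u" for n using Ck_SucD[OF Ck_log_profile[OF a]] .
  have p: "continuous_on UNIV (partials is ?u)" for "is" by (rule Ck_continuous[OF Ck_partials[OF u]])
  note dec = Ck_rapid_decays[OF a]
  have ai: "integrable lborel a" by (rule decays_integrable[OF dec])
  have fe: "f = (\<lambda>x. 2 * pi\<^sup>2 * k * a x)" using eq by auto
  have fi: "integrable lborel f" unfolding fe by (intro integrable_mult_right ai)
  define v where "v x = (\<Sum>i\<in>UNIV. partials [i, i] ?u x)" for x
  define J where "J x = (LINT y|lborel. a y * (1 / (norm (x - y))\<^sup>2))" for x
  have v: "v x = - k * J x - 6 * b" for x
    unfolding v_def J_def by (rule laplacian_log_profile[OF dec Ck_continuous[OF a]])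
  have vc: "continuous_on UNIV v" unfolding v_def by (intro continuous_intros p)
  obtain B where B: "\<And>x. norm (a x) \<le> B"
  proof -
    obtain C where C: "C > 0" "\<And>x. norm (a x) \<le> C / (1 + norm x)^5" using decaysE[OF dec] by blast
    have "norm (a x) \<le> C" for x
    proof -
      have "1 \<le> (1 + norm x)^5" by (intro one_le_power) simp
      then have "C / (1 + norm x)^5 \<le> C" using C(1) frac_le[of C C 1 "(1 + norm x)^5"] by simp
      then show ?thesis using C(2)[of x] by simp
    qed
    then show ?thesis by (rule that)
  qed
  \<comment> \<open>Boundedness of J makes the continuous function v bounded, hence a member of
    \<open>L_half\<close>.\<close>
  have "\<bar>J x\<bar> \<le> B * (4 * pi) + (LINT x|lborel. norm (a x))" for x
  proof -
    have "\<bar>J x\<bar> \<le> (LINT y|lborel. norm (a y * (1 / (norm (x - y))\<^sup>2)))"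
      unfolding J_def using integral_norm_bound[of lborel "\<lambda>y. a y * (1 / (norm (x - y))\<^sup>2)"] by simp
    also have "\<dots> = (LINT y|lborel. norm ((1 / (norm (y - x))\<^sup>2) *\<^sub>R a y))"
      by (simp add: norm_minus_commute mult.commute)
    also have "\<dots> \<le> B * (4 * pi) + (LINT x|lborel. norm (a x))" by (rule inverse_sq_conv_bound[OF ai B])
    finally show ?thesis .
  qed
  then have "\<bar>v x\<bar> \<le> \<bar>k\<bar> * (B * (4 * pi) + (LINT x|lborel. norm (a x))) + 6 * \<bar>b\<bar>" for x
  proof -
    have "\<bar>v x\<bar> \<le> \<bar>k * J x\<bar> + \<bar>6 * b\<bar>" unfolding v by linarith
    also have "\<bar>k * J x\<bar> \<le> \<bar>k\<bar> * (B * (4 * pi) + (LINT x|lborel. norm (a x)))"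
      unfolding abs_mult by (intro mult_left_mono \<open>\<And>x. \<bar>J x\<bar> \<le> _\<close>) simp
    finally show ?thesis by (simp add: abs_mult)
  qed
  then have vL: "v \<in> L_half" by (rule bounded_continuous_L_half[OF vc])
  have W: "?u \<in> W21_loc"
    unfolding W21_loc_def using continuous_L1_loc[OF Ck_continuous[OF u]] weak_partials_of_Ck[OF u] by blast
  have L: "weak_laplacian ?u v"
    unfolding weak_laplacian_def
  proof (intro exI[of _ "\<lambda>i. partials [i, i] ?u"] conjI allI)
    show "weak_partials [i, i] ?u (partials [i, i] ?u)" for i using weak_partials_of_Ck[OF u, of "[i, i]"] by simp
    show "v = (\<lambda>x. \<Sum>i\<in>UNIV. partials [i, i] ?u x)" by (simp add: v_def fun_eq_iff)
  qed
  have "(LINT x|lebesgue. (- v x) *\<^sub>R half_laplacian \<phi> x) = distribution_of f \<phi>" if \<phi>: "\<phi> \<in> schwartz" for \<phi>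
  proof -
    let ?g = "half_laplacian \<phi>"
    have gi: "integrable lborel ?g" by (rule half_laplacian_schwartz(2)[OF \<phi>])
    note P = potential_half_laplacian[OF ai \<phi>, folded J_def]
    have [measurable]: "v \<in> borel_measurable borel" "?g \<in> borel_measurable borel"
      using vc gi by (auto intro: borel_measurable_continuous_onI)
    have "(LINT x|lebesgue. (- v x) *\<^sub>R ?g x) = (LINT x|lborel. (- v x) *\<^sub>R ?g x)"
      by (rule integral_completion) measurable
    also have "\<dots> = (LINT x|lborel. k *\<^sub>R (J x *\<^sub>R ?g x) + (6 * b) *\<^sub>R ?g x)"
      unfolding v by (simp add: scaleR_add_left add.commute)
    also have "\<dots> = k *\<^sub>R (LINT x|lborel. J x *\<^sub>R ?g x) + (6 * b) *\<^sub>R (LINT x|lborel. ?g x)"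
    proof -
      have i: "integrable lborel (\<lambda>x. k *\<^sub>R (J x *\<^sub>R ?g x))" "integrable lborel (\<lambda>x. (6 * b) *\<^sub>R ?g x)"
        by (intro integrable_scaleR_right P(1) gi)+
      show ?thesis unfolding Bochner_Integration.integral_add[OF i] by (simp only: integral_scaleR_right)
    qed
    also have "\<dots> = (2 * pi\<^sup>2 * k) *\<^sub>R (LINT y|lborel. a y *\<^sub>R \<phi> y)"
      unfolding P(2) integral_half_laplacian[OF \<phi>] by (simp add: scaleR_conv_of_real mult_ac)
    also have "\<dots> = (LINT y|lborel. (2 * pi\<^sup>2 * k) *\<^sub>R (a y *\<^sub>R \<phi> y))" by (rule integral_scaleR_right[symmetric])
    also have "\<dots> = distribution_of f \<phi>" unfolding distribution_of_eq_lborel[OF fi \<phi>] by (simp add: eq)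
    finally show ?thesis .
  qed
  then show ?thesis
    unfolding is_solution_def using tempered_distribution_of_integrable[OF fi] W L vL by blast
qed

theorem theorem2:
  fixes V :: real
  assumes "0 < V" and "V < 2 * pi\<^sup>2"
  shows "\<exists>u :: real^3 \<Rightarrow> real. smooth u
    \<and> is_solution (distribution_of (\<lambda>x. 2 * exp (3 * u x))) u
    \<and> has_bochner_integral lebesgue (\<lambda>x. exp (3 * u x)) V"
proof -
  \<comment> \<open>Chosen so that 2 pi^2 (\<alpha> / A) a = 2 (V / A) a, which is the right-hand
    side once exp (3 u) = (V / A) a.\<close>
  define \<alpha> where "\<alpha> = V / pi\<^sup>2"
  have \<alpha>: "0 < \<alpha>" "\<alpha> < 2" using assms by (auto simp: \<alpha>_def divide_less_eq)
  obtain b a where b: "0 < b" and a: "weight a" and fp: "gibbs \<alpha> b a = a" by (rule gibbs_fixed_point[OF \<alpha>])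
  define A where "A = (LINT x|lborel. a x)"
  have A: "0 < A" using weightD(4)[OF a] by (simp add: A_def)
  \<comment> \<open>Puts back the normalisation by \<open>pot a 0\<close> and replaces the value 1
    at the origin by total mass V.\<close>
  define c where "c = ln (V / A) / 3 - \<alpha> / A * pot a 0"
  define u where "u = log_profile (\<alpha> / A) c b a"
  have e: "exp (3 * u x) = V / A * a x" for x
  proof -
    have "3 * u x = ln (V / A) + (3 * \<alpha> * ((pot a x - pot a 0) / A) - 3 * b * (norm x)\<^sup>2)"
      by (simp add: u_def log_profile_def c_def diff_divide_distrib right_diff_distrib)
    moreover have "a x = exp (3 * \<alpha> * ((pot a x - pot a 0) / A) - 3 * b * (norm x)\<^sup>2)"
      using fun_cong[OF fp, of x] unfolding gibbs_def A_def by simp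
    ultimately show ?thesis using assms A by (simp add: exp_add)
  qed
  have ae: "a x = A / V * exp (3 * u x)" for x using assms A by (simp add: e)
  have "continuous_on UNIV (gibbs \<alpha> b a)"
    unfolding gibbs_def[abs_def] using A unfolding A_def by (intro continuous_intros pot_continuous weightD(2)[OF a]) auto
  then have ac: "continuous_on UNIV a" by (simp only: fp)
  have ar: "rapid_decay a"
  proof (rule rapid_decay_gaussian_bound[where c="3 * b"])
    show "\<bar>a x\<bar> \<le> exp (- (3 * b) * (norm x)\<^sup>2)" for x
      using gibbs_le[OF a, of \<alpha> b x] weightD(3)[OF a, of x] \<alpha> by (simp add: fp)
  qed (use b in simp)
  have C: "Ck rapid_decay n a" for n
    by (rule Ck_exp_fixed[OF ae[unfolded u_def] ac ar])
  have "smooth u" unfolding u_def by (rule Ck_smooth[OF Ck_SucD[OF Ck_log_profile[OF C]]])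
  moreover have "is_solution (distribution_of (\<lambda>x. 2 * exp (3 * u x))) u"
    unfolding u_def
  proof (rule is_solution_log_profile[OF C])
    show "2 * exp (3 * log_profile (\<alpha> / A) c b a x) = 2 * pi\<^sup>2 * (\<alpha> / A) * a x" for x
      using e[of x] by (simp add: u_def \<alpha>_def)
  qed
  moreover have "has_bochner_integral lebesgue (\<lambda>x. exp (3 * u x)) V"
  proof -
    have "integrable lborel (\<lambda>x. V / A * a x)" "(LINT x|lborel. V / A * a x) = V"
      using weightD(5)[OF a] A by (auto simp: A_def[symmetric])
    moreover from this(1) have "(\<lambda>x. V / A * a x) \<in> borel_measurable lborel" by (rule borel_measurable_integrable)
    ultimately show ?thesis
      unfolding e has_bochner_integral_iff by (simp only: integrable_completion integral_completion)
  qed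
  ultimately show ?thesis by blast
qed

end
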